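(* Let $A$ be a Koszul complex Calabi-Yau (Kc-Calabi-Yau) algebra of dimension $n$ over a field $\mathbb{F}$. Then for any $A$-bimodule $M$, the $\mathbb{F}$-vector spaces $\mathrm{HK}^p(A,M)$ and $\mathrm{HK}_{n-p}(A,M)$ are isomorphic.
   Context: Quadratic algebras. Let $\mathcal{Q}=(\mathcal{Q}_0,\mathcal{Q}_1)$ be a finite quiver, $\mathbb{F}$ a field, $k=\mathbb{F}\mathcal{Q}_0$ (with orthogonal idempotents $e_i$, $i\in\mathcal{Q}_0$), and $V=\mathbb{F}\mathcal{Q}_1$, a $k$-bimodule via $e_j\alpha e_i=\alpha$ if $i$ is the source and $j$ the target of $\alpha$, and $0$ otherwise; thus $T_k(V)\cong\mathbb{F}\mathcal{Q}$ (paths written from right to left). A quadratic $k$-algebra over $\mathcal{Q}$ is $A=T_k(V)/(R)$ with $R\subseteq V\otimes_kV$ a sub-$k$-bimodule. $\otimes=\otimes_{\mathbb{F}}$, $A^e=A\otimes A^{op}$; $A$-bimodules are $\mathbb{F}$-symmetric and are regarded as left or right $A^e$-modules. Koszul complex. Put $W_0=k$, $W_1=V$, $W_p=\bigcap_{i+2+j=p}V^{\otimes_k i}\otimes_kR\otimes_kV^{\otimes_k j}$ for $p\geq2$; elements of $W_p$ are written $x_1\ldots x_p$ (a sum is understood). $K(A)$ is the complex of finitely generated projective $A$-bimodules $K(A)_p=A\otimes_kW_p\otimes_kA$ with $d(a\otimes_k x_1\ldots x_p\otimes_k a')=ax_1\otimes_k x_2\ldots x_p\otimes_k a'+(-1)^pa\otimes_k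 x_1\ldots x_{p-1}\otimes_k x_pa'$. It has length $n$ if $K(A)_n\neq0$ and $K(A)_p=0$ for $p>n$. For an $A$-bimodule $M$, $\mathrm{HK}_\bullet(A,M)=H_\bullet(M\otimes_{A^e}K(A))$ and $\mathrm{HK}^\bullet(A,M)=H^\bullet(\mathrm{Hom}_{A^e}(K(A),M))$; these are $0$ in negative degrees. Definition. A quadratic $k$-algebra $A$ over $\mathcal{Q}$ is Koszul complex Calabi-Yau (Kc-Calabi-Yau) of dimension $n$, for an integer $n\geq0$, if (i) $K(A)$ has length $n$, and (ii) $\mathrm{RHom}_{A^e}(K(A),A^e)\cong K(A)[-n]$ in the bounded derived category of $A$-bimodules. Here $\mathrm{Hom}_{A^e}$ uses the left $A^e$-module structure of $A^e$, the bimodule structure on the result comes from the right $A^e$-module structure of $A^e$, and $K(A)[-n]$, as a cochain complex, has $K(A)_{n-p}$ in degree $p$. *)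

theory Defs
  imports "HOL-Algebra.Algebra" "HOL-Algebra.Free_Abelian_Groups" "Graph_Theory.Digraph"
    "Graph_Theory.Arc_Walk"
begin

text \<open>
  Conventions. The ground field is the type \<open>'f :: field\<close>. Algebras over it are records
  \<open>('f, 'a) module\<close>, read as a (not necessarily commutative) ring with a scalar multiplication.
  As for modules in HOL-Algebra, records of (bi)modules extend ring records; the fields
  \<^const>\<open>monoid.mult\<close> and \<^const>\<open>one\<close> of such a record carry no meaning.
\<close>

section \<open>Bimodules and tensor products\<close>

record ('a, 'b, 'm) bimod = "'m ring" +
  lact :: "'a \<Rightarrow> 'm \<Rightarrow> 'm"
  ract :: "'m \<Rightarrow> 'b \<Rightarrow> 'm"

definition as_bimod ::
    "('m, 'x) ring_scheme \<Rightarrow> ('a \<Rightarrow> 'm \<Rightarrow> 'm) \<Rightarrow> ('m \<Rightarrow> 'b \<Rightarrow> 'm) \<Rightarrow> ('a, 'b, 'm) bimod" where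
  "as_bimod M l r = \<lparr>carrier = carrier M, monoid.mult = monoid.mult M, one = one M,
     ring.zero = ring.zero M, add = add M, lact = l, ract = r\<rparr>"

text \<open>Bimodules over an algebra, symmetric over the ground field.\<close>

locale algebra_bimodule = abelian_group M
  for A :: "('f::field, 'a) module" and M :: "('a, 'a, 'm) bimod" +
  assumes lact_closed: "a \<in> carrier A \<Longrightarrow> m \<in> carrier M \<Longrightarrow> lact M a m \<in> carrier M"
    and ract_closed: "a \<in> carrier A \<Longrightarrow> m \<in> carrier M \<Longrightarrow> ract M m a \<in> carrier M"
    and lact_add_right: "a \<in> carrier A \<Longrightarrow> m \<in> carrier M \<Longrightarrow> m' \<in> carrier M \<Longrightarrow>
      lact M a (m \<oplus>\<^bsub>M\<^esub> m') = lact M a m \<oplus>\<^bsub>M\<^esub> lact M a m'"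
    and lact_add_left: "a \<in> carrier A \<Longrightarrow> a' \<in> carrier A \<Longrightarrow> m \<in> carrier M \<Longrightarrow>
      lact M (a \<oplus>\<^bsub>A\<^esub> a') m = lact M a m \<oplus>\<^bsub>M\<^esub> lact M a' m"
    and ract_add_left: "a \<in> carrier A \<Longrightarrow> m \<in> carrier M \<Longrightarrow> m' \<in> carrier M \<Longrightarrow>
      ract M (m \<oplus>\<^bsub>M\<^esub> m') a = ract M m a \<oplus>\<^bsub>M\<^esub> ract M m' a"
    and ract_add_right: "a \<in> carrier A \<Longrightarrow> a' \<in> carrier A \<Longrightarrow> m \<in> carrier M \<Longrightarrow>
      ract M m (a \<oplus>\<^bsub>A\<^esub> a') = ract M m a \<oplus>\<^bsub>M\<^esub> ract M m a'"
    and lact_mult: "a \<in> carrier A \<Longrightarrow> a' \<in> carrier A \<Longrightarrow> m \<in> carrier M \<Longrightarrow>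
      lact M (a \<otimes>\<^bsub>A\<^esub> a') m = lact M a (lact M a' m)"
    and ract_mult: "a \<in> carrier A \<Longrightarrow> a' \<in> carrier A \<Longrightarrow> m \<in> carrier M \<Longrightarrow>
      ract M m (a \<otimes>\<^bsub>A\<^esub> a') = ract M (ract M m a) a'"
    and lact_one: "m \<in> carrier M \<Longrightarrow> lact M \<one>\<^bsub>A\<^esub> m = m"
    and ract_one: "m \<in> carrier M \<Longrightarrow> ract M m \<one>\<^bsub>A\<^esub> = m"
    and lact_ract: "a \<in> carrier A \<Longrightarrow> a' \<in> carrier A \<Longrightarrow> m \<in> carrier M \<Longrightarrow>
      ract M (lact M a m) a' = lact M a (ract M m a')"
    and scalar_symmetric: "m \<in> carrier M \<Longrightarrow>
      lact M (c \<odot>\<^bsub>A\<^esub> \<one>\<^bsub>A\<^esub>) m = ract M m (c \<odot>\<^bsub>A\<^esub> \<one>\<^bsub>A\<^esub>)"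

definition bimod_linear ::
    "('f, 'a) module \<Rightarrow> ('a, 'a, 'm) bimod \<Rightarrow> ('a, 'a, 'n) bimod \<Rightarrow> ('m \<Rightarrow> 'n) \<Rightarrow> bool" where
  "bimod_linear A M N f \<longleftrightarrow> f \<in> hom (add_monoid M) (add_monoid N) \<and>
     (\<forall>a\<in>carrier A. \<forall>m\<in>carrier M.
        f (lact M a m) = lact N a (f m) \<and> f (ract M m a) = ract N (f m) a)"

text \<open>
  The tensor product over a ring with set of elements \<open>S\<close>: the free abelian group on pairs
  modulo additivity in both arguments and \<open>(m s, n) \<sim> (m, s n)\<close> for \<open>s \<in> S\<close>.
\<close>

definition tensor_relators ::
    "'s set \<Rightarrow> ('a, 's, 'm) bimod \<Rightarrow> ('s, 'b, 'n) bimod \<Rightarrow> ('m \<times> 'n \<Rightarrow>\<^sub>0 int) set" where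
  "tensor_relators S M N =
     {frag_of (m \<oplus>\<^bsub>M\<^esub> m', n) - frag_of (m, n) - frag_of (m', n) | m m' n.
        m \<in> carrier M \<and> m' \<in> carrier M \<and> n \<in> carrier N} \<union>
     {frag_of (m, n \<oplus>\<^bsub>N\<^esub> n') - frag_of (m, n) - frag_of (m, n') | m n n'.
        m \<in> carrier M \<and> n \<in> carrier N \<and> n' \<in> carrier N} \<union>
     {frag_of (ract M m s, n) - frag_of (m, lact N s n) | m s n.
        m \<in> carrier M \<and> s \<in> S \<and> n \<in> carrier N}"

definition tensor_kernel ::
    "'s set \<Rightarrow> ('a, 's, 'm) bimod \<Rightarrow> ('s, 'b, 'n) bimod \<Rightarrow> ('m \<times> 'n \<Rightarrow>\<^sub>0 int) set" where
  "tensor_kernel S M N =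
     generate (free_Abelian_group (carrier M \<times> carrier N)) (tensor_relators S M N)"

definition tensor_group ::
    "'s set \<Rightarrow> ('a, 's, 'm) bimod \<Rightarrow> ('s, 'b, 'n) bimod \<Rightarrow> ('m \<times> 'n \<Rightarrow>\<^sub>0 int) set ring" where
  "tensor_group S M N =
     (let Q = free_Abelian_group (carrier M \<times> carrier N) Mod tensor_kernel S M N
      in \<lparr>carrier = carrier Q, monoid.mult = undefined, one = undefined,
          ring.zero = one Q, add = monoid.mult Q\<rparr>)"

definition pure_tensor ::
    "'s set \<Rightarrow> ('a, 's, 'm) bimod \<Rightarrow> ('s, 'b, 'n) bimod \<Rightarrow> 'm \<Rightarrow> 'n \<Rightarrow> ('m \<times> 'n \<Rightarrow>\<^sub>0 int) set" where
  "pure_tensor S M N m n =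
     tensor_kernel S M N #>\<^bsub>free_Abelian_group (carrier M \<times> carrier N)\<^esub> frag_of (m, n)"

text \<open>The additive map on the tensor product with prescribed values on pure tensors.\<close>

definition tensor_lift ::
    "'s set \<Rightarrow> ('a, 's, 'm) bimod \<Rightarrow> ('s, 'b, 'n) bimod \<Rightarrow> ('p, 'x) ring_scheme \<Rightarrow>
      ('m \<Rightarrow> 'n \<Rightarrow> 'p) \<Rightarrow> ('m \<times> 'n \<Rightarrow>\<^sub>0 int) set \<Rightarrow> 'p" where
  "tensor_lift S M N P \<beta> =
     (THE h. h \<in> extensional (carrier (tensor_group S M N)) \<and>
        h \<in> hom (add_monoid (tensor_group S M N)) (add_monoid P) \<and>
        (\<forall>m\<in>carrier M. \<forall>n\<in>carrier N. h (pure_tensor S M N m n) = \<beta> m n))"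

definition tensor ::
    "'s set \<Rightarrow> ('a, 's, 'm) bimod \<Rightarrow> ('s, 'b, 'n) bimod \<Rightarrow>
      ('a, 'b, ('m \<times> 'n \<Rightarrow>\<^sub>0 int) set) bimod" where
  "tensor S M N = (let T = tensor_group S M N in
     as_bimod T
       (\<lambda>a. tensor_lift S M N T (\<lambda>m n. pure_tensor S M N (lact M a m) n))
       (\<lambda>t b. tensor_lift S M N T (\<lambda>m n. pure_tensor S M N m (ract N n b)) t))"


section \<open>The enveloping algebra, \<open>Hom\<close> and tensor product over it\<close>

text \<open>
  \<open>A\<^sup>e = A \<otimes> A\<^sup>o\<^sup>p\<close>. Its left regular module structure is the outer bimodule structure
  \<open>a (x \<otimes> y) b = a x \<otimes> y b\<close>; since a right \<open>A\<^sup>e\<close>-module is a bimodule via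
  \<open>m (a \<otimes> b) = b m a\<close>, its right regular module structure is the inner one,
  \<open>b (x \<otimes> y) a = x a \<otimes> b y\<close>.
\<close>

definition env_left :: "('f, 'a) module \<Rightarrow> ('a, 'f, 'a) bimod" where
  "env_left A = as_bimod A (monoid.mult A) (\<lambda>a c. c \<odot>\<^bsub>A\<^esub> a)"

definition env_right :: "('f, 'a) module \<Rightarrow> ('f, 'a, 'a) bimod" where
  "env_right A = as_bimod A (smult A) (monoid.mult A)"

definition env :: "('f, 'a) module \<Rightarrow> ('a, 'a, ('a \<times> 'a \<Rightarrow>\<^sub>0 int) set) bimod" where
  "env A = tensor (UNIV :: 'f set) (env_left A) (env_right A)"

definition env_inner :: "('f, 'a) module \<Rightarrow> ('a, 'a, ('a \<times> 'a \<Rightarrow>\<^sub>0 int) set) bimod" where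
  "env_inner A =
     (let pure = pure_tensor (UNIV :: 'f set) (env_left A) (env_right A);
          lift = tensor_lift (UNIV :: 'f set) (env_left A) (env_right A) (env A)
      in as_bimod (env A)
           (\<lambda>b. lift (\<lambda>x y. pure x (b \<otimes>\<^bsub>A\<^esub> y)))
           (\<lambda>t a. lift (\<lambda>x y. pure (x \<otimes>\<^bsub>A\<^esub> a) y) t))"

definition bimod_hom :: "('f, 'a) module \<Rightarrow> ('a, 'a, 'm) bimod \<Rightarrow> ('a, 'a, 'n) bimod \<Rightarrow> ('m \<Rightarrow> 'n) set"
  where "bimod_hom A M N = {f \<in> extensional (carrier M). bimod_linear A M N f}"

text \<open>\<open>Hom\<^bsub>A\<^sup>e\<^esub>(N, A\<^sup>e)\<close> with the bimodule structure coming from the inner structure of \<open>A\<^sup>e\<close>.\<close>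

definition hom_env :: "('f, 'a) module \<Rightarrow> ('a, 'a, 'n) bimod \<Rightarrow>
    ('a, 'a, 'n \<Rightarrow> ('a \<times> 'a \<Rightarrow>\<^sub>0 int) set) bimod" where
  "hom_env A N = \<lparr>carrier = bimod_hom A N (env A), monoid.mult = undefined, one = undefined,
     ring.zero = (\<lambda>x\<in>carrier N. \<zero>\<^bsub>env A\<^esub>),
     add = (\<lambda>f g. \<lambda>x\<in>carrier N. f x \<oplus>\<^bsub>env A\<^esub> g x),
     lact = (\<lambda>a f. \<lambda>x\<in>carrier N. lact (env_inner A) a (f x)),
     ract = (\<lambda>f a. \<lambda>x\<in>carrier N. ract (env_inner A) (f x) a)\<rparr>"

text \<open>\<open>Hom\<^bsub>A\<^sup>e\<^esub>(N, M)\<close> as a vector space.\<close>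

definition hom_space :: "('f, 'a) module \<Rightarrow> ('a, 'a, 'n) bimod \<Rightarrow> ('a, 'a, 'm) bimod \<Rightarrow>
    ('f, 'n \<Rightarrow> 'm) module" where
  "hom_space A N M = \<lparr>carrier = bimod_hom A N M, monoid.mult = undefined, one = undefined,
     ring.zero = (\<lambda>x\<in>carrier N. \<zero>\<^bsub>M\<^esub>),
     add = (\<lambda>f g. \<lambda>x\<in>carrier N. f x \<oplus>\<^bsub>M\<^esub> g x),
     smult = (\<lambda>c f. \<lambda>x\<in>carrier N. lact M (c \<odot>\<^bsub>A\<^esub> \<one>\<^bsub>A\<^esub>) (f x))\<rparr>"

text \<open>
  For \<open>M \<otimes>\<^bsub>A\<^sup>e\<^esub> N\<close>, the bimodule \<open>M\<close> is a right module by \<open>m (a \<otimes> b) = b m a\<close> and \<open>N\<close> a left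
  module by \<open>(a \<otimes> b) x = a x b\<close>. Elements \<open>a \<otimes> b\<close> of \<open>A\<^sup>e\<close> are encoded as pairs \<open>(a, b)\<close>:
  they generate \<open>A\<^sup>e\<close> additively, so balancing over them is balancing over \<open>A\<^sup>e\<close>.
\<close>

definition as_right_env :: "('f, 'a) module \<Rightarrow> ('a, 'a, 'm) bimod \<Rightarrow> ('f, 'a \<times> 'a, 'm) bimod" where
  "as_right_env A M = as_bimod M (\<lambda>c m. lact M (c \<odot>\<^bsub>A\<^esub> \<one>\<^bsub>A\<^esub>) m)
     (\<lambda>m (a, b). lact M b (ract M m a))"

definition as_left_env :: "('f, 'a) module \<Rightarrow> ('a, 'a, 'm) bimod \<Rightarrow> ('a \<times> 'a, 'f, 'm) bimod" where
  "as_left_env A N = as_bimod N (\<lambda>(a, b) x. lact N a (ract N x b))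
     (\<lambda>x c. ract N x (c \<odot>\<^bsub>A\<^esub> \<one>\<^bsub>A\<^esub>))"

definition env_tensor_space :: "('f, 'a) module \<Rightarrow> ('a, 'a, 'm) bimod \<Rightarrow> ('a, 'a, 'n) bimod \<Rightarrow>
    ('f, ('m \<times> 'n \<Rightarrow>\<^sub>0 int) set) module" where
  "env_tensor_space A M N =
     (let T = tensor (carrier A \<times> carrier A) (as_right_env A M) (as_left_env A N)
      in \<lparr>carrier = carrier T, monoid.mult = undefined, one = undefined,
          ring.zero = ring.zero T, add = add T, smult = lact T\<rparr>)"


section \<open>Complexes and the derived category\<close>

text \<open>
  Graded objects with structure maps; \<open>dif C p\<close> goes from degree \<open>p\<close> to degree \<open>p - 1\<close> for
  chain complexes and to degree \<open>p + 1\<close> for cochain complexes.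
\<close>

record ('o, 'm) gcomplex =
  obj :: "int \<Rightarrow> 'o"
  dif :: "int \<Rightarrow> 'm \<Rightarrow> 'm"

text \<open>Homology at \<open>M\<close> of \<open>L \<rightarrow> M \<rightarrow> N\<close>, as an additive group and as a vector space.\<close>

definition homology_at :: "('x, 'r) ring_scheme \<Rightarrow> ('x \<Rightarrow> 'y) \<Rightarrow> ('y, 's) ring_scheme \<Rightarrow>
    ('y \<Rightarrow> 'z) \<Rightarrow> ('z, 't) ring_scheme \<Rightarrow> 'y set monoid" where
  "homology_at L f M g N =
     A_FactGroup (M\<lparr>carrier := {y \<in> carrier M. g y = \<zero>\<^bsub>N\<^esub>}\<rparr>) (f ` carrier L)"

definition homology_space_at :: "('f, 'x) module \<Rightarrow> ('x \<Rightarrow> 'y) \<Rightarrow> ('f, 'y) module \<Rightarrow>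
    ('y \<Rightarrow> 'z) \<Rightarrow> ('f, 'z) module \<Rightarrow> ('f, 'y set) module" where
  "homology_space_at L f M g N = (let H = homology_at L f M g N in
     \<lparr>carrier = carrier H, monoid.mult = undefined, one = undefined,
      ring.zero = one H, add = monoid.mult H,
      smult = (\<lambda>c U. (f ` carrier L) <+>\<^bsub>M\<^esub> ((\<lambda>y. c \<odot>\<^bsub>M\<^esub> y) ` U))\<rparr>)"

definition cohomology_group :: "(('m, 'x) ring_scheme, 'm) gcomplex \<Rightarrow> int \<Rightarrow> 'm set monoid" where
  "cohomology_group C p =
     homology_at (obj C (p - 1)) (dif C (p - 1)) (obj C p) (dif C p) (obj C (p + 1))"

definition cohomology_space :: "(('f, 'm) module, 'm) gcomplex \<Rightarrow> int \<Rightarrow> ('f, 'm set) module" where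
  "cohomology_space C p =
     homology_space_at (obj C (p - 1)) (dif C (p - 1)) (obj C p) (dif C p) (obj C (p + 1))"

definition homology_space :: "(('f, 'm) module, 'm) gcomplex \<Rightarrow> int \<Rightarrow> ('f, 'm set) module" where
  "homology_space C p =
     homology_space_at (obj C (p + 1)) (dif C (p + 1)) (obj C p) (dif C p) (obj C (p - 1))"

definition bounded_cochain_complex ::
    "('f::field, 'a) module \<Rightarrow> (('a, 'a, 'm) bimod, 'm) gcomplex \<Rightarrow> bool" where
  "bounded_cochain_complex A C \<longleftrightarrow>
     (\<forall>p. algebra_bimodule A (obj C p)) \<and>
     (\<forall>p. bimod_linear A (obj C p) (obj C (p + 1)) (dif C p)) \<and>
     (\<forall>p. \<forall>x\<in>carrier (obj C p). dif C (p + 1) (dif C p x) = \<zero>\<^bsub>obj C (p + 2)\<^esub>) \<and>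
     (\<exists>b. \<forall>p. b < \<bar>p\<bar> \<longrightarrow> carrier (obj C p) = {\<zero>\<^bsub>obj C p\<^esub>})"

definition cochain_quasi_iso :: "('f, 'a) module \<Rightarrow> (('a, 'a, 'm) bimod, 'm) gcomplex \<Rightarrow>
    (('a, 'a, 'n) bimod, 'n) gcomplex \<Rightarrow> (int \<Rightarrow> 'm \<Rightarrow> 'n) \<Rightarrow> bool" where
  "cochain_quasi_iso A C D f \<longleftrightarrow>
     (\<forall>p. bimod_linear A (obj C p) (obj D p) (f p)) \<and>
     (\<forall>p. \<forall>x\<in>carrier (obj C p). f (p + 1) (dif C p x) = dif D p (f p x)) \<and>
     (\<forall>p. bij_betw
        (\<lambda>U. (dif D (p - 1) ` carrier (obj D (p - 1))) <+>\<^bsub>obj D p\<^esub> (f p ` U))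
        (carrier (cohomology_group C p)) (carrier (cohomology_group D p)))"

text \<open>
  Isomorphism of bounded complexes in the bounded derived category: a roof of two
  quasi-isomorphisms \<open>C \<leftarrow> Z \<rightarrow> D\<close>. The type argument is the type of the elements
  of the apex \<open>Z\<close>; a statement assuming \<open>derived_iso TYPE('z)\<close> for a free type variable
  \<open>'z\<close> covers apexes of any size.
\<close>

definition derived_iso :: "'z itself \<Rightarrow> ('f::field, 'a) module \<Rightarrow>
    (('a, 'a, 'm) bimod, 'm) gcomplex \<Rightarrow> (('a, 'a, 'n) bimod, 'n) gcomplex \<Rightarrow> bool" where
  "derived_iso _ A C D \<longleftrightarrow>
     (\<exists>(Z :: (('a, 'a, 'z) bimod, 'z) gcomplex) s t.
        bounded_cochain_complex A Z \<and> cochain_quasi_iso A Z C s \<and> cochain_quasi_iso A Z D t)"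

definition signed :: "('m, 'x) ring_scheme \<Rightarrow> int \<Rightarrow> 'm \<Rightarrow> 'm" where
  "signed M p x = (if even p then x else \<ominus>\<^bsub>M\<^esub> x)"

text \<open>The cochain complex \<open>C[-n]\<close> for a chain complex \<open>C\<close>, placed in degrees \<open>-p\<close>.\<close>

definition shift_cochain :: "int \<Rightarrow> (('m, 'x) ring_scheme, 'm) gcomplex \<Rightarrow>
    (('m, 'x) ring_scheme, 'm) gcomplex" where
  "shift_cochain n C = \<lparr>obj = (\<lambda>p. obj C (n - p)),
     dif = (\<lambda>p x. signed (obj C (n - p - 1)) n (dif C (n - p) x))\<rparr>"

text \<open>
  The contravariant functors \<open>Hom\<^bsub>A\<^sup>e\<^esub>(-, A\<^sup>e)\<close> and \<open>Hom\<^bsub>A\<^sup>e\<^esub>(-, M)\<close> applied to a chain complex,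
  without additional signs.
\<close>

definition hom_env_complex :: "('f, 'a) module \<Rightarrow> (('a, 'a, 'n) bimod, 'n) gcomplex \<Rightarrow>
    (('a, 'a, 'n \<Rightarrow> ('a \<times> 'a \<Rightarrow>\<^sub>0 int) set) bimod, 'n \<Rightarrow> ('a \<times> 'a \<Rightarrow>\<^sub>0 int) set) gcomplex" where
  "hom_env_complex A C = \<lparr>obj = (\<lambda>p. hom_env A (obj C p)),
     dif = (\<lambda>p f. compose (carrier (obj C (p + 1))) f (dif C (p + 1)))\<rparr>"

definition hom_complex :: "('f, 'a) module \<Rightarrow> (('a, 'a, 'n) bimod, 'n) gcomplex \<Rightarrow>
    ('a, 'a, 'm) bimod \<Rightarrow> (('f, 'n \<Rightarrow> 'm) module, 'n \<Rightarrow> 'm) gcomplex" where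
  "hom_complex A C M = \<lparr>obj = (\<lambda>p. hom_space A (obj C p) M),
     dif = (\<lambda>p f. compose (carrier (obj C (p + 1))) f (dif C (p + 1)))\<rparr>"

definition env_tensor_complex :: "('f, 'a) module \<Rightarrow> ('a, 'a, 'm) bimod \<Rightarrow>
    (('a, 'a, 'n) bimod, 'n) gcomplex \<Rightarrow>
    (('f, ('m \<times> 'n \<Rightarrow>\<^sub>0 int) set) module, ('m \<times> 'n \<Rightarrow>\<^sub>0 int) set) gcomplex" where
  "env_tensor_complex A M C = \<lparr>obj = (\<lambda>p. env_tensor_space A M (obj C p)),
     dif = (\<lambda>p. tensor_lift (carrier A \<times> carrier A)
              (as_right_env A M) (as_left_env A (obj C p)) (env_tensor_space A M (obj C (p - 1)))
              (\<lambda>m x. pure_tensor (carrier A \<times> carrier A)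
                 (as_right_env A M) (as_left_env A (obj C (p - 1))) m (dif C p x)))\<rparr>"


section \<open>Quadratic algebras over a finite quiver\<close>

text \<open>
  A finite quiver is a \<^locale>\<open>fin_digraph\<close>, with \<^const>\<open>tail\<close> and \<^const>\<open>head\<close> as source and target.
  The path \<open>x\<^sub>1 \<dots> x\<^sub>p\<close>, written from right to left, with source \<open>i\<close> and target \<open>j\<close> is
  \<open>(j, [x\<^sub>1, \<dots>, x\<^sub>p], i)\<close>. Under \<open>T\<^sub>k(V) \<cong> F Q\<close>, the path algebra plays the role of
  the tensor algebra, and paths of length \<open>p\<close> span the \<open>p\<close>-fold tensor power of \<open>V\<close> over \<open>k\<close>.
\<close>

type_synonym ('v, 'b) qpath = "'v \<times> 'b list \<times> 'v"
type_synonym ('v, 'b, 'f) pelem = "('v, 'b) qpath \<Rightarrow> 'f"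
type_synonym ('v, 'b, 'f) qelem = "('v, 'b, 'f) pelem set"

definition qpaths :: "('v, 'b) pre_digraph \<Rightarrow> ('v, 'b) qpath set" where
  "qpaths G = {(j, w, i). pre_digraph.awalk G i (rev w) j}"

definition path_algebra :: "('v, 'b) pre_digraph \<Rightarrow> ('f::field, ('v, 'b, 'f) pelem) module" where
  "path_algebra G =
     \<lparr>carrier = {f. finite {q. f q \<noteq> 0} \<and> {q. f q \<noteq> 0} \<subseteq> qpaths G},
      monoid.mult = (\<lambda>f g (j, w, i).
        \<Sum>l\<le>length w. \<Sum>m\<in>verts G. f (j, take l w, m) * g (m, drop l w, i)),
      one = (\<lambda>(j, w, i). if j \<in> verts G \<and> w = [] \<and> i = j then 1 else 0),
      ring.zero = (\<lambda>q. 0),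
      add = (\<lambda>f g q. f q + g q),
      smult = (\<lambda>c f q. c * f q)\<rparr>"

definition path_part :: "('v, 'b) pre_digraph \<Rightarrow> nat \<Rightarrow> ('v, 'b, 'f::field) pelem set" where
  "path_part G p = {f \<in> carrier (path_algebra G). \<forall>j w i. f (j, w, i) \<noteq> 0 \<longrightarrow> length w = p}"

definition arrow_elem :: "('v, 'b) pre_digraph \<Rightarrow> 'b \<Rightarrow> ('v, 'b, 'f::field) pelem" where
  "arrow_elem G x = (\<lambda>q. if q = (head G x, [x], tail G x) then 1 else 0)"

text \<open>\<open>R\<close> is a sub-\<open>k\<close>-bimodule of \<open>V \<otimes>\<^sub>k V\<close>, where \<open>k\<close> is spanned by the paths of length 0.\<close>

locale quadratic_quiver = fin_digraph G for G :: "('v, 'b) pre_digraph" +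
  fixes R :: "('v, 'b, 'f::field) pelem set"
  assumes R_subset: "R \<subseteq> path_part G 2"
    and R_subgroup: "subgroup R (add_monoid (path_algebra G))"
    and R_left: "c \<in> path_part G 0 \<Longrightarrow> r \<in> R \<Longrightarrow> c \<otimes>\<^bsub>path_algebra G\<^esub> r \<in> R"
    and R_right: "c \<in> path_part G 0 \<Longrightarrow> r \<in> R \<Longrightarrow> r \<otimes>\<^bsub>path_algebra G\<^esub> c \<in> R"

definition quad_ideal :: "('v, 'b) pre_digraph \<Rightarrow> ('v, 'b, 'f::field) pelem set \<Rightarrow>
    ('v, 'b, 'f) pelem set" where
  "quad_ideal G R = Idl\<^bsub>path_algebra G\<^esub> R"

definition quad_class :: "('v, 'b) pre_digraph \<Rightarrow> ('v, 'b, 'f::field) pelem set \<Rightarrow>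
    ('v, 'b, 'f) pelem \<Rightarrow> ('v, 'b, 'f) qelem" where
  "quad_class G R f = quad_ideal G R +>\<^bsub>path_algebra G\<^esub> f"

definition quad_algebra :: "('v, 'b) pre_digraph \<Rightarrow> ('v, 'b, 'f::field) pelem set \<Rightarrow>
    ('f, ('v, 'b, 'f) qelem) module" where
  "quad_algebra G R = (let P = path_algebra G; Q = P Quot quad_ideal G R in
     \<lparr>carrier = carrier Q, monoid.mult = monoid.mult Q, one = one Q,
      ring.zero = ring.zero Q, add = add Q,
      smult = (\<lambda>c U. quad_ideal G R <+>\<^bsub>P\<^esub> ((\<lambda>f. c \<odot>\<^bsub>P\<^esub> f) ` U))\<rparr>)"


section \<open>The Koszul complex\<close>

text \<open>The subspace \<open>V\<^sup>i \<otimes>\<^sub>k R \<otimes>\<^sub>k V\<^sup>j\<close> of the \<open>(i + 2 + j)\<close>-fold tensor power of \<open>V\<close>.\<close>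

definition relation_part :: "('v, 'b) pre_digraph \<Rightarrow> ('v, 'b, 'f::field) pelem set \<Rightarrow>
    nat \<Rightarrow> nat \<Rightarrow> ('v, 'b, 'f) pelem set" where
  "relation_part G R i j = generate (add_monoid (path_algebra G))
     {x \<otimes>\<^bsub>path_algebra G\<^esub> r \<otimes>\<^bsub>path_algebra G\<^esub> y | x r y.
        x \<in> path_part G i \<and> r \<in> R \<and> y \<in> path_part G j}"

definition koszul_W :: "('v, 'b) pre_digraph \<Rightarrow> ('v, 'b, 'f::field) pelem set \<Rightarrow>
    int \<Rightarrow> ('v, 'b, 'f) pelem set" where
  "koszul_W G R p =
     (if p < 0 then {\<zero>\<^bsub>path_algebra G\<^esub>}
      else if p < 2 then path_part G (nat p)
      else \<Inter>{relation_part G R i j | i j. i + 2 + j = nat p})"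

text \<open>\<open>W\<^sub>p\<close> as a \<open>k\<close>-bimodule, and \<open>A\<close> as an \<open>A\<close>-\<open>k\<close>-bimodule and as a \<open>k\<close>-\<open>A\<close>-bimodule.\<close>

definition W_bimod :: "('v, 'b) pre_digraph \<Rightarrow> ('v, 'b, 'f::field) pelem set \<Rightarrow> int \<Rightarrow>
    (('v, 'b, 'f) pelem, ('v, 'b, 'f) pelem, ('v, 'b, 'f) pelem) bimod" where
  "W_bimod G R p = as_bimod ((path_algebra G)\<lparr>carrier := koszul_W G R p\<rparr>)
     (monoid.mult (path_algebra G)) (monoid.mult (path_algebra G))"

definition A_k_bimod :: "('v, 'b) pre_digraph \<Rightarrow> ('v, 'b, 'f::field) pelem set \<Rightarrow>
    (('v, 'b, 'f) qelem, ('v, 'b, 'f) pelem, ('v, 'b, 'f) qelem) bimod" where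
  "A_k_bimod G R = as_bimod (quad_algebra G R) (monoid.mult (quad_algebra G R))
     (\<lambda>a c. a \<otimes>\<^bsub>quad_algebra G R\<^esub> quad_class G R c)"

definition k_A_bimod :: "('v, 'b) pre_digraph \<Rightarrow> ('v, 'b, 'f::field) pelem set \<Rightarrow>
    (('v, 'b, 'f) pelem, ('v, 'b, 'f) qelem, ('v, 'b, 'f) qelem) bimod" where
  "k_A_bimod G R = as_bimod (quad_algebra G R)
     (\<lambda>c a. quad_class G R c \<otimes>\<^bsub>quad_algebra G R\<^esub> a) (monoid.mult (quad_algebra G R))"

type_synonym ('v, 'b, 'f) awelem = "(('v, 'b, 'f) qelem \<times> ('v, 'b, 'f) pelem \<Rightarrow>\<^sub>0 int) set"
type_synonym ('v, 'b, 'f) kelem = "(('v, 'b, 'f) awelem \<times> ('v, 'b, 'f) qelem \<Rightarrow>\<^sub>0 int) set"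

definition AW_bimod :: "('v, 'b) pre_digraph \<Rightarrow> ('v, 'b, 'f::field) pelem set \<Rightarrow> int \<Rightarrow>
    (('v, 'b, 'f) qelem, ('v, 'b, 'f) pelem, ('v, 'b, 'f) awelem) bimod" where
  "AW_bimod G R p = tensor (path_part G 0) (A_k_bimod G R) (W_bimod G R p)"

definition koszul_obj :: "('v, 'b) pre_digraph \<Rightarrow> ('v, 'b, 'f::field) pelem set \<Rightarrow> int \<Rightarrow>
    (('v, 'b, 'f) qelem, ('v, 'b, 'f) qelem, ('v, 'b, 'f) kelem) bimod" where
  "koszul_obj G R p = tensor (path_part G 0) (AW_bimod G R p) (k_A_bimod G R)"

text \<open>The element \<open>a \<otimes> w \<otimes> a'\<close> of \<open>K(A)\<^sub>p\<close>.\<close>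

definition koszul_pure :: "('v, 'b) pre_digraph \<Rightarrow> ('v, 'b, 'f::field) pelem set \<Rightarrow> int \<Rightarrow>
    ('v, 'b, 'f) qelem \<Rightarrow> ('v, 'b, 'f) pelem \<Rightarrow> ('v, 'b, 'f) qelem \<Rightarrow> ('v, 'b, 'f) kelem" where
  "koszul_pure G R p a w a' = pure_tensor (path_part G 0) (AW_bimod G R p) (k_A_bimod G R)
     (pure_tensor (path_part G 0) (A_k_bimod G R) (W_bimod G R p) a w) a'"

text \<open>
  An element \<open>w\<close> of degree \<open>p \<ge> 1\<close> decomposes uniquely as the sum over all arrows \<open>x\<close> of
  \<open>x \<cdot> left_strip G x w\<close> and as the sum of \<open>right_strip G x w \<cdot> x\<close>, where the stripped elements
  end at the source, respectively start at the target, of \<open>x\<close>. These are the sums understood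
  in the notation \<open>x\<^sub>1 (x\<^sub>2 \<dots> x\<^sub>p)\<close> and \<open>(x\<^sub>1 \<dots> x\<^sub>p\<^sub>-\<^sub>1) x\<^sub>p\<close>.
\<close>

definition left_strip :: "('v, 'b) pre_digraph \<Rightarrow> 'b \<Rightarrow> ('v, 'b, 'f::field) pelem \<Rightarrow>
    ('v, 'b, 'f) pelem" where
  "left_strip G x w = (\<lambda>(j, u, i). if j = tail G x then w (head G x, x # u, i) else 0)"

definition right_strip :: "('v, 'b) pre_digraph \<Rightarrow> 'b \<Rightarrow> ('v, 'b, 'f::field) pelem \<Rightarrow>
    ('v, 'b, 'f) pelem" where
  "right_strip G x w = (\<lambda>(j, u, i). if i = head G x then w (j, u @ [x], tail G x) else 0)"

definition koszul_dif_pure :: "('v, 'b) pre_digraph \<Rightarrow> ('v, 'b, 'f::field) pelem set \<Rightarrow> int \<Rightarrow>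
    ('v, 'b, 'f) qelem \<Rightarrow> ('v, 'b, 'f) pelem \<Rightarrow> ('v, 'b, 'f) qelem \<Rightarrow> ('v, 'b, 'f) kelem" where
  "koszul_dif_pure G R p a w a' = (let A = quad_algebra G R; K = koszul_obj G R (p - 1) in
     (\<Oplus>\<^bsub>K\<^esub>x\<in>arcs G.
        koszul_pure G R (p - 1) (a \<otimes>\<^bsub>A\<^esub> quad_class G R (arrow_elem G x)) (left_strip G x w) a')
     \<oplus>\<^bsub>K\<^esub>
     signed K p (\<Oplus>\<^bsub>K\<^esub>x\<in>arcs G.
        koszul_pure G R (p - 1) a (right_strip G x w) (quad_class G R (arrow_elem G x) \<otimes>\<^bsub>A\<^esub> a')))"

definition koszul_dif :: "('v, 'b) pre_digraph \<Rightarrow> ('v, 'b, 'f::field) pelem set \<Rightarrow> int \<Rightarrow>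
    ('v, 'b, 'f) kelem \<Rightarrow> ('v, 'b, 'f) kelem" where
  "koszul_dif G R p =
     tensor_lift (path_part G 0) (AW_bimod G R p) (k_A_bimod G R) (koszul_obj G R (p - 1))
       (\<lambda>t a'. tensor_lift (path_part G 0) (A_k_bimod G R) (W_bimod G R p)
          (koszul_obj G R (p - 1)) (\<lambda>a w. koszul_dif_pure G R p a w a') t)"

definition koszul_complex :: "('v, 'b) pre_digraph \<Rightarrow> ('v, 'b, 'f::field) pelem set \<Rightarrow>
    ((('v, 'b, 'f) qelem, ('v, 'b, 'f) qelem, ('v, 'b, 'f) kelem) bimod, ('v, 'b, 'f) kelem)
      gcomplex" where
  "koszul_complex G R = \<lparr>obj = koszul_obj G R, dif = koszul_dif G R\<rparr>"

definition HK_homology :: "('v, 'b) pre_digraph \<Rightarrow> ('v, 'b, 'f::field) pelem set \<Rightarrow>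
    (('v, 'b, 'f) qelem, ('v, 'b, 'f) qelem, 'm) bimod \<Rightarrow> int \<Rightarrow>
    ('f, ('m \<times> ('v, 'b, 'f) kelem \<Rightarrow>\<^sub>0 int) set set) module" where
  "HK_homology G R M p =
     homology_space (env_tensor_complex (quad_algebra G R) M (koszul_complex G R)) p"

definition HK_cohomology :: "('v, 'b) pre_digraph \<Rightarrow> ('v, 'b, 'f::field) pelem set \<Rightarrow>
    (('v, 'b, 'f) qelem, ('v, 'b, 'f) qelem, 'm) bimod \<Rightarrow> int \<Rightarrow>
    ('f, (('v, 'b, 'f) kelem \<Rightarrow> 'm) set) module" where
  "HK_cohomology G R M p =
     cohomology_space (hom_complex (quad_algebra G R) (koszul_complex G R) M) p"

definition koszul_length :: "('v, 'b) pre_digraph \<Rightarrow> ('v, 'b, 'f::field) pelem set \<Rightarrow> nat \<Rightarrow> bool"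
  where
  "koszul_length G R n \<longleftrightarrow>
     carrier (koszul_obj G R (int n)) \<noteq> {\<zero>\<^bsub>koszul_obj G R (int n)\<^esub>} \<and>
     (\<forall>p>int n. carrier (koszul_obj G R p) = {\<zero>\<^bsub>koszul_obj G R p\<^esub>})"

text \<open>
  \<open>K(A)\<close> is a bounded complex of finitely generated projective bimodules, so that
  \<open>RHom\<^bsub>A\<^sup>e\<^esub>(K(A), A\<^sup>e)\<close> is the complex \<open>Hom\<^bsub>A\<^sup>e\<^esub>(K(A), A\<^sup>e)\<close>.
\<close>

definition kc_calabi_yau :: "'z itself \<Rightarrow> ('v, 'b) pre_digraph \<Rightarrow>
    ('v, 'b, 'f::field) pelem set \<Rightarrow> nat \<Rightarrow> bool" where
  "kc_calabi_yau U G R n \<longleftrightarrow> koszul_length G R n \<and>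
     derived_iso U (quad_algebra G R)
       (hom_env_complex (quad_algebra G R) (koszul_complex G R))
       (shift_cochain (int n) (koszul_complex G R))"

definition vector_space_iso :: "('f, 'x) module \<Rightarrow> ('f, 'y) module \<Rightarrow> bool" where
  "vector_space_iso V W \<longleftrightarrow> (\<exists>\<phi>\<in>iso (add_monoid V) (add_monoid W).
     \<forall>c. \<forall>x\<in>carrier V. \<phi> (c \<odot>\<^bsub>V\<^esub> x) = c \<odot>\<^bsub>W\<^esub> \<phi> x)"

end

theory Submission
  imports Defs
begin

text \<open>
  Each \<open>W\<^sub>p\<close> is finite-dimensional, so \<open>K(A)\<^sub>p\<close> has a finite dual basis over \<open>A\<^sup>e\<close>. Evaluation then gives a
  natural isomorphism of \<open>M \<otimes> Hom(K(A)\<^sub>p, A\<^sup>e)\<close> (tensor product over \<open>A\<^sup>e\<close>) with \<open>Hom(K(A)\<^sub>p, M)\<close>. The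
  complexes \<open>Hom(K(A), A\<^sup>e)\<close> and \<open>K(A)[-n]\<close> are bounded with projective terms, and a map from such a complex
  lifts up to homotopy along quasi-isomorphisms. Hence the roof between them given by the Calabi-Yau condition
  collapses to a homotopy equivalence, which remains one after tensoring with \<open>M\<close> over \<open>A\<^sup>e\<close>; the cohomology
  of \<open>M \<otimes> K(A)[-n]\<close> in degree \<open>p\<close> is \<open>HK\<close> homology in degree \<open>n - p\<close>.
\<close>

section \<open>Tensor products of bimodules\<close>

text \<open>Tensoring with \<open>M\<close> need not preserve quasi-isomorphisms out of the apex of
  a roof, whose terms are arbitrary bimodules; it does preserve homotopies, being additive. So every
  comparison has to be moved onto the two outer complexes. Projectivity enters through dual bases
  x_i, f_i with y the sum of the f_i(y) x_i: choices z_i made at the x_i extend to the bimodule map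
  sending y to the sum of the f_i(y) z_i. A dual basis passes to the dual by exchanging the factors
  of A^e, which swaps its outer and inner bimodule structures. As k is a product of copies of the
  field, A \<otimes> W_p \<otimes> A over k is in general not free; the idempotents at the ends of a
  path cut the right summand out of A^e. That K(A) is a complex has to be proved: the mixed terms of
  d^2 cancel by sign, and the outer ones vanish because fixing the last or first p - 2 letters of an
  element of W_p leaves a relation, which is zero in A. Tensor products are quotients of free
  abelian groups and maps out of them are definite descriptions, so a map exists once its data are
  balanced, and identities are checked on pure tensors.\<close>

definition additive_map :: "('m, 'x) ring_scheme \<Rightarrow> ('n, 'y) ring_scheme \<Rightarrow> ('m \<Rightarrow> 'n) \<Rightarrow> bool" where
  "additive_map P Q h \<longleftrightarrow> (\<forall>x\<in>carrier P. h x \<in> carrier Q) \<and>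
     (\<forall>x\<in>carrier P. \<forall>y\<in>carrier P. h (x \<oplus>\<^bsub>P\<^esub> y) = h x \<oplus>\<^bsub>Q\<^esub> h y)"

lemma additive_map_iff_hom: "additive_map P Q h \<longleftrightarrow> h \<in> hom (add_monoid P) (add_monoid Q)"
  unfolding additive_map_def hom_def by auto

lemma additive_mapI:
  assumes "\<And>x. x \<in> carrier P \<Longrightarrow> h x \<in> carrier Q"
    and "\<And>x y. x \<in> carrier P \<Longrightarrow> y \<in> carrier P \<Longrightarrow> h (x \<oplus>\<^bsub>P\<^esub> y) = h x \<oplus>\<^bsub>Q\<^esub> h y"
  shows "additive_map P Q h"
  using assms unfolding additive_map_def by blast

lemma additive_map_closed: "additive_map P Q h \<Longrightarrow> x \<in> carrier P \<Longrightarrow> h x \<in> carrier Q"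
  unfolding additive_map_def by blast

lemma additive_map_add:
  "additive_map P Q h \<Longrightarrow> x \<in> carrier P \<Longrightarrow> y \<in> carrier P \<Longrightarrow> h (x \<oplus>\<^bsub>P\<^esub> y) = h x \<oplus>\<^bsub>Q\<^esub> h y"
  unfolding additive_map_def by blast

lemma additive_map_zero:
  assumes "abelian_group P" "abelian_group Q" "additive_map P Q h"
  shows "h \<zero>\<^bsub>P\<^esub> = \<zero>\<^bsub>Q\<^esub>"
proof -
  interpret P: abelian_group P by fact
  interpret Q: abelian_group Q by fact
  have "h \<zero>\<^bsub>P\<^esub> \<oplus>\<^bsub>Q\<^esub> h \<zero>\<^bsub>P\<^esub> = h \<zero>\<^bsub>P\<^esub>"
    using additive_map_add[OF assms(3), of "\<zero>\<^bsub>P\<^esub>" "\<zero>\<^bsub>P\<^esub>"] by simp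
  then show ?thesis
    using additive_map_closed[OF assms(3) P.zero_closed] by simp
qed

lemma additive_map_neg:
  assumes "abelian_group P" "abelian_group Q" "additive_map P Q h" "x \<in> carrier P"
  shows "h (\<ominus>\<^bsub>P\<^esub> x) = \<ominus>\<^bsub>Q\<^esub> h x"
proof -
  interpret P: abelian_group P by fact
  interpret Q: abelian_group Q by fact
  have "h (\<ominus>\<^bsub>P\<^esub> x) \<oplus>\<^bsub>Q\<^esub> h x = \<zero>\<^bsub>Q\<^esub>"
    using additive_map_add[OF assms(3), of "\<ominus>\<^bsub>P\<^esub> x" x] additive_map_zero[OF assms(1-3)] assms(4)
    by (simp add: P.l_neg)
  then show ?thesis
    using additive_map_closed[OF assms(3)] assms(4) by (simp add: Q.minus_equality)
qed

lemma additive_map_finsum: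
  assumes "abelian_group P" "abelian_group Q" "additive_map P Q h"
    and "\<And>i. i \<in> I \<Longrightarrow> g i \<in> carrier P"
  shows "h (\<Oplus>\<^bsub>P\<^esub>i\<in>I. g i) = (\<Oplus>\<^bsub>Q\<^esub>i\<in>I. h (g i))"
proof -
  interpret P: abelian_group P by fact
  interpret Q: abelian_group Q by fact
  note z = additive_map_zero[OF assms(1-3)]
  show ?thesis
    using assms(4)
  proof (induction I rule: infinite_finite_induct)
    case (insert i I)
    then have "h (\<Oplus>\<^bsub>P\<^esub>i\<in>insert i I. g i) = h (g i \<oplus>\<^bsub>P\<^esub> (\<Oplus>\<^bsub>P\<^esub>i\<in>I. g i))"
      by (subst P.finsum_insert) auto
    also have "\<dots> = h (g i) \<oplus>\<^bsub>Q\<^esub> h (\<Oplus>\<^bsub>P\<^esub>i\<in>I. g i)"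
      using insert by (intro additive_map_add[OF assms(3)] P.finsum_closed) auto
    also have "\<dots> = h (g i) \<oplus>\<^bsub>Q\<^esub> (\<Oplus>\<^bsub>Q\<^esub>i\<in>I. h (g i))"
      using insert by simp
    also have "\<dots> = (\<Oplus>\<^bsub>Q\<^esub>i\<in>insert i I. h (g i))"
      using insert additive_map_closed[OF assms(3)] by (subst Q.finsum_insert) auto
    finally show ?case .
  qed (simp_all add: z)
qed

lemma additive_map_comp:
  "additive_map P Q f \<Longrightarrow> additive_map Q T g \<Longrightarrow> additive_map P T (\<lambda>x. g (f x))"
  unfolding additive_map_def by auto

section \<open>Balanced maps and the universal property of the tensor product\<close>

definition balanced_map :: "'s set \<Rightarrow> ('a, 's, 'm) bimod \<Rightarrow> ('s, 'b, 'n) bimod \<Rightarrow>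
    ('p, 'x) ring_scheme \<Rightarrow> ('m \<Rightarrow> 'n \<Rightarrow> 'p) \<Rightarrow> bool" where
  "balanced_map S M N P \<beta> \<longleftrightarrow>
     (\<forall>n\<in>carrier N. additive_map M P (\<lambda>m. \<beta> m n)) \<and>
     (\<forall>m\<in>carrier M. additive_map N P (\<beta> m)) \<and>
     (\<forall>m\<in>carrier M. \<forall>s\<in>S. \<forall>n\<in>carrier N. \<beta> (ract M m s) n = \<beta> m (lact N s n))"

lemma balanced_mapI:
  assumes "\<And>m n. m \<in> carrier M \<Longrightarrow> n \<in> carrier N \<Longrightarrow> \<beta> m n \<in> carrier P"
    and "\<And>m m' n. m \<in> carrier M \<Longrightarrow> m' \<in> carrier M \<Longrightarrow> n \<in> carrier N \<Longrightarrow>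
      \<beta> (m \<oplus>\<^bsub>M\<^esub> m') n = \<beta> m n \<oplus>\<^bsub>P\<^esub> \<beta> m' n"
    and "\<And>m n n'. m \<in> carrier M \<Longrightarrow> n \<in> carrier N \<Longrightarrow> n' \<in> carrier N \<Longrightarrow>
      \<beta> m (n \<oplus>\<^bsub>N\<^esub> n') = \<beta> m n \<oplus>\<^bsub>P\<^esub> \<beta> m n'"
    and "\<And>m s n. m \<in> carrier M \<Longrightarrow> s \<in> S \<Longrightarrow> n \<in> carrier N \<Longrightarrow>
      \<beta> (ract M m s) n = \<beta> m (lact N s n)"
  shows "balanced_map S M N P \<beta>"
  using assms unfolding balanced_map_def by (auto intro!: additive_mapI)

lemma tensor_sel:
  "carrier (tensor S M N) = carrier (tensor_group S M N)"
  "add (tensor S M N) = add (tensor_group S M N)"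
  "ring.zero (tensor S M N) = ring.zero (tensor_group S M N)"
  by (simp_all add: tensor_def as_bimod_def Let_def)

text \<open>The balancing set \<open>S\<close> carries no ring structure and has only to act inside
  the carriers. This covers both the vertex algebra and \<open>carrier A \<times> carrier A\<close>,
  whose pairs stand for pure tensors and not for all elements of the enveloping algebra.\<close>

locale tensor_context = M: abelian_group M + N: abelian_group N
  for S :: "'s set" and M :: "('a, 's, 'm) bimod" and N :: "('s, 'b, 'n) bimod" +
  assumes balance_ract_closed: "s \<in> S \<Longrightarrow> m \<in> carrier M \<Longrightarrow> ract M m s \<in> carrier M"
    and balance_lact_closed: "s \<in> S \<Longrightarrow> n \<in> carrier N \<Longrightarrow> lact N s n \<in> carrier N"
begin

abbreviation "free_pairs \<equiv> free_Abelian_group (carrier M \<times> carrier N)"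
abbreviation "ker \<equiv> tensor_kernel S M N"
abbreviation "T \<equiv> tensor S M N"
abbreviation "pure \<equiv> pure_tensor S M N"

sublocale F: comm_group free_pairs
  by (rule abelian_free_Abelian_group)

lemma diff_closed: "x \<in> carrier free_pairs \<Longrightarrow> y \<in> carrier free_pairs \<Longrightarrow> x - y \<in> carrier free_pairs"
  using keys_diff[of x y] by auto

lemma relators_subset: "tensor_relators S M N \<subseteq> carrier free_pairs"
  unfolding tensor_relators_def
  by (auto simp del: carrier_free_Abelian_group_iff
      intro!: diff_closed simp: balance_ract_closed balance_lact_closed)

lemma kernel_subgroup: "subgroup ker free_pairs"
  unfolding tensor_kernel_def by (rule F.generate_is_subgroup[OF relators_subset])

lemma kernel_normal: "ker \<lhd> free_pairs"
  by (rule F.subgroup_imp_normal[OF kernel_subgroup])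

sublocale ker: normal ker free_pairs
  by (rule kernel_normal)

lemma tensor_group_sel:
  "carrier T = carrier (free_pairs Mod ker)"
  "add T = monoid.mult (free_pairs Mod ker)"
  "\<zero>\<^bsub>T\<^esub> = \<one>\<^bsub>free_pairs Mod ker\<^esub>"
  by (simp_all add: tensor_sel tensor_group_def Let_def)

lemma comm_group_T: "comm_group (add_monoid T)"
proof -
  have "comm_group (free_pairs Mod ker)"
    by (rule F.abelian_FactGroup[OF kernel_subgroup])
  then show ?thesis
    by (auto simp: comm_group_def comm_monoid_def comm_monoid_axioms_def group_def group_axioms_def
        monoid_def Units_def tensor_group_sel)
qed

sublocale T: abelian_group T
  using comm_group_T
  by (auto simp: abelian_group_def abelian_monoid_def abelian_group_axioms_def comm_group_def)

lemma abelian_group_tensor_group: "abelian_group (tensor_group S M N)"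
proof -
  have "comm_group (add_monoid (tensor_group S M N))"
    using comm_group_T unfolding tensor_sel
    by (auto simp: comm_group_def comm_monoid_def comm_monoid_axioms_def group_def group_axioms_def
        monoid_def Units_def)
  then show ?thesis
    by (auto simp: abelian_group_def abelian_monoid_def abelian_group_axioms_def comm_group_def)
qed

lemma coset_add:
  assumes "x \<in> carrier free_pairs" "y \<in> carrier free_pairs"
  shows "(ker #>\<^bsub>free_pairs\<^esub> x) \<oplus>\<^bsub>T\<^esub> (ker #>\<^bsub>free_pairs\<^esub> y) = ker #>\<^bsub>free_pairs\<^esub> (x + y)"
  using ker.rcos_sum[OF assms] by (simp add: tensor_group_sel)

lemma coset_closed: "x \<in> carrier free_pairs \<Longrightarrow> (ker #>\<^bsub>free_pairs\<^esub> x) \<in> carrier T"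
  unfolding tensor_group_sel by (auto simp: FactGroup_def RCOSETS_def)

lemma coset_eqI:
  assumes "x \<in> carrier free_pairs" "y \<in> carrier free_pairs" "x - y \<in> ker"
  shows "ker #>\<^bsub>free_pairs\<^esub> x = ker #>\<^bsub>free_pairs\<^esub> y"
proof -
  have "x \<in> ker #>\<^bsub>free_pairs\<^esub> y"
    unfolding r_coset_def using assms(3) by (auto intro!: bexI[of _ "x - y"])
  then show ?thesis
    using F.repr_independence[OF _ assms(2) kernel_subgroup] by simp
qed

lemma pure_closed: "m \<in> carrier M \<Longrightarrow> n \<in> carrier N \<Longrightarrow> pure m n \<in> carrier T"
  unfolding pure_tensor_def by (rule coset_closed) simp

lemma relator_in_kernel: "r \<in> tensor_relators S M N \<Longrightarrow> r \<in> ker"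
  unfolding tensor_kernel_def by (rule generate.incl)

lemma frag_of_closed: "m \<in> carrier M \<Longrightarrow> n \<in> carrier N \<Longrightarrow> frag_of (m, n) \<in> carrier free_pairs"
  by simp

lemma add_closed: "x \<in> carrier free_pairs \<Longrightarrow> y \<in> carrier free_pairs \<Longrightarrow> x + y \<in> carrier free_pairs"
  using F.m_closed by simp

lemma pure_add_left:
  assumes "m \<in> carrier M" "m' \<in> carrier M" "n \<in> carrier N"
  shows "pure (m \<oplus>\<^bsub>M\<^esub> m') n = pure m n \<oplus>\<^bsub>T\<^esub> pure m' n"
proof -
  have "frag_of (m \<oplus>\<^bsub>M\<^esub> m', n) - frag_of (m, n) - frag_of (m', n) \<in> ker"
    using assms by (intro relator_in_kernel) (auto simp: tensor_relators_def)
  then show ?thesis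
    unfolding pure_tensor_def using assms
    by (subst coset_add, simp, simp) (intro coset_eqI add_closed frag_of_closed, auto simp: algebra_simps)
qed

lemma pure_add_right:
  assumes "m \<in> carrier M" "n \<in> carrier N" "n' \<in> carrier N"
  shows "pure m (n \<oplus>\<^bsub>N\<^esub> n') = pure m n \<oplus>\<^bsub>T\<^esub> pure m n'"
proof -
  have "frag_of (m, n \<oplus>\<^bsub>N\<^esub> n') - frag_of (m, n) - frag_of (m, n') \<in> ker"
    using assms by (intro relator_in_kernel) (auto simp: tensor_relators_def)
  then show ?thesis
    unfolding pure_tensor_def using assms
    by (subst coset_add, simp, simp) (intro coset_eqI add_closed frag_of_closed, auto simp: algebra_simps)
qed

lemma pure_balanced:
  assumes "m \<in> carrier M" "s \<in> S" "n \<in> carrier N"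
  shows "pure (ract M m s) n = pure m (lact N s n)"
proof -
  have "frag_of (ract M m s, n) - frag_of (m, lact N s n) \<in> ker"
    using assms by (intro relator_in_kernel) (auto simp: tensor_relators_def)
  then show ?thesis
    unfolding pure_tensor_def using assms
    by (intro coset_eqI frag_of_closed) (auto simp: balance_ract_closed balance_lact_closed)
qed

lemma pure_zero_left:
  assumes "n \<in> carrier N"
  shows "pure \<zero>\<^bsub>M\<^esub> n = \<zero>\<^bsub>T\<^esub>"
  by (rule additive_map_zero[OF M.abelian_group_axioms T.abelian_group_axioms, of "\<lambda>m. pure m n"])
    (auto intro!: additive_mapI simp: assms pure_closed pure_add_left)

lemma pure_zero_right:
  assumes "m \<in> carrier M"
  shows "pure m \<zero>\<^bsub>N\<^esub> = \<zero>\<^bsub>T\<^esub>"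
  by (rule additive_map_zero[OF N.abelian_group_axioms T.abelian_group_axioms, of "pure m"])
    (auto intro!: additive_mapI simp: assms pure_closed pure_add_right)

lemma pure_neg:
  assumes "m \<in> carrier M" "n \<in> carrier N"
  shows "\<ominus>\<^bsub>T\<^esub> pure m n = pure (\<ominus>\<^bsub>M\<^esub> m) n"
  by (rule additive_map_neg[OF M.abelian_group_axioms T.abelian_group_axioms, of "\<lambda>m. pure m n", symmetric])
    (auto intro!: additive_mapI simp: assms pure_closed pure_add_left)

text \<open>Neither zero nor negatives need a case of their own: zero is the pure tensor of two
  zeros, and minus a pure tensor is again pure, the sign being absorbed into the left
  factor.\<close>

lemma tensor_induct [consumes 1, case_names pure add]:
  assumes t: "t \<in> carrier T"
    and pure: "\<And>m n. m \<in> carrier M \<Longrightarrow> n \<in> carrier N \<Longrightarrow> P (pure m n)"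
    and add: "\<And>t u. t \<in> carrier T \<Longrightarrow> u \<in> carrier T \<Longrightarrow> P t \<Longrightarrow> P u \<Longrightarrow> P (t \<oplus>\<^bsub>T\<^esub> u)"
  shows "P t"
proof -
  define c where "c x = ker #>\<^bsub>free_pairs\<^esub> x" for x
  have cfrag: "c (frag_of (m, n)) = pure m n" for m n
    by (simp add: c_def pure_tensor_def)
  obtain x where x: "x \<in> carrier free_pairs" "t = c x"
    using t unfolding tensor_group_sel c_def by (auto simp: FactGroup_def RCOSETS_def)
  have zero: "\<zero>\<^bsub>T\<^esub> = c 0"
  proof -
    have "\<zero>\<^bsub>T\<^esub> = ker" by (simp add: tensor_group_sel FactGroup_def)
    also have "\<dots> = c 0"
      unfolding c_def r_coset_def by simp
    finally show ?thesis .
  qed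
  have neg: "c (- y) = \<ominus>\<^bsub>T\<^esub> c y" if y: "y \<in> carrier free_pairs" for y
  proof -
    have y': "- y \<in> carrier free_pairs" using y by simp
    have "c (- y) \<oplus>\<^bsub>T\<^esub> c y = \<zero>\<^bsub>T\<^esub>"
      unfolding c_def by (subst coset_add[OF y' y]) (simp add: zero c_def)
    then show ?thesis
      using coset_closed[OF y] coset_closed[OF y'] T.minus_equality unfolding c_def by simp
  qed
  have Pz: "P \<zero>\<^bsub>T\<^esub>"
    using pure[of "\<zero>\<^bsub>M\<^esub>" "\<zero>\<^bsub>N\<^esub>"] by (simp add: pure_zero_left)
  have neg0: "\<ominus>\<^bsub>T\<^esub> \<zero>\<^bsub>T\<^esub> = \<zero>\<^bsub>T\<^esub>"
    by (rule T.minus_equality) simp_all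
  \<comment> \<open>Induction on the free abelian group produces differences, so the claim is
    strengthened to include the negative of the coset.\<close>
  have "P (c x) \<and> P (\<ominus>\<^bsub>T\<^esub> c x)"
    using x(1) unfolding carrier_free_Abelian_group_iff
  proof (induction x rule: free_Abelian_group_induct[consumes 1])
    case 1
    then show ?case using Pz by (simp only: zero[symmetric] neg0)
  next
    case (2 x y)
    then have x: "x \<in> carrier free_pairs" and y: "y \<in> carrier free_pairs" by auto
    then have y': "- y \<in> carrier free_pairs" by simp
    have eq: "c (x - y) = c x \<oplus>\<^bsub>T\<^esub> \<ominus>\<^bsub>T\<^esub> c y"
      using coset_add[OF x y'] neg[OF y] by (simp add: c_def)
    have cl: "c x \<in> carrier T" "c y \<in> carrier T"
      using coset_closed x y by (auto simp: c_def)
    have "\<ominus>\<^bsub>T\<^esub> c (x - y) = \<ominus>\<^bsub>T\<^esub> c x \<oplus>\<^bsub>T\<^esub> c y"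
      using cl by (simp add: eq T.minus_add)
    then show ?case
      using 2(3,4) cl by (auto simp: eq intro!: add)
  next
    case (3 a)
    then show ?case
      by (cases a) (auto simp: cfrag pure_neg intro!: pure)
  qed
  then show ?thesis using x(2) by simp
qed

lemma additive_map_eqI:
  assumes "additive_map T P f" "additive_map T P g"
    and "\<And>m n. m \<in> carrier M \<Longrightarrow> n \<in> carrier N \<Longrightarrow> f (pure m n) = g (pure m n)"
    and "t \<in> carrier T"
  shows "f t = g t"
  using assms(4)
proof (induction rule: tensor_induct)
  case (add t u)
  then show ?case by (simp add: additive_map_add[OF assms(1)] additive_map_add[OF assms(2)])
qed (use assms(3) in auto)

text \<open>The map is first extended additively to the free group; it vanishes on the three kinds
  of relators because \<open>\<beta>\<close> is balanced, hence on the subgroup they generate, and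
  so it factors through the quotient.\<close>

lemma lift_exists:
  assumes P: "abelian_group P" and \<beta>: "balanced_map S M N P \<beta>"
  shows "\<exists>h. additive_map T P h \<and> (\<forall>m\<in>carrier M. \<forall>n\<in>carrier N. h (pure m n) = \<beta> m n)"
proof -
  interpret P: abelian_group P by fact
  have bl: "\<beta> m n \<in> carrier P" if "m \<in> carrier M" "n \<in> carrier N" for m n
    using \<beta> that unfolding balanced_map_def additive_map_def by blast
  have "(\<lambda>(m, n). \<beta> m n) ` (carrier M \<times> carrier N) \<subseteq> carrier (add_monoid P)"
    using bl by auto
  then obtain h where h: "h \<in> hom free_pairs (add_monoid P)"
    and hf: "\<And>x. x \<in> carrier M \<times> carrier N \<Longrightarrow> h (frag_of x) = (\<lambda>(m, n). \<beta> m n) x"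
    using P.a_comm_group comm_group.free_Abelian_group_universal by blast
  interpret h: group_hom free_pairs "add_monoid P" h
    using h P.a_group by (intro group_hom.intro group_hom_axioms.intro F.group_axioms) auto
  have hadd: "h (x + y) = h x \<oplus>\<^bsub>P\<^esub> h y" if "x \<in> carrier free_pairs" "y \<in> carrier free_pairs" for x y
    using h.hom_mult[OF that] by simp
  have hcl: "h x \<in> carrier P" if "x \<in> carrier free_pairs" for x
    using h.hom_closed[OF that] by simp
  have hdiff: "h (x - y) \<oplus>\<^bsub>P\<^esub> h y = h x" if "x \<in> carrier free_pairs" "y \<in> carrier free_pairs" for x y
    using hadd[OF diff_closed[OF that] that(2)] by simp
  have hrel: "h r = \<zero>\<^bsub>P\<^esub>" if r: "r \<in> tensor_relators S M N" for r
  proof -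
    have key: "h (x - y) = \<zero>\<^bsub>P\<^esub>" if "x \<in> carrier free_pairs" "y \<in> carrier free_pairs" "h x = h y" for x y
      using hdiff[OF that(1,2)] that(3) hcl[OF that(2)] hcl[OF diff_closed[OF that(1,2)]]
      by (simp add: P.add.r_cancel_one)
    consider m m' n where "m \<in> carrier M" "m' \<in> carrier M" "n \<in> carrier N"
        "r = frag_of (m \<oplus>\<^bsub>M\<^esub> m', n) - (frag_of (m, n) + frag_of (m', n))"
      | m n n' where "m \<in> carrier M" "n \<in> carrier N" "n' \<in> carrier N"
        "r = frag_of (m, n \<oplus>\<^bsub>N\<^esub> n') - (frag_of (m, n) + frag_of (m, n'))"
      | m s n where "m \<in> carrier M" "s \<in> S" "n \<in> carrier N"
        "r = frag_of (ract M m s, n) - frag_of (m, lact N s n)"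
      using r unfolding tensor_relators_def by (fastforce simp: algebra_simps)
    then show ?thesis
    proof cases
      case 1
      with \<beta> show ?thesis
        by (auto intro!: key add_closed simp: hadd hf balanced_map_def additive_map_def
            simp del: carrier_free_Abelian_group_iff)
    next
      case 2
      with \<beta> show ?thesis
        by (auto intro!: key add_closed simp: hadd hf balanced_map_def additive_map_def
            simp del: carrier_free_Abelian_group_iff)
    next
      case 3
      with \<beta> show ?thesis
        by (auto intro!: key simp: hf balanced_map_def balance_ract_closed balance_lact_closed
            simp del: carrier_free_Abelian_group_iff)
    qed
  qed
  have hker: "h r = \<zero>\<^bsub>P\<^esub>" if "r \<in> ker" for r
  proof -
    have "ker \<subseteq> kernel free_pairs (add_monoid P) h"
      unfolding tensor_kernel_def
      by (rule F.generate_subgroup_incl[OF _ h.subgroup_kernel])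
        (use relators_subset hrel in \<open>auto simp: kernel_def simp del: carrier_free_Abelian_group_iff\<close>)
    then show ?thesis using that by (auto simp: kernel_def)
  qed
  have "h x = h y" if "x \<in> carrier free_pairs" "y \<in> carrier free_pairs"
    "ker #>\<^bsub>free_pairs\<^esub> x = ker #>\<^bsub>free_pairs\<^esub> y" for x y
  proof -
    have "x \<in> ker #>\<^bsub>free_pairs\<^esub> y"
      using F.rcos_self[OF that(1) kernel_subgroup] that(3) by simp
    then obtain k where k: "k \<in> ker" "x = k + y"
      unfolding r_coset_def by auto
    have "k \<in> carrier free_pairs" using k(1) ker.subset by blast
    then show ?thesis
      using hadd[OF _ that(2), of k] hker[OF k(1)] k(2) hcl[OF that(2)] by simp
  qed
  then obtain g where g: "g \<in> hom (free_pairs Mod ker) (add_monoid P)"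
    and gx: "\<And>x. x \<in> carrier free_pairs \<Longrightarrow> g (ker #>\<^bsub>free_pairs\<^esub> x) = h x"
    using FactGroup_universal[OF h kernel_normal] by blast
  show ?thesis
  proof (intro exI conjI ballI)
    show "additive_map T P g"
      using g by (auto simp: additive_map_def hom_def tensor_group_sel Pi_iff)
    show "g (pure m n) = \<beta> m n" if "m \<in> carrier M" "n \<in> carrier N" for m n
      unfolding pure_tensor_def using that by (subst gx) (simp_all add: hf)
  qed
qed

text \<open>\<open>tensor_lift\<close> is a definite description, so uniqueness is needed besides
  existence: an additive map is determined by its values on pure tensors, and extensionality fixes
  it off the carrier.\<close>

lemma lift_props:
  assumes P: "abelian_group P" and \<beta>: "balanced_map S M N P \<beta>"
  shows "additive_map T P (tensor_lift S M N P \<beta>)"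
    and "m \<in> carrier M \<Longrightarrow> n \<in> carrier N \<Longrightarrow> tensor_lift S M N P \<beta> (pure m n) = \<beta> m n"
    and "tensor_lift S M N P \<beta> \<in> extensional (carrier T)"
proof -
  obtain h where h: "additive_map T P h" "\<forall>m\<in>carrier M. \<forall>n\<in>carrier N. h (pure m n) = \<beta> m n"
    using lift_exists[OF assms] by blast
  let ?Q = "\<lambda>h. h \<in> extensional (carrier (tensor_group S M N)) \<and> h \<in> hom (add_monoid (tensor_group S M N)) (add_monoid P) \<and>
        (\<forall>m\<in>carrier M. \<forall>n\<in>carrier N. h (pure m n) = \<beta> m n)"
  have hom_iff: "h \<in> hom (add_monoid (tensor_group S M N)) (add_monoid P) \<longleftrightarrow> additive_map T P h" for h
    by (auto simp: additive_map_def tensor_sel hom_def)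
  have r: "additive_map T P (restrict h (carrier T))"
    using h(1) unfolding additive_map_def by simp
  have "?Q (THE h. ?Q h)"
  proof (rule theI[of ?Q "restrict h (carrier T)"])
    show "?Q (restrict h (carrier T))"
      unfolding hom_iff using r h(2) by (simp add: pure_closed tensor_sel(1)[symmetric])
    fix h'
    assume h': "?Q h'"
    show "h' = restrict h (carrier T)"
    proof (rule extensionalityI)
      show "h' x = restrict h (carrier T) x" if "x \<in> carrier T" for x
        using additive_map_eqI[OF _ r _ that] h'[unfolded hom_iff] h(2) by (simp add: pure_closed)
    qed (use h' in \<open>auto simp: tensor_sel\<close>)
  qed
  then show "additive_map T P (tensor_lift S M N P \<beta>)"
    and "m \<in> carrier M \<Longrightarrow> n \<in> carrier N \<Longrightarrow> tensor_lift S M N P \<beta> (pure m n) = \<beta> m n"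
    and "tensor_lift S M N P \<beta> \<in> extensional (carrier T)"
    unfolding tensor_lift_def hom_iff tensor_sel(1) by auto
qed

text \<open>Stated for one element \<open>a\<close> that acts additively and commutes with the
  balancing, not for a bimodule: it also serves the scalar action on a tensor product over the
  enveloping algebra, where the left operators are field elements.\<close>

lemma lact_tensor:
  assumes "additive_map M M (lact M a)"
    and "\<And>m s. m \<in> carrier M \<Longrightarrow> s \<in> S \<Longrightarrow> lact M a (ract M m s) = ract M (lact M a m) s"
  shows "additive_map T T (lact (tensor S M N) a)"
    and "m \<in> carrier M \<Longrightarrow> n \<in> carrier N \<Longrightarrow> lact (tensor S M N) a (pure m n) = pure (lact M a m) n"
proof -
  have "balanced_map S M N (tensor_group S M N) (\<lambda>m n. pure (lact M a m) n)"
    by (rule balanced_mapI, unfold tensor_sel[symmetric])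
      (simp_all add: pure_closed pure_add_left pure_add_right pure_balanced assms(2)
        additive_map_closed[OF assms(1)] additive_map_add[OF assms(1)])
  from lift_props[OF abelian_group_tensor_group this]
  show "additive_map T T (lact (tensor S M N) a)"
    and "m \<in> carrier M \<Longrightarrow> n \<in> carrier N \<Longrightarrow> lact (tensor S M N) a (pure m n) = pure (lact M a m) n"
    by (simp_all add: tensor_def as_bimod_def Let_def additive_map_def)
qed

lemma ract_tensor:
  assumes "additive_map N N (\<lambda>n. ract N n b)"
    and "\<And>n s. n \<in> carrier N \<Longrightarrow> s \<in> S \<Longrightarrow> ract N (lact N s n) b = lact N s (ract N n b)"
  shows "additive_map T T (\<lambda>t. ract (tensor S M N) t b)"
    and "m \<in> carrier M \<Longrightarrow> n \<in> carrier N \<Longrightarrow> ract (tensor S M N) (pure m n) b = pure m (ract N n b)"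
proof -
  have "balanced_map S M N (tensor_group S M N) (\<lambda>m n. pure m (ract N n b))"
    by (rule balanced_mapI, unfold tensor_sel[symmetric])
      (simp_all add: pure_closed pure_add_left pure_add_right pure_balanced assms(2)
        additive_map_closed[OF assms(1)] additive_map_add[OF assms(1)])
  from lift_props[OF abelian_group_tensor_group this]
  show "additive_map T T (\<lambda>t. ract (tensor S M N) t b)"
    and "m \<in> carrier M \<Longrightarrow> n \<in> carrier N \<Longrightarrow> ract (tensor S M N) (pure m n) b = pure m (ract N n b)"
    by (simp_all add: tensor_def as_bimod_def Let_def additive_map_def)
qed

end

section \<open>Bimodules over two rings and their tensor products\<close>

lemma abelian_group_transfer:
  assumes "abelian_group M" "carrier M' = carrier M" "add M' = add M" "\<zero>\<^bsub>M'\<^esub> = \<zero>\<^bsub>M\<^esub>"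
  shows "abelian_group M'"
proof -
  interpret M: abelian_group M by fact
  show ?thesis
  proof (rule abelian_groupI)
    show "\<exists>y\<in>carrier M'. y \<oplus>\<^bsub>M'\<^esub> x = \<zero>\<^bsub>M'\<^esub>" if "x \<in> carrier M'" for x
      using that M.l_neg[of x] M.a_inv_closed[of x] unfolding assms(2-4) by blast
  qed (simp_all add: assms(2-4) M.a_ac)
qed

text \<open>Two possibly different rings act, since the Koszul terms are assembled from A-k-, k-k-
  and k-A-bimodules, and the enveloping algebra from bimodules over A and the field. Symmetry over
  the field is added separately in \<open>algebra_bimodule_iff\<close>.\<close>

locale bimodule_over = abelian_group M
  for A :: "('a, 'x) ring_scheme" and B :: "('b, 'y) ring_scheme" and M :: "('a, 'b, 'm) bimod" +
  assumes l_closed: "a \<in> carrier A \<Longrightarrow> m \<in> carrier M \<Longrightarrow> lact M a m \<in> carrier M"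
    and r_closed: "b \<in> carrier B \<Longrightarrow> m \<in> carrier M \<Longrightarrow> ract M m b \<in> carrier M"
    and l_add_right: "a \<in> carrier A \<Longrightarrow> m \<in> carrier M \<Longrightarrow> m' \<in> carrier M \<Longrightarrow>
      lact M a (m \<oplus>\<^bsub>M\<^esub> m') = lact M a m \<oplus>\<^bsub>M\<^esub> lact M a m'"
    and l_add_left: "a \<in> carrier A \<Longrightarrow> a' \<in> carrier A \<Longrightarrow> m \<in> carrier M \<Longrightarrow>
      lact M (a \<oplus>\<^bsub>A\<^esub> a') m = lact M a m \<oplus>\<^bsub>M\<^esub> lact M a' m"
    and r_add_left: "b \<in> carrier B \<Longrightarrow> m \<in> carrier M \<Longrightarrow> m' \<in> carrier M \<Longrightarrow>
      ract M (m \<oplus>\<^bsub>M\<^esub> m') b = ract M m b \<oplus>\<^bsub>M\<^esub> ract M m' b"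
    and r_add_right: "b \<in> carrier B \<Longrightarrow> b' \<in> carrier B \<Longrightarrow> m \<in> carrier M \<Longrightarrow>
      ract M m (b \<oplus>\<^bsub>B\<^esub> b') = ract M m b \<oplus>\<^bsub>M\<^esub> ract M m b'"
    and l_mult: "a \<in> carrier A \<Longrightarrow> a' \<in> carrier A \<Longrightarrow> m \<in> carrier M \<Longrightarrow>
      lact M (a \<otimes>\<^bsub>A\<^esub> a') m = lact M a (lact M a' m)"
    and r_mult: "b \<in> carrier B \<Longrightarrow> b' \<in> carrier B \<Longrightarrow> m \<in> carrier M \<Longrightarrow>
      ract M m (b \<otimes>\<^bsub>B\<^esub> b') = ract M (ract M m b) b'"
    and l_one: "m \<in> carrier M \<Longrightarrow> lact M \<one>\<^bsub>A\<^esub> m = m"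
    and r_one: "m \<in> carrier M \<Longrightarrow> ract M m \<one>\<^bsub>B\<^esub> = m"
    and l_r: "a \<in> carrier A \<Longrightarrow> b \<in> carrier B \<Longrightarrow> m \<in> carrier M \<Longrightarrow>
      ract M (lact M a m) b = lact M a (ract M m b)"
begin

lemma l_additive: "a \<in> carrier A \<Longrightarrow> additive_map M M (lact M a)"
  by (simp add: additive_mapI l_closed l_add_right)

lemma r_additive: "b \<in> carrier B \<Longrightarrow> additive_map M M (\<lambda>m. ract M m b)"
  by (simp add: additive_mapI r_closed r_add_left)

lemma l_zero: "a \<in> carrier A \<Longrightarrow> lact M a \<zero>\<^bsub>M\<^esub> = \<zero>\<^bsub>M\<^esub>"
  by (rule additive_map_zero[OF abelian_group_axioms abelian_group_axioms l_additive])

lemma r_zero: "b \<in> carrier B \<Longrightarrow> ract M \<zero>\<^bsub>M\<^esub> b = \<zero>\<^bsub>M\<^esub>"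
  by (rule additive_map_zero[OF abelian_group_axioms abelian_group_axioms r_additive])

end

lemma algebra_bimodule_iff:
  "algebra_bimodule A M \<longleftrightarrow> bimodule_over A A M \<and>
     (\<forall>m\<in>carrier M. \<forall>c. lact M (c \<odot>\<^bsub>A\<^esub> \<one>\<^bsub>A\<^esub>) m = ract M m (c \<odot>\<^bsub>A\<^esub> \<one>\<^bsub>A\<^esub>))"
  unfolding algebra_bimodule_def algebra_bimodule_axioms_def bimodule_over_def
    bimodule_over_axioms_def
  by auto

locale bimodule_tensor = A: ring A + B: ring B + M: bimodule_over A K M + N: bimodule_over K B N
  for A :: "('a, 'x) ring_scheme" and K :: "('s, 'z) ring_scheme" and B :: "('b, 'y) ring_scheme"
    and M :: "('a, 's, 'm) bimod" and N :: "('s, 'b, 'n) bimod"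

sublocale bimodule_tensor \<subseteq> tensor_context "carrier K" M N
  by unfold_locales (simp_all add: M.r_closed N.l_closed)

context bimodule_tensor
begin

lemma lact_pure:
  "a \<in> carrier A \<Longrightarrow> m \<in> carrier M \<Longrightarrow> n \<in> carrier N \<Longrightarrow> lact T a (pure m n) = pure (lact M a m) n"
  by (rule lact_tensor(2)[OF M.l_additive]) (simp_all add: M.l_r)

lemma ract_pure:
  "b \<in> carrier B \<Longrightarrow> m \<in> carrier M \<Longrightarrow> n \<in> carrier N \<Longrightarrow> ract T (pure m n) b = pure m (ract N n b)"
  by (rule ract_tensor(2)[OF N.r_additive]) (simp_all add: N.l_r)

lemma lact_additive: "a \<in> carrier A \<Longrightarrow> additive_map T T (lact T a)"
  by (rule lact_tensor(1)[OF M.l_additive]) (simp_all add: M.l_r)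

lemma ract_additive: "b \<in> carrier B \<Longrightarrow> additive_map T T (\<lambda>t. ract T t b)"
  by (rule ract_tensor(1)[OF N.r_additive]) (simp_all add: N.l_r)

text \<open>Each axiom compares additive maps on the tensor product, hence is checked on pure
  tensors, where it reduces to an axiom of one of the factors.\<close>

lemma bimodule_over_tensor: "bimodule_over A B T"
proof -
  note clo = additive_map_closed[OF lact_additive] additive_map_closed[OF ract_additive]
    and add = additive_map_add[OF lact_additive] additive_map_add[OF ract_additive]
  have 1: "lact T \<one>\<^bsub>A\<^esub> m = m" if "m \<in> carrier T" for m
    using that by (induction rule: tensor_induct) (simp_all add: add clo lact_pure M.l_one)
  have 2: "ract T m \<one>\<^bsub>B\<^esub> = m" if "m \<in> carrier T" for m
    using that by (induction rule: tensor_induct) (simp_all add: add clo ract_pure N.r_one)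
  have 3: "ract T (lact T a m) b = lact T a (ract T m b)"
    if "a \<in> carrier A" "b \<in> carrier B" "m \<in> carrier T" for a b m
    using that(3) by (induction rule: tensor_induct)
      (simp_all add: add clo lact_pure ract_pure that M.l_closed N.r_closed)
  have 4: "lact T (a \<otimes>\<^bsub>A\<^esub> a') m = lact T a (lact T a' m)"
    if "a \<in> carrier A" "a' \<in> carrier A" "m \<in> carrier T" for a a' m
    using that(3) by (induction rule: tensor_induct)
      (simp_all add: add clo lact_pure that M.l_closed M.l_mult)
  have 5: "ract T m (b \<otimes>\<^bsub>B\<^esub> b') = ract T (ract T m b) b'"
    if "b \<in> carrier B" "b' \<in> carrier B" "m \<in> carrier T" for b b' m
    using that(3) by (induction rule: tensor_induct)
      (simp_all add: add clo ract_pure that N.r_closed N.r_mult)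
  have 6: "lact T (a \<oplus>\<^bsub>A\<^esub> a') m = lact T a m \<oplus>\<^bsub>T\<^esub> lact T a' m"
    if "a \<in> carrier A" "a' \<in> carrier A" "m \<in> carrier T" for a a' m
    using that(3) by (induction rule: tensor_induct)
      (simp_all add: add clo lact_pure that M.l_closed M.l_add_left pure_add_left T.a_ac)
  have 7: "ract T m (b \<oplus>\<^bsub>B\<^esub> b') = ract T m b \<oplus>\<^bsub>T\<^esub> ract T m b'"
    if "b \<in> carrier B" "b' \<in> carrier B" "m \<in> carrier T" for b b' m
    using that(3) by (induction rule: tensor_induct)
      (simp_all add: add clo ract_pure that N.r_closed N.r_add_right pure_add_right T.a_ac)
  show ?thesis
    by (intro bimodule_over.intro bimodule_over_axioms.intro T.abelian_group_axioms)
      (simp_all add: add clo 1 2 3 4 5 6 7)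
qed

sublocale X: bimodule_over A B T
  by (rule bimodule_over_tensor)

end

subsection \<open>The enveloping algebra\<close>

text \<open>Commutativity is not assumed, so scalars are required to pass both factors of a product;
  this makes the scalar multiples of the unit central.\<close>

locale kalgebra = ring A for A :: "('f::field, 'a) module" +
  assumes smult_closed: "a \<in> carrier A \<Longrightarrow> c \<odot>\<^bsub>A\<^esub> a \<in> carrier A"
    and smult_add_left: "a \<in> carrier A \<Longrightarrow> (c + d) \<odot>\<^bsub>A\<^esub> a = c \<odot>\<^bsub>A\<^esub> a \<oplus>\<^bsub>A\<^esub> d \<odot>\<^bsub>A\<^esub> a"
    and smult_add_right: "a \<in> carrier A \<Longrightarrow> b \<in> carrier A \<Longrightarrow>
      c \<odot>\<^bsub>A\<^esub> (a \<oplus>\<^bsub>A\<^esub> b) = c \<odot>\<^bsub>A\<^esub> a \<oplus>\<^bsub>A\<^esub> c \<odot>\<^bsub>A\<^esub> b"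
    and smult_smult: "a \<in> carrier A \<Longrightarrow> (c * d) \<odot>\<^bsub>A\<^esub> a = c \<odot>\<^bsub>A\<^esub> (d \<odot>\<^bsub>A\<^esub> a)"
    and smult_one: "a \<in> carrier A \<Longrightarrow> 1 \<odot>\<^bsub>A\<^esub> a = a"
    and smult_mult_left: "a \<in> carrier A \<Longrightarrow> b \<in> carrier A \<Longrightarrow>
      (c \<odot>\<^bsub>A\<^esub> a) \<otimes>\<^bsub>A\<^esub> b = c \<odot>\<^bsub>A\<^esub> (a \<otimes>\<^bsub>A\<^esub> b)"
    and smult_mult_right: "a \<in> carrier A \<Longrightarrow> b \<in> carrier A \<Longrightarrow>
      a \<otimes>\<^bsub>A\<^esub> (c \<odot>\<^bsub>A\<^esub> b) = c \<odot>\<^bsub>A\<^esub> (a \<otimes>\<^bsub>A\<^esub> b)"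

text \<open>The field as a ring record, so that the enveloping algebra becomes an instance of
  \<open>bimodule_tensor\<close>. It also serves as the target of coordinate functions in finite
  sums.\<close>

definition field_ring :: "'f::field ring" where
  "field_ring = \<lparr>carrier = UNIV, monoid.mult = (*), one = 1, ring.zero = 0, add = (+)\<rparr>"

lemma field_ring_sel [simp]:
  "carrier field_ring = UNIV" "x \<otimes>\<^bsub>field_ring\<^esub> y = x * y" "\<one>\<^bsub>field_ring\<^esub> = 1"
  "x \<oplus>\<^bsub>field_ring\<^esub> y = x + y"
  by (simp_all add: field_ring_def)

lemma as_bimod_sel [simp]:
  "carrier (as_bimod M l r) = carrier M" "add (as_bimod M l r) = add M"
  "\<zero>\<^bsub>as_bimod M l r\<^esub> = \<zero>\<^bsub>M\<^esub>" "lact (as_bimod M l r) = l" "ract (as_bimod M l r) = r"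
  by (simp_all add: as_bimod_def)

lemma abelian_group_as_bimod: "abelian_group M \<Longrightarrow> abelian_group (as_bimod M l r)"
  by (rule abelian_group_transfer) simp_all

text \<open>The left A^e-module structure of a bimodule, extended from pure tensors to all of
  A^e.\<close>

definition env_act :: "('f, 'a) module \<Rightarrow> ('a, 'a, 'n) bimod \<Rightarrow> ('a \<times> 'a \<Rightarrow>\<^sub>0 int) set \<Rightarrow> 'n \<Rightarrow> 'n" where
  "env_act A N t x = tensor_lift (UNIV :: 'f set) (env_left A) (env_right A) N
     (\<lambda>a b. lact N a (ract N x b)) t"

text \<open>The exchange of factors is an anti-automorphism of A^e. It carries the inner bimodule
  structure to the outer one and turns right A^e-actions into left ones.\<close>

definition env_flip :: "('f, 'a) module \<Rightarrow> ('a \<times> 'a \<Rightarrow>\<^sub>0 int) set \<Rightarrow> ('a \<times> 'a \<Rightarrow>\<^sub>0 int) set" where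
  "env_flip A = tensor_lift (UNIV :: 'f set) (env_left A) (env_right A) (env A)
     (\<lambda>x y. pure_tensor (UNIV :: 'f set) (env_left A) (env_right A) y x)"

context kalgebra
begin

abbreviation "E \<equiv> env A"
abbreviation "I \<equiv> env_inner A"
abbreviation "epure \<equiv> pure_tensor (UNIV :: 'f set) (env_left A) (env_right A)"
abbreviation "elift \<equiv> tensor_lift (UNIV :: 'f set) (env_left A) (env_right A)"

lemma env_sel [simp]:
  "carrier (env_left A) = carrier A" "add (env_left A) = add A"
  "lact (env_left A) = monoid.mult A" "ract (env_left A) a c = c \<odot>\<^bsub>A\<^esub> a"
  "carrier (env_right A) = carrier A" "add (env_right A) = add A"
  "lact (env_right A) = smult A" "ract (env_right A) = monoid.mult A"
  by (simp_all add: env_left_def env_right_def)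

lemma env_bimodule_tensor: "bimodule_tensor A field_ring A (env_left A) (env_right A)"
proof (intro bimodule_tensor.intro ring_axioms bimodule_over.intro)
  show "abelian_group (env_left A)" "abelian_group (env_right A)"
    unfolding env_left_def env_right_def by (simp_all add: abelian_group_as_bimod abelian_group_axioms)
  show "bimodule_over_axioms A field_ring (env_left A)"
    by unfold_locales
      (simp_all add: l_distr r_distr m_assoc smult_closed smult_add_left smult_add_right
        smult_one smult_mult_left smult_mult_right smult_smult[symmetric] mult.commute)
  show "bimodule_over_axioms field_ring A (env_right A)"
    by unfold_locales
      (simp_all add: l_distr r_distr m_assoc smult_closed smult_add_left smult_add_right
        smult_one smult_mult_left smult_mult_right smult_smult)
qed

lemma env_eq: "tensor (UNIV :: 'f set) (env_left A) (env_right A) = E"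
  by (simp add: env_def)

context
begin

interpretation e: bimodule_tensor A field_ring A "env_left A" "env_right A"
  by (rule env_bimodule_tensor)

lemma env_bimodule_over: "bimodule_over A A E"
  using e.bimodule_over_tensor unfolding field_ring_sel env_eq .

lemmas env_pure_closed = e.pure_closed[unfolded field_ring_sel env_eq env_sel]
  and env_pure_add_left = e.pure_add_left[unfolded field_ring_sel env_eq env_sel]
  and env_pure_add_right = e.pure_add_right[unfolded field_ring_sel env_eq env_sel]
  and env_pure_balanced = e.pure_balanced[unfolded field_ring_sel env_eq env_sel, OF _ UNIV_I]
  and env_induct [consumes 1, case_names pure add] =
    e.tensor_induct[unfolded field_ring_sel env_eq env_sel]
  and env_map_eqI = e.additive_map_eqI[unfolded field_ring_sel env_eq env_sel]
  and env_lact_pure = e.lact_pure[unfolded field_ring_sel env_eq env_sel]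
  and env_ract_pure = e.ract_pure[unfolded field_ring_sel env_eq env_sel]

lemma env_lift:
  assumes "abelian_group P"
    and "\<And>x y. x \<in> carrier A \<Longrightarrow> y \<in> carrier A \<Longrightarrow> \<beta> x y \<in> carrier P"
    and "\<And>x x' y. x \<in> carrier A \<Longrightarrow> x' \<in> carrier A \<Longrightarrow> y \<in> carrier A \<Longrightarrow>
      \<beta> (x \<oplus>\<^bsub>A\<^esub> x') y = \<beta> x y \<oplus>\<^bsub>P\<^esub> \<beta> x' y"
    and "\<And>x y y'. x \<in> carrier A \<Longrightarrow> y \<in> carrier A \<Longrightarrow> y' \<in> carrier A \<Longrightarrow>
      \<beta> x (y \<oplus>\<^bsub>A\<^esub> y') = \<beta> x y \<oplus>\<^bsub>P\<^esub> \<beta> x y'"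
    and "\<And>x c y. x \<in> carrier A \<Longrightarrow> y \<in> carrier A \<Longrightarrow> \<beta> (c \<odot>\<^bsub>A\<^esub> x) y = \<beta> x (c \<odot>\<^bsub>A\<^esub> y)"
  shows "additive_map E P (elift P \<beta>)"
    and "x \<in> carrier A \<Longrightarrow> y \<in> carrier A \<Longrightarrow> elift P \<beta> (epure x y) = \<beta> x y"
proof -
  have b: "balanced_map UNIV (env_left A) (env_right A) P \<beta>"
    by (rule balanced_mapI) (simp_all add: assms(2-5))
  show "additive_map E P (elift P \<beta>)"
    and "x \<in> carrier A \<Longrightarrow> y \<in> carrier A \<Longrightarrow> elift P \<beta> (epure x y) = \<beta> x y"
    using e.lift_props(1,2)[unfolded field_ring_sel env_eq env_sel, OF assms(1) b] by blast+
qed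

end

lemma env_pure_smult:
  assumes "x \<in> carrier A" "y \<in> carrier A"
  shows "epure (c \<odot>\<^bsub>A\<^esub> x) y = epure x (c \<odot>\<^bsub>A\<^esub> y)"
  by (rule env_pure_balanced[OF assms])

sublocale E: bimodule_over A A E
  by (rule env_bimodule_over)

lemma smult_one_mult:
  "a \<in> carrier A \<Longrightarrow> (c \<odot>\<^bsub>A\<^esub> \<one>\<^bsub>A\<^esub>) \<otimes>\<^bsub>A\<^esub> a = c \<odot>\<^bsub>A\<^esub> a"
  "a \<in> carrier A \<Longrightarrow> a \<otimes>\<^bsub>A\<^esub> (c \<odot>\<^bsub>A\<^esub> \<one>\<^bsub>A\<^esub>) = c \<odot>\<^bsub>A\<^esub> a"
  by (simp_all add: smult_mult_left smult_mult_right)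

lemma smult_one_closed: "c \<odot>\<^bsub>A\<^esub> \<one>\<^bsub>A\<^esub> \<in> carrier A"
  by (simp add: smult_closed)

lemma algebra_bimodule_env: "algebra_bimodule A E"
  unfolding algebra_bimodule_iff
proof (intro conjI ballI allI env_bimodule_over)
  fix t c assume "t \<in> carrier E"
  then show "lact E (c \<odot>\<^bsub>A\<^esub> \<one>\<^bsub>A\<^esub>) t = ract E t (c \<odot>\<^bsub>A\<^esub> \<one>\<^bsub>A\<^esub>)"
    by (induction rule: env_induct)
      (simp_all add: env_lact_pure env_ract_pure smult_one_mult smult_one_closed env_pure_smult
        E.l_add_right E.r_add_left)
qed

lemma inner_sel [simp]:
  "carrier I = carrier E" "add I = add E" "\<zero>\<^bsub>I\<^esub> = \<zero>\<^bsub>E\<^esub>"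
  by (simp_all add: env_inner_def Let_def)

lemma inner_lact:
  assumes b: "b \<in> carrier A"
  shows "additive_map E E (lact I b)"
    and "x \<in> carrier A \<Longrightarrow> y \<in> carrier A \<Longrightarrow> lact I b (epure x y) = epure x (b \<otimes>\<^bsub>A\<^esub> y)"
proof -
  have *: "lact I b = elift E (\<lambda>x y. epure x (b \<otimes>\<^bsub>A\<^esub> y))"
    by (simp add: env_inner_def Let_def)
  show "additive_map E E (lact I b)"
    unfolding * by (rule env_lift[OF E.abelian_group_axioms])
      (simp_all add: b env_pure_closed env_pure_add_left env_pure_add_right env_pure_smult
        smult_closed r_distr smult_mult_right)
  show "x \<in> carrier A \<Longrightarrow> y \<in> carrier A \<Longrightarrow> lact I b (epure x y) = epure x (b \<otimes>\<^bsub>A\<^esub> y)"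
    unfolding * by (rule env_lift[OF E.abelian_group_axioms])
      (simp_all add: b env_pure_closed env_pure_add_left env_pure_add_right env_pure_smult
        smult_closed r_distr smult_mult_right)
qed

lemma inner_ract:
  assumes b: "b \<in> carrier A"
  shows "additive_map E E (\<lambda>t. ract I t b)"
    and "x \<in> carrier A \<Longrightarrow> y \<in> carrier A \<Longrightarrow> ract I (epure x y) b = epure (x \<otimes>\<^bsub>A\<^esub> b) y"
proof -
  have *: "ract I t b = elift E (\<lambda>x y. epure (x \<otimes>\<^bsub>A\<^esub> b) y) t" for t
    by (simp add: env_inner_def Let_def)
  show "additive_map E E (\<lambda>t. ract I t b)"
    unfolding * by (rule env_lift[OF E.abelian_group_axioms])
      (simp_all add: b env_pure_closed env_pure_add_left env_pure_add_right env_pure_smult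
        smult_closed l_distr smult_mult_left)
  show "x \<in> carrier A \<Longrightarrow> y \<in> carrier A \<Longrightarrow> ract I (epure x y) b = epure (x \<otimes>\<^bsub>A\<^esub> b) y"
    unfolding * by (rule env_lift[OF E.abelian_group_axioms])
      (simp_all add: b env_pure_closed env_pure_add_left env_pure_add_right env_pure_smult
        smult_closed l_distr smult_mult_left)
qed

lemmas inner_add = additive_map_add[OF inner_lact(1)] additive_map_add[OF inner_ract(1)]
  and inner_closed = additive_map_closed[OF inner_lact(1)] additive_map_closed[OF inner_ract(1)]

lemma algebra_bimodule_inner: "algebra_bimodule A I"
proof -
  note s = inner_add inner_closed inner_lact(2) inner_ract(2)
  have 1: "lact I \<one>\<^bsub>A\<^esub> m = m" if "m \<in> carrier E" for m
    using that by (induction rule: env_induct) (simp_all add: s)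
  have 2: "ract I m \<one>\<^bsub>A\<^esub> = m" if "m \<in> carrier E" for m
    using that by (induction rule: env_induct) (simp_all add: s)
  have 3: "ract I (lact I a m) b = lact I a (ract I m b)"
    if "a \<in> carrier A" "b \<in> carrier A" "m \<in> carrier E" for a b m
    using that(3) by (induction rule: env_induct) (simp_all add: s that)
  have 4: "lact I (a \<otimes>\<^bsub>A\<^esub> a') m = lact I a (lact I a' m)"
    if "a \<in> carrier A" "a' \<in> carrier A" "m \<in> carrier E" for a a' m
    using that(3) by (induction rule: env_induct) (simp_all add: s that m_assoc)
  have 5: "ract I m (b \<otimes>\<^bsub>A\<^esub> b') = ract I (ract I m b) b'"
    if "b \<in> carrier A" "b' \<in> carrier A" "m \<in> carrier E" for b b' m
    using that(3) by (induction rule: env_induct) (simp_all add: s that m_assoc)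
  have 6: "lact I (a \<oplus>\<^bsub>A\<^esub> a') m = lact I a m \<oplus>\<^bsub>E\<^esub> lact I a' m"
    if "a \<in> carrier A" "a' \<in> carrier A" "m \<in> carrier E" for a a' m
    using that(3) by (induction rule: env_induct)
      (simp_all add: s that l_distr env_pure_add_right E.a_ac)
  have 7: "ract I m (b \<oplus>\<^bsub>A\<^esub> b') = ract I m b \<oplus>\<^bsub>E\<^esub> ract I m b'"
    if "b \<in> carrier A" "b' \<in> carrier A" "m \<in> carrier E" for b b' m
    using that(3) by (induction rule: env_induct)
      (simp_all add: s that r_distr env_pure_add_left E.a_ac)
  have 8: "lact I (c \<odot>\<^bsub>A\<^esub> \<one>\<^bsub>A\<^esub>) m = ract I m (c \<odot>\<^bsub>A\<^esub> \<one>\<^bsub>A\<^esub>)" if "m \<in> carrier E" for m c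
    using that by (induction rule: env_induct)
      (simp_all add: s smult_one_closed smult_one_mult env_pure_smult)
  have ag: "abelian_group I"
    by (rule abelian_group_transfer[OF E.abelian_group_axioms]) simp_all
  show ?thesis
    unfolding algebra_bimodule_iff
    by (intro conjI bimodule_over.intro bimodule_over_axioms.intro ag)
      (simp_all add: 1 2 3 4 5 6 7 8 inner_add inner_closed)
qed

text \<open>On x \<otimes> y the outer actions multiply x from the left and y from the right, the
  inner ones x from the right and y from the left, so they commute. This is what makes the dual of a
  bimodule a bimodule.\<close>

lemma inner_outer:
  assumes "a \<in> carrier A" "b \<in> carrier A" "t \<in> carrier E"
  shows "lact I b (lact E a t) = lact E a (lact I b t)"
    and "lact I b (ract E t a) = ract E (lact I b t) a"
    and "ract I (lact E a t) b = lact E a (ract I t b)"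
    and "ract I (ract E t a) b = ract E (ract I t b) a"
  using assms(3)
  by (induction rule: env_induct)
    (simp_all add: assms inner_add inner_closed inner_lact(2) inner_ract(2) env_lact_pure env_ract_pure
      E.l_closed E.r_closed E.l_add_right E.r_add_left m_assoc)

lemma env_flip:
  shows env_flip_additive: "additive_map E E (env_flip A)"
    and env_flip_pure: "x \<in> carrier A \<Longrightarrow> y \<in> carrier A \<Longrightarrow> env_flip A (epure x y) = epure y x"
  unfolding env_flip_def
  by (rule env_lift[OF E.abelian_group_axioms];
      simp add: env_pure_closed env_pure_add_left env_pure_add_right env_pure_smult)+

lemmas env_flip_closed = additive_map_closed[OF env_flip_additive]
  and env_flip_add = additive_map_add[OF env_flip_additive]

lemma env_flip_lact:
  assumes "a \<in> carrier A" "t \<in> carrier E"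
  shows "env_flip A (lact I a t) = lact E a (env_flip A t)"
    and "env_flip A (ract I t a) = ract E (env_flip A t) a"
  using assms(2)
  by (induction rule: env_induct)
    (simp_all add: assms inner_add inner_closed inner_lact(2) inner_ract(2) env_lact_pure env_ract_pure
      E.l_closed E.r_closed E.l_add_right E.r_add_left env_flip_add env_flip_closed env_flip_pure)

end

locale algebra_with_bimodule = kalgebra A + N: algebra_bimodule A N
  for A :: "('f::field, 'a) module" and N :: "('a, 'a, 'n) bimod"
begin

sublocale N: bimodule_over A A N
  using N.algebra_bimodule_axioms algebra_bimodule_iff by blast

lemma act_lift:
  assumes x: "x \<in> carrier N"
  shows act_additive: "additive_map E N (\<lambda>t. env_act A N t x)"
    and act_pure: "a \<in> carrier A \<Longrightarrow> b \<in> carrier A \<Longrightarrow>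
      env_act A N (epure a b) x = lact N a (ract N x b)"
proof -
  \<comment> \<open>Balancing over the field: the scalar leaves the left factor as a multiple of the
    unit, crosses the element by symmetry of \<open>N\<close>, and is absorbed on the right.\<close>
  have *: "lact N (c \<odot>\<^bsub>A\<^esub> a) (ract N x b) = lact N a (ract N x (c \<odot>\<^bsub>A\<^esub> b))"
    if "a \<in> carrier A" "b \<in> carrier A" for a b c
  proof -
    have "lact N (c \<odot>\<^bsub>A\<^esub> a) (ract N x b) = lact N (a \<otimes>\<^bsub>A\<^esub> (c \<odot>\<^bsub>A\<^esub> \<one>\<^bsub>A\<^esub>)) (ract N x b)"
      using that by (simp add: smult_one_mult)
    also have "\<dots> = lact N a (ract N (ract N x b) (c \<odot>\<^bsub>A\<^esub> \<one>\<^bsub>A\<^esub>))"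
      using that x by (simp add: N.l_mult smult_one_closed N.r_closed N.scalar_symmetric)
    also have "ract N (ract N x b) (c \<odot>\<^bsub>A\<^esub> \<one>\<^bsub>A\<^esub>) = ract N x (c \<odot>\<^bsub>A\<^esub> b)"
      using that x by (simp add: N.r_mult[symmetric] smult_one_closed smult_one_mult)
    finally show ?thesis .
  qed
  show "additive_map E N (\<lambda>t. env_act A N t x)"
    unfolding env_act_def
    by (rule env_lift[OF N.abelian_group_axioms])
      (simp_all add: x * N.l_closed N.r_closed N.l_add_left N.l_add_right N.r_add_right)
  show "env_act A N (epure a b) x = lact N a (ract N x b)" if "a \<in> carrier A" "b \<in> carrier A"
    unfolding env_act_def
    by (rule env_lift[OF N.abelian_group_axioms])
      (simp_all add: that x * N.l_closed N.r_closed N.l_add_left N.l_add_right N.r_add_right)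
qed

lemma act_closed: "t \<in> carrier E \<Longrightarrow> x \<in> carrier N \<Longrightarrow> env_act A N t x \<in> carrier N"
  using additive_map_closed[OF act_additive] by blast

lemma act_add_left: "t \<in> carrier E \<Longrightarrow> u \<in> carrier E \<Longrightarrow> x \<in> carrier N \<Longrightarrow>
    env_act A N (t \<oplus>\<^bsub>E\<^esub> u) x = env_act A N t x \<oplus>\<^bsub>N\<^esub> env_act A N u x"
  using additive_map_add[OF act_additive] by blast

lemma act_add_right:
  assumes "t \<in> carrier E" "x \<in> carrier N" "y \<in> carrier N"
  shows "env_act A N t (x \<oplus>\<^bsub>N\<^esub> y) = env_act A N t x \<oplus>\<^bsub>N\<^esub> env_act A N t y"
  using assms(1) by (induction rule: env_induct)
    (simp_all add: assms act_pure act_add_left act_closed N.l_closed N.r_closed N.l_add_right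
      N.r_add_left N.a_ac)

lemma act_lact:
  assumes "t \<in> carrier E" "x \<in> carrier N" "a \<in> carrier A"
  shows "env_act A N (lact E a t) x = lact N a (env_act A N t x)"
    and "env_act A N (ract E t a) x = ract N (env_act A N t x) a"
  using assms(1) by (induction rule: env_induct)
    (simp_all add: assms act_pure act_add_left act_closed N.l_closed N.r_closed N.l_add_right
      N.r_add_left E.l_closed E.r_closed E.l_add_right E.r_add_left
      env_lact_pure env_ract_pure N.l_mult N.r_mult N.l_r)

end

section \<open>Homomorphisms of bimodules\<close>

lemma bimod_linear_iff:
  "bimod_linear A M N f \<longleftrightarrow> additive_map M N f \<and>
     (\<forall>a\<in>carrier A. \<forall>m\<in>carrier M. f (lact M a m) = lact N a (f m) \<and> f (ract M m a) = ract N (f m) a)"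
  unfolding bimod_linear_def additive_map_iff_hom ..

lemma bimod_linear_additive: "bimod_linear A M N f \<Longrightarrow> additive_map M N f"
  by (simp add: bimod_linear_iff)

lemma bimod_linear_closed: "bimod_linear A M N f \<Longrightarrow> x \<in> carrier M \<Longrightarrow> f x \<in> carrier N"
  by (rule additive_map_closed[OF bimod_linear_additive])

lemma bimod_linear_add: "bimod_linear A M N f \<Longrightarrow> x \<in> carrier M \<Longrightarrow> y \<in> carrier M \<Longrightarrow>
    f (x \<oplus>\<^bsub>M\<^esub> y) = f x \<oplus>\<^bsub>N\<^esub> f y"
  by (rule additive_map_add[OF bimod_linear_additive])

lemma bimod_linear_lact: "bimod_linear A M N f \<Longrightarrow> a \<in> carrier A \<Longrightarrow> x \<in> carrier M \<Longrightarrow>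
    f (lact M a x) = lact N a (f x)"
  by (simp add: bimod_linear_iff)

lemma bimod_linear_ract: "bimod_linear A M N f \<Longrightarrow> a \<in> carrier A \<Longrightarrow> x \<in> carrier M \<Longrightarrow>
    f (ract M x a) = ract N (f x) a"
  by (simp add: bimod_linear_iff)

lemma bimod_linear_comp:
  "bimod_linear A M N f \<Longrightarrow> bimod_linear A N L g \<Longrightarrow> bimod_linear A M L (\<lambda>x. g (f x))"
  unfolding bimod_linear_iff additive_map_def by simp

lemma bimod_linear_id: "bimod_linear A M M (\<lambda>x. x)"
  unfolding bimod_linear_iff additive_map_def by simp

lemma bimod_linear_zero:
  assumes "algebra_bimodule A N"
  shows "bimod_linear A M N (\<lambda>x. \<zero>\<^bsub>N\<^esub>)"
proof -
  interpret N: bimodule_over A A N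
    using assms algebra_bimodule_iff by blast
  show ?thesis
    unfolding bimod_linear_iff additive_map_def by (simp add: N.l_zero N.r_zero)
qed

lemma bimod_hom_linear: "f \<in> bimod_hom A M N \<Longrightarrow> bimod_linear A M N f"
  by (simp add: bimod_hom_def)

context kalgebra
begin

lemma act_hom:
  assumes "algebra_bimodule A M" "algebra_bimodule A N" "bimod_linear A M N f"
    and "t \<in> carrier E" "x \<in> carrier M"
  shows "f (env_act A M t x) = env_act A N t (f x)"
proof -
  interpret M: algebra_with_bimodule A M
    using assms(1) kalgebra_axioms by (rule algebra_with_bimodule.intro[rotated])
  interpret N: algebra_with_bimodule A N
    using assms(2) kalgebra_axioms by (rule algebra_with_bimodule.intro[rotated])
  note f = bimod_linear_closed[OF assms(3)] bimod_linear_add[OF assms(3)]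
    bimod_linear_lact[OF assms(3)] bimod_linear_ract[OF assms(3)]
  show ?thesis
    using assms(4) by (induction rule: env_induct)
      (simp_all add: assms(5) f M.act_pure N.act_pure M.act_add_left N.act_add_left
        M.act_closed M.N.r_closed)
qed

text \<open>For s = x \<otimes> y and t = u \<otimes> v both sides are xu \<otimes> vy, the product
  st in A^e: acting by s on t from outside is the same as acting by the exchange of t on s from
  inside. The dual basis of a dual module rests on this identity.\<close>

lemma act_inner_flip:
  assumes "s \<in> carrier E" "t \<in> carrier E"
  shows "env_act A I (env_flip A t) s = env_act A E s t"
proof -
  interpret e: algebra_with_bimodule A E
    using algebra_bimodule_env kalgebra_axioms by (rule algebra_with_bimodule.intro[rotated])
  interpret i: algebra_with_bimodule A I
    using algebra_bimodule_inner kalgebra_axioms by (rule algebra_with_bimodule.intro[rotated])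
  show ?thesis
    using assms(2)
  proof (induction rule: env_induct)
    case (pure u v)
    show ?case
      using assms(1) by (induction rule: env_induct)
        (simp_all add: pure env_flip_pure i.act_pure e.act_pure env_pure_closed inner_lact(2)
          inner_ract(2) env_lact_pure env_ract_pure inner_add inner_closed e.act_add_left)
  next
    case (add t u)
    then show ?case
      using assms(1) i.act_add_left by (simp add: env_flip_add env_flip_closed e.act_add_right)
  qed
qed

end

section \<open>Duals and dual bases\<close>

lemma bimod_hom_closed: "f \<in> bimod_hom A M N \<Longrightarrow> x \<in> carrier M \<Longrightarrow> f x \<in> carrier N"
  by (rule bimod_linear_closed[OF bimod_hom_linear])

lemma bimod_hom_add: "f \<in> bimod_hom A M N \<Longrightarrow> x \<in> carrier M \<Longrightarrow> y \<in> carrier M \<Longrightarrow>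
    f (x \<oplus>\<^bsub>M\<^esub> y) = f x \<oplus>\<^bsub>N\<^esub> f y"
  by (rule bimod_linear_add[OF bimod_hom_linear])

lemma bimod_hom_lact: "f \<in> bimod_hom A M N \<Longrightarrow> a \<in> carrier A \<Longrightarrow> x \<in> carrier M \<Longrightarrow>
    f (lact M a x) = lact N a (f x)"
  by (rule bimod_linear_lact[OF bimod_hom_linear])

lemma bimod_hom_ract: "f \<in> bimod_hom A M N \<Longrightarrow> a \<in> carrier A \<Longrightarrow> x \<in> carrier M \<Longrightarrow>
    f (ract M x a) = ract N (f x) a"
  by (rule bimod_linear_ract[OF bimod_hom_linear])

lemma bimod_hom_eqI:
  assumes "f \<in> bimod_hom A M N" "g \<in> bimod_hom A M N" "\<And>x. x \<in> carrier M \<Longrightarrow> f x = g x"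
  shows "f = g"
  using assms by (intro extensionalityI[of f "carrier M" g]) (simp_all add: bimod_hom_def)

text \<open>Closure of the carrier of \<open>M\<close> under its operations allows a linear map to
  be altered off the carrier; this is how restrictions become elements of
  \<open>bimod_hom\<close>.\<close>

lemma bimod_linear_cong:
  assumes "bimod_linear A M N f" "algebra_bimodule A M" "\<And>x. x \<in> carrier M \<Longrightarrow> f x = g x"
  shows "bimod_linear A M N g"
proof -
  interpret M: algebra_bimodule A M by fact
  show ?thesis
    using assms(1,3) M.lact_closed M.ract_closed M.add.m_closed
    unfolding bimod_linear_iff additive_map_def by metis
qed

lemma restrict_bimod_hom:
  assumes "bimod_linear A M N f" "algebra_bimodule A M"
  shows "(\<lambda>x\<in>carrier M. f x) \<in> bimod_hom A M N"
  unfolding bimod_hom_def using bimod_linear_cong[OF assms] by simp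

lemma bimod_linear_sum:
  assumes "algebra_bimodule A N" "bimod_linear A M N f" "bimod_linear A M N g"
  shows "bimod_linear A M N (\<lambda>x. f x \<oplus>\<^bsub>N\<^esub> g x)"
proof -
  interpret N: algebra_bimodule A N by fact
  note f = bimod_linear_closed[OF assms(2)] bimod_linear_add[OF assms(2)]
    bimod_linear_lact[OF assms(2)] bimod_linear_ract[OF assms(2)]
  note g = bimod_linear_closed[OF assms(3)] bimod_linear_add[OF assms(3)]
    bimod_linear_lact[OF assms(3)] bimod_linear_ract[OF assms(3)]
  show ?thesis
    unfolding bimod_linear_iff additive_map_def
    by (simp add: f g N.a_ac N.lact_add_right N.ract_add_left)
qed

lemma bimod_linear_neg:
  assumes "algebra_bimodule A N" "bimod_linear A M N f"
  shows "bimod_linear A M N (\<lambda>x. \<ominus>\<^bsub>N\<^esub> f x)"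
proof -
  interpret N: algebra_bimodule A N by fact
  interpret N: bimodule_over A A N using assms(1) algebra_bimodule_iff by blast
  note f = bimod_linear_closed[OF assms(2)] bimod_linear_add[OF assms(2)]
    bimod_linear_lact[OF assms(2)] bimod_linear_ract[OF assms(2)]
  show ?thesis
    unfolding bimod_linear_iff additive_map_def
    by (simp add: f N.minus_add additive_map_neg[OF N.abelian_group_axioms N.abelian_group_axioms N.l_additive]
       additive_map_neg[OF N.abelian_group_axioms N.abelian_group_axioms N.r_additive])
qed

lemma hom_space_sel [simp]:
  "carrier (hom_space A P N) = bimod_hom A P N"
  "\<zero>\<^bsub>hom_space A P N\<^esub> = (\<lambda>x\<in>carrier P. \<zero>\<^bsub>N\<^esub>)"
  "f \<oplus>\<^bsub>hom_space A P N\<^esub> g = (\<lambda>x\<in>carrier P. f x \<oplus>\<^bsub>N\<^esub> g x)"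
  "c \<odot>\<^bsub>hom_space A P N\<^esub> f = (\<lambda>x\<in>carrier P. lact N (c \<odot>\<^bsub>A\<^esub> \<one>\<^bsub>A\<^esub>) (f x))"
  by (simp_all add: hom_space_def)

lemma hom_env_sel [simp]:
  "carrier (hom_env A P) = bimod_hom A P (env A)"
  "\<zero>\<^bsub>hom_env A P\<^esub> = (\<lambda>x\<in>carrier P. \<zero>\<^bsub>env A\<^esub>)"
  "f \<oplus>\<^bsub>hom_env A P\<^esub> g = (\<lambda>x\<in>carrier P. f x \<oplus>\<^bsub>env A\<^esub> g x)"
  "lact (hom_env A P) a f = (\<lambda>x\<in>carrier P. lact (env_inner A) a (f x))"
  "ract (hom_env A P) f a = (\<lambda>x\<in>carrier P. ract (env_inner A) (f x) a)"
  by (simp_all add: hom_env_def)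

lemma abelian_group_hom_space:
  assumes P: "algebra_bimodule A P" and N: "algebra_bimodule A N"
  shows "abelian_group (hom_space A P N)"
proof -
  interpret P: algebra_bimodule A P by fact
  interpret N: algebra_bimodule A N by fact
  have add: "(\<lambda>x\<in>carrier P. f x \<oplus>\<^bsub>N\<^esub> g x) \<in> bimod_hom A P N"
    if "f \<in> bimod_hom A P N" "g \<in> bimod_hom A P N" for f g
    by (intro restrict_bimod_hom P bimod_linear_sum N bimod_hom_linear that)
  have zero: "(\<lambda>x\<in>carrier P. \<zero>\<^bsub>N\<^esub>) \<in> bimod_hom A P N"
    by (intro restrict_bimod_hom P bimod_linear_zero N)
  have neg: "(\<lambda>x\<in>carrier P. \<ominus>\<^bsub>N\<^esub> f x) \<in> bimod_hom A P N" if "f \<in> bimod_hom A P N" for f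
    by (intro restrict_bimod_hom P bimod_linear_neg N bimod_hom_linear that)
  show ?thesis
  proof (rule abelian_groupI, unfold hom_space_sel)
    fix f g h
    assume f: "f \<in> bimod_hom A P N"
    show "\<exists>g\<in>bimod_hom A P N. (\<lambda>x\<in>carrier P. g x \<oplus>\<^bsub>N\<^esub> f x) = (\<lambda>x\<in>carrier P. \<zero>\<^bsub>N\<^esub>)"
      using bimod_hom_closed[OF f] by (intro bexI[OF _ neg[OF f]] restrict_ext) (simp add: N.l_neg)
    show "(\<lambda>x\<in>carrier P. (\<lambda>x\<in>carrier P. \<zero>\<^bsub>N\<^esub>) x \<oplus>\<^bsub>N\<^esub> f x) = f"
      by (rule bimod_hom_eqI[OF add[OF zero f] f]) (simp add: bimod_hom_closed[OF f])
    assume g: "g \<in> bimod_hom A P N"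
    show "(\<lambda>x\<in>carrier P. f x \<oplus>\<^bsub>N\<^esub> g x) = (\<lambda>x\<in>carrier P. g x \<oplus>\<^bsub>N\<^esub> f x)"
      by (rule restrict_ext) (simp add: bimod_hom_closed[OF f] bimod_hom_closed[OF g] N.a_comm)
    assume h: "h \<in> bimod_hom A P N"
    show "(\<lambda>x\<in>carrier P. (\<lambda>x\<in>carrier P. f x \<oplus>\<^bsub>N\<^esub> g x) x \<oplus>\<^bsub>N\<^esub> h x) =
        (\<lambda>x\<in>carrier P. f x \<oplus>\<^bsub>N\<^esub> (\<lambda>x\<in>carrier P. g x \<oplus>\<^bsub>N\<^esub> h x) x)"
      by (rule restrict_ext)
        (simp add: bimod_hom_closed[OF f] bimod_hom_closed[OF g] bimod_hom_closed[OF h] N.a_assoc)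
  qed (use add zero in blast)+
qed

text \<open>This is not in general a map with x_i \<mapsto> z_i; that holds only if the z_i are
  themselves the values of a linear map at the x_i. Conditions on the z_i are therefore transported
  by \<open>dual_ext_comp\<close> and \<open>dual_ext_cong\<close> and not read off at the
  generators.\<close>

definition dual_ext :: "('f, 'a) module \<Rightarrow> ('a, 'a, 'n) bimod \<Rightarrow> 'i set \<Rightarrow>
    ('i \<Rightarrow> 'p \<Rightarrow> ('a \<times> 'a \<Rightarrow>\<^sub>0 int) set) \<Rightarrow> ('i \<Rightarrow> 'n) \<Rightarrow> 'p \<Rightarrow> 'n" where
  "dual_ext A N J f z y = (\<Oplus>\<^bsub>N\<^esub>i\<in>J. env_act A N (f i y) (z i))"

text \<open>The dual basis criterion: such a finite system exists exactly when \<open>P\<close> is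
  finitely generated projective over A^e. The index type is left free so that paths of a quiver can
  serve as indices.\<close>

definition dual_basis :: "('f, 'a) module \<Rightarrow> ('a, 'a, 'p) bimod \<Rightarrow> 'i set \<Rightarrow> ('i \<Rightarrow> 'p) \<Rightarrow>
    ('i \<Rightarrow> 'p \<Rightarrow> ('a \<times> 'a \<Rightarrow>\<^sub>0 int) set) \<Rightarrow> bool" where
  "dual_basis A P J x f \<longleftrightarrow> finite J \<and> (\<forall>i\<in>J. x i \<in> carrier P) \<and>
     (\<forall>i\<in>J. f i \<in> bimod_hom A P (env A)) \<and> (\<forall>y\<in>carrier P. dual_ext A P J f x y = y)"

context kalgebra
begin

lemma algebra_bimodule_hom_env:
  assumes P: "algebra_bimodule A P"
  shows "algebra_bimodule A (hom_env A P)"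
proof -
  interpret P: algebra_bimodule A P by fact
  interpret i: algebra_bimodule A I by (rule algebra_bimodule_inner)
  have ag: "abelian_group (hom_env A P)"
    by (rule abelian_group_transfer[OF abelian_group_hom_space[OF P algebra_bimodule_env]])
      (simp_all add: fun_eq_iff)
  \<comment> \<open>An inner action applied after an A^e-linear map gives an A^e-linear map again,
    because inner and outer actions commute.\<close>
  have l: "(\<lambda>x\<in>carrier P. lact I a (f x)) \<in> bimod_hom A P E"
    and r: "(\<lambda>x\<in>carrier P. ract I (f x) a) \<in> bimod_hom A P E"
    if "f \<in> bimod_hom A P E" "a \<in> carrier A" for f a
    by (intro restrict_bimod_hom P, unfold bimod_linear_iff additive_map_def,
      simp add: bimod_hom_closed[OF that(1)] bimod_hom_add[OF that(1)] bimod_hom_lact[OF that(1)]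
        bimod_hom_ract[OF that(1)] inner_outer that(2) inner_add inner_closed)+
  show ?thesis
    unfolding algebra_bimodule_def algebra_bimodule_axioms_def
  proof (intro conjI ag allI impI, unfold hom_env_sel)
    fix f g a b c
    assume a: "a \<in> carrier A" and f: "f \<in> bimod_hom A P E"
    note fc = bimod_hom_closed[OF f]
    show "(\<lambda>x\<in>carrier P. lact I a (f x)) \<in> bimod_hom A P E"
      "(\<lambda>x\<in>carrier P. ract I (f x) a) \<in> bimod_hom A P E"
      by (rule l[OF f a], rule r[OF f a])
    show "(\<lambda>x\<in>carrier P. lact I a ((\<lambda>x\<in>carrier P. f x \<oplus>\<^bsub>E\<^esub> g x) x)) =
        (\<lambda>x\<in>carrier P. (\<lambda>x\<in>carrier P. lact I a (f x)) x \<oplus>\<^bsub>E\<^esub> (\<lambda>x\<in>carrier P. lact I a (g x)) x)"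
      "(\<lambda>x\<in>carrier P. ract I ((\<lambda>x\<in>carrier P. f x \<oplus>\<^bsub>E\<^esub> g x) x) a) =
        (\<lambda>x\<in>carrier P. (\<lambda>x\<in>carrier P. ract I (f x) a) x \<oplus>\<^bsub>E\<^esub> (\<lambda>x\<in>carrier P. ract I (g x) a) x)"
      if "g \<in> bimod_hom A P E"
      by (rule restrict_ext, simp add: fc bimod_hom_closed[OF that] inner_add a)+
    assume b: "b \<in> carrier A"
    show "(\<lambda>x\<in>carrier P. lact I (a \<oplus>\<^bsub>A\<^esub> b) (f x)) =
        (\<lambda>x\<in>carrier P. (\<lambda>x\<in>carrier P. lact I a (f x)) x \<oplus>\<^bsub>E\<^esub> (\<lambda>x\<in>carrier P. lact I b (f x)) x)"
      "(\<lambda>x\<in>carrier P. ract I (f x) (a \<oplus>\<^bsub>A\<^esub> b)) =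
        (\<lambda>x\<in>carrier P. (\<lambda>x\<in>carrier P. ract I (f x) a) x \<oplus>\<^bsub>E\<^esub> (\<lambda>x\<in>carrier P. ract I (f x) b) x)"
      "(\<lambda>x\<in>carrier P. lact I (a \<otimes>\<^bsub>A\<^esub> b) (f x)) =
        (\<lambda>x\<in>carrier P. lact I a ((\<lambda>x\<in>carrier P. lact I b (f x)) x))"
      "(\<lambda>x\<in>carrier P. ract I (f x) (a \<otimes>\<^bsub>A\<^esub> b)) =
        (\<lambda>x\<in>carrier P. ract I ((\<lambda>x\<in>carrier P. ract I (f x) a) x) b)"
      "(\<lambda>x\<in>carrier P. ract I ((\<lambda>x\<in>carrier P. lact I a (f x)) x) b) =
        (\<lambda>x\<in>carrier P. lact I a ((\<lambda>x\<in>carrier P. ract I (f x) b) x))"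
      using i.lact_add_left i.ract_add_right i.lact_mult i.ract_mult i.lact_ract a b fc
      by (auto intro!: restrict_ext)
  next
    fix f c
    assume f: "f \<in> bimod_hom A P E"
    note fc = bimod_hom_closed[OF f]
    show "(\<lambda>x\<in>carrier P. lact I \<one>\<^bsub>A\<^esub> (f x)) = f"
      by (rule bimod_hom_eqI[OF l[OF f] f]) (use fc i.lact_one in auto)
    show "(\<lambda>x\<in>carrier P. ract I (f x) \<one>\<^bsub>A\<^esub>) = f"
      by (rule bimod_hom_eqI[OF r[OF f] f]) (use fc i.ract_one in auto)
    show "(\<lambda>x\<in>carrier P. lact I (c \<odot>\<^bsub>A\<^esub> \<one>\<^bsub>A\<^esub>) (f x)) =
        (\<lambda>x\<in>carrier P. ract I (f x) (c \<odot>\<^bsub>A\<^esub> \<one>\<^bsub>A\<^esub>))"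
      using fc i.scalar_symmetric by (auto intro!: restrict_ext)
  qed
qed

lemma dual_ext_closed:
  assumes N: "algebra_bimodule A N" and "\<And>i. i \<in> J \<Longrightarrow> f i \<in> bimod_hom A P E"
    "\<And>i. i \<in> J \<Longrightarrow> z i \<in> carrier N" "y \<in> carrier P"
  shows "dual_ext A N J f z y \<in> carrier N"
proof -
  interpret n: algebra_with_bimodule A N
    using N kalgebra_axioms by (rule algebra_with_bimodule.intro[rotated])
  show ?thesis
    unfolding dual_ext_def
    by (intro n.N.finsum_closed Pi_I n.act_closed assms bimod_hom_closed[OF assms(2)])
qed

text \<open>In each summand y enters only through the acting element f_i(y) of A^e, which depends
  linearly on y.\<close>

lemma dual_ext_linear:
  assumes N: "algebra_bimodule A N" and f: "\<And>i. i \<in> J \<Longrightarrow> f i \<in> bimod_hom A P E"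
    and z: "\<And>i. i \<in> J \<Longrightarrow> z i \<in> carrier N"
  shows "bimod_linear A P N (dual_ext A N J f z)"
proof -
  interpret n: algebra_with_bimodule A N
    using N kalgebra_axioms by (rule algebra_with_bimodule.intro[rotated])
  have c: "env_act A N (f i y) (z i) \<in> carrier N" if "i \<in> J" "y \<in> carrier P" for i y
    by (intro n.act_closed z bimod_hom_closed[OF f] that)
  have 1: "env_act A N (f i (y \<oplus>\<^bsub>P\<^esub> y')) (z i) = env_act A N (f i y) (z i) \<oplus>\<^bsub>N\<^esub> env_act A N (f i y') (z i)"
    if "i \<in> J" "y \<in> carrier P" "y' \<in> carrier P" for i y y'
    by (simp add: bimod_hom_add[OF f] bimod_hom_closed[OF f] n.act_add_left z that)
  have 2: "env_act A N (f i (lact P a y)) (z i) = lact N a (env_act A N (f i y) (z i))"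
    "env_act A N (f i (ract P y a)) (z i) = ract N (env_act A N (f i y) (z i)) a"
    if "i \<in> J" "y \<in> carrier P" "a \<in> carrier A" for i y a
    by (simp_all add: bimod_hom_lact[OF f] bimod_hom_ract[OF f] bimod_hom_closed[OF f] n.act_lact z that)
  show ?thesis
    unfolding bimod_linear_iff additive_map_def
  proof (intro conjI ballI)
    fix y y' assume y: "y \<in> carrier P"
    show "dual_ext A N J f z y \<in> carrier N"
      by (rule dual_ext_closed[OF N f z y])
    show "dual_ext A N J f z (y \<oplus>\<^bsub>P\<^esub> y') = dual_ext A N J f z y \<oplus>\<^bsub>N\<^esub> dual_ext A N J f z y'"
      if "y' \<in> carrier P"
      unfolding dual_ext_def
      by (rule trans[OF n.N.finsum_cong'[OF refl] n.N.finsum_addf]) (auto simp: c 1 y that)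
  next
    fix a y assume a: "a \<in> carrier A" and y: "y \<in> carrier P"
    have "lact N a (dual_ext A N J f z y) = (\<Oplus>\<^bsub>N\<^esub>i\<in>J. lact N a (env_act A N (f i y) (z i)))"
      unfolding dual_ext_def
      by (rule additive_map_finsum[OF n.N.abelian_group_axioms n.N.abelian_group_axioms n.N.l_additive])
        (simp_all add: a y c)
    then show "dual_ext A N J f z (lact P a y) = lact N a (dual_ext A N J f z y)"
      unfolding dual_ext_def using a y by (auto simp: 2 c n.N.l_closed intro!: n.N.finsum_cong')
    have "ract N (dual_ext A N J f z y) a = (\<Oplus>\<^bsub>N\<^esub>i\<in>J. ract N (env_act A N (f i y) (z i)) a)"
      unfolding dual_ext_def
      by (rule additive_map_finsum[OF n.N.abelian_group_axioms n.N.abelian_group_axioms n.N.r_additive])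
        (simp_all add: a y c)
    then show "dual_ext A N J f z (ract P y a) = ract N (dual_ext A N J f z y) a"
      unfolding dual_ext_def using a y by (auto simp: 2 c n.N.r_closed intro!: n.N.finsum_cong')
  qed
qed

lemma dual_ext_comp:
  assumes N: "algebra_bimodule A N" and N': "algebra_bimodule A N'"
    and h: "bimod_linear A N N' h" and f: "\<And>i. i \<in> J \<Longrightarrow> f i \<in> bimod_hom A P E"
    and z: "\<And>i. i \<in> J \<Longrightarrow> z i \<in> carrier N" and y: "y \<in> carrier P"
  shows "h (dual_ext A N J f z y) = dual_ext A N' J f (\<lambda>i. h (z i)) y"
proof -
  interpret n: algebra_with_bimodule A N
    using N kalgebra_axioms by (rule algebra_with_bimodule.intro[rotated])
  interpret n': algebra_with_bimodule A N'
    using N' kalgebra_axioms by (rule algebra_with_bimodule.intro[rotated])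
  have "h (dual_ext A N J f z y) = (\<Oplus>\<^bsub>N'\<^esub>i\<in>J. h (env_act A N (f i y) (z i)))"
    unfolding dual_ext_def
    by (rule additive_map_finsum[OF n.N.abelian_group_axioms n'.N.abelian_group_axioms
          bimod_linear_additive[OF h]])
      (intro n.act_closed z y bimod_hom_closed[OF f])
  also have "\<dots> = dual_ext A N' J f (\<lambda>i. h (z i)) y"
    unfolding dual_ext_def
    by (rule n'.N.finsum_cong')
      (auto simp: act_hom[OF N N' h] bimod_hom_closed[OF f] z y
        intro!: n'.act_closed bimod_linear_closed[OF h])
  finally show ?thesis .
qed

lemma dual_ext_cong:
  assumes N: "algebra_bimodule A N" and f: "\<And>i. i \<in> J \<Longrightarrow> f i \<in> bimod_hom A P E"
    and z: "\<And>i. i \<in> J \<Longrightarrow> z i = z' i" "\<And>i. i \<in> J \<Longrightarrow> z' i \<in> carrier N" and y: "y \<in> carrier P"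
  shows "dual_ext A N J f z y = dual_ext A N J f z' y"
proof -
  interpret n: algebra_with_bimodule A N
    using N kalgebra_axioms by (rule algebra_with_bimodule.intro[rotated])
  show ?thesis
    unfolding dual_ext_def
    by (rule n.N.finsum_cong') (auto simp: z bimod_hom_closed[OF f] y intro!: n.act_closed)
qed

text \<open>Apply \<open>h\<close> to the expansion of y and move it past the A^e-action onto the
  generators.\<close>

lemma dual_basis_expand:
  assumes P: "algebra_bimodule A P" and N: "algebra_bimodule A N"
    and d: "dual_basis A P J x f" and h: "bimod_linear A P N h" and y: "y \<in> carrier P"
  shows "dual_ext A N J f (\<lambda>i. h (x i)) y = h y"
  using dual_ext_comp[OF P N h _ _ y, of J f x] d y unfolding dual_basis_def by simp

lemma dual_ext_add:
  assumes N: "algebra_bimodule A N" and f: "\<And>i. i \<in> J \<Longrightarrow> f i \<in> bimod_hom A P E"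
    and z: "\<And>i. i \<in> J \<Longrightarrow> z i \<in> carrier N" and w: "\<And>i. i \<in> J \<Longrightarrow> w i \<in> carrier N"
    and y: "y \<in> carrier P"
  shows "dual_ext A N J f (\<lambda>i. z i \<oplus>\<^bsub>N\<^esub> w i) y = dual_ext A N J f z y \<oplus>\<^bsub>N\<^esub> dual_ext A N J f w y"
proof -
  interpret n: algebra_with_bimodule A N
    using N kalgebra_axioms by (rule algebra_with_bimodule.intro[rotated])
  have c: "env_act A N (f i y) (z i) \<in> carrier N" "env_act A N (f i y) (w i) \<in> carrier N" if "i \<in> J" for i
    by (intro n.act_closed z w bimod_hom_closed[OF f] that y)+
  show ?thesis
    unfolding dual_ext_def
    by (rule trans[OF n.N.finsum_cong'[OF refl] n.N.finsum_addf])
      (auto simp: c n.act_add_right bimod_hom_closed[OF f] z w y)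
qed

text \<open>Evaluation at a point commutes with the action on the dual, so computations in the dual
  reduce to the inner structure of A^e.\<close>

lemma act_hom_env:
  assumes P: "algebra_bimodule A P" and t: "t \<in> carrier E" and f: "f \<in> bimod_hom A P E"
    and y: "y \<in> carrier P"
  shows "env_act A (hom_env A P) t f y = env_act A I t (f y)"
proof -
  interpret h: algebra_with_bimodule A "hom_env A P"
    using algebra_bimodule_hom_env[OF P] kalgebra_axioms by (rule algebra_with_bimodule.intro[rotated])
  interpret i: algebra_with_bimodule A I
    using algebra_bimodule_inner kalgebra_axioms by (rule algebra_with_bimodule.intro[rotated])
  show ?thesis
    using t
  proof (induction rule: env_induct)
    case (pure a b)
    then show ?case
      using f y h.act_pure i.act_pure bimod_hom_closed[OF f] by simp
  next
    case (add t u)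
    then show ?case
      using f y h.act_add_left i.act_add_left bimod_hom_closed[OF f] by simp
  qed
qed

lemma eval_additive:
  assumes "y \<in> carrier P"
  shows "additive_map (hom_env A P) E (\<lambda>f. f y)"
  unfolding additive_map_def using assms bimod_hom_closed by fastforce

text \<open>The functional paired with \<open>f\<^sub>i\<close> is evaluation at \<open>x\<^sub>i\<close>, followed by the exchange of the two
  bimodule structures of the enveloping algebra.\<close>

lemma dual_basis_hom_env:
  assumes P: "algebra_bimodule A P" and d: "dual_basis A P J x f"
  shows "dual_basis A (hom_env A P) J f (\<lambda>i. \<lambda>g\<in>carrier (hom_env A P). env_flip A (g (x i)))"
proof -
  let ?H = "hom_env A P"
  let ?F = "\<lambda>i. \<lambda>g\<in>carrier ?H. env_flip A (g (x i))"
  note H = algebra_bimodule_hom_env[OF P]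
  interpret h: algebra_with_bimodule A ?H
    using H kalgebra_axioms by (rule algebra_with_bimodule.intro[rotated])
  interpret e: algebra_with_bimodule A E
    using algebra_bimodule_env kalgebra_axioms by (rule algebra_with_bimodule.intro[rotated])
  have x: "x i \<in> carrier P" and f: "f i \<in> bimod_hom A P E" if "i \<in> J" for i
    using d that unfolding dual_basis_def by auto
  have F: "?F i \<in> bimod_hom A ?H E" if i: "i \<in> J" for i
  proof (intro restrict_bimod_hom H)
    have "g (x i) \<in> carrier E" if "g \<in> bimod_hom A P E" for g
      by (rule bimod_hom_closed[OF that x[OF i]])
    then show "bimod_linear A ?H E (\<lambda>g. env_flip A (g (x i)))"
      by (simp add: bimod_linear_iff additive_map_def x[OF i] env_flip_lact env_flip_closed env_flip_add)
  qed
  have "dual_ext A ?H J ?F f g = g" if g: "g \<in> carrier ?H" for g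
  proof (rule bimod_hom_eqI)
    have gl: "g \<in> bimod_hom A P E" using g by simp
    show "dual_ext A ?H J ?F f g \<in> bimod_hom A P E"
      using dual_ext_closed[where z = f, OF H F _ g] f by simp
    show "g \<in> bimod_hom A P E" by (rule gl)
    fix y assume y: "y \<in> carrier P"
    have gx: "g (x i) \<in> carrier E" if "i \<in> J" for i
      by (rule bimod_hom_closed[OF gl x[OF that]])
    have "dual_ext A ?H J ?F f g y = (\<Oplus>\<^bsub>E\<^esub>i\<in>J. env_act A ?H (?F i g) (f i) y)"
      unfolding dual_ext_def
      by (rule additive_map_finsum[OF h.N.abelian_group_axioms E.abelian_group_axioms eval_additive[OF y]])
        (intro h.act_closed bimod_hom_closed[OF F], use f g in auto)
    \<comment> \<open>By \<open>act_inner_flip\<close> the exchange of g(x_i), acting on f_i(y) from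
      inside, becomes f_i(y) acting on g(x_i) from outside; the sum is then g applied to the
      expansion of y.\<close>
    also have "\<dots> = (\<Oplus>\<^bsub>E\<^esub>i\<in>J. env_act A E (f i y) (g (x i)))"
    proof (rule E.finsum_cong'[OF refl])
      show "env_act A ?H (?F i g) (f i) y = env_act A E (f i y) (g (x i))" if i: "i \<in> J" for i
        using g by (simp add: act_hom_env[OF P _ f[OF i] y] env_flip_closed gx i act_inner_flip
            bimod_hom_closed[OF f[OF i] y])
    qed (intro Pi_I e.act_closed bimod_hom_closed[OF f] y gx)
    also have "\<dots> = g y"
      using dual_basis_expand[OF P algebra_bimodule_env d bimod_hom_linear[OF gl] y]
      by (simp add: dual_ext_def)
    finally show "dual_ext A ?H J ?F f g y = g y" .
  qed
  with d F f show ?thesis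
    unfolding dual_basis_def by simp
qed

end

section \<open>The functor M \<otimes> - over the enveloping algebra\<close>

definition env_tensor_map :: "('f::field, 'a) module \<Rightarrow> ('a, 'a, 'm) bimod \<Rightarrow> ('a, 'a, 'n) bimod \<Rightarrow>
    ('a, 'a, 'n1) bimod \<Rightarrow> ('n \<Rightarrow> 'n1) \<Rightarrow> ('m \<times> 'n \<Rightarrow>\<^sub>0 int) set \<Rightarrow> ('m \<times> 'n1 \<Rightarrow>\<^sub>0 int) set" where
  "env_tensor_map A M N N' f = tensor_lift (carrier A \<times> carrier A)
     (as_right_env A M) (as_left_env A N) (env_tensor_space A M N')
     (\<lambda>m x. pure_tensor (carrier A \<times> carrier A) (as_right_env A M) (as_left_env A N') m (f x))"

abbreviation (input) env_pure ::
    "('f::field, 'a) module \<Rightarrow> ('a, 'a, 'm) bimod \<Rightarrow> ('a, 'a, 'n) bimod \<Rightarrow> 'm \<Rightarrow> 'n \<Rightarrow>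
      ('m \<times> 'n \<Rightarrow>\<^sub>0 int) set" where
  "env_pure A M N \<equiv> pure_tensor (carrier A \<times> carrier A) (as_right_env A M) (as_left_env A N)"

lemma env_tensor_space_sel:
  "carrier (env_tensor_space A M N) =
     carrier (tensor (carrier A \<times> carrier A) (as_right_env A M) (as_left_env A N))"
  "\<zero>\<^bsub>env_tensor_space A M N\<^esub> =
     \<zero>\<^bsub>tensor (carrier A \<times> carrier A) (as_right_env A M) (as_left_env A N)\<^esub>"
  "add (env_tensor_space A M N) =
     add (tensor (carrier A \<times> carrier A) (as_right_env A M) (as_left_env A N))"
  "smult (env_tensor_space A M N) =
     lact (tensor (carrier A \<times> carrier A) (as_right_env A M) (as_left_env A N))"
  by (simp_all add: env_tensor_space_def Let_def)

lemma as_env_sel: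
  "carrier (as_right_env A M) = carrier M" "add (as_right_env A M) = add M"
  "\<zero>\<^bsub>as_right_env A M\<^esub> = \<zero>\<^bsub>M\<^esub>" "lact (as_right_env A M) c m = lact M (c \<odot>\<^bsub>A\<^esub> \<one>\<^bsub>A\<^esub>) m"
  "ract (as_right_env A M) m s = lact M (snd s) (ract M m (fst s))"
  "carrier (as_left_env A N) = carrier N" "add (as_left_env A N) = add N"
  "\<zero>\<^bsub>as_left_env A N\<^esub> = \<zero>\<^bsub>N\<^esub>" "lact (as_left_env A N) s x = lact N (fst s) (ract N x (snd s))"
  by (simp_all add: as_right_env_def as_left_env_def case_prod_unfold)

locale env_tensor_context = kalgebra A + M: algebra_bimodule A M + N: algebra_bimodule A N
  for A :: "('f::field, 'a) module" and M :: "('a, 'a, 'm) bimod" and N :: "('a, 'a, 'n) bimod"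
begin

lemma tensor_context: "tensor_context (carrier A \<times> carrier A) (as_right_env A M) (as_left_env A N)"
proof (intro tensor_context.intro tensor_context_axioms.intro)
  show "abelian_group (as_right_env A M)" "abelian_group (as_left_env A N)"
    unfolding as_right_env_def as_left_env_def
    by (simp_all add: abelian_group_as_bimod M.abelian_group_axioms N.abelian_group_axioms)
qed (auto simp: as_env_sel M.lact_closed M.ract_closed N.lact_closed N.ract_closed)

interpretation t: tensor_context "carrier A \<times> carrier A" "as_right_env A M" "as_left_env A N"
  by (rule tensor_context)

abbreviation "TS \<equiv> env_tensor_space A M N"
abbreviation "tpure \<equiv> env_pure A M N"

lemma abelian_group_env_tensor: "abelian_group TS"
  by (rule abelian_group_transfer[OF t.T.abelian_group_axioms]) (simp_all add: env_tensor_space_sel)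

lemmas tpure_closed = t.pure_closed[unfolded as_env_sel env_tensor_space_sel[symmetric]]
  and tpure_add_left = t.pure_add_left[unfolded as_env_sel env_tensor_space_sel[symmetric]]
  and tpure_add_right = t.pure_add_right[unfolded as_env_sel env_tensor_space_sel[symmetric]]
  and tensor_induct [consumes 1, case_names pure add] =
    t.tensor_induct[unfolded as_env_sel env_tensor_space_sel[symmetric]]

lemma tpure_balanced:
  assumes "m \<in> carrier M" "a \<in> carrier A" "b \<in> carrier A" "n \<in> carrier N"
  shows "tpure (lact M b (ract M m a)) n = tpure m (lact N a (ract N n b))"
  using t.pure_balanced[of m "(a, b)" n] assms by (simp add: as_env_sel)

lemma tpure_smult:
  shows "m \<in> carrier M \<Longrightarrow> n \<in> carrier N \<Longrightarrow> c \<odot>\<^bsub>TS\<^esub> tpure m n = tpure (lact M (c \<odot>\<^bsub>A\<^esub> \<one>\<^bsub>A\<^esub>) m) n"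
    and smult_additive: "additive_map TS TS (smult TS c)"
proof -
  have c: "c \<odot>\<^bsub>A\<^esub> \<one>\<^bsub>A\<^esub> \<in> carrier A" by (rule smult_one_closed)
  have 1: "additive_map (as_right_env A M) (as_right_env A M) (lact (as_right_env A M) c)"
    by (simp add: additive_map_def as_env_sel M.lact_closed M.lact_add_right c)
  \<comment> \<open>Scalar multiples of the unit are central, so the scalar action commutes with the
    balancing by pairs.\<close>
  have 2: "lact (as_right_env A M) c (ract (as_right_env A M) m s) =
      ract (as_right_env A M) (lact (as_right_env A M) c m) s"
    if ms: "m \<in> carrier (as_right_env A M)" "s \<in> carrier A \<times> carrier A" for m s
  proof -
    obtain a b where s: "s = (a, b)" "a \<in> carrier A" "b \<in> carrier A" using ms(2) by (cases s) auto
    have m: "m \<in> carrier M" using ms(1) by (simp add: as_env_sel)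
    have "lact M (c \<odot>\<^bsub>A\<^esub> \<one>\<^bsub>A\<^esub>) (lact M b (ract M m a)) = lact M b (lact M (c \<odot>\<^bsub>A\<^esub> \<one>\<^bsub>A\<^esub>) (ract M m a))"
      using s m by (simp add: M.lact_mult[symmetric] c M.ract_closed smult_one_mult)
    then show ?thesis
      using s m by (simp add: as_env_sel M.lact_ract c)
  qed
  show "c \<odot>\<^bsub>TS\<^esub> tpure m n = tpure (lact M (c \<odot>\<^bsub>A\<^esub> \<one>\<^bsub>A\<^esub>) m) n"
    if "m \<in> carrier M" "n \<in> carrier N"
    using t.lact_tensor(2)[OF 1 2] that by (simp add: as_env_sel env_tensor_space_sel)
  show "additive_map TS TS (smult TS c)"
    using t.lact_tensor(1)[OF 1 2] by (simp add: additive_map_def env_tensor_space_sel)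
qed

lemma tensor_lift_props:
  assumes "abelian_group P"
    and "\<And>m n. m \<in> carrier M \<Longrightarrow> n \<in> carrier N \<Longrightarrow> \<beta> m n \<in> carrier P"
    and "\<And>m m' n. m \<in> carrier M \<Longrightarrow> m' \<in> carrier M \<Longrightarrow> n \<in> carrier N \<Longrightarrow>
      \<beta> (m \<oplus>\<^bsub>M\<^esub> m') n = \<beta> m n \<oplus>\<^bsub>P\<^esub> \<beta> m' n"
    and "\<And>m n n'. m \<in> carrier M \<Longrightarrow> n \<in> carrier N \<Longrightarrow> n' \<in> carrier N \<Longrightarrow>
      \<beta> m (n \<oplus>\<^bsub>N\<^esub> n') = \<beta> m n \<oplus>\<^bsub>P\<^esub> \<beta> m n'"
    and "\<And>m a b n. m \<in> carrier M \<Longrightarrow> a \<in> carrier A \<Longrightarrow> b \<in> carrier A \<Longrightarrow> n \<in> carrier N \<Longrightarrow>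
      \<beta> (lact M b (ract M m a)) n = \<beta> m (lact N a (ract N n b))"
  shows "additive_map TS P
      (tensor_lift (carrier A \<times> carrier A) (as_right_env A M) (as_left_env A N) P \<beta>)"
    and "m \<in> carrier M \<Longrightarrow> n \<in> carrier N \<Longrightarrow>
      tensor_lift (carrier A \<times> carrier A) (as_right_env A M) (as_left_env A N) P \<beta> (tpure m n) = \<beta> m n"
proof -
  have b: "balanced_map (carrier A \<times> carrier A) (as_right_env A M) (as_left_env A N) P \<beta>"
    by (rule balanced_mapI) (auto simp add: as_env_sel assms(2-5))
  show "additive_map TS P
      (tensor_lift (carrier A \<times> carrier A) (as_right_env A M) (as_left_env A N) P \<beta>)"
    using t.lift_props(1)[OF assms(1) b] by (simp add: additive_map_def env_tensor_space_sel)
  show "m \<in> carrier M \<Longrightarrow> n \<in> carrier N \<Longrightarrow>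
      tensor_lift (carrier A \<times> carrier A) (as_right_env A M) (as_left_env A N) P \<beta> (tpure m n) = \<beta> m n"
    using t.lift_props(2)[OF assms(1) b] by (simp add: as_env_sel)
qed

sublocale TS: abelian_group TS
  by (rule abelian_group_env_tensor)

lemma tensor_map_eqI:
  assumes "additive_map TS P f" "additive_map TS P g"
    and "\<And>m n. m \<in> carrier M \<Longrightarrow> n \<in> carrier N \<Longrightarrow> f (tpure m n) = g (tpure m n)"
    and "t \<in> carrier TS"
  shows "f t = g t"
  using assms(4)
proof (induction rule: tensor_induct)
  case (add t u)
  then show ?case by (simp add: additive_map_add[OF assms(1)] additive_map_add[OF assms(2)])
qed (use assms(3) in auto)

text \<open>Balancing is imposed only for pairs, and additivity extends it to all of A^e. The
  exchange appears because the right action on \<open>M\<close> is m (a \<otimes> b) = b m a, which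
  is the left action of b \<otimes> a.\<close>

lemma tensor_act_balanced:
  assumes m: "m \<in> carrier M" and n: "n \<in> carrier N" and t: "t \<in> carrier E"
  shows "tpure (env_act A M t m) n = tpure m (env_act A N (env_flip A t) n)"
proof -
  interpret m: algebra_with_bimodule A M by unfold_locales
  interpret n: algebra_with_bimodule A N by unfold_locales
  show ?thesis
    using t
  proof (induction rule: env_induct)
    case (pure a b)
    then show ?case
      using m n by (simp add: m.act_pure n.act_pure env_flip_pure tpure_balanced)
  next
    case (add t u)
    then show ?case
      using m n by (simp add: m.act_add_left n.act_add_left env_flip_add env_flip_closed m.act_closed
          n.act_closed tpure_add_left tpure_add_right)
  qed
qed

lemma tpure_zero_right: "m \<in> carrier M \<Longrightarrow> tpure m \<zero>\<^bsub>N\<^esub> = \<zero>\<^bsub>TS\<^esub>"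
  using t.pure_zero_right by (simp add: as_env_sel env_tensor_space_sel)

end

context kalgebra
begin

lemma env_tensor_map:
  assumes M: "algebra_bimodule A M" and N: "algebra_bimodule A N" and N': "algebra_bimodule A N'"
    and f: "bimod_linear A N N' f"
  shows env_tensor_map_additive:
      "additive_map (env_tensor_space A M N) (env_tensor_space A M N') (env_tensor_map A M N N' f)"
    and env_tensor_map_pure: "m \<in> carrier M \<Longrightarrow> n \<in> carrier N \<Longrightarrow>
      env_tensor_map A M N N' f (env_pure A M N m n) = env_pure A M N' m (f n)"
proof -
  interpret t: env_tensor_context A M N
    by (intro env_tensor_context.intro kalgebra_axioms M N)
  interpret t': env_tensor_context A M N'
    by (intro env_tensor_context.intro kalgebra_axioms M N')
  note f = bimod_linear_closed[OF f] bimod_linear_add[OF f] bimod_linear_lact[OF f]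
    bimod_linear_ract[OF f]
  note r = t.tensor_lift_props[OF t'.TS.abelian_group_axioms, of "\<lambda>m n. t'.tpure m (f n)",
      folded env_tensor_map_def]
  show "additive_map (env_tensor_space A M N) (env_tensor_space A M N') (env_tensor_map A M N N' f)"
    by (rule r(1)) (simp_all add: f t'.tpure_closed t'.tpure_add_left t'.tpure_add_right
        t'.tpure_balanced t.N.ract_closed)
  show "m \<in> carrier M \<Longrightarrow> n \<in> carrier N \<Longrightarrow>
      env_tensor_map A M N N' f (env_pure A M N m n) = env_pure A M N' m (f n)"
    by (rule r(2)) (simp_all add: f t'.tpure_closed t'.tpure_add_left t'.tpure_add_right
        t'.tpure_balanced t.N.ract_closed)
qed

lemma env_tensor_map_smult:
  assumes M: "algebra_bimodule A M" and N: "algebra_bimodule A N" and N': "algebra_bimodule A N'"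
    and f: "bimod_linear A N N' f" and t: "t \<in> carrier (env_tensor_space A M N)"
  shows "env_tensor_map A M N N' f (c \<odot>\<^bsub>env_tensor_space A M N\<^esub> t) =
    c \<odot>\<^bsub>env_tensor_space A M N'\<^esub> env_tensor_map A M N N' f t"
proof -
  interpret t: env_tensor_context A M N
    by (intro env_tensor_context.intro kalgebra_axioms M N)
  interpret t': env_tensor_context A M N'
    by (intro env_tensor_context.intro kalgebra_axioms M N')
  show ?thesis
    by (rule t.tensor_map_eqI[OF additive_map_comp[OF t.smult_additive env_tensor_map_additive[OF M N N' f]]
          additive_map_comp[OF env_tensor_map_additive[OF M N N' f] t'.smult_additive] _ t])
      (simp_all add: t.tpure_smult t'.tpure_smult env_tensor_map_pure[OF M N N' f]
        bimod_linear_closed[OF f] t.M.lact_closed smult_one_closed)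
qed

lemma env_tensor_map_comp:
  assumes M: "algebra_bimodule A M" and N: "algebra_bimodule A N" and N': "algebra_bimodule A N'"
    and N'': "algebra_bimodule A N''"
    and f: "bimod_linear A N N' f" and g: "bimod_linear A N' N'' g"
    and t: "t \<in> carrier (env_tensor_space A M N)"
  shows "env_tensor_map A M N' N'' g (env_tensor_map A M N N' f t) =
    env_tensor_map A M N N'' (\<lambda>x. g (f x)) t"
proof -
  interpret t: env_tensor_context A M N
    by (intro env_tensor_context.intro kalgebra_axioms M N)
  note gf = bimod_linear_comp[OF f g]
  show ?thesis
    by (rule t.tensor_map_eqI[OF additive_map_comp[OF env_tensor_map_additive[OF M N N' f]
          env_tensor_map_additive[OF M N' N'' g]] env_tensor_map_additive[OF M N N'' gf] _ t])
      (simp add: env_tensor_map_pure[OF M N N' f] env_tensor_map_pure[OF M N' N'' g]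
        env_tensor_map_pure[OF M N N'' gf] bimod_linear_closed[OF f])
qed

text \<open>Together with compatibility with composition this makes the tensor functor additive,
  which is why chain homotopies survive it.\<close>

lemma env_tensor_map_sum:
  assumes M: "algebra_bimodule A M" and N: "algebra_bimodule A N" and N': "algebra_bimodule A N'"
    and f: "bimod_linear A N N' f" and g: "bimod_linear A N N' g"
    and t: "t \<in> carrier (env_tensor_space A M N)"
  shows "env_tensor_map A M N N' (\<lambda>x. f x \<oplus>\<^bsub>N'\<^esub> g x) t =
    env_tensor_map A M N N' f t \<oplus>\<^bsub>env_tensor_space A M N'\<^esub> env_tensor_map A M N N' g t"
proof -
  interpret t: env_tensor_context A M N
    by (intro env_tensor_context.intro kalgebra_axioms M N)
  interpret t': env_tensor_context A M N'
    by (intro env_tensor_context.intro kalgebra_axioms M N')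
  note fg = bimod_linear_sum[OF N' f g]
  have "additive_map (env_tensor_space A M N) (env_tensor_space A M N')
     (\<lambda>t. env_tensor_map A M N N' f t \<oplus>\<^bsub>env_tensor_space A M N'\<^esub> env_tensor_map A M N N' g t)"
    using env_tensor_map_additive[OF M N N' f] env_tensor_map_additive[OF M N N' g]
    unfolding additive_map_def by (simp add: t'.TS.a_ac)
  from t.tensor_map_eqI[OF env_tensor_map_additive[OF M N N' fg] this _ t]
  show ?thesis
    by (simp add: env_tensor_map_pure[OF M N N' f] env_tensor_map_pure[OF M N N' g]
        env_tensor_map_pure[OF M N N' fg] bimod_linear_closed[OF f] bimod_linear_closed[OF g]
        t'.tpure_add_right)
qed

lemma env_tensor_map_cong:
  assumes M: "algebra_bimodule A M" and N: "algebra_bimodule A N" and N': "algebra_bimodule A N'"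
    and f: "bimod_linear A N N' f" and fg: "\<And>x. x \<in> carrier N \<Longrightarrow> f x = g x"
    and t: "t \<in> carrier (env_tensor_space A M N)"
  shows "env_tensor_map A M N N' f t = env_tensor_map A M N N' g t"
proof -
  interpret t: env_tensor_context A M N
    by (intro env_tensor_context.intro kalgebra_axioms M N)
  note g = bimod_linear_cong[OF f N fg]
  show ?thesis
    by (rule t.tensor_map_eqI[OF env_tensor_map_additive[OF M N N' f]
          env_tensor_map_additive[OF M N N' g] _ t])
      (simp_all add: env_tensor_map_pure[OF M N N' f] env_tensor_map_pure[OF M N N' g] fg)
qed

lemma env_tensor_map_id:
  assumes M: "algebra_bimodule A M" and N: "algebra_bimodule A N"
    and t: "t \<in> carrier (env_tensor_space A M N)"
  shows "env_tensor_map A M N N (\<lambda>x. x) t = t"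
proof -
  interpret t: env_tensor_context A M N
    by (intro env_tensor_context.intro kalgebra_axioms M N)
  have "additive_map (env_tensor_space A M N) (env_tensor_space A M N) (\<lambda>t. t)"
    by (simp add: additive_map_def)
  from t.tensor_map_eqI[OF env_tensor_map_additive[OF M N N bimod_linear_id] this _ t]
  show ?thesis
    by (simp add: env_tensor_map_pure[OF M N N bimod_linear_id])
qed

end

context kalgebra
begin

lemma env_tensor_map_zero:
  assumes M: "algebra_bimodule A M" and N: "algebra_bimodule A N" and N': "algebra_bimodule A N'"
    and f: "\<And>x. x \<in> carrier N \<Longrightarrow> f x = \<zero>\<^bsub>N'\<^esub>" and t: "t \<in> carrier (env_tensor_space A M N)"
  shows "env_tensor_map A M N N' f t = \<zero>\<^bsub>env_tensor_space A M N'\<^esub>"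
proof -
  interpret t: env_tensor_context A M N
    by (intro env_tensor_context.intro kalgebra_axioms M N)
  interpret t': env_tensor_context A M N'
    by (intro env_tensor_context.intro kalgebra_axioms M N')
  have l: "bimod_linear A N N' f"
    by (rule bimod_linear_cong[OF bimod_linear_zero[OF N'] N]) (simp add: f)
  have "additive_map (env_tensor_space A M N) (env_tensor_space A M N') (\<lambda>t. \<zero>\<^bsub>env_tensor_space A M N'\<^esub>)"
    by (simp add: additive_map_def)
  from t.tensor_map_eqI[OF env_tensor_map_additive[OF M N N' l] this _ t]
  show ?thesis
    by (simp add: env_tensor_map_pure[OF M N N' l] f t'.tpure_zero_right)
qed

text \<open>Meant for the sign of the shifted complex. The images of f and of its negative add up to
  the image of the zero map.\<close>

lemma env_tensor_map_neg:
  assumes M: "algebra_bimodule A M" and N: "algebra_bimodule A N" and N': "algebra_bimodule A N'"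
    and f: "bimod_linear A N N' f" and t: "t \<in> carrier (env_tensor_space A M N)"
  shows "env_tensor_map A M N N' (\<lambda>x. \<ominus>\<^bsub>N'\<^esub> f x) t =
    \<ominus>\<^bsub>env_tensor_space A M N'\<^esub> env_tensor_map A M N N' f t"
proof -
  interpret N': algebra_bimodule A N' by fact
  interpret t': env_tensor_context A M N'
    by (intro env_tensor_context.intro kalgebra_axioms M N')
  note nf = bimod_linear_neg[OF N' f]
  have "env_tensor_map A M N N' (\<lambda>x. \<ominus>\<^bsub>N'\<^esub> f x) t \<oplus>\<^bsub>env_tensor_space A M N'\<^esub> env_tensor_map A M N N' f t =
      env_tensor_map A M N N' (\<lambda>x. \<ominus>\<^bsub>N'\<^esub> f x \<oplus>\<^bsub>N'\<^esub> f x) t"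
    by (rule env_tensor_map_sum[OF M N N' nf f t, symmetric])
  also have "\<dots> = \<zero>\<^bsub>env_tensor_space A M N'\<^esub>"
    by (rule env_tensor_map_zero[OF M N N' _ t]) (simp add: bimod_linear_closed[OF f] N'.l_neg)
  finally show ?thesis
    using additive_map_closed[OF env_tensor_map_additive[OF M N N' f] t]
      additive_map_closed[OF env_tensor_map_additive[OF M N N' nf] t]
    by (metis t'.TS.minus_equality)
qed

end

section \<open>The evaluation map from M \<otimes> Hom(P, A^e) to Hom(P, M)\<close>

definition hom_eval :: "('f::field, 'a) module \<Rightarrow> ('a, 'a, 'm) bimod \<Rightarrow> ('a, 'a, 'p) bimod \<Rightarrow>
    ('m \<times> ('p \<Rightarrow> ('a \<times> 'a \<Rightarrow>\<^sub>0 int) set) \<Rightarrow>\<^sub>0 int) set \<Rightarrow> 'p \<Rightarrow> 'm" where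
  "hom_eval A M P = tensor_lift (carrier A \<times> carrier A) (as_right_env A M)
     (as_left_env A (hom_env A P)) (hom_space A P M) (\<lambda>m f. \<lambda>y\<in>carrier P. env_act A M (f y) m)"

locale hom_eval_context = kalgebra A + M: algebra_bimodule A M + P: algebra_bimodule A P
  for A :: "('f::field, 'a) module" and M :: "('a, 'a, 'm) bimod" and P :: "('a, 'a, 'p) bimod"
begin

abbreviation "H \<equiv> hom_env A P"

sublocale t: env_tensor_context A M H
  by (intro env_tensor_context.intro kalgebra_axioms M.algebra_bimodule_axioms
      algebra_bimodule_hom_env P.algebra_bimodule_axioms)

sublocale m: algebra_with_bimodule A M
  by unfold_locales

sublocale S: abelian_group "hom_space A P M"
  by (rule abelian_group_hom_space[OF P.algebra_bimodule_axioms M.algebra_bimodule_axioms])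

lemma hom_eval_bilinear:
  assumes m: "m \<in> carrier M" and f: "f \<in> bimod_hom A P E"
  shows "(\<lambda>y\<in>carrier P. env_act A M (f y) m) \<in> bimod_hom A P M"
  by (intro restrict_bimod_hom P.algebra_bimodule_axioms)
    (simp add: bimod_linear_iff additive_map_def m bimod_hom_closed[OF f] bimod_hom_add[OF f]
      bimod_hom_lact[OF f] bimod_hom_ract[OF f] m.act_closed m.act_add_left m.act_lact)

text \<open>For t = x \<otimes> y both sides are x b m a y. The inner structure occurs on the right
  because it is the one through which the pair (a, b) acts on the dual.\<close>

lemma hom_eval_balance:
  assumes m: "m \<in> carrier M" and t: "t \<in> carrier E" and a: "a \<in> carrier A" and b: "b \<in> carrier A"
  shows "env_act A M t (lact M b (ract M m a)) = env_act A M (lact I a (ract I t b)) m"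
  using t
proof (induction rule: env_induct)
  case (pure x y)
  then show ?case
    using m a b by (simp add: inner_lact(2) inner_ract(2) m.act_pure M.lact_closed M.ract_closed
        M.lact_mult M.ract_mult M.lact_ract)
next
  case (add t u)
  then show ?case
    using m a b by (simp add: inner_add inner_closed m.act_add_left M.lact_closed M.ract_closed)
qed

lemma hom_eval:
  shows hom_eval_additive: "additive_map t.TS (hom_space A P M) (hom_eval A M P)"
    and hom_eval_pure: "m \<in> carrier M \<Longrightarrow> f \<in> bimod_hom A P E \<Longrightarrow>
      hom_eval A M P (t.tpure m f) = (\<lambda>y\<in>carrier P. env_act A M (f y) m)"
proof -
  have c: "f y \<in> carrier E" if "f \<in> bimod_hom A P E" "y \<in> carrier P" for f y
    using that by (rule bimod_hom_closed)
  note r = t.tensor_lift_props[OF S.abelian_group_axioms,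
      of "\<lambda>m f. \<lambda>y\<in>carrier P. env_act A M (f y) m", folded hom_eval_def, unfolded hom_env_sel hom_space_sel]
  show "additive_map t.TS (hom_space A P M) (hom_eval A M P)"
    by (rule r(1)) (auto simp: hom_eval_bilinear m.act_add_left m.act_add_right c hom_eval_balance
        intro!: restrict_ext)
  show "m \<in> carrier M \<Longrightarrow> f \<in> bimod_hom A P E \<Longrightarrow>
      hom_eval A M P (t.tpure m f) = (\<lambda>y\<in>carrier P. env_act A M (f y) m)"
    by (rule r(2)) (auto simp: hom_eval_bilinear m.act_add_left m.act_add_right c hom_eval_balance
        intro!: restrict_ext)
qed

lemma hom_eval_smult:
  assumes t: "t \<in> carrier t.TS"
  shows "hom_eval A M P (c \<odot>\<^bsub>t.TS\<^esub> t) = c \<odot>\<^bsub>hom_space A P M\<^esub> hom_eval A M P t"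
proof -
  have eq: "env_act A M s (lact M (c \<odot>\<^bsub>A\<^esub> \<one>\<^bsub>A\<^esub>) m) = lact M (c \<odot>\<^bsub>A\<^esub> \<one>\<^bsub>A\<^esub>) (env_act A M s m)"
    if s: "s \<in> carrier E" and m: "m \<in> carrier M" for s m
    using s
  proof (induction rule: env_induct)
    case (pure a b)
    have "lact M a (lact M (c \<odot>\<^bsub>A\<^esub> \<one>\<^bsub>A\<^esub>) (ract M m b)) =
        lact M (c \<odot>\<^bsub>A\<^esub> \<one>\<^bsub>A\<^esub>) (lact M a (ract M m b))"
      using pure m by (simp add: M.lact_mult[symmetric] M.ract_closed smult_one_closed smult_one_mult)
    then show ?case
      using pure m by (simp add: m.act_pure M.lact_closed M.ract_closed smult_one_closed M.lact_ract)
  next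
    case (add s u)
    then show ?case
      using m by (simp add: m.act_add_left M.lact_closed smult_one_closed m.act_closed M.lact_add_right)
  qed
  have sa: "additive_map (hom_space A P M) (hom_space A P M) (smult (hom_space A P M) c)"
  proof (rule additive_mapI, unfold hom_space_sel)
    fix f g assume f: "f \<in> bimod_hom A P M"
    note f' = bimod_hom_closed[OF f] bimod_hom_add[OF f] bimod_hom_lact[OF f] bimod_hom_ract[OF f]
    have sw: "lact M (c \<odot>\<^bsub>A\<^esub> \<one>\<^bsub>A\<^esub>) (lact M a x) = lact M a (lact M (c \<odot>\<^bsub>A\<^esub> \<one>\<^bsub>A\<^esub>) x)"
      if "a \<in> carrier A" "x \<in> carrier M" for a x
      using that by (simp add: M.lact_mult[symmetric] smult_one_closed smult_one_mult)
    show "(\<lambda>x\<in>carrier P. lact M (c \<odot>\<^bsub>A\<^esub> \<one>\<^bsub>A\<^esub>) (f x)) \<in> bimod_hom A P M"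
      by (intro restrict_bimod_hom P.algebra_bimodule_axioms)
        (simp add: bimod_linear_iff additive_map_def f' M.lact_closed smult_one_closed
          M.lact_add_right M.lact_ract sw)
    assume "g \<in> bimod_hom A P M"
    then show "(\<lambda>x\<in>carrier P. lact M (c \<odot>\<^bsub>A\<^esub> \<one>\<^bsub>A\<^esub>) ((\<lambda>x\<in>carrier P. f x \<oplus>\<^bsub>M\<^esub> g x) x)) =
      (\<lambda>x\<in>carrier P. (\<lambda>x\<in>carrier P. lact M (c \<odot>\<^bsub>A\<^esub> \<one>\<^bsub>A\<^esub>) (f x)) x \<oplus>\<^bsub>M\<^esub>
        (\<lambda>x\<in>carrier P. lact M (c \<odot>\<^bsub>A\<^esub> \<one>\<^bsub>A\<^esub>) (g x)) x)"
      by (auto intro!: restrict_ext simp: M.lact_add_right smult_one_closed f'(1) bimod_hom_closed)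
  qed
  show ?thesis
    by (rule t.tensor_map_eqI[OF additive_map_comp[OF t.smult_additive hom_eval_additive]
          additive_map_comp[OF hom_eval_additive sa] _ t])
      (auto simp: t.tpure_smult hom_eval_pure M.lact_closed smult_one_closed eq bimod_hom_closed
        intro!: restrict_ext)
qed

text \<open>The inverse sends g to the sum of the g(x_i) \<otimes> f_i. One composite is the
  expansion of g along the dual basis of \<open>P\<close>; for the other, the element g(x_i) of A^e
  is moved across the tensor sign and the dual basis of the dual module is used.\<close>

lemma hom_eval_bij:
  assumes d: "dual_basis A P J x f"
  shows "bij_betw (hom_eval A M P) (carrier t.TS) (bimod_hom A P M)"
proof -
  note Pa = P.algebra_bimodule_axioms and Ma = M.algebra_bimodule_axioms
  have x: "x i \<in> carrier P" and f: "f i \<in> bimod_hom A P E" if "i \<in> J" for i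
    using d that unfolding dual_basis_def by auto
  define iv where "iv g = (\<Oplus>\<^bsub>t.TS\<^esub>i\<in>J. t.tpure (g (x i)) (f i))" for g
  have cl: "t.tpure (g (x i)) (f i) \<in> carrier t.TS" if "g \<in> bimod_hom A P M" "i \<in> J" for g i
    using t.tpure_closed[OF bimod_hom_closed[OF that(1) x[OF that(2)]]] f[OF that(2)] by simp
  have inv_closed: "iv g \<in> carrier t.TS" if "g \<in> bimod_hom A P M" for g
    unfolding iv_def by (intro t.TS.finsum_closed Pi_I cl that)
  have inv_add: "additive_map (hom_space A P M) t.TS iv"
  proof (rule additive_mapI, unfold hom_space_sel)
    fix g g' assume g: "g \<in> bimod_hom A P M" and g': "g' \<in> bimod_hom A P M"
    show "iv (\<lambda>x\<in>carrier P. g x \<oplus>\<^bsub>M\<^esub> g' x) = iv g \<oplus>\<^bsub>t.TS\<^esub> iv g'"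
      unfolding iv_def
      by (rule trans[OF t.TS.finsum_cong'[OF refl] t.TS.finsum_addf])
        (auto simp: cl g g' x f t.tpure_add_left bimod_hom_closed[OF g] bimod_hom_closed[OF g'])
  qed (rule inv_closed)
  have 1: "hom_eval A M P (iv g) = g" if g: "g \<in> bimod_hom A P M" for g
  proof (rule bimod_hom_eqI[OF _ g])
    show "hom_eval A M P (iv g) \<in> bimod_hom A P M"
      using additive_map_closed[OF hom_eval_additive inv_closed[OF g]] by simp
    fix y assume y: "y \<in> carrier P"
    have ev: "additive_map (hom_space A P M) M (\<lambda>g. g y)"
      using y bimod_hom_closed by (fastforce simp: additive_map_def)
    have "hom_eval A M P (iv g) y = (\<Oplus>\<^bsub>M\<^esub>i\<in>J. hom_eval A M P (t.tpure (g (x i)) (f i)) y)"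
      unfolding iv_def
      by (rule additive_map_finsum[OF t.TS.abelian_group_axioms M.abelian_group_axioms
            additive_map_comp[OF hom_eval_additive ev]]) (rule cl[OF g])
    also have "\<dots> = dual_ext A M J f (\<lambda>i. g (x i)) y"
      unfolding dual_ext_def
      by (rule M.finsum_cong'[OF refl])
        (auto simp: hom_eval_pure bimod_hom_closed[OF g] x f y bimod_hom_closed[OF f] intro!: m.act_closed)
    also have "\<dots> = g y"
      by (rule dual_basis_expand[OF Pa Ma d bimod_hom_linear[OF g] y])
    finally show "hom_eval A M P (iv g) y = g y" .
  qed
  have 2: "iv (hom_eval A M P t) = t" if t: "t \<in> carrier t.TS" for t
  proof (rule t.tensor_map_eqI[OF additive_map_comp[OF hom_eval_additive inv_add] _ _ t])
    show "additive_map t.TS t.TS (\<lambda>t. t)" by (simp add: additive_map_def)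
    fix m g assume m: "m \<in> carrier M" and "g \<in> carrier H"
    then have g: "g \<in> bimod_hom A P E" by simp
    let ?F = "\<lambda>i. \<lambda>g\<in>carrier H. env_flip A (g (x i))"
    note dH = dual_basis_hom_env[OF Pa d]
    have F: "?F i \<in> bimod_hom A H E" if "i \<in> J" for i
      using dH that unfolding dual_basis_def by blast
    have ac: "env_act A H (?F i g) (f i) \<in> carrier H" if "i \<in> J" for i
    proof -
      interpret h: algebra_with_bimodule A H by unfold_locales
      show ?thesis
        using that g by (intro h.act_closed bimod_hom_closed[OF F]) (simp_all add: f)
    qed
    have tm: "additive_map H t.TS (t.tpure m)"
      unfolding additive_map_def using t.tpure_closed[OF m] t.tpure_add_right[OF m] by blast
    have "iv (hom_eval A M P (t.tpure m g)) = (\<Oplus>\<^bsub>t.TS\<^esub>i\<in>J. t.tpure m (env_act A H (?F i g) (f i)))"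
      unfolding iv_def
    proof (rule t.TS.finsum_cong'[OF refl])
      fix i assume i: "i \<in> J"
      have "t.tpure (hom_eval A M P (t.tpure m g) (x i)) (f i) = t.tpure (env_act A M (g (x i)) m) (f i)"
        by (simp add: hom_eval_pure m g x i)
      also have "\<dots> = t.tpure m (env_act A H (env_flip A (g (x i))) (f i))"
        by (rule t.tensor_act_balanced[OF m]) (use f x i bimod_hom_closed[OF g] in simp_all)
      finally show "t.tpure (hom_eval A M P (t.tpure m g) (x i)) (f i) =
          t.tpure m (env_act A H (?F i g) (f i))"
        using g by simp
    qed (use ac m t.tpure_closed in blast)
    also have "\<dots> = t.tpure m (dual_ext A H J ?F f g)"
      unfolding dual_ext_def
      by (rule additive_map_finsum[OF t.N.abelian_group_axioms t.TS.abelian_group_axioms tm ac, symmetric])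
    also have "dual_ext A H J ?F f g = g"
      using dH g unfolding dual_basis_def by simp
    finally show "iv (hom_eval A M P (t.tpure m g)) = t.tpure m g" .
  qed
  show ?thesis
    by (rule bij_betw_byWitness[of _ iv])
      (use 1 2 inv_closed additive_map_closed[OF hom_eval_additive] in auto)
qed

end

context kalgebra
begin

text \<open>Precomposition with \<open>\<delta>\<close> does not touch the values of f in A^e, so
  both orders send m \<otimes> f to the map y \<mapsto> f(\<delta>(y)) m. In a complex this makes
  evaluation commute with the differentials.\<close>

lemma hom_eval_natural:
  assumes M: "algebra_bimodule A M" and P: "algebra_bimodule A P" and P': "algebra_bimodule A P'"
    and \<delta>: "bimod_linear A P' P \<delta>"
  defines "\<delta>' \<equiv> \<lambda>f. compose (carrier P') f \<delta>"
  shows compose_linear: "bimod_linear A (hom_env A P) (hom_env A P') \<delta>'"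
    and "t \<in> carrier (env_tensor_space A M (hom_env A P)) \<Longrightarrow>
      hom_eval A M P' (env_tensor_map A M (hom_env A P) (hom_env A P') \<delta>' t) =
      compose (carrier P') (hom_eval A M P t) \<delta>"
proof -
  interpret P': algebra_bimodule A P' by fact
  interpret h: hom_eval_context A M P
    by (intro hom_eval_context.intro kalgebra_axioms M P)
  interpret h': hom_eval_context A M P'
    by (intro hom_eval_context.intro kalgebra_axioms M P')
  note d = bimod_linear_closed[OF \<delta>]
  have comp: "compose (carrier P') f \<delta> \<in> bimod_hom A P' N" if "f \<in> bimod_hom A P N" for f N
    unfolding compose_def
    by (intro restrict_bimod_hom P' bimod_linear_comp[OF \<delta> bimod_hom_linear[OF that]])
  show lin: "bimod_linear A (hom_env A P) (hom_env A P') \<delta>'"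
    unfolding \<delta>'_def bimod_linear_iff additive_map_def
    using comp d P'.add.m_closed by (auto simp: compose_def intro!: restrict_ext)
  assume t: "t \<in> carrier (env_tensor_space A M (hom_env A P))"
  have "additive_map (hom_space A P M) (hom_space A P' M) (\<lambda>g. compose (carrier P') g \<delta>)"
    unfolding additive_map_def using comp d by (auto simp: compose_def intro!: restrict_ext)
  then have ad: "additive_map (hom_space A P M) (hom_space A P' M) (\<lambda>g. compose (carrier P') g \<delta>)" .
  show "hom_eval A M P' (env_tensor_map A M (hom_env A P) (hom_env A P') \<delta>' t) =
      compose (carrier P') (hom_eval A M P t) \<delta>"
  proof (rule h.t.tensor_map_eqI[OF additive_map_comp[OF env_tensor_map_additive[OF M h.t.N.algebra_bimodule_axioms
        h'.t.N.algebra_bimodule_axioms lin] h'.hom_eval_additive] additive_map_comp[OF h.hom_eval_additive ad] _ t])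
    fix m f assume m: "m \<in> carrier M" and "f \<in> carrier (hom_env A P)"
    then have f: "f \<in> bimod_hom A P E" by simp
    have "env_tensor_map A M h.H h'.H \<delta>' (h.t.tpure m f) = h'.t.tpure m (\<delta>' f)"
      by (rule env_tensor_map_pure[OF M h.t.N.algebra_bimodule_axioms h'.t.N.algebra_bimodule_axioms lin m])
        (simp add: f)
    then show "hom_eval A M P' (env_tensor_map A M h.H h'.H \<delta>' (h.t.tpure m f)) =
        compose (carrier P') (hom_eval A M P (h.t.tpure m f)) \<delta>"
      using h'.hom_eval_pure[OF m comp[OF f]] h.hom_eval_pure[OF m f] d
      by (auto simp: \<delta>'_def compose_def intro!: restrict_ext)
  qed
qed

end

section \<open>Complexes\<close>

definition hcoset :: "('x, 'r) ring_scheme \<Rightarrow> ('x \<Rightarrow> 'y) \<Rightarrow> ('y, 's) ring_scheme \<Rightarrow> 'y \<Rightarrow> 'y set" where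
  "hcoset L f M y = (\<lambda>l. f l \<oplus>\<^bsub>M\<^esub> y) ` carrier L"

lemma homology_at_sel:
  "carrier (homology_at L f M g N) = hcoset L f M ` {y \<in> carrier M. g y = \<zero>\<^bsub>N\<^esub>}"
  "monoid.mult (homology_at L f M g N) U V = (\<Union>u\<in>U. \<Union>v\<in>V. {u \<oplus>\<^bsub>M\<^esub> v})"
  by (auto simp: homology_at_def A_FactGroup_def FactGroup_def A_RCOSETS_def RCOSETS_def r_coset_def
      hcoset_def set_add_def set_mult_def)

lemma homology_space_at_sel:
  "carrier (homology_space_at L f M g N) = hcoset L f M ` {y \<in> carrier M. g y = \<zero>\<^bsub>N\<^esub>}"
  "U \<oplus>\<^bsub>homology_space_at L f M g N\<^esub> V = (\<Union>u\<in>U. \<Union>v\<in>V. {u \<oplus>\<^bsub>M\<^esub> v})"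
  "c \<odot>\<^bsub>homology_space_at L f M g N\<^esub> U = (\<Union>l\<in>carrier L. \<Union>v\<in>U. {f l \<oplus>\<^bsub>M\<^esub> c \<odot>\<^bsub>M\<^esub> v})"
  by (auto simp: homology_space_at_def Let_def homology_at_sel set_add_def set_mult_def)

lemma hcoset_eq_iff:
  assumes "abelian_group L" "abelian_group M" "additive_map L M f" "y \<in> carrier M" "y' \<in> carrier M"
  shows "hcoset L f M y = hcoset L f M y' \<longleftrightarrow> (\<exists>l\<in>carrier L. y = f l \<oplus>\<^bsub>M\<^esub> y')"
proof -
  interpret L: abelian_group L by fact
  interpret M: abelian_group M by fact
  note f = additive_map_closed[OF assms(3)] additive_map_add[OF assms(3)]
    additive_map_zero[OF assms(1-3)] additive_map_neg[OF assms(1-3)]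
  have self: "y \<in> hcoset L f M y" if "y \<in> carrier M" for y
    unfolding hcoset_def using that by (intro image_eqI[of _ _ "\<zero>\<^bsub>L\<^esub>"]) (simp_all add: f)
  show ?thesis
  proof
    assume "hcoset L f M y = hcoset L f M y'"
    then show "\<exists>l\<in>carrier L. y = f l \<oplus>\<^bsub>M\<^esub> y'"
      using self[OF assms(4)] by (auto simp: hcoset_def)
  next
    assume "\<exists>l\<in>carrier L. y = f l \<oplus>\<^bsub>M\<^esub> y'"
    then obtain l where l: "l \<in> carrier L" "y = f l \<oplus>\<^bsub>M\<^esub> y'" by blast
    show "hcoset L f M y = hcoset L f M y'"
    proof (intro equalityI subsetI)
      fix u assume "u \<in> hcoset L f M y"
      then obtain k where k: "k \<in> carrier L" "u = f k \<oplus>\<^bsub>M\<^esub> y" by (auto simp: hcoset_def)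
      then have "u = f (k \<oplus>\<^bsub>L\<^esub> l) \<oplus>\<^bsub>M\<^esub> y'"
        using l assms by (simp add: f M.a_assoc)
      then show "u \<in> hcoset L f M y'" unfolding hcoset_def using k l by blast
    next
      fix u assume "u \<in> hcoset L f M y'"
      then obtain k where k: "k \<in> carrier L" "u = f k \<oplus>\<^bsub>M\<^esub> y'" by (auto simp: hcoset_def)
      have "f (k \<oplus>\<^bsub>L\<^esub> \<ominus>\<^bsub>L\<^esub> l) \<oplus>\<^bsub>M\<^esub> y = f (k \<oplus>\<^bsub>L\<^esub> \<ominus>\<^bsub>L\<^esub> l \<oplus>\<^bsub>L\<^esub> l) \<oplus>\<^bsub>M\<^esub> y'"
        using l k assms by (simp add: f M.a_assoc)
      also have "\<dots> = u"
        using l k by (simp add: L.a_assoc L.l_neg)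
      finally show "u \<in> hcoset L f M y" unfolding hcoset_def using k l by (metis L.a_closed L.a_inv_closed image_eqI)
    qed
  qed
qed

lemma hcoset_add:
  assumes "abelian_group L" "abelian_group M" "additive_map L M f" "y \<in> carrier M" "y' \<in> carrier M"
  shows "(\<Union>u\<in>hcoset L f M y. \<Union>v\<in>hcoset L f M y'. {u \<oplus>\<^bsub>M\<^esub> v}) = hcoset L f M (y \<oplus>\<^bsub>M\<^esub> y')"
proof -
  interpret L: abelian_group L by fact
  interpret M: abelian_group M by fact
  note f = additive_map_closed[OF assms(3)] additive_map_add[OF assms(3)]
    additive_map_zero[OF assms(1-3)]
  have 1: "(f l \<oplus>\<^bsub>M\<^esub> y) \<oplus>\<^bsub>M\<^esub> (f k \<oplus>\<^bsub>M\<^esub> y') = f (l \<oplus>\<^bsub>L\<^esub> k) \<oplus>\<^bsub>M\<^esub> (y \<oplus>\<^bsub>M\<^esub> y')"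
    if "l \<in> carrier L" "k \<in> carrier L" for l k
    using that assms by (simp add: f M.a_ac)
  have 2: "f l \<oplus>\<^bsub>M\<^esub> (y \<oplus>\<^bsub>M\<^esub> y') = (f l \<oplus>\<^bsub>M\<^esub> y) \<oplus>\<^bsub>M\<^esub> (f \<zero>\<^bsub>L\<^esub> \<oplus>\<^bsub>M\<^esub> y')" if "l \<in> carrier L" for l
    using that assms by (simp add: f M.a_ac)
  show ?thesis
  proof (intro equalityI subsetI)
    fix u assume "u \<in> (\<Union>u\<in>hcoset L f M y. \<Union>v\<in>hcoset L f M y'. {u \<oplus>\<^bsub>M\<^esub> v})"
    then obtain l k where "l \<in> carrier L" "k \<in> carrier L"
      "u = (f l \<oplus>\<^bsub>M\<^esub> y) \<oplus>\<^bsub>M\<^esub> (f k \<oplus>\<^bsub>M\<^esub> y')"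
      unfolding hcoset_def by blast
    then show "u \<in> hcoset L f M (y \<oplus>\<^bsub>M\<^esub> y')"
      unfolding hcoset_def by (intro image_eqI[of _ _ "l \<oplus>\<^bsub>L\<^esub> k"]) (simp_all add: 1)
  next
    fix u assume "u \<in> hcoset L f M (y \<oplus>\<^bsub>M\<^esub> y')"
    then obtain l where "l \<in> carrier L" "u = f l \<oplus>\<^bsub>M\<^esub> (y \<oplus>\<^bsub>M\<^esub> y')"
      unfolding hcoset_def by blast
    then show "u \<in> (\<Union>u\<in>hcoset L f M y. \<Union>v\<in>hcoset L f M y'. {u \<oplus>\<^bsub>M\<^esub> v})"
      unfolding hcoset_def using 2 L.zero_closed by blast
  qed
qed

text \<open>As h maps boundaries to boundaries, adding all boundaries of the target to the image of
  a coset yields a single coset. This form covers scalar multiplication on homology as well as the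
  map in \<open>cochain_quasi_iso\<close>.\<close>

lemma hcoset_map:
  assumes "abelian_group L" "abelian_group M" "additive_map L M f"
    and "abelian_group L'" "abelian_group M'" "additive_map L' M' f'"
    and "additive_map M M' h" and "\<And>l. l \<in> carrier L \<Longrightarrow> \<exists>l'\<in>carrier L'. h (f l) = f' l'"
    and "y \<in> carrier M"
  shows "(\<Union>l\<in>carrier L'. \<Union>v\<in>h ` hcoset L f M y. {f' l \<oplus>\<^bsub>M'\<^esub> v}) = hcoset L' f' M' (h y)"
proof -
  interpret L: abelian_group L by fact
  interpret M: abelian_group M by fact
  interpret L': abelian_group L' by fact
  interpret M': abelian_group M' by fact
  note f = additive_map_closed[OF assms(3)] additive_map_add[OF assms(3)]
    additive_map_zero[OF assms(1-3)]
  note f' = additive_map_closed[OF assms(6)] additive_map_add[OF assms(6)]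
  note h = additive_map_closed[OF assms(7)] additive_map_add[OF assms(7)]
  have 1: "\<exists>k\<in>carrier L'. f' l \<oplus>\<^bsub>M'\<^esub> h (f m \<oplus>\<^bsub>M\<^esub> y) = f' k \<oplus>\<^bsub>M'\<^esub> h y"
    if lm: "l \<in> carrier L'" "m \<in> carrier L" for l m
  proof -
    obtain k where k: "k \<in> carrier L'" "h (f m) = f' k" using assms(8)[OF lm(2)] by blast
    then have "f' l \<oplus>\<^bsub>M'\<^esub> h (f m \<oplus>\<^bsub>M\<^esub> y) = f' (l \<oplus>\<^bsub>L'\<^esub> k) \<oplus>\<^bsub>M'\<^esub> h y"
      using lm assms(9) by (simp add: h f f' M'.a_assoc)
    then show ?thesis using k lm L'.a_closed by blast
  qed
  have 2: "f' l \<oplus>\<^bsub>M'\<^esub> h y = f' l \<oplus>\<^bsub>M'\<^esub> h (f \<zero>\<^bsub>L\<^esub> \<oplus>\<^bsub>M\<^esub> y)" for l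
    using assms(9) by (simp add: f)
  show ?thesis
  proof (intro equalityI subsetI)
    fix u assume "u \<in> (\<Union>l\<in>carrier L'. \<Union>v\<in>h ` hcoset L f M y. {f' l \<oplus>\<^bsub>M'\<^esub> v})"
    then obtain l m where "l \<in> carrier L'" "m \<in> carrier L" "u = f' l \<oplus>\<^bsub>M'\<^esub> h (f m \<oplus>\<^bsub>M\<^esub> y)"
      unfolding hcoset_def by blast
    then show "u \<in> hcoset L' f' M' (h y)"
      unfolding hcoset_def using 1[of l m] by blast
  next
    fix u assume "u \<in> hcoset L' f' M' (h y)"
    then obtain l where "l \<in> carrier L'" "u = f' l \<oplus>\<^bsub>M'\<^esub> h y"
      unfolding hcoset_def by blast
    then show "u \<in> (\<Union>l\<in>carrier L'. \<Union>v\<in>h ` hcoset L f M y. {f' l \<oplus>\<^bsub>M'\<^esub> v})"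
      unfolding hcoset_def using 2[of l] L.zero_closed by blast
  qed
qed

text \<open>Only one degree is compared, and \<open>h\<close> respects boundaries and cycles merely
  as sets: the map used later commutes with the differentials only up to the sign of the shift.
  Injectivity and surjectivity are stated modulo boundaries, in the form that homotopy inverses
  provide.\<close>

lemma homology_space_isoI:
  assumes L: "abelian_group L" and M: "abelian_group M" and f: "additive_map L M f"
    and L': "abelian_group L'" and M': "abelian_group M'" and f': "additive_map L' M' f'"
    and N: "abelian_group N" and N': "abelian_group N'"
    and g: "additive_map M N g" and g': "additive_map M' N' g'"
    and h: "additive_map M M' h"
    and hs: "\<And>c y. y \<in> carrier M \<Longrightarrow> h (c \<odot>\<^bsub>M\<^esub> y) = c \<odot>\<^bsub>M'\<^esub> h y"
    and sM: "\<And>c. additive_map M M (smult M c)" and sM': "\<And>c. additive_map M' M' (smult M' c)"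
    and sf: "\<And>c l. l \<in> carrier L \<Longrightarrow> \<exists>k\<in>carrier L. c \<odot>\<^bsub>M\<^esub> f l = f k"
    and sf': "\<And>c l. l \<in> carrier L' \<Longrightarrow> \<exists>k\<in>carrier L'. c \<odot>\<^bsub>M'\<^esub> f' l = f' k"
    and sg: "\<And>c y. y \<in> carrier M \<Longrightarrow> g y = \<zero>\<^bsub>N\<^esub> \<Longrightarrow> g (c \<odot>\<^bsub>M\<^esub> y) = \<zero>\<^bsub>N\<^esub>"
    and hf: "\<And>l. l \<in> carrier L \<Longrightarrow> \<exists>l'\<in>carrier L'. h (f l) = f' l'"
    and hg: "\<And>y. y \<in> carrier M \<Longrightarrow> g y = \<zero>\<^bsub>N\<^esub> \<Longrightarrow> g' (h y) = \<zero>\<^bsub>N'\<^esub>"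
    and inj: "\<And>y l'. y \<in> carrier M \<Longrightarrow> g y = \<zero>\<^bsub>N\<^esub> \<Longrightarrow> l' \<in> carrier L' \<Longrightarrow> h y = f' l' \<Longrightarrow>
      \<exists>l\<in>carrier L. y = f l"
    and surj: "\<And>y'. y' \<in> carrier M' \<Longrightarrow> g' y' = \<zero>\<^bsub>N'\<^esub> \<Longrightarrow>
      \<exists>y\<in>carrier M. g y = \<zero>\<^bsub>N\<^esub> \<and> (\<exists>l'\<in>carrier L'. y' = f' l' \<oplus>\<^bsub>M'\<^esub> h y)"
  shows "vector_space_iso (homology_space_at L f M g N) (homology_space_at L' f' M' g' N')"
proof -
  let ?V = "homology_space_at L f M g N" and ?W = "homology_space_at L' f' M' g' N'"
  let ?c = "hcoset L f M" and ?c' = "hcoset L' f' M'"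
  interpret M: abelian_group M by fact
  interpret M': abelian_group M' by fact
  interpret N: abelian_group N by fact
  define \<phi> where "\<phi> U = (\<Union>l\<in>carrier L'. \<Union>v\<in>h ` U. {f' l \<oplus>\<^bsub>M'\<^esub> v})" for U
  have \<phi>: "\<phi> (?c y) = ?c' (h y)" if "y \<in> carrier M" for y
    unfolding \<phi>_def by (rule hcoset_map[OF L M f L' M' f' h hf that])
  note eq = hcoset_eq_iff[OF L M f] and eq' = hcoset_eq_iff[OF L' M' f']
  note hc = additive_map_closed[OF h] and ha = additive_map_add[OF h]
  have hn: "h (\<ominus>\<^bsub>M\<^esub> y) = \<ominus>\<^bsub>M'\<^esub> h y" if "y \<in> carrier M" for y
    by (rule additive_map_neg[OF M M' h that])
  have gsub: "g (y \<oplus>\<^bsub>M\<^esub> \<ominus>\<^bsub>M\<^esub> z) = \<zero>\<^bsub>N\<^esub>"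
    if "y \<in> carrier M" "g y = \<zero>\<^bsub>N\<^esub>" "z \<in> carrier M" "g z = \<zero>\<^bsub>N\<^esub>" for y z
    using that additive_map_add[OF g] additive_map_neg[OF M N g] N.minus_equality[of "\<zero>\<^bsub>N\<^esub>" "\<zero>\<^bsub>N\<^esub>"] by simp
  have sc: "c \<odot>\<^bsub>?V\<^esub> ?c y = ?c (c \<odot>\<^bsub>M\<^esub> y)" if "y \<in> carrier M" for c y
    using hcoset_map[OF L M f L M f sM[of c] sf that] by (auto simp: homology_space_at_sel)
  have sc': "c \<odot>\<^bsub>?W\<^esub> ?c' y = ?c' (c \<odot>\<^bsub>M'\<^esub> y)" if "y \<in> carrier M'" for c y
    using hcoset_map[OF L' M' f' L' M' f' sM'[of c] sf' that] by (auto simp: homology_space_at_sel)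
  have "\<phi> \<in> hom (add_monoid ?V) (add_monoid ?W)"
    unfolding additive_map_iff_hom[symmetric]
  proof (rule additive_mapI)
    fix U assume "U \<in> carrier ?V"
    then obtain y where y: "U = ?c y" "y \<in> carrier M" "g y = \<zero>\<^bsub>N\<^esub>"
      by (auto simp: homology_space_at_sel)
    show "\<phi> U \<in> carrier ?W"
      unfolding homology_space_at_sel y(1) \<phi>[OF y(2)] using hc[OF y(2)] hg[OF y(2,3)] by blast
    fix U' assume "U' \<in> carrier ?V"
    then obtain y' where y': "U' = ?c y'" "y' \<in> carrier M" "g y' = \<zero>\<^bsub>N\<^esub>"
      by (auto simp: homology_space_at_sel)
    show "\<phi> (U \<oplus>\<^bsub>?V\<^esub> U') = \<phi> U \<oplus>\<^bsub>?W\<^esub> \<phi> U'"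
      using y y' by (simp add: homology_space_at_sel(2) hcoset_add[OF L M f] hcoset_add[OF L' M' f'] \<phi> hc ha)
  qed
  moreover have "bij_betw \<phi> (carrier ?V) (carrier ?W)"
    unfolding bij_betw_def
  proof
    show "inj_on \<phi> (carrier ?V)"
    proof (rule inj_onI)
      fix U U' assume "U \<in> carrier ?V" "U' \<in> carrier ?V" and e: "\<phi> U = \<phi> U'"
      then obtain y y' where y: "U = ?c y" "y \<in> carrier M" "g y = \<zero>\<^bsub>N\<^esub>"
        and y': "U' = ?c y'" "y' \<in> carrier M" "g y' = \<zero>\<^bsub>N\<^esub>"
        by (auto simp: homology_space_at_sel)
      obtain l where l: "l \<in> carrier L'" "h y = f' l \<oplus>\<^bsub>M'\<^esub> h y'"
        using e y y' eq'[OF hc hc] by (auto simp: \<phi>)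
      have "h (y \<oplus>\<^bsub>M\<^esub> \<ominus>\<^bsub>M\<^esub> y') = f' l"
        using l y y' additive_map_closed[OF f' l(1)] by (simp add: ha hn hc M'.a_assoc M'.r_neg)
      then obtain k where k: "k \<in> carrier L" "y \<oplus>\<^bsub>M\<^esub> \<ominus>\<^bsub>M\<^esub> y' = f k"
        using inj[OF _ gsub l(1)] y y' by blast
      have "f k \<oplus>\<^bsub>M\<^esub> y' = y"
        unfolding k(2)[symmetric] using y y' by (simp add: M.a_assoc M.l_neg)
      then show "U = U'"
        unfolding y(1) y'(1) using eq[OF y(2) y'(2)] k(1) by metis
    qed
    show "\<phi> ` carrier ?V = carrier ?W"
    proof (intro equalityI subsetI)
      fix W assume "W \<in> \<phi> ` carrier ?V"
      then obtain y where y: "W = \<phi> (?c y)" "y \<in> carrier M" "g y = \<zero>\<^bsub>N\<^esub>"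
        unfolding homology_space_at_sel by blast
      show "W \<in> carrier ?W"
        unfolding homology_space_at_sel y(1) \<phi>[OF y(2)] using hc[OF y(2)] hg[OF y(2,3)] by blast
    next
      fix W assume "W \<in> carrier ?W"
      then obtain y' where y': "W = ?c' y'" "y' \<in> carrier M'" "g' y' = \<zero>\<^bsub>N'\<^esub>"
        by (auto simp: homology_space_at_sel)
      obtain y l where y: "y \<in> carrier M" "g y = \<zero>\<^bsub>N\<^esub>" "l \<in> carrier L'" "y' = f' l \<oplus>\<^bsub>M'\<^esub> h y"
        using surj[OF y'(2,3)] by blast
      then have "W = \<phi> (?c y)"
        unfolding \<phi>[OF y(1)] y'(1) using eq'[OF y'(2) hc[OF y(1)]] by blast
      then show "W \<in> \<phi> ` carrier ?V"
        using y by (auto simp: homology_space_at_sel)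
    qed
  qed
  moreover have "\<phi> (c \<odot>\<^bsub>?V\<^esub> U) = c \<odot>\<^bsub>?W\<^esub> \<phi> U" if "U \<in> carrier ?V" for c U
  proof -
    obtain y where y: "U = ?c y" "y \<in> carrier M" "g y = \<zero>\<^bsub>N\<^esub>"
      using \<open>U \<in> carrier ?V\<close> by (auto simp: homology_space_at_sel)
    show ?thesis
      unfolding y(1) using y(2) by (simp add: sc sc' \<phi> hc hs additive_map_closed[OF sM])
  qed
  ultimately show ?thesis
    unfolding vector_space_iso_def iso_def by auto
qed

subsection \<open>Lifting along quasi-isomorphisms\<close>

text \<open>Boundedness is kept apart: where it enters, in \<open>quasi_iso_lift\<close>, it is an
  upper bound on the degrees of the source.\<close>

definition cochain_complex :: "('f::field, 'a) module \<Rightarrow> (('a, 'a, 'm) bimod, 'm) gcomplex \<Rightarrow> bool" where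
  "cochain_complex A C \<longleftrightarrow>
     (\<forall>p. algebra_bimodule A (obj C p)) \<and>
     (\<forall>p. bimod_linear A (obj C p) (obj C (p + 1)) (dif C p)) \<and>
     (\<forall>p. \<forall>x\<in>carrier (obj C p). dif C (p + 1) (dif C p x) = \<zero>\<^bsub>obj C (p + 2)\<^esub>)"

definition cochain_map :: "('f::field, 'a) module \<Rightarrow> (('a, 'a, 'm) bimod, 'm) gcomplex \<Rightarrow>
    (('a, 'a, 'n) bimod, 'n) gcomplex \<Rightarrow> (int \<Rightarrow> 'm \<Rightarrow> 'n) \<Rightarrow> bool" where
  "cochain_map A C D f \<longleftrightarrow>
     (\<forall>p. bimod_linear A (obj C p) (obj D p) (f p)) \<and>
     (\<forall>p. \<forall>x\<in>carrier (obj C p). f (p + 1) (dif C p x) = dif D p (f p x))"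

text \<open>The coset-free form of \<open>cochain_quasi_iso\<close>; injectivity is tested at zero
  only, which suffices for additive maps.\<close>

definition quasi_iso :: "('f::field, 'a) module \<Rightarrow> (('a, 'a, 'm) bimod, 'm) gcomplex \<Rightarrow>
    (('a, 'a, 'n) bimod, 'n) gcomplex \<Rightarrow> (int \<Rightarrow> 'm \<Rightarrow> 'n) \<Rightarrow> bool" where
  "quasi_iso A C D f \<longleftrightarrow> cochain_map A C D f \<and>
     (\<forall>p. \<forall>z\<in>carrier (obj C p). \<forall>y\<in>carrier (obj D (p - 1)).
        dif C p z = \<zero>\<^bsub>obj C (p + 1)\<^esub> \<longrightarrow> f p z = dif D (p - 1) y \<longrightarrow>
        (\<exists>w\<in>carrier (obj C (p - 1)). z = dif C (p - 1) w)) \<and>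
     (\<forall>p. \<forall>y\<in>carrier (obj D p). dif D p y = \<zero>\<^bsub>obj D (p + 1)\<^esub> \<longrightarrow>
        (\<exists>z\<in>carrier (obj C p). dif C p z = \<zero>\<^bsub>obj C (p + 1)\<^esub> \<and>
          (\<exists>w\<in>carrier (obj D (p - 1)). y = f p z \<oplus>\<^bsub>obj D p\<^esub> dif D (p - 1) w)))"

definition homotopic :: "('f::field, 'a) module \<Rightarrow> (('a, 'a, 'm) bimod, 'm) gcomplex \<Rightarrow>
    (('a, 'a, 'n) bimod, 'n) gcomplex \<Rightarrow> (int \<Rightarrow> 'm \<Rightarrow> 'n) \<Rightarrow> (int \<Rightarrow> 'm \<Rightarrow> 'n) \<Rightarrow>
    (int \<Rightarrow> 'm \<Rightarrow> 'n) \<Rightarrow> bool" where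
  "homotopic A C D f g k \<longleftrightarrow>
     (\<forall>p. bimod_linear A (obj C p) (obj D (p - 1)) (k p)) \<and>
     (\<forall>p. \<forall>x\<in>carrier (obj C p).
        f p x = g p x \<oplus>\<^bsub>obj D p\<^esub> dif D (p - 1) (k p x) \<oplus>\<^bsub>obj D p\<^esub> k (p + 1) (dif C p x))"

lemma cochain_complexD:
  assumes "cochain_complex A C"
  shows "algebra_bimodule A (obj C p)" "abelian_group (obj C p)"
    "bimod_linear A (obj C p) (obj C (p + 1)) (dif C p)"
    "bimod_linear A (obj C (p - 1)) (obj C p) (dif C (p - 1))"
    "x \<in> carrier (obj C p) \<Longrightarrow> dif C (p + 1) (dif C p x) = \<zero>\<^bsub>obj C (p + 2)\<^esub>"
    "x \<in> carrier (obj C (p - 1)) \<Longrightarrow> dif C p (dif C (p - 1) x) = \<zero>\<^bsub>obj C (p + 1)\<^esub>"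
proof -
  show b: "algebra_bimodule A (obj C p)"
    "bimod_linear A (obj C p) (obj C (p + 1)) (dif C p)"
    "x \<in> carrier (obj C p) \<Longrightarrow> dif C (p + 1) (dif C p x) = \<zero>\<^bsub>obj C (p + 2)\<^esub>" for p
    using assms unfolding cochain_complex_def by blast+
  show "abelian_group (obj C p)"
    using b(1) by (simp add: algebra_bimodule_def)
  show "bimod_linear A (obj C (p - 1)) (obj C p) (dif C (p - 1))"
    using b(2)[of "p - 1"] by simp
  show "x \<in> carrier (obj C (p - 1)) \<Longrightarrow> dif C p (dif C (p - 1) x) = \<zero>\<^bsub>obj C (p + 1)\<^esub>"
    using b(3)[of "p - 1"] by (simp add: add.commute)
qed

lemma cochain_mapD:
  assumes "cochain_map A C D f"
  shows "bimod_linear A (obj C p) (obj D p) (f p)"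
    "x \<in> carrier (obj C p) \<Longrightarrow> f (p + 1) (dif C p x) = dif D p (f p x)"
    "x \<in> carrier (obj C (p - 1)) \<Longrightarrow> f p (dif C (p - 1) x) = dif D (p - 1) (f (p - 1) x)"
proof -
  show b: "bimod_linear A (obj C p) (obj D p) (f p)"
    "x \<in> carrier (obj C p) \<Longrightarrow> f (p + 1) (dif C p x) = dif D p (f p x)" for p
    using assms unfolding cochain_map_def by blast+
  show "x \<in> carrier (obj C (p - 1)) \<Longrightarrow> f p (dif C (p - 1) x) = dif D (p - 1) (f (p - 1) x)"
    using b(2)[of "p - 1"] by simp
qed

lemma quasi_isoD:
  assumes "quasi_iso A C D f"
  shows "cochain_map A C D f"
    and "z \<in> carrier (obj C p) \<Longrightarrow> y \<in> carrier (obj D (p - 1)) \<Longrightarrow> dif C p z = \<zero>\<^bsub>obj C (p + 1)\<^esub> \<Longrightarrow>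
      f p z = dif D (p - 1) y \<Longrightarrow> \<exists>w\<in>carrier (obj C (p - 1)). z = dif C (p - 1) w"
    and "y \<in> carrier (obj D p) \<Longrightarrow> dif D p y = \<zero>\<^bsub>obj D (p + 1)\<^esub> \<Longrightarrow>
      \<exists>z\<in>carrier (obj C p). dif C p z = \<zero>\<^bsub>obj C (p + 1)\<^esub> \<and>
          (\<exists>w\<in>carrier (obj D (p - 1)). y = f p z \<oplus>\<^bsub>obj D p\<^esub> dif D (p - 1) w)"
  using assms unfolding quasi_iso_def by blast+

text \<open>For injectivity, the cosets of z and of zero have the same image, so they agree and z is
  a coboundary; for surjectivity, a preimage coset is represented by a cocycle.\<close>

lemma quasi_iso_cochain_quasi_iso:
  assumes C: "cochain_complex A C" and D: "cochain_complex A D" and f: "cochain_quasi_iso A C D f"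
  shows "quasi_iso A C D f"
proof -
  have m: "cochain_map A C D f"
    using f unfolding cochain_quasi_iso_def cochain_map_def by blast
  note CD = cochain_complexD[OF C] and DD = cochain_complexD[OF D] and fD = cochain_mapD[OF m]
  let ?c = "\<lambda>p. hcoset (obj C (p - 1)) (dif C (p - 1)) (obj C p)"
  let ?d = "\<lambda>p. hcoset (obj D (p - 1)) (dif D (p - 1)) (obj D p)"
  let ?\<phi> = "\<lambda>p U. (dif D (p - 1) ` carrier (obj D (p - 1))) <+>\<^bsub>obj D p\<^esub> (f p ` U)"
  have \<phi>: "?\<phi> p (?c p y) = ?d p (f p y)" if "y \<in> carrier (obj C p)" for p y
  proof -
    have "?\<phi> p U = (\<Union>l\<in>carrier (obj D (p - 1)). \<Union>v\<in>f p ` U. {dif D (p - 1) l \<oplus>\<^bsub>obj D p\<^esub> v})" for U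
      by (auto simp: set_add_def set_mult_def)
    moreover have "\<exists>l'\<in>carrier (obj D (p - 1)). f p (dif C (p - 1) l) = dif D (p - 1) l'"
      if "l \<in> carrier (obj C (p - 1))" for l
      using fD(3)[OF that] bimod_linear_closed[OF fD(1) that] by blast
    ultimately show ?thesis
      using hcoset_map[OF CD(2) CD(2) bimod_linear_additive[OF CD(4)] DD(2) DD(2)
          bimod_linear_additive[OF DD(4)] bimod_linear_additive[OF fD(1)] _ that] by simp
  qed
  have bij: "bij_betw (?\<phi> p) (?c p ` {y \<in> carrier (obj C p). dif C p y = \<zero>\<^bsub>obj C (p + 1)\<^esub>})
      (?d p ` {y \<in> carrier (obj D p). dif D p y = \<zero>\<^bsub>obj D (p + 1)\<^esub>})" for p
    using f unfolding cochain_quasi_iso_def cohomology_group_def homology_at_sel by blast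
  show ?thesis
    unfolding quasi_iso_def
  proof (intro conjI m allI ballI impI)
    fix p z y assume z: "z \<in> carrier (obj C p)" and y: "y \<in> carrier (obj D (p - 1))"
      and zc: "dif C p z = \<zero>\<^bsub>obj C (p + 1)\<^esub>" and e: "f p z = dif D (p - 1) y"
    interpret C: abelian_group "obj C p" by (rule CD(2))
    interpret D: abelian_group "obj D p" by (rule DD(2))
    have z0: "\<zero>\<^bsub>obj C p\<^esub> \<in> {y \<in> carrier (obj C p). dif C p y = \<zero>\<^bsub>obj C (p + 1)\<^esub>}"
      using additive_map_zero[OF CD(2) CD(2) bimod_linear_additive[OF CD(3)]] by simp
    have f0: "f p \<zero>\<^bsub>obj C p\<^esub> = \<zero>\<^bsub>obj D p\<^esub>"
      by (rule additive_map_zero[OF CD(2) DD(2) bimod_linear_additive[OF fD(1)]])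
    have "?d p (f p z) = ?d p (f p \<zero>\<^bsub>obj C p\<^esub>)"
      unfolding hcoset_eq_iff[OF DD(2) DD(2) bimod_linear_additive[OF DD(4)]
          bimod_linear_closed[OF fD(1) z] bimod_linear_closed[OF fD(1) C.zero_closed]]
      using bimod_linear_closed[OF DD(4) y] by (intro bexI[OF _ y]) (simp add: f0 e)
    then have "?\<phi> p (?c p z) = ?\<phi> p (?c p \<zero>\<^bsub>obj C p\<^esub>)"
      by (simp only: \<phi>[OF z] \<phi>[OF C.zero_closed])
    then have "?c p z = ?c p \<zero>\<^bsub>obj C p\<^esub>"
      using bij[of p] z zc z0 unfolding bij_betw_def inj_on_def by blast
    then obtain l where "l \<in> carrier (obj C (p - 1))" "z = dif C (p - 1) l \<oplus>\<^bsub>obj C p\<^esub> \<zero>\<^bsub>obj C p\<^esub>"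
      using hcoset_eq_iff[OF CD(2) CD(2) bimod_linear_additive[OF CD(4)] z C.zero_closed] by blast
    then show "\<exists>w\<in>carrier (obj C (p - 1)). z = dif C (p - 1) w"
      using bimod_linear_closed[OF CD(4)] by auto
  next
    fix p y assume y: "y \<in> carrier (obj D p)" and yc: "dif D p y = \<zero>\<^bsub>obj D (p + 1)\<^esub>"
    interpret D: abelian_group "obj D p" by (rule DD(2))
    have "?d p y \<in> ?\<phi> p ` (?c p ` {y \<in> carrier (obj C p). dif C p y = \<zero>\<^bsub>obj C (p + 1)\<^esub>})"
      using bij[of p] y yc unfolding bij_betw_def by blast
    then obtain z where z: "z \<in> carrier (obj C p)" "dif C p z = \<zero>\<^bsub>obj C (p + 1)\<^esub>" "?d p y = ?d p (f p z)"
      using \<phi> by auto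
    then obtain l where l: "l \<in> carrier (obj D (p - 1))" "y = dif D (p - 1) l \<oplus>\<^bsub>obj D p\<^esub> f p z"
      using hcoset_eq_iff[OF DD(2) DD(2) bimod_linear_additive[OF DD(4)] y
          bimod_linear_closed[OF fD(1) z(1)]] by blast
    then show "\<exists>z\<in>carrier (obj C p). dif C p z = \<zero>\<^bsub>obj C (p + 1)\<^esub> \<and>
          (\<exists>w\<in>carrier (obj D (p - 1)). y = f p z \<oplus>\<^bsub>obj D p\<^esub> dif D (p - 1) w)"
      using z bimod_linear_closed[OF DD(4) l(1)] bimod_linear_closed[OF fD(1) z(1)] D.a_comm by blast
  qed
qed

text \<open>Exactness is pulled back in two stages; for surjectivity, g carries the coboundary
  correction made in the middle complex to the last one, where the two corrections add up.\<close>

lemma quasi_iso_comp: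
  assumes C: "cochain_complex A C" and D: "cochain_complex A D" and B: "cochain_complex A B"
    and f: "quasi_iso A C D f" and g: "quasi_iso A D B g"
  shows "quasi_iso A C B (\<lambda>p x. g p (f p x))"
proof -
  note fm = quasi_isoD(1)[OF f] and gm = quasi_isoD(1)[OF g]
  note fD = cochain_mapD[OF fm] and gD = cochain_mapD[OF gm]
  note DD = cochain_complexD[OF D] and BD = cochain_complexD[OF B] and CD = cochain_complexD[OF C]
  show ?thesis
    unfolding quasi_iso_def
  proof (intro conjI allI ballI impI)
    show "cochain_map A C B (\<lambda>p x. g p (f p x))"
      unfolding cochain_map_def
      using bimod_linear_comp[OF fD(1) gD(1)] fD(2) gD(2) bimod_linear_closed[OF fD(1)] by simp
    fix p z y assume z: "z \<in> carrier (obj C p)" and y: "y \<in> carrier (obj B (p - 1))"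
      and zc: "dif C p z = \<zero>\<^bsub>obj C (p + 1)\<^esub>" and e: "g p (f p z) = dif B (p - 1) y"
    have "dif D p (f p z) = \<zero>\<^bsub>obj D (p + 1)\<^esub>"
      using fD(2)[OF z] zc additive_map_zero[OF CD(2) DD(2) bimod_linear_additive[OF fD(1)]] by simp
    from quasi_isoD(2)[OF g bimod_linear_closed[OF fD(1) z] y this e]
    obtain w where "w \<in> carrier (obj D (p - 1))" "f p z = dif D (p - 1) w" by blast
    from quasi_isoD(2)[OF f z this(1) zc this(2)]
    show "\<exists>w\<in>carrier (obj C (p - 1)). z = dif C (p - 1) w" .
  next
    fix p y assume y: "y \<in> carrier (obj B p)" "dif B p y = \<zero>\<^bsub>obj B (p + 1)\<^esub>"
    obtain z w where z: "z \<in> carrier (obj D p)" "dif D p z = \<zero>\<^bsub>obj D (p + 1)\<^esub>"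
      and w: "w \<in> carrier (obj B (p - 1))" "y = g p z \<oplus>\<^bsub>obj B p\<^esub> dif B (p - 1) w"
      using quasi_isoD(3)[OF g y] by blast
    obtain x v where x: "x \<in> carrier (obj C p)" "dif C p x = \<zero>\<^bsub>obj C (p + 1)\<^esub>"
      and v: "v \<in> carrier (obj D (p - 1))" "z = f p x \<oplus>\<^bsub>obj D p\<^esub> dif D (p - 1) v"
      using quasi_isoD(3)[OF f z] by blast
    interpret B: abelian_group "obj B p" by (rule BD(2))
    interpret B1: abelian_group "obj B (p - 1)" by (rule BD(2))
    have gv: "g (p - 1) v \<in> carrier (obj B (p - 1))" using gD(1) v(1) by (rule bimod_linear_closed)
    have "y = g p (f p x) \<oplus>\<^bsub>obj B p\<^esub> dif B (p - 1) (g (p - 1) v \<oplus>\<^bsub>obj B (p - 1)\<^esub> w)"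
      unfolding w(2) v(2)
      using x v w(1) gv bimod_linear_closed[OF fD(1) x(1)] bimod_linear_closed[OF DD(4) v(1)]
        bimod_linear_closed[OF gD(1)] bimod_linear_closed[OF BD(4)]
      by (simp add: bimod_linear_add[OF gD(1)] bimod_linear_add[OF BD(4)] gD(3) B.a_assoc)
    then show "\<exists>z\<in>carrier (obj C p). dif C p z = \<zero>\<^bsub>obj C (p + 1)\<^esub> \<and>
          (\<exists>w\<in>carrier (obj B (p - 1)). y = g p (f p z) \<oplus>\<^bsub>obj B p\<^esub> dif B (p - 1) w)"
      using x gv w(1) by blast
  qed
qed

text \<open>The acyclicity of the mapping cone of \<open>s\<close> in terms of elements: (z, y) is a
  cocycle of the cone and (z', y') bounds it, up to signs. Any primitive of z misses y by a cocycle
  of \<open>Y\<close>, and surjectivity on cohomology supplies the correction.\<close>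

lemma quasi_iso_lift_cocycle:
  assumes Z: "cochain_complex A Z" and Y: "cochain_complex A Y" and s: "quasi_iso A Z Y s"
    and z: "z \<in> carrier (obj Z (p + 1))" "dif Z (p + 1) z = \<zero>\<^bsub>obj Z (p + 2)\<^esub>"
    and y: "y \<in> carrier (obj Y p)" "s (p + 1) z = dif Y p y"
  shows "\<exists>z'\<in>carrier (obj Z p). \<exists>y'\<in>carrier (obj Y (p - 1)).
    dif Z p z' = z \<and> s p z' = y \<oplus>\<^bsub>obj Y p\<^esub> dif Y (p - 1) y'"
proof -
  note sD = cochain_mapD[OF quasi_isoD(1)[OF s]]
  note ZD = cochain_complexD[OF Z] and YD = cochain_complexD[OF Y]
  interpret Z: abelian_group "obj Z p" by (rule ZD(2))
  interpret Z1: abelian_group "obj Z (p + 1)" by (rule ZD(2))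
  interpret Y: abelian_group "obj Y p" by (rule YD(2))
  interpret Y1: abelian_group "obj Y (p + 1)" by (rule YD(2))
  have "\<exists>w\<in>carrier (obj Z p). z = dif Z p w"
    using quasi_isoD(2)[OF s, of z "p + 1" y] z y by (simp add: add.assoc)
  then obtain z0 where z0: "z0 \<in> carrier (obj Z p)" "dif Z p z0 = z" by blast
  \<comment> \<open>The error of the first choice; it is a cocycle because y and the image of z0
    have the same differential.\<close>
  define e where "e = y \<oplus>\<^bsub>obj Y p\<^esub> \<ominus>\<^bsub>obj Y p\<^esub> s p z0"
  have sz0: "s p z0 \<in> carrier (obj Y p)" using bimod_linear_closed[OF sD(1) z0(1)] .
  have e: "e \<in> carrier (obj Y p)" unfolding e_def using y(1) sz0 by simp
  have "dif Y p e = dif Y p y \<oplus>\<^bsub>obj Y (p + 1)\<^esub> \<ominus>\<^bsub>obj Y (p + 1)\<^esub> dif Y p (s p z0)"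
    unfolding e_def using y(1) sz0
    by (simp add: bimod_linear_add[OF YD(3)]
        additive_map_neg[OF YD(2) YD(2) bimod_linear_additive[OF YD(3)]])
  also have "dif Y p (s p z0) = dif Y p y"
    using sD(2)[OF z0(1)] z0(2) y(2) by simp
  finally have "dif Y p e = \<zero>\<^bsub>obj Y (p + 1)\<^esub>"
    using bimod_linear_closed[OF YD(3) y(1)] by (simp add: Y1.r_neg)
  from quasi_isoD(3)[OF s e this]
  obtain z1 w where z1: "z1 \<in> carrier (obj Z p)" "dif Z p z1 = \<zero>\<^bsub>obj Z (p + 1)\<^esub>"
    and w: "w \<in> carrier (obj Y (p - 1))" "e = s p z1 \<oplus>\<^bsub>obj Y p\<^esub> dif Y (p - 1) w" by blast
  interpret Y': abelian_group "obj Y (p - 1)" by (rule YD(2))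
  have sz1: "s p z1 \<in> carrier (obj Y p)" using bimod_linear_closed[OF sD(1) z1(1)] .
  have dw: "dif Y (p - 1) w \<in> carrier (obj Y p)" using bimod_linear_closed[OF YD(4) w(1)] .
  have dnw: "dif Y (p - 1) (\<ominus>\<^bsub>obj Y (p - 1)\<^esub> w) = \<ominus>\<^bsub>obj Y p\<^esub> dif Y (p - 1) w"
    by (rule additive_map_neg[OF YD(2) YD(2) bimod_linear_additive[OF YD(4)] w(1)])
  have "y = e \<oplus>\<^bsub>obj Y p\<^esub> s p z0"
    unfolding e_def using y(1) sz0 by (simp add: Y.a_assoc Y.l_neg)
  then have "s p (z0 \<oplus>\<^bsub>obj Z p\<^esub> z1) = y \<oplus>\<^bsub>obj Y p\<^esub> dif Y (p - 1) (\<ominus>\<^bsub>obj Y (p - 1)\<^esub> w)"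
    unfolding w(2) dnw using z0(1) z1(1) sz0 sz1 dw
    by (simp add: bimod_linear_add[OF sD(1)] Y.a_ac Y.r_neg)
  moreover have "dif Z p (z0 \<oplus>\<^bsub>obj Z p\<^esub> z1) = z"
    using z0 z1 z(1) by (simp add: bimod_linear_add[OF ZD(3)])
  ultimately show ?thesis
    using z0(1) z1(1) w(1) Z.a_closed Y'.a_inv_closed by blast
qed

text \<open>Extends the pair (u, k) by one degree downwards. The equations are solved at the
  generators x_i, with no control over how the solutions depend on x_i; \<open>dual_ext\<close>
  turns these choices into linear maps, and the equations persist because the prescribed parts of
  their right-hand sides are linear in v. This is where projectivity is used.\<close>

lemma quasi_iso_lift_step:
  assumes A: "kalgebra A" and V: "cochain_complex A V"
    and Z: "cochain_complex A Z" and Y: "cochain_complex A Y" and s: "quasi_iso A Z Y s"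
    and g: "cochain_map A V Y g" and d: "dual_basis A (obj V p) J x f"
    and u: "bimod_linear A (obj V (p + 1)) (obj Z (p + 1)) u"
    and k: "bimod_linear A (obj V (p + 1)) (obj Y p) k"
    and uk: "\<And>v. v \<in> carrier (obj V (p + 1)) \<Longrightarrow> dif V (p + 1) v = \<zero>\<^bsub>obj V (p + 2)\<^esub> \<Longrightarrow>
      dif Z (p + 1) (u v) = \<zero>\<^bsub>obj Z (p + 2)\<^esub> \<and> s (p + 1) (u v) = g (p + 1) v \<oplus>\<^bsub>obj Y (p + 1)\<^esub> dif Y p (k v)"
  shows "\<exists>u' k'. bimod_linear A (obj V p) (obj Z p) u' \<and> bimod_linear A (obj V p) (obj Y (p - 1)) k' \<and>
    (\<forall>v\<in>carrier (obj V p). dif Z p (u' v) = u (dif V p v) \<and>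
      s p (u' v) = g p v \<oplus>\<^bsub>obj Y p\<^esub> dif Y (p - 1) (k' v) \<oplus>\<^bsub>obj Y p\<^esub> k (dif V p v))"
proof -
  interpret kalgebra A by fact
  note sD = cochain_mapD[OF quasi_isoD(1)[OF s]] and gD = cochain_mapD[OF g]
  note ZD = cochain_complexD[OF Z] and YD = cochain_complexD[OF Y] and XD = cochain_complexD[OF V]
  interpret Y: abelian_group "obj Y p" by (rule YD(2))
  have x: "x i \<in> carrier (obj V p)" and f: "f i \<in> bimod_hom A (obj V p) E" if "i \<in> J" for i
    using d that unfolding dual_basis_def by auto
  have dk: "bimod_linear A (obj V p) (obj Y p) (\<lambda>v. k (dif V p v))"
    by (rule bimod_linear_comp[OF XD(3) k])
  have du: "bimod_linear A (obj V p) (obj Z (p + 1)) (\<lambda>v. u (dif V p v))"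
    by (rule bimod_linear_comp[OF XD(3) u])
  have gk: "bimod_linear A (obj V p) (obj Y p) (\<lambda>v. g p v \<oplus>\<^bsub>obj Y p\<^esub> k (dif V p v))"
    by (rule bimod_linear_sum[OF YD(1) gD(1) dk])
  have "\<exists>z'\<in>carrier (obj Z p). \<exists>y'\<in>carrier (obj Y (p - 1)). dif Z p z' = u (dif V p v) \<and>
      s p z' = (g p v \<oplus>\<^bsub>obj Y p\<^esub> k (dif V p v)) \<oplus>\<^bsub>obj Y p\<^esub> dif Y (p - 1) y'"
    if v: "v \<in> carrier (obj V p)" for v
  proof -
    have dv: "dif V p v \<in> carrier (obj V (p + 1))" by (rule bimod_linear_closed[OF XD(3) v])
    note uk' = uk[OF dv XD(5)[OF v]]
    show ?thesis
    proof (rule quasi_iso_lift_cocycle[OF Z Y s])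
      show "u (dif V p v) \<in> carrier (obj Z (p + 1))" by (rule bimod_linear_closed[OF u dv])
      show "dif Z (p + 1) (u (dif V p v)) = \<zero>\<^bsub>obj Z (p + 2)\<^esub>" using uk' ..
      show "g p v \<oplus>\<^bsub>obj Y p\<^esub> k (dif V p v) \<in> carrier (obj Y p)"
        by (rule bimod_linear_closed[OF gk v])
      show "s (p + 1) (u (dif V p v)) = dif Y p (g p v \<oplus>\<^bsub>obj Y p\<^esub> k (dif V p v))"
        using uk' gD(2)[OF v] bimod_linear_closed[OF gD(1) v] bimod_linear_closed[OF dk v]
        by (simp add: bimod_linear_add[OF YD(3)])
    qed
  qed
  then have "\<forall>i\<in>J. \<exists>z' y'. z' \<in> carrier (obj Z p) \<and> y' \<in> carrier (obj Y (p - 1)) \<and>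
      dif Z p z' = u (dif V p (x i)) \<and>
      s p z' = (g p (x i) \<oplus>\<^bsub>obj Y p\<^esub> k (dif V p (x i))) \<oplus>\<^bsub>obj Y p\<^esub> dif Y (p - 1) y'"
    using x by blast
  then obtain zz yy where zz: "\<And>i. i \<in> J \<Longrightarrow> zz i \<in> carrier (obj Z p)"
    and yy: "\<And>i. i \<in> J \<Longrightarrow> yy i \<in> carrier (obj Y (p - 1))"
    and dzz: "\<And>i. i \<in> J \<Longrightarrow> dif Z p (zz i) = u (dif V p (x i))"
    and szz: "\<And>i. i \<in> J \<Longrightarrow> s p (zz i) =
      (g p (x i) \<oplus>\<^bsub>obj Y p\<^esub> k (dif V p (x i))) \<oplus>\<^bsub>obj Y p\<^esub> dif Y (p - 1) (yy i)"
    by metis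
  define u' where "u' = dual_ext A (obj Z p) J f zz"
  define k' where "k' = dual_ext A (obj Y (p - 1)) J f yy"
  have u': "bimod_linear A (obj V p) (obj Z p) u'"
    unfolding u'_def by (rule dual_ext_linear[OF ZD(1) f zz])
  have k': "bimod_linear A (obj V p) (obj Y (p - 1)) k'"
    unfolding k'_def by (rule dual_ext_linear[OF YD(1) f yy])
  have "dif Z p (u' v) = u (dif V p v)" if v: "v \<in> carrier (obj V p)" for v
  proof -
    have "dif Z p (u' v) = dual_ext A (obj Z (p + 1)) J f (\<lambda>i. dif Z p (zz i)) v"
      unfolding u'_def by (rule dual_ext_comp[OF ZD(1) ZD(1) ZD(3) f zz v])
    also have "\<dots> = dual_ext A (obj Z (p + 1)) J f (\<lambda>i. u (dif V p (x i))) v"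
      by (rule dual_ext_cong[OF ZD(1) f dzz bimod_linear_closed[OF du x] v])
    also have "\<dots> = u (dif V p v)"
      by (rule dual_basis_expand[OF XD(1) ZD(1) d du v])
    finally show ?thesis .
  qed
  moreover have "s p (u' v) = g p v \<oplus>\<^bsub>obj Y p\<^esub> dif Y (p - 1) (k' v) \<oplus>\<^bsub>obj Y p\<^esub> k (dif V p v)"
    if v: "v \<in> carrier (obj V p)" for v
  proof -
    let ?w = "\<lambda>v. g p v \<oplus>\<^bsub>obj Y p\<^esub> k (dif V p v)"
    have dyy: "dif Y (p - 1) (yy i) \<in> carrier (obj Y p)" if "i \<in> J" for i
      by (rule bimod_linear_closed[OF YD(4) yy[OF that]])
    have wx: "?w (x i) \<in> carrier (obj Y p)" if "i \<in> J" for i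
      by (rule bimod_linear_closed[OF gk x[OF that]])
    have "s p (u' v) = dual_ext A (obj Y p) J f (\<lambda>i. s p (zz i)) v"
      unfolding u'_def by (rule dual_ext_comp[OF ZD(1) YD(1) sD(1) f zz v])
    also have "\<dots> = dual_ext A (obj Y p) J f (\<lambda>i. ?w (x i) \<oplus>\<^bsub>obj Y p\<^esub> dif Y (p - 1) (yy i)) v"
      by (rule dual_ext_cong[OF YD(1) f szz _ v]) (simp_all add: wx dyy)
    also have "\<dots> = dual_ext A (obj Y p) J f (\<lambda>i. ?w (x i)) v \<oplus>\<^bsub>obj Y p\<^esub>
        dual_ext A (obj Y p) J f (\<lambda>i. dif Y (p - 1) (yy i)) v"
      by (rule dual_ext_add[OF YD(1) f wx dyy v])
    also have "dual_ext A (obj Y p) J f (\<lambda>i. ?w (x i)) v = ?w v"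
      by (rule dual_basis_expand[OF XD(1) YD(1) d gk v])
    also have "dual_ext A (obj Y p) J f (\<lambda>i. dif Y (p - 1) (yy i)) v = dif Y (p - 1) (k' v)"
      unfolding k'_def by (rule dual_ext_comp[OF YD(1) YD(1) YD(4) f yy v, symmetric])
    finally show ?thesis
      using bimod_linear_closed[OF gD(1) v] bimod_linear_closed[OF dk v]
        bimod_linear_closed[OF YD(4) bimod_linear_closed[OF k' v]]
      by (simp add: Y.a_ac)
  qed
  ultimately show ?thesis using u' k' by blast
qed

text \<open>Descending induction on the degree: a complex of projectives that vanishes in high
  degrees lifts through quasi-isomorphisms. An actual map, together with a homotopy, thus takes the
  place of the formal inverse of \<open>s\<close> in the derived category.\<close>

theorem quasi_iso_lift:
  assumes A: "kalgebra A" and V: "cochain_complex A V"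
    and Z: "cochain_complex A Z" and Y: "cochain_complex A Y" and s: "quasi_iso A Z Y s"
    and g: "cochain_map A V Y g"
    and d: "\<And>p. \<exists>(J :: 'i set) x f. dual_basis A (obj V p) J x f"
    and b: "\<And>p. b < p \<Longrightarrow> carrier (obj V p) = {\<zero>\<^bsub>obj V p\<^esub>}"
  shows "\<exists>u k. cochain_map A V Z u \<and> homotopic A V Y (\<lambda>p x. s p (u p x)) g k"
proof -
  note sD = cochain_mapD[OF quasi_isoD(1)[OF s]] and gD = cochain_mapD[OF g]
  note ZD = cochain_complexD[OF Z] and YD = cochain_complexD[OF Y] and XD = cochain_complexD[OF V]
  \<comment> \<open>Degrees are counted downwards from b + 1, where the source is already zero, so
    that zero maps start the induction.\<close>
  define q where "q n = b + 1 - int n" for n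
  have q: "q (Suc n) + 1 = q n" "q n - 1 = q (Suc n)" "q (Suc n) + 2 = q n + 1" for n
    by (simp_all add: q_def)
  \<comment> \<open>The invariant concerns cocycles only, since the next step applies it to
    differentials. For a cocycle v the term k(dv) of the homotopy equation is zero, so the invariant
    mentions a single degree of k.\<close>
  define P where "P n uk \<longleftrightarrow> bimod_linear A (obj V (q n)) (obj Z (q n)) (fst uk) \<and>
      bimod_linear A (obj V (q n)) (obj Y (q n - 1)) (snd uk) \<and>
      (\<forall>v\<in>carrier (obj V (q n)). dif V (q n) v = \<zero>\<^bsub>obj V (q n + 1)\<^esub> \<longrightarrow>
        dif Z (q n) (fst uk v) = \<zero>\<^bsub>obj Z (q n + 1)\<^esub> \<and>
        s (q n) (fst uk v) = g (q n) v \<oplus>\<^bsub>obj Y (q n)\<^esub> dif Y (q n - 1) (snd uk v))" for n uk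
  define Q where "Q n uk uk' \<longleftrightarrow> (\<forall>v\<in>carrier (obj V (q n - 1)).
      dif Z (q n - 1) (fst uk' v) = fst uk (dif V (q n - 1) v) \<and>
      s (q n - 1) (fst uk' v) = g (q n - 1) v \<oplus>\<^bsub>obj Y (q n - 1)\<^esub> dif Y (q n - 1 - 1) (snd uk' v)
        \<oplus>\<^bsub>obj Y (q n - 1)\<^esub> snd uk (dif V (q n - 1) v))" for n uk uk'
  have "P 0 (\<lambda>x. \<zero>\<^bsub>obj Z (q 0)\<^esub>, \<lambda>x. \<zero>\<^bsub>obj Y (q 0 - 1)\<^esub>)"
  proof -
    interpret Y: abelian_group "obj Y (q 0)" by (rule YD(2))
    have 0: "carrier (obj V (q 0)) = {\<zero>\<^bsub>obj V (q 0)\<^esub>}" by (rule b) (simp add: q_def)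
    have "dif Y (q 0 - 1) \<zero>\<^bsub>obj Y (q 0 - 1)\<^esub> = \<zero>\<^bsub>obj Y (q 0)\<^esub>"
      by (rule additive_map_zero[OF YD(2) YD(2) bimod_linear_additive[OF YD(4)]])
    moreover have "g (q 0) \<zero>\<^bsub>obj V (q 0)\<^esub> = \<zero>\<^bsub>obj Y (q 0)\<^esub>"
      by (rule additive_map_zero[OF XD(2) YD(2) bimod_linear_additive[OF gD(1)]])
    moreover have "s (q 0) \<zero>\<^bsub>obj Z (q 0)\<^esub> = \<zero>\<^bsub>obj Y (q 0)\<^esub>"
      by (rule additive_map_zero[OF ZD(2) YD(2) bimod_linear_additive[OF sD(1)]])
    moreover have "dif Z (q 0) \<zero>\<^bsub>obj Z (q 0)\<^esub> = \<zero>\<^bsub>obj Z (q 0 + 1)\<^esub>"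
      by (rule additive_map_zero[OF ZD(2) ZD(2) bimod_linear_additive[OF ZD(3)]])
    ultimately show ?thesis
      unfolding P_def by (simp add: 0 bimod_linear_zero[OF ZD(1)] bimod_linear_zero[OF YD(1)])
  qed
  moreover have "\<exists>uk'. P (Suc n) uk' \<and> Q n uk uk'" if P: "P n uk" for n uk
  proof -
    let ?p = "q (Suc n)"
    obtain J :: "'i set" and x f where d': "dual_basis A (obj V ?p) J x f" using d by blast
    have "\<exists>u' k'. bimod_linear A (obj V ?p) (obj Z ?p) u' \<and> bimod_linear A (obj V ?p) (obj Y (?p - 1)) k' \<and>
      (\<forall>v\<in>carrier (obj V ?p). dif Z ?p (u' v) = fst uk (dif V ?p v) \<and>
        s ?p (u' v) = g ?p v \<oplus>\<^bsub>obj Y ?p\<^esub> dif Y (?p - 1) (k' v) \<oplus>\<^bsub>obj Y ?p\<^esub> snd uk (dif V ?p v))"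
      by (rule quasi_iso_lift_step[OF A V Z Y s g d'])
        (use P in \<open>auto simp: P_def q\<close>)
    then obtain u' k' where u': "bimod_linear A (obj V ?p) (obj Z ?p) u'"
      and k': "bimod_linear A (obj V ?p) (obj Y (?p - 1)) k'"
      and e: "\<And>v. v \<in> carrier (obj V ?p) \<Longrightarrow> dif Z ?p (u' v) = fst uk (dif V ?p v)"
        "\<And>v. v \<in> carrier (obj V ?p) \<Longrightarrow>
          s ?p (u' v) = g ?p v \<oplus>\<^bsub>obj Y ?p\<^esub> dif Y (?p - 1) (k' v) \<oplus>\<^bsub>obj Y ?p\<^esub> snd uk (dif V ?p v)"
      by blast
    interpret Y: abelian_group "obj Y ?p" by (rule YD(2))
    have ul: "bimod_linear A (obj V (?p + 1)) (obj Z (?p + 1)) (fst uk)"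
      and kl: "bimod_linear A (obj V (?p + 1)) (obj Y ?p) (snd uk)"
      using P by (simp_all add: P_def q)
    have "fst uk \<zero>\<^bsub>obj V (?p + 1)\<^esub> = \<zero>\<^bsub>obj Z (?p + 1)\<^esub>"
      by (rule additive_map_zero[OF XD(2) ZD(2) bimod_linear_additive[OF ul]])
    moreover have "snd uk \<zero>\<^bsub>obj V (?p + 1)\<^esub> = \<zero>\<^bsub>obj Y ?p\<^esub>"
      by (rule additive_map_zero[OF XD(2) YD(2) bimod_linear_additive[OF kl]])
    ultimately have "P (Suc n) (u', k')"
      unfolding P_def using u' k' e bimod_linear_closed[OF gD(1)]
        bimod_linear_closed[OF YD(4) bimod_linear_closed[OF k']]
      by simp
    moreover have "Q n uk (u', k')"
      using e unfolding Q_def q by simp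
    ultimately show ?thesis by blast
  qed
  \<comment> \<open>The lift in one degree must fit the one chosen a degree higher, which
    \<open>Q\<close> records; the choices are therefore made dependently.\<close>
  ultimately obtain F where F: "\<And>n. P n (F n)" "\<And>n. Q n (F n) (F (Suc n))"
    using dependent_nat_choice[of P Q] by blast
  define u where "u p = (if p \<le> b + 1 then fst (F (nat (b + 1 - p))) else (\<lambda>x. \<zero>\<^bsub>obj Z p\<^esub>))" for p
  define k where "k p = (if p \<le> b + 1 then snd (F (nat (b + 1 - p))) else (\<lambda>x. \<zero>\<^bsub>obj Y (p - 1)\<^esub>))" for p
  have qn: "q (nat (b + 1 - p)) = p" if "p \<le> b + 1" for p
    using that by (simp add: q_def)
  have u: "bimod_linear A (obj V p) (obj Z p) (u p)" for p
    using F(1)[of "nat (b + 1 - p)"] bimod_linear_zero[OF ZD(1)]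
    by (cases "p \<le> b + 1") (simp_all add: u_def P_def qn)
  have k: "bimod_linear A (obj V p) (obj Y (p - 1)) (k p)" for p
    using F(1)[of "nat (b + 1 - p)"] bimod_linear_zero[OF YD(1)]
    by (cases "p \<le> b + 1") (simp_all add: k_def P_def qn)
  have main: "u (p + 1) (dif V p x) = dif Z p (u p x) \<and>
      s p (u p x) = g p x \<oplus>\<^bsub>obj Y p\<^esub> dif Y (p - 1) (k p x) \<oplus>\<^bsub>obj Y p\<^esub> k (p + 1) (dif V p x)"
    if x: "x \<in> carrier (obj V p)" for p x
  proof (cases "p \<le> b")
    case True
    let ?n = "nat (b - p)"
    have n: "nat (b + 1 - p) = Suc ?n" "nat (b + 1 - (p + 1)) = ?n" using True by simp_all
    have "q ?n = p + 1" using True by (simp add: q_def)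
    then show ?thesis
      using F(2)[of ?n] x True unfolding Q_def u_def k_def n by simp
  next
    case False
    then have x0: "x = \<zero>\<^bsub>obj V p\<^esub>" using b[of p] x by simp
    interpret Y: abelian_group "obj Y p" by (rule YD(2))
    interpret Y': abelian_group "obj Y (p - 1)" by (rule YD(2))
    have z: "dif V p \<zero>\<^bsub>obj V p\<^esub> = \<zero>\<^bsub>obj V (p + 1)\<^esub>" "u p \<zero>\<^bsub>obj V p\<^esub> = \<zero>\<^bsub>obj Z p\<^esub>"
      "u (p + 1) \<zero>\<^bsub>obj V (p + 1)\<^esub> = \<zero>\<^bsub>obj Z (p + 1)\<^esub>" "dif Z p \<zero>\<^bsub>obj Z p\<^esub> = \<zero>\<^bsub>obj Z (p + 1)\<^esub>"
      "s p \<zero>\<^bsub>obj Z p\<^esub> = \<zero>\<^bsub>obj Y p\<^esub>" "g p \<zero>\<^bsub>obj V p\<^esub> = \<zero>\<^bsub>obj Y p\<^esub>"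
      "k p \<zero>\<^bsub>obj V p\<^esub> = \<zero>\<^bsub>obj Y (p - 1)\<^esub>" "dif Y (p - 1) \<zero>\<^bsub>obj Y (p - 1)\<^esub> = \<zero>\<^bsub>obj Y p\<^esub>"
      "k (p + 1) \<zero>\<^bsub>obj V (p + 1)\<^esub> = \<zero>\<^bsub>obj Y (p + 1 - 1)\<^esub>"
      by (rule additive_map_zero[OF _ _ bimod_linear_additive], rule XD ZD YD, rule XD ZD YD,
          rule XD(3) ZD(3) u k sD(1) gD(1) YD(4))+
    show ?thesis unfolding x0 using z by simp
  qed
  have "cochain_map A V Z u"
    unfolding cochain_map_def using u main by blast
  moreover have "homotopic A V Y (\<lambda>p x. s p (u p x)) g k"
    unfolding homotopic_def using k main by blast
  ultimately show ?thesis by blast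
qed

text \<open>As \<open>s\<close> after \<open>u\<close> is homotopic to the identity,
  \<open>u\<close> induces on cohomology the inverse of the bijection induced by \<open>s\<close>.
  The result is a quasi-isomorphism to which the lifting theorem can be applied again.\<close>

lemma quasi_iso_of_homotopy_inverse:
  assumes V: "cochain_complex A V" and Z: "cochain_complex A Z"
    and s: "quasi_iso A Z V s" and u: "cochain_map A V Z u"
    and h: "homotopic A V V (\<lambda>p x. s p (u p x)) (\<lambda>p x. x) k"
  shows "quasi_iso A V Z u"
proof -
  note sD = cochain_mapD[OF quasi_isoD(1)[OF s]] and uD = cochain_mapD[OF u]
  note ZD = cochain_complexD[OF Z] and XD = cochain_complexD[OF V]
  have k: "bimod_linear A (obj V p) (obj V (p - 1)) (k p)" for p
    using h unfolding homotopic_def by blast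
  have k0: "k (p + 1) \<zero>\<^bsub>obj V (p + 1)\<^esub> = \<zero>\<^bsub>obj V p\<^esub>" for p
    using additive_map_zero[OF XD(2) XD(2) bimod_linear_additive[OF k[of "p + 1"]]] by simp
  have hz: "s p (u p x) = x \<oplus>\<^bsub>obj V p\<^esub> dif V (p - 1) (k p x)"
    if x: "x \<in> carrier (obj V p)" and c: "dif V p x = \<zero>\<^bsub>obj V (p + 1)\<^esub>" for p x
  proof -
    interpret V: abelian_group "obj V p" by (rule XD(2))
    have "s p (u p x) = x \<oplus>\<^bsub>obj V p\<^esub> dif V (p - 1) (k p x) \<oplus>\<^bsub>obj V p\<^esub> k (p + 1) (dif V p x)"
      using h x unfolding homotopic_def by blast
    then show ?thesis
      using x bimod_linear_closed[OF XD(4) bimod_linear_closed[OF k x]] by (simp add: c k0)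
  qed
  show ?thesis
    unfolding quasi_iso_def
  proof (intro conjI u allI ballI impI)
    fix p x w assume x: "x \<in> carrier (obj V p)" and w: "w \<in> carrier (obj Z (p - 1))"
      and c: "dif V p x = \<zero>\<^bsub>obj V (p + 1)\<^esub>" and e: "u p x = dif Z (p - 1) w"
    interpret V: abelian_group "obj V p" by (rule XD(2))
    interpret V': abelian_group "obj V (p - 1)" by (rule XD(2))
    have kx: "k p x \<in> carrier (obj V (p - 1))" by (rule bimod_linear_closed[OF k x])
    have sw: "s (p - 1) w \<in> carrier (obj V (p - 1))" by (rule bimod_linear_closed[OF sD(1) w])
    have "dif V (p - 1) (s (p - 1) w) = x \<oplus>\<^bsub>obj V p\<^esub> dif V (p - 1) (k p x)"
      using hz[OF x c] sD(3)[OF w] e by simp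
    then have "x = dif V (p - 1) (s (p - 1) w \<oplus>\<^bsub>obj V (p - 1)\<^esub> \<ominus>\<^bsub>obj V (p - 1)\<^esub> k p x)"
      using kx sw x bimod_linear_closed[OF XD(4) kx]
      by (simp add: bimod_linear_add[OF XD(4)] V.a_assoc V.r_neg
          additive_map_neg[OF XD(2) XD(2) bimod_linear_additive[OF XD(4)]])
    then show "\<exists>w\<in>carrier (obj V (p - 1)). x = dif V (p - 1) w"
      using kx sw V'.a_closed V'.a_inv_closed by blast
  next
    fix p z assume z: "z \<in> carrier (obj Z p)" and c: "dif Z p z = \<zero>\<^bsub>obj Z (p + 1)\<^esub>"
    interpret V: abelian_group "obj V p" by (rule XD(2))
    interpret V': abelian_group "obj V (p - 1)" by (rule XD(2))
    interpret Z: abelian_group "obj Z p" by (rule ZD(2))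
    interpret Z1: abelian_group "obj Z (p + 1)" by (rule ZD(2))
    have sz: "s p z \<in> carrier (obj V p)" by (rule bimod_linear_closed[OF sD(1) z])
    have szc: "dif V p (s p z) = \<zero>\<^bsub>obj V (p + 1)\<^esub>"
      using sD(2)[OF z] c additive_map_zero[OF ZD(2) XD(2) bimod_linear_additive[OF sD(1)]] by simp
    let ?x = "s p z"
    have kx: "k p ?x \<in> carrier (obj V (p - 1))" by (rule bimod_linear_closed[OF k sz])
    have us: "u p ?x \<in> carrier (obj Z p)" by (rule bimod_linear_closed[OF uD(1) sz])
    have usc: "dif Z p (u p ?x) = \<zero>\<^bsub>obj Z (p + 1)\<^esub>"
      using uD(2)[OF sz] szc additive_map_zero[OF XD(2) ZD(2) bimod_linear_additive[OF uD(1)]] by simp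
    \<comment> \<open>This cocycle is sent by \<open>s\<close> to a coboundary, because s u s z and
      s z differ by one; injectivity of \<open>s\<close> on cohomology then makes it exact.\<close>
    let ?e = "z \<oplus>\<^bsub>obj Z p\<^esub> \<ominus>\<^bsub>obj Z p\<^esub> u p ?x"
    note neg = additive_map_neg[OF ZD(2) ZD(2) bimod_linear_additive[OF ZD(3)]]
      additive_map_neg[OF ZD(2) XD(2) bimod_linear_additive[OF sD(1)]]
      additive_map_neg[OF XD(2) XD(2) bimod_linear_additive[OF XD(4)]]
    have "dif Z p ?e = \<zero>\<^bsub>obj Z (p + 1)\<^esub>"
      using z us c usc Z1.minus_equality[of "\<zero>\<^bsub>obj Z (p + 1)\<^esub>" "\<zero>\<^bsub>obj Z (p + 1)\<^esub>"]
      by (simp add: bimod_linear_add[OF ZD(3)] neg)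
    moreover have "s p ?e = dif V (p - 1) (\<ominus>\<^bsub>obj V (p - 1)\<^esub> k p ?x)"
      using z us sz kx bimod_linear_closed[OF XD(4) kx] hz[OF sz szc]
      by (simp add: bimod_linear_add[OF sD(1)] neg V.minus_add V.a_assoc[symmetric] V.r_neg)
    moreover have "?e \<in> carrier (obj Z p)" "\<ominus>\<^bsub>obj V (p - 1)\<^esub> k p ?x \<in> carrier (obj V (p - 1))"
      using z us kx by simp_all
    ultimately obtain w where w: "w \<in> carrier (obj Z (p - 1))" "?e = dif Z (p - 1) w"
      using quasi_isoD(2)[OF s] by blast
    have "u p ?x \<oplus>\<^bsub>obj Z p\<^esub> dif Z (p - 1) w = z"
      unfolding w(2)[symmetric] using z us by (simp add: Z.a_lcomm Z.r_neg)
    then show "\<exists>x\<in>carrier (obj V p). dif V p x = \<zero>\<^bsub>obj V (p + 1)\<^esub> \<and>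
        (\<exists>w\<in>carrier (obj Z (p - 1)). z = u p x \<oplus>\<^bsub>obj Z p\<^esub> dif Z (p - 1) w)"
      using sz szc w(1) by metis
  qed
qed

lemma cochain_map_id: "cochain_map A V V (\<lambda>p x. x)"
  unfolding cochain_map_def by (simp add: bimod_linear_id)

subsection \<open>Duality for complexes of projective bimodules\<close>

context kalgebra
begin

text \<open>The homotopy equation consists of sums and composites, which the tensor functor
  respects.\<close>

lemma tensor_homotopy:
  assumes M: "algebra_bimodule A M" and C: "cochain_complex A C" and D: "cochain_complex A D"
    and f: "cochain_map A C D f" and g: "cochain_map A C D g" and h: "homotopic A C D f g k"
    and t: "t \<in> carrier (env_tensor_space A M (obj C p))"
  shows "env_tensor_map A M (obj C p) (obj D p) (f p) t =
    env_tensor_map A M (obj C p) (obj D p) (g p) t \<oplus>\<^bsub>env_tensor_space A M (obj D p)\<^esub>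
    env_tensor_map A M (obj D (p - 1)) (obj D p) (dif D (p - 1))
      (env_tensor_map A M (obj C p) (obj D (p - 1)) (k p) t) \<oplus>\<^bsub>env_tensor_space A M (obj D p)\<^esub>
    env_tensor_map A M (obj C (p + 1)) (obj D p) (k (p + 1))
      (env_tensor_map A M (obj C p) (obj C (p + 1)) (dif C p) t)"
proof -
  note CD = cochain_complexD[OF C] and DD = cochain_complexD[OF D]
    and fD = cochain_mapD[OF f] and gD = cochain_mapD[OF g]
  have k: "bimod_linear A (obj C p) (obj D (p - 1)) (k p)" for p
    using h unfolding homotopic_def by blast
  have k': "bimod_linear A (obj C (p + 1)) (obj D p) (k (p + 1))"
    using k[of "p + 1"] by simp
  note dk = bimod_linear_comp[OF k DD(4)] and kd = bimod_linear_comp[OF CD(3) k']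
  note gdk = bimod_linear_sum[OF DD(1) gD(1) dk]
  have "env_tensor_map A M (obj C p) (obj D p) (f p) t = env_tensor_map A M (obj C p) (obj D p)
      (\<lambda>x. (g p x \<oplus>\<^bsub>obj D p\<^esub> dif D (p - 1) (k p x)) \<oplus>\<^bsub>obj D p\<^esub> k (p + 1) (dif C p x)) t"
    using h unfolding homotopic_def
    by (intro env_tensor_map_cong[OF M CD(1) DD(1) fD(1) _ t]) blast
  then show ?thesis
    by (simp add: env_tensor_map_sum[OF M CD(1) DD(1) gdk kd t] env_tensor_map_sum[OF M CD(1) DD(1) gD(1) dk t]
        env_tensor_map_comp[OF M CD(1) DD(1) DD(1) k DD(4) t]
        env_tensor_map_comp[OF M CD(1) CD(1) DD(1) CD(3) k' t])
qed

lemma tensor_chain: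
  assumes M: "algebra_bimodule A M" and C: "cochain_complex A C" and D: "cochain_complex A D"
    and f: "cochain_map A C D f" and t: "t \<in> carrier (env_tensor_space A M (obj C p))"
  shows "env_tensor_map A M (obj C (p + 1)) (obj D (p + 1)) (f (p + 1))
      (env_tensor_map A M (obj C p) (obj C (p + 1)) (dif C p) t) =
    env_tensor_map A M (obj D p) (obj D (p + 1)) (dif D p) (env_tensor_map A M (obj C p) (obj D p) (f p) t)"
proof -
  note CD = cochain_complexD[OF C] and DD = cochain_complexD[OF D] and fD = cochain_mapD[OF f]
  show ?thesis
    unfolding env_tensor_map_comp[OF M CD(1) CD(1) DD(1) CD(3) fD(1) t]
      env_tensor_map_comp[OF M CD(1) DD(1) DD(1) fD(1) DD(3) t]
    by (rule env_tensor_map_cong[OF M CD(1) DD(1) bimod_linear_comp[OF CD(3) fD(1)] fD(2) t])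
qed

text \<open>A left homotopy inverse suffices for injectivity: for a cycle t one has t = g f t - d k
  t, and g turns a primitive of f t into one of g f t.\<close>

lemma tensor_quasi_inj:
  assumes M: "algebra_bimodule A M" and C: "cochain_complex A C" and D: "cochain_complex A D"
    and f: "cochain_map A C D f" and g: "cochain_map A D C g"
    and h: "homotopic A C C (\<lambda>p x. g p (f p x)) (\<lambda>p x. x) k"
    and t: "t \<in> carrier (env_tensor_space A M (obj C p))"
      "env_tensor_map A M (obj C p) (obj C (p + 1)) (dif C p) t = \<zero>\<^bsub>env_tensor_space A M (obj C (p + 1))\<^esub>"
    and w: "w \<in> carrier (env_tensor_space A M (obj D (p - 1)))"
      "env_tensor_map A M (obj C p) (obj D p) (f p) t =
        env_tensor_map A M (obj D (p - 1)) (obj D p) (dif D (p - 1)) w"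
  shows "\<exists>v\<in>carrier (env_tensor_space A M (obj C (p - 1))).
    t = env_tensor_map A M (obj C (p - 1)) (obj C p) (dif C (p - 1)) v"
proof -
  note CD = cochain_complexD[OF C] and DD = cochain_complexD[OF D] and fD = cochain_mapD[OF f]
    and gD = cochain_mapD[OF g]
  have gf: "cochain_map A C C (\<lambda>p x. g p (f p x))"
    unfolding cochain_map_def
    using bimod_linear_comp[OF fD(1) gD(1)] fD(2) gD(2) bimod_linear_closed[OF fD(1)] by simp
  have k: "bimod_linear A (obj C p) (obj C (p - 1)) (k p)" for p
    using h unfolding homotopic_def by blast
  have k': "bimod_linear A (obj C (p + 1)) (obj C p) (k (p + 1))"
    using k[of "p + 1"] by simp
  interpret c: env_tensor_context A M "obj C p"
    by (intro env_tensor_context.intro kalgebra_axioms M CD(1))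
  interpret c1: env_tensor_context A M "obj C (p - 1)"
    by (intro env_tensor_context.intro kalgebra_axioms M CD(1))
  interpret c2: env_tensor_context A M "obj C (p + 1)"
    by (intro env_tensor_context.intro kalgebra_axioms M CD(1))
  let ?d = "env_tensor_map A M (obj C (p - 1)) (obj C p) (dif C (p - 1))"
  let ?g = "env_tensor_map A M (obj D (p - 1)) (obj C (p - 1)) (g (p - 1)) w"
  let ?k = "env_tensor_map A M (obj C p) (obj C (p - 1)) (k p) t"
  note da = env_tensor_map_additive[OF M CD(1) CD(1) CD(4)]
  have gw: "?g \<in> carrier c1.TS"
    by (rule additive_map_closed[OF env_tensor_map_additive[OF M DD(1) CD(1) gD(1)] w(1)])
  have kt: "?k \<in> carrier c1.TS"
    by (rule additive_map_closed[OF env_tensor_map_additive[OF M CD(1) CD(1) k] t(1)])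
  have k0: "env_tensor_map A M (obj C (p + 1)) (obj C p) (k (p + 1)) \<zero>\<^bsub>c2.TS\<^esub> = \<zero>\<^bsub>c.TS\<^esub>"
    by (rule additive_map_zero[OF c2.TS.abelian_group_axioms c.TS.abelian_group_axioms
          env_tensor_map_additive[OF M CD(1) CD(1) k']])
  have "?d ?g = env_tensor_map A M (obj D p) (obj C p) (g p)
      (env_tensor_map A M (obj D (p - 1)) (obj D p) (dif D (p - 1)) w)"
    using tensor_chain[OF M D C g w(1)] by simp
  also have "\<dots> = env_tensor_map A M (obj C p) (obj C p) (\<lambda>x. g p (f p x)) t"
    unfolding w(2)[symmetric] by (rule env_tensor_map_comp[OF M CD(1) DD(1) CD(1) fD(1) gD(1) t(1)])
  also have "\<dots> = t \<oplus>\<^bsub>c.TS\<^esub> ?d ?k"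
    unfolding tensor_homotopy[OF M C C gf cochain_map_id h t(1)]
    using t additive_map_closed[OF da kt] by (simp add: env_tensor_map_id[OF M CD(1)] k0)
  finally have "t = ?d (?g \<oplus>\<^bsub>c1.TS\<^esub> \<ominus>\<^bsub>c1.TS\<^esub> ?k)"
    using gw kt t(1) additive_map_closed[OF da kt]
    by (simp add: additive_map_add[OF da]
        additive_map_neg[OF c1.TS.abelian_group_axioms c.TS.abelian_group_axioms da] c.TS.a_assoc c.TS.r_neg)
  then show ?thesis using gw kt c1.TS.a_closed c1.TS.a_inv_closed by blast
qed

text \<open>A right homotopy inverse suffices for surjectivity: a cycle t equals f(g t) up to the
  boundary of -k t. Injectivity and surjectivity may thus use different inverses of the same
  map.\<close>

lemma tensor_quasi_surj:
  assumes M: "algebra_bimodule A M" and C: "cochain_complex A C" and D: "cochain_complex A D"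
    and f: "cochain_map A C D f" and g: "cochain_map A D C g"
    and h: "homotopic A D D (\<lambda>p x. f p (g p x)) (\<lambda>p x. x) k"
    and t: "t \<in> carrier (env_tensor_space A M (obj D p))"
      "env_tensor_map A M (obj D p) (obj D (p + 1)) (dif D p) t = \<zero>\<^bsub>env_tensor_space A M (obj D (p + 1))\<^esub>"
  shows "\<exists>v\<in>carrier (env_tensor_space A M (obj C p)).
    env_tensor_map A M (obj C p) (obj C (p + 1)) (dif C p) v = \<zero>\<^bsub>env_tensor_space A M (obj C (p + 1))\<^esub> \<and>
    (\<exists>w\<in>carrier (env_tensor_space A M (obj D (p - 1))).
      t = env_tensor_map A M (obj D (p - 1)) (obj D p) (dif D (p - 1)) w \<oplus>\<^bsub>env_tensor_space A M (obj D p)\<^esub>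
        env_tensor_map A M (obj C p) (obj D p) (f p) v)"
proof -
  note CD = cochain_complexD[OF C] and DD = cochain_complexD[OF D] and fD = cochain_mapD[OF f]
    and gD = cochain_mapD[OF g]
  have fg: "cochain_map A D D (\<lambda>p x. f p (g p x))"
    unfolding cochain_map_def
    using bimod_linear_comp[OF gD(1) fD(1)] fD(2) gD(2) bimod_linear_closed[OF gD(1)] by simp
  have k: "bimod_linear A (obj D p) (obj D (p - 1)) (k p)" for p
    using h unfolding homotopic_def by blast
  have k': "bimod_linear A (obj D (p + 1)) (obj D p) (k (p + 1))"
    using k[of "p + 1"] by simp
  interpret d: env_tensor_context A M "obj D p"
    by (intro env_tensor_context.intro kalgebra_axioms M DD(1))
  interpret d1: env_tensor_context A M "obj D (p - 1)"
    by (intro env_tensor_context.intro kalgebra_axioms M DD(1))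
  interpret d2: env_tensor_context A M "obj D (p + 1)"
    by (intro env_tensor_context.intro kalgebra_axioms M DD(1))
  interpret c2: env_tensor_context A M "obj C (p + 1)"
    by (intro env_tensor_context.intro kalgebra_axioms M CD(1))
  let ?d = "env_tensor_map A M (obj D (p - 1)) (obj D p) (dif D (p - 1))"
  let ?g = "env_tensor_map A M (obj D p) (obj C p) (g p) t"
  let ?f = "env_tensor_map A M (obj C p) (obj D p) (f p)"
  let ?k = "env_tensor_map A M (obj D p) (obj D (p - 1)) (k p) t"
  note da = env_tensor_map_additive[OF M DD(1) DD(1) DD(4)]
  have gt: "?g \<in> carrier (env_tensor_space A M (obj C p))"
    by (rule additive_map_closed[OF env_tensor_map_additive[OF M DD(1) CD(1) gD(1)] t(1)])
  have fgt: "?f ?g \<in> carrier d.TS"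
    by (rule additive_map_closed[OF env_tensor_map_additive[OF M CD(1) DD(1) fD(1)] gt])
  have kt: "?k \<in> carrier d1.TS"
    by (rule additive_map_closed[OF env_tensor_map_additive[OF M DD(1) DD(1) k] t(1)])
  have k0: "env_tensor_map A M (obj D (p + 1)) (obj D p) (k (p + 1)) \<zero>\<^bsub>d2.TS\<^esub> = \<zero>\<^bsub>d.TS\<^esub>"
    by (rule additive_map_zero[OF d2.TS.abelian_group_axioms d.TS.abelian_group_axioms
          env_tensor_map_additive[OF M DD(1) DD(1) k']])
  have "?f ?g = env_tensor_map A M (obj D p) (obj D p) (\<lambda>x. f p (g p x)) t"
    by (rule env_tensor_map_comp[OF M DD(1) CD(1) DD(1) gD(1) fD(1) t(1)])
  also have "\<dots> = t \<oplus>\<^bsub>d.TS\<^esub> ?d ?k"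
    unfolding tensor_homotopy[OF M D D fg cochain_map_id h t(1)]
    using t additive_map_closed[OF da kt] by (simp add: env_tensor_map_id[OF M DD(1)] k0)
  finally have "t = ?d (\<ominus>\<^bsub>d1.TS\<^esub> ?k) \<oplus>\<^bsub>d.TS\<^esub> ?f ?g"
    using kt t(1) additive_map_closed[OF da kt]
    by (simp add: additive_map_neg[OF d1.TS.abelian_group_axioms d.TS.abelian_group_axioms da]
        d.TS.a_ac d.TS.l_neg d.TS.r_neg)
  moreover have "env_tensor_map A M (obj C p) (obj C (p + 1)) (dif C p) ?g = \<zero>\<^bsub>c2.TS\<^esub>"
    unfolding tensor_chain[OF M D C g t(1), symmetric] t(2)
    by (rule additive_map_zero[OF d2.TS.abelian_group_axioms c2.TS.abelian_group_axioms
          env_tensor_map_additive[OF M DD(1) CD(1) gD(1)]])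
  ultimately show ?thesis
    using gt kt d1.TS.a_inv_closed by blast
qed

end

section \<open>The dual complex, the shifted complex and their comparison\<close>

context kalgebra
begin

lemma cochain_complex_hom_env:
  assumes K: "\<And>p. algebra_bimodule A (obj K p)"
    and d: "\<And>p. bimod_linear A (obj K p) (obj K (p - 1)) (dif K p)"
    and dd: "\<And>p x. x \<in> carrier (obj K p) \<Longrightarrow> dif K (p - 1) (dif K p x) = \<zero>\<^bsub>obj K (p - 2)\<^esub>"
  shows "cochain_complex A (hom_env_complex A K)"
  unfolding cochain_complex_def
proof (intro conjI allI ballI)
  fix p
  have d': "bimod_linear A (obj K (p + 1)) (obj K p) (dif K (p + 1))" for p
    using d[of "p + 1"] by simp
  show "algebra_bimodule A (obj (hom_env_complex A K) p)"
    by (simp add: hom_env_complex_def algebra_bimodule_hom_env K)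
  show "bimod_linear A (obj (hom_env_complex A K) p) (obj (hom_env_complex A K) (p + 1))
      (dif (hom_env_complex A K) p)"
    using compose_linear[OF algebra_bimodule_env K K d'] by (simp add: hom_env_complex_def)
  fix f assume "f \<in> carrier (obj (hom_env_complex A K) p)"
  then have f: "f \<in> bimod_hom A (obj K p) E" by (simp add: hom_env_complex_def)
  have "f \<zero>\<^bsub>obj K p\<^esub> = \<zero>\<^bsub>E\<^esub>"
    using additive_map_zero[OF _ E.abelian_group_axioms bimod_linear_additive[OF bimod_hom_linear[OF f]]] K
    by (simp add: algebra_bimodule_def)
  moreover have "dif K (p + 1) (dif K (p + 2) x) = \<zero>\<^bsub>obj K p\<^esub>" "dif K (p + 2) x \<in> carrier (obj K (p + 1))"
    if "x \<in> carrier (obj K (p + 2))" for x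
    using dd[OF that] bimod_linear_closed[OF d'[of "p + 1"], of x] that by (simp_all add: algebra_simps)
  ultimately show "dif (hom_env_complex A K) (p + 1) (dif (hom_env_complex A K) p f) =
      \<zero>\<^bsub>obj (hom_env_complex A K) (p + 2)\<^esub>"
    by (auto simp: hom_env_complex_def compose_def add.assoc intro!: restrict_ext)
qed

lemma signed_linear:
  assumes "algebra_bimodule A N" "bimod_linear A M N f"
  shows "bimod_linear A M N (\<lambda>x. signed N n (f x))"
  using bimod_linear_neg[OF assms] assms(2) by (cases "even n") (simp_all add: signed_def)

text \<open>The sign (-1)^n is harmless: additive differentials commute with negation, and the
  negative of zero is zero.\<close>

lemma cochain_complex_shift:
  assumes K: "\<And>p. algebra_bimodule A (obj K p)"
    and d: "\<And>p. bimod_linear A (obj K p) (obj K (p - 1)) (dif K p)"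
    and dd: "\<And>p x. x \<in> carrier (obj K p) \<Longrightarrow> dif K (p - 1) (dif K p x) = \<zero>\<^bsub>obj K (p - 2)\<^esub>"
  shows "cochain_complex A (shift_cochain n K)"
  unfolding cochain_complex_def
proof (intro conjI allI ballI)
  fix p
  have e: "n - (p + 1) = n - p - 1" "n - (p + 2) = n - p - 2" "n - p - 1 - 1 = n - p - 2" by simp_all
  show "algebra_bimodule A (obj (shift_cochain n K) p)"
    by (simp add: shift_cochain_def K)
  show "bimod_linear A (obj (shift_cochain n K) p) (obj (shift_cochain n K) (p + 1)) (dif (shift_cochain n K) p)"
    using signed_linear[OF K d[of "n - p"]] by (simp add: shift_cochain_def e)
  fix x assume x: "x \<in> carrier (obj (shift_cochain n K) p)"
  have ag: "abelian_group (obj K q)" for q using K by (simp add: algebra_bimodule_def)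
  interpret b: abelian_group "obj K (n - p - 2)" by (rule ag)
  have x': "x \<in> carrier (obj K (n - p))" using x by (simp add: shift_cochain_def)
  have "dif K (n - p - 1) (signed (obj K (n - p - 1)) n (dif K (n - p) x)) = \<zero>\<^bsub>obj K (n - p - 2)\<^esub>"
    using dd[OF x'] additive_map_neg[OF ag ag bimod_linear_additive[OF d] bimod_linear_closed[OF d x']]
      b.minus_equality[of "\<zero>\<^bsub>obj K (n - p - 2)\<^esub>" "\<zero>\<^bsub>obj K (n - p - 2)\<^esub>"]
    by (auto simp: signed_def e)
  then show "dif (shift_cochain n K) (p + 1) (dif (shift_cochain n K) p x) = \<zero>\<^bsub>obj (shift_cochain n K) (p + 2)\<^esub>"
    using b.minus_equality[of "\<zero>\<^bsub>obj K (n - p - 2)\<^esub>" "\<zero>\<^bsub>obj K (n - p - 2)\<^esub>"]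
    by (auto simp: shift_cochain_def e signed_def)
qed

lemma hom_env_zero:
  assumes "algebra_bimodule A P" "carrier P = {\<zero>\<^bsub>P\<^esub>}"
  shows "carrier (hom_env A P) = {\<zero>\<^bsub>hom_env A P\<^esub>}"
proof -
  interpret h: algebra_bimodule A "hom_env A P" by (rule algebra_bimodule_hom_env[OF assms(1)])
  have ag: "abelian_group P" using assms(1) by (simp add: algebra_bimodule_def)
  have "f = \<zero>\<^bsub>hom_env A P\<^esub>" if f: "f \<in> carrier (hom_env A P)" for f
  proof (rule bimod_hom_eqI)
    show f': "f \<in> bimod_hom A P E" using f by simp
    show "\<zero>\<^bsub>hom_env A P\<^esub> \<in> bimod_hom A P E" using h.zero_closed by simp
    show "f x = \<zero>\<^bsub>hom_env A P\<^esub> x" if "x \<in> carrier P" for x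
      using additive_map_zero[OF ag E.abelian_group_axioms bimod_linear_additive[OF bimod_hom_linear[OF f']]]
        that assms(2) by simp
  qed
  then show ?thesis using h.zero_closed by blast
qed

text \<open>Three lifts are needed. With C the dual, D the shift and the roof given by s: Z -> C and
  t: Z -> D, a map v: D -> Z inverts t on one side, and \<open>\<alpha>\<close> = s v: D -> C is a
  quasi-isomorphism. Lifting along \<open>\<alpha>\<close> gives \<open>\<phi>\<close>: C -> D with
  \<open>\<alpha>\<close> as left inverse up to homotopy; \<open>\<phi>\<close> is again a
  quasi-isomorphism, and lifting along it gives a right inverse \<open>\<psi>\<close>: D -> C. The
  apex no longer occurs in these homotopies.\<close>

theorem derived_duality:
  fixes K :: "(('a, 'a, 'k) bimod, 'k) gcomplex" and U :: "'z itself"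
  assumes M: "algebra_bimodule A M"
    and K: "\<And>p. algebra_bimodule A (obj K p)"
    and d: "\<And>p. bimod_linear A (obj K p) (obj K (p - 1)) (dif K p)"
    and dd: "\<And>p x. x \<in> carrier (obj K p) \<Longrightarrow> dif K (p - 1) (dif K p x) = \<zero>\<^bsub>obj K (p - 2)\<^esub>"
    and basis: "\<And>p. \<exists>(J :: 'i set) x f. dual_basis A (obj K p) J x f"
    and low: "\<And>p. p < 0 \<Longrightarrow> carrier (obj K p) = {\<zero>\<^bsub>obj K p\<^esub>}"
    and high: "\<And>p. n < p \<Longrightarrow> carrier (obj K p) = {\<zero>\<^bsub>obj K p\<^esub>}"
    and der: "derived_iso U A (hom_env_complex A K) (shift_cochain n K)"
  shows "vector_space_iso (cohomology_space (hom_complex A K M) p)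
    (homology_space (env_tensor_complex A M K) (n - p))"
proof -
  define C where "C = hom_env_complex A K"
  define D where "D = shift_cochain n K"
  have oC: "obj C q = hom_env A (obj K q)" for q by (simp add: C_def hom_env_complex_def)
  have oD: "obj D q = obj K (n - q)" for q by (simp add: D_def shift_cochain_def)
  have dC: "dif C q = (\<lambda>f. compose (carrier (obj K (q + 1))) f (dif K (q + 1)))" for q
    by (simp add: C_def hom_env_complex_def)
  have dD: "dif D q = (\<lambda>x. signed (obj K (n - q - 1)) n (dif K (n - q) x))" for q
    by (simp add: D_def shift_cochain_def)
  have C: "cochain_complex A C" unfolding C_def by (rule cochain_complex_hom_env[OF K d dd])
  have D: "cochain_complex A D" unfolding D_def by (rule cochain_complex_shift[OF K d dd])
  obtain Z :: "(('a, 'a, 'z) bimod, 'z) gcomplex" and s t where Zb: "bounded_cochain_complex A Z"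
    and s: "cochain_quasi_iso A Z C s" and t: "cochain_quasi_iso A Z D t"
    using der unfolding derived_iso_def C_def D_def by blast
  have Z: "cochain_complex A Z"
    using Zb unfolding bounded_cochain_complex_def cochain_complex_def by blast
  note s = quasi_iso_cochain_quasi_iso[OF Z C s] and t = quasi_iso_cochain_quasi_iso[OF Z D t]
  \<comment> \<open>Projectivity of the dual terms: the dual basis of a term of \<open>K\<close>
    yields one of its dual, with the same index set.\<close>
  have Cb: "\<exists>(J :: 'i set) x f. dual_basis A (obj C q) J x f" for q
    using basis[of q] dual_basis_hom_env[OF K] unfolding oC by blast
  have Db: "\<exists>(J :: 'i set) x f. dual_basis A (obj D q) J x f" for q
    using basis unfolding oD by blast
  \<comment> \<open>In degree q, C is the dual of K_q, so \<open>high\<close> bounds it by n; D is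
    K_(n-q), so \<open>low\<close> gives the same bound.\<close>
  have C0: "carrier (obj C q) = {\<zero>\<^bsub>obj C q\<^esub>}" if "n < q" for q
    unfolding oC by (rule hom_env_zero[OF K high[OF that]])
  have D0: "carrier (obj D q) = {\<zero>\<^bsub>obj D q\<^esub>}" if "n < q" for q
    unfolding oD by (rule low) (use that in simp)
  obtain v k1 where v: "cochain_map A D Z v" "homotopic A D D (\<lambda>p x. t p (v p x)) (\<lambda>p x. x) k1"
    using quasi_iso_lift[OF kalgebra_axioms D Z D t cochain_map_id Db D0] by blast
  note vq = quasi_iso_of_homotopy_inverse[OF D Z t v]
  define \<alpha> where "\<alpha> p x = s p (v p x)" for p x
  have \<alpha>: "quasi_iso A D C \<alpha>"
    using quasi_iso_comp[OF D Z C vq s] unfolding \<alpha>_def .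
  obtain \<phi> k2 where \<phi>: "cochain_map A C D \<phi>" and k2: "homotopic A C C (\<lambda>p x. \<alpha> p (\<phi> p x)) (\<lambda>p x. x) k2"
    using quasi_iso_lift[OF kalgebra_axioms C D C \<alpha> cochain_map_id Cb C0] by blast
  note \<phi>q = quasi_iso_of_homotopy_inverse[OF C D \<alpha> \<phi> k2]
  obtain \<psi> k3 where \<psi>: "cochain_map A D C \<psi>" and k3: "homotopic A D D (\<lambda>p x. \<phi> p (\<psi> p x)) (\<lambda>p x. x) k3"
    using quasi_iso_lift[OF kalgebra_axioms D C D \<phi>q cochain_map_id Db D0] by blast
  note CD = cochain_complexD[OF C] and DD = cochain_complexD[OF D] and \<phi>D = cochain_mapD[OF \<phi>]
  note inj = tensor_quasi_inj[where f = \<phi> and g = \<alpha>, OF M C D \<phi> quasi_isoD(1)[OF \<alpha>] k2]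
    and surj = tensor_quasi_surj[where f = \<phi> and g = \<psi>, OF M C D \<phi> \<psi> k3]
    and chain = tensor_chain[OF M C D \<phi>]
  let ?T = "\<lambda>q. env_tensor_space A M (obj K q)"
  let ?TC = "\<lambda>q. env_tensor_space A M (obj C q)"
  let ?H = "\<lambda>q. hom_space A (obj K q) M"
  let ?dC = "\<lambda>q. env_tensor_map A M (obj C q) (obj C (q + 1)) (dif C q)"
  let ?dD = "\<lambda>q. env_tensor_map A M (obj D q) (obj D (q + 1)) (dif D q)"
  let ?dK = "\<lambda>q. env_tensor_map A M (obj K q) (obj K (q - 1)) (dif K q)"
  let ?\<phi> = "\<lambda>q. env_tensor_map A M (obj C q) (obj D q) (\<phi> q)"
  let ?e = "\<lambda>q. hom_eval A M (obj K q)"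
  let ?c = "\<lambda>q g. compose (carrier (obj K (q + 1))) g (dif K (q + 1))"
  \<comment> \<open>The inverse of evaluation. The map \<open>h\<close> then leads from Hom(K_q, M)
    back to M \<otimes> Hom(K_q, A^e) and along \<open>\<phi>\<close> to M \<otimes>
    K_(n-q).\<close>
  define \<theta> where "\<theta> q = inv_into (carrier (?TC q)) (?e q)" for q
  define h where "h q g = ?\<phi> q (\<theta> q g)" for q g
  have T: "abelian_group (?T q)" for q
    by (intro env_tensor_context.abelian_group_env_tensor env_tensor_context.intro kalgebra_axioms M K)
  have TC: "abelian_group (?TC q)" for q
    by (intro env_tensor_context.abelian_group_env_tensor env_tensor_context.intro kalgebra_axioms M CD)
  have H: "abelian_group (?H q)" for q
    by (rule abelian_group_hom_space[OF K M])
  have hc: "hom_eval_context A M (obj K q)" for q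
    by (intro hom_eval_context.intro kalgebra_axioms M K)
  note ea = hom_eval_context.hom_eval_additive[OF hc, folded oC]
    and es = hom_eval_context.hom_eval_smult[OF hc, folded oC]
  have eb: "bij_betw (?e q) (carrier (?TC q)) (bimod_hom A (obj K q) M)" for q
    using basis[of q] hom_eval_context.hom_eval_bij[OF hc, folded oC] by blast
  have \<theta>e: "\<theta> q (?e q u) = u" if "u \<in> carrier (?TC q)" for q u
    unfolding \<theta>_def using eb[of q] that by (simp add: bij_betw_def inv_into_f_f)
  have e\<theta>: "?e q (\<theta> q g) = g" and \<theta>c: "\<theta> q g \<in> carrier (?TC q)" if "g \<in> bimod_hom A (obj K q) M" for q g
    unfolding \<theta>_def using eb[of q] that
    by (simp_all add: bij_betw_def f_inv_into_f inv_into_into)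
  have Hadd: "g \<oplus>\<^bsub>?H q\<^esub> g' \<in> bimod_hom A (obj K q) M"
    if "g \<in> bimod_hom A (obj K q) M" "g' \<in> bimod_hom A (obj K q) M" for q g g'
    using abelian_monoid.a_closed[OF abelian_group.axioms(1)[OF H[of q]]] that by simp
  have \<theta>add: "additive_map (?H q) (?TC q) (\<theta> q)" for q
  proof (rule additive_mapI, unfold hom_space_sel(1))
    fix g g' assume g: "g \<in> bimod_hom A (obj K q) M" and g': "g' \<in> bimod_hom A (obj K q) M"
    have "?e q (\<theta> q g \<oplus>\<^bsub>?TC q\<^esub> \<theta> q g') = g \<oplus>\<^bsub>?H q\<^esub> g'"
      using additive_map_add[OF ea \<theta>c[OF g] \<theta>c[OF g']] e\<theta>[OF g] e\<theta>[OF g'] by simp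
    then show "\<theta> q (g \<oplus>\<^bsub>?H q\<^esub> g') = \<theta> q g \<oplus>\<^bsub>?TC q\<^esub> \<theta> q g'"
      using \<theta>e abelian_monoid.a_closed[OF abelian_group.axioms(1)[OF TC[of q]] \<theta>c[OF g] \<theta>c[OF g']] by metis
  qed (rule \<theta>c)
  have tsC: "additive_map (?TC q) (?TC q) (smult (?TC q) c)" for q c
    by (intro env_tensor_context.smult_additive env_tensor_context.intro kalgebra_axioms M CD)
  have ts: "additive_map (?T q) (?T q) (smult (?T q) c)" for q c
    by (intro env_tensor_context.smult_additive env_tensor_context.intro kalgebra_axioms M K)
  have \<theta>s: "\<theta> q (c \<odot>\<^bsub>?H q\<^esub> g) = c \<odot>\<^bsub>?TC q\<^esub> \<theta> q g" if g: "g \<in> bimod_hom A (obj K q) M" for q c g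
    using es[OF \<theta>c[OF g], of c] e\<theta>[OF g] \<theta>e[OF additive_map_closed[OF tsC \<theta>c[OF g]]] by metis
  \<comment> \<open>Additivity of operations on the Hom spaces is transported from the tensor side
    along evaluation and its inverse.\<close>
  have Hs: "additive_map (?H q) (?H q) (smult (?H q) c)" for q c
  proof -
    have e: "c \<odot>\<^bsub>?H q\<^esub> g = ?e q (c \<odot>\<^bsub>?TC q\<^esub> \<theta> q g)" if "g \<in> carrier (?H q)" for g
      using es[OF \<theta>c, of g q c] e\<theta>[of g q] that by simp
    have "additive_map (?H q) (?H q) (\<lambda>g. ?e q (c \<odot>\<^bsub>?TC q\<^esub> \<theta> q g))"
      by (rule additive_map_comp[OF additive_map_comp[OF \<theta>add tsC] ea])
    then show ?thesis
      using Hadd unfolding additive_map_def by (simp add: e[symmetric] del: hom_space_sel(2-4))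
  qed
  have K': "bimod_linear A (obj K (q + 1)) (obj K q) (dif K (q + 1))" for q
    using d[of "q + 1"] by simp
  have nat: "?e (q + 1) (?dC q u) = ?c q (?e q u)" if "u \<in> carrier (?TC q)" for q u
    using hom_eval_natural(2)[OF M K K K'[of q]] that unfolding oC dC by simp
  have cl: "additive_map (?H q) (?H (q + 1)) (?c q)" for q
  proof -
    have e: "?c q g = ?e (q + 1) (?dC q (\<theta> q g))" if "g \<in> carrier (?H q)" for g
      using nat[OF \<theta>c] e\<theta> that by simp
    have "additive_map (?H q) (?H (q + 1)) (\<lambda>g. ?e (q + 1) (?dC q (\<theta> q g)))"
      by (rule additive_map_comp[OF additive_map_comp[OF \<theta>add env_tensor_map_additive[OF M CD(1) CD(1) CD(3)]] ea])
    then show ?thesis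
      using Hadd unfolding additive_map_def by (simp add: e[symmetric] del: hom_space_sel(2-4))
  qed
  have \<theta>d: "\<theta> (q + 1) (?c q g) = ?dC q (\<theta> q g)" if g: "g \<in> bimod_hom A (obj K q) M" for q g
    using nat[OF \<theta>c[OF g]] e\<theta>[OF g]
      \<theta>e[OF additive_map_closed[OF env_tensor_map_additive[OF M CD(1) CD(1) CD(3)] \<theta>c[OF g]]] by metis
  \<comment> \<open>The differential of the shift is (-1)^n times that of \<open>K\<close>, and the
    tensor functor lets the sign pass outside.\<close>
  have ddK: "?dD q u = signed (?T (n - q - 1)) n (?dK (n - q) u)" if u: "u \<in> carrier (?T (n - q))" for q u
  proof (cases "even n")
    case True
    have e: "n - (q + 1) = n - q - 1" by simp
    then show ?thesis using True by (simp add: signed_def dD oD e)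
  next
    case False
    have e: "n - (q + 1) = n - q - 1" by simp
    then show ?thesis using False env_tensor_map_neg[OF M K K d[of "n - q"] u]
      by (simp add: signed_def dD oD e)
  qed
  have signed0: "signed (?T q) n x = \<zero>\<^bsub>?T q\<^esub> \<longleftrightarrow> x = \<zero>\<^bsub>?T q\<^esub>" if "x \<in> carrier (?T q)" for q x
  proof -
    interpret T: abelian_group "?T q" by (rule T)
    have "\<ominus>\<^bsub>?T q\<^esub> x = \<zero>\<^bsub>?T q\<^esub> \<longleftrightarrow> x = \<zero>\<^bsub>?T q\<^esub>"
      using that T.minus_minus[of x] T.minus_equality[of "\<zero>\<^bsub>?T q\<^esub>" "\<zero>\<^bsub>?T q\<^esub>"] by auto
    then show ?thesis by (simp add: signed_def)
  qed
  \<comment> \<open>Both differentials have the same image, the sign being absorbed into the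
    preimage. What is used below is this equality and the corresponding one of kernels in
    \<open>cyc\<close>.\<close>
  have bd1: "\<exists>l\<in>carrier (?T (n - p + 1)). ?dD (p - 1) u = ?dK (n - p + 1) l"
    and bd2: "\<exists>l\<in>carrier (?T (n - p + 1)). ?dK (n - p + 1) u = ?dD (p - 1) l"
    if u: "u \<in> carrier (?T (n - p + 1))" for u
  proof -
    have e: "n - (p - 1) = n - p + 1" by simp
    interpret T: abelian_group "?T (n - p + 1)" by (rule T)
    interpret T': abelian_group "?T (n - p)" by (rule T)
    have da: "additive_map (?T (n - p + 1)) (?T (n - p)) (?dK (n - p + 1))"
      using env_tensor_map_additive[OF M K K d[of "n - p + 1"]] by simp
    have neg: "?dK (n - p + 1) (\<ominus>\<^bsub>?T (n - p + 1)\<^esub> u) = \<ominus>\<^bsub>?T (n - p)\<^esub> ?dK (n - p + 1) u"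
      by (rule additive_map_neg[OF T T da u])
    have s: "?dD (p - 1) w = signed (?T (n - p)) n (?dK (n - p + 1) w)" if "w \<in> carrier (?T (n - p + 1))" for w
      using ddK[of w "p - 1"] that by (simp add: e)
    have cl: "?dK (n - p + 1) u \<in> carrier (?T (n - p))" by (rule additive_map_closed[OF da u])
    show "\<exists>l\<in>carrier (?T (n - p + 1)). ?dD (p - 1) u = ?dK (n - p + 1) l"
    proof (cases "even n")
      case True then show ?thesis using u by (intro bexI[of _ u]) (simp_all only: s signed_def if_True)
    next
      case False then show ?thesis
        using u by (intro bexI[OF _ T.a_inv_closed[OF u]]) (simp only: s signed_def if_False neg)
    qed
    show "\<exists>l\<in>carrier (?T (n - p + 1)). ?dK (n - p + 1) u = ?dD (p - 1) l"
    proof (cases "even n")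
      case True then show ?thesis using u by (intro bexI[of _ u]) (simp_all only: s signed_def if_True)
    next
      case False then show ?thesis
        using T'.minus_minus[OF cl]
        by (intro bexI[OF _ T.a_inv_closed[OF u]]) (simp only: s[OF T.a_inv_closed[OF u]] signed_def if_False neg)
    qed
  qed
  have cyc: "?dD p u = \<zero>\<^bsub>?T (n - p - 1)\<^esub> \<longleftrightarrow> ?dK (n - p) u = \<zero>\<^bsub>?T (n - p - 1)\<^esub>" if u: "u \<in> carrier (?T (n - p))" for u
    using ddK[OF u] signed0[OF additive_map_closed[OF env_tensor_map_additive[OF M K K d] u]] by simp
  have e: "n - (p + 1) = n - p - 1" "n - (p - 1) = n - p + 1" by simp_all
  note ha = additive_map_comp[OF \<theta>add env_tensor_map_additive[OF M CD(1) DD(1) \<phi>D(1)], folded h_def, unfolded oD]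
  have hd: "h (q + 1) (?c q g) = ?dD q (h q g)" if g: "g \<in> bimod_hom A (obj K q) M" for q g
    unfolding h_def \<theta>d[OF g] by (rule chain[OF \<theta>c[OF g]])
  have c1: "additive_map (?H (p - 1)) (?H p) (?c (p - 1))" using cl[of "p - 1"] by simp
  have iso: "vector_space_iso
      (homology_space_at (?H (p - 1)) (?c (p - 1)) (?H p) (?c p) (?H (p + 1)))
      (homology_space_at (?T (n - p + 1)) (?dK (n - p + 1)) (?T (n - p)) (?dK (n - p)) (?T (n - p - 1)))"
  proof (rule homology_space_isoI[OF H H c1 T T _ H T cl _ ha[of p]])
    show "additive_map (?T (n - p + 1)) (?T (n - p)) (?dK (n - p + 1))"
      using env_tensor_map_additive[OF M K K d[of "n - p + 1"]] by simp
    show "additive_map (?T (n - p)) (?T (n - p - 1)) (?dK (n - p))"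
      by (rule env_tensor_map_additive[OF M K K d])
    show "additive_map (?H p) (?H p) (smult (?H p) c)" for c by (rule Hs)
    show "additive_map (?T (n - p)) (?T (n - p)) (smult (?T (n - p)) c)" for c by (rule ts)
    fix c g assume g: "g \<in> carrier (?H p)"
    then have g': "g \<in> bimod_hom A (obj K p) M" by simp
    show "h p (c \<odot>\<^bsub>?H p\<^esub> g) = c \<odot>\<^bsub>?T (n - p)\<^esub> h p g"
      unfolding h_def \<theta>s[OF g']
      using env_tensor_map_smult[OF M CD(1) DD(1) \<phi>D(1) \<theta>c[OF g']] by (simp add: oD)
    assume gc: "?c p g = \<zero>\<^bsub>?H (p + 1)\<^esub>"
    show "?c p (c \<odot>\<^bsub>?H p\<^esub> g) = \<zero>\<^bsub>?H (p + 1)\<^esub>"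
    proof -
      have "?c p (c \<odot>\<^bsub>?H p\<^esub> g) = c \<odot>\<^bsub>?H (p + 1)\<^esub> ?c p g"
        using bimod_linear_closed[OF K'] by (auto simp: compose_def intro!: restrict_ext)
      then show ?thesis
        unfolding gc using additive_map_zero[OF H H Hs] by simp
    qed
    have hpc: "h p g \<in> carrier (?T (n - p))" by (rule additive_map_closed[OF ha g])
    have h0: "h (p + 1) \<zero>\<^bsub>?H (p + 1)\<^esub> = \<zero>\<^bsub>?T (n - p - 1)\<^esub>"
      using additive_map_zero[OF H T ha[of "p + 1"]] by (simp only: e)
    show "?dK (n - p) (h p g) = \<zero>\<^bsub>?T (n - p - 1)\<^esub>"
      using hd[OF g'] gc h0 cyc[OF hpc] by simp
    fix l' assume l': "l' \<in> carrier (?T (n - p + 1))" and hl: "h p g = ?dK (n - p + 1) l'"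
    obtain w where w: "w \<in> carrier (?T (n - p + 1))" "?dK (n - p + 1) l' = ?dD (p - 1) w"
      using bd2[OF l'] by blast
    have \<theta>z: "?dC p (\<theta> p g) = \<zero>\<^bsub>?TC (p + 1)\<^esub>"
      unfolding \<theta>d[OF g', symmetric] gc by (rule additive_map_zero[OF H TC \<theta>add])
    \<comment> \<open>Injectivity of \<open>\<phi>\<close> after tensoring makes the cycle
      corresponding to g a boundary; evaluation commutes with the differentials and carries a
      primitive back to Hom(K, M).\<close>
    have "\<exists>v\<in>carrier (?TC (p - 1)). \<theta> p g = env_tensor_map A M (obj C (p - 1)) (obj C p) (dif C (p - 1)) v"
    proof (rule inj[OF \<theta>c[OF g'] \<theta>z])
      show "w \<in> carrier (env_tensor_space A M (obj D (p - 1)))"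
        using w(1) by (simp only: oD e)
      show "?\<phi> p (\<theta> p g) = env_tensor_map A M (obj D (p - 1)) (obj D p) (dif D (p - 1)) w"
        using hl w(2) by (simp add: h_def)
    qed
    then obtain v where v: "v \<in> carrier (?TC (p - 1))" "\<theta> p g = ?dC (p - 1) v" by auto
    have "g = ?e p (?dC (p - 1) v)" using e\<theta>[OF g'] v(2) by simp
    also have "\<dots> = ?c (p - 1) (?e (p - 1) v)" using nat[OF v(1)] by simp
    finally show "\<exists>l\<in>carrier (?H (p - 1)). g = ?c (p - 1) l"
      using additive_map_closed[OF ea v(1)] by blast
  next
    fix c l assume l: "l \<in> carrier (?H (p - 1))"
    then have l': "l \<in> bimod_hom A (obj K (p - 1)) M" by simp
    have "c \<odot>\<^bsub>?H p\<^esub> ?c (p - 1) l = ?c (p - 1) (c \<odot>\<^bsub>?H (p - 1)\<^esub> l)"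
      using bimod_linear_closed[OF K'[of "p - 1"]] by (auto simp: compose_def intro!: restrict_ext)
    then show "\<exists>k\<in>carrier (?H (p - 1)). c \<odot>\<^bsub>?H p\<^esub> ?c (p - 1) l = ?c (p - 1) k"
      using additive_map_closed[OF Hs l] by blast
    have "h (p - 1) l \<in> carrier (?T (n - p + 1))"
      using additive_map_closed[OF ha l] by (simp only: e)
    from bd1[OF this] show "\<exists>l'\<in>carrier (?T (n - p + 1)). h p (?c (p - 1) l) = ?dK (n - p + 1) l'"
      using hd[OF l'] by simp
  next
    fix c l assume l: "l \<in> carrier (?T (n - p + 1))"
    show "\<exists>k\<in>carrier (?T (n - p + 1)). c \<odot>\<^bsub>?T (n - p)\<^esub> ?dK (n - p + 1) l = ?dK (n - p + 1) k"
      using env_tensor_map_smult[OF M K K d[of "n - p + 1"] l, of c] additive_map_closed[OF ts l, of c] by auto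
  next
    fix y assume y: "y \<in> carrier (?T (n - p))" "?dK (n - p) y = \<zero>\<^bsub>?T (n - p - 1)\<^esub>"
    have yD: "y \<in> carrier (env_tensor_space A M (obj D p))" using y(1) by (simp only: oD)
    have "?dD p y = \<zero>\<^bsub>env_tensor_space A M (obj D (p + 1))\<^esub>"
      using cyc[OF y(1)] y(2) by (simp add: oD e)
    from surj[OF yD this] obtain v w where v: "v \<in> carrier (?TC p)" "?dC p v = \<zero>\<^bsub>?TC (p + 1)\<^esub>"
      and w: "w \<in> carrier (env_tensor_space A M (obj D (p - 1)))"
        "y = env_tensor_map A M (obj D (p - 1)) (obj D p) (dif D (p - 1)) w \<oplus>\<^bsub>env_tensor_space A M (obj D p)\<^esub> ?\<phi> p v"
      by blast
    have w': "w \<in> carrier (?T (n - p + 1))" using w(1) by (simp only: oD e)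
    obtain l where l: "l \<in> carrier (?T (n - p + 1))" "?dD (p - 1) w = ?dK (n - p + 1) l"
      using bd1[OF w'] by blast
    have "?c p (?e p v) = ?e (p + 1) \<zero>\<^bsub>?TC (p + 1)\<^esub>" using nat[OF v(1)] v(2) by simp
    then have "?c p (?e p v) = \<zero>\<^bsub>?H (p + 1)\<^esub>"
      using additive_map_zero[OF TC H ea] by simp
    moreover have "y = ?dK (n - p + 1) l \<oplus>\<^bsub>?T (n - p)\<^esub> h p (?e p v)"
      using w(2) l(2) \<theta>e[OF v(1)] by (simp add: h_def oD)
    ultimately show "\<exists>g\<in>carrier (?H p). ?c p g = \<zero>\<^bsub>?H (p + 1)\<^esub> \<and>
        (\<exists>l'\<in>carrier (?T (n - p + 1)). y = ?dK (n - p + 1) l' \<oplus>\<^bsub>?T (n - p)\<^esub> h p g)"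
      using additive_map_closed[OF ea v(1)] l(1) by blast
  qed
  have "cohomology_space (hom_complex A K M) p =
      homology_space_at (?H (p - 1)) (?c (p - 1)) (?H p) (?c p) (?H (p + 1))"
    by (simp add: cohomology_space_def hom_complex_def)
  \<comment> \<open>\<open>env_tensor_map\<close> unfolds literally to the differential of
    \<open>env_tensor_complex\<close>.\<close>
  moreover have "homology_space (env_tensor_complex A M K) (n - p) =
      homology_space_at (?T (n - p + 1)) (?dK (n - p + 1)) (?T (n - p)) (?dK (n - p)) (?T (n - p - 1))"
    by (simp add: homology_space_def env_tensor_complex_def env_tensor_map_def)
  ultimately show ?thesis using iso by simp
qed

end

section \<open>Quadratic algebras\<close>

lemma ring_transfer:
  assumes "ring S" "carrier S' = carrier S" "add S' = add S" "\<zero>\<^bsub>S'\<^esub> = \<zero>\<^bsub>S\<^esub>"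
    "monoid.mult S' = monoid.mult S" "\<one>\<^bsub>S'\<^esub> = \<one>\<^bsub>S\<^esub>"
  shows "ring S'"
proof -
  interpret S: ring S by fact
  show ?thesis
  proof (rule ringI)
    show "abelian_group S'"
      by (rule abelian_group_transfer[OF S.abelian_group_axioms]) (simp_all add: assms)
    show "monoid S'"
      by (rule monoidI) (simp_all add: assms S.m_assoc)
  qed (simp_all add: assms S.l_distr S.r_distr)
qed

section \<open>The path algebra of a finite quiver\<close>

context fin_digraph
begin

abbreviation "P \<equiv> path_algebra G"

lemma qpaths_iff: "(j, w, i) \<in> qpaths G \<longleftrightarrow> awalk i (rev w) j"
  by (simp add: qpaths_def)

lemma qpaths_Nil: "(j, [], i) \<in> qpaths G \<longleftrightarrow> j \<in> verts G \<and> i = j"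
  by (auto simp: qpaths_iff awalk_Nil_iff)

lemma qpaths_append: "(j, u, m) \<in> qpaths G \<Longrightarrow> (m, v, i) \<in> qpaths G \<Longrightarrow> (j, u @ v, i) \<in> qpaths G"
  by (auto simp: qpaths_iff)

lemma qpaths_Cons:
  assumes "(j, x # u, i) \<in> qpaths G"
  shows "x \<in> arcs G" "j = head G x" "(tail G x, u, i) \<in> qpaths G"
  using assms by (auto simp: qpaths_iff awalk_Cons_iff arc_to_ends_def)

lemma qpaths_snoc:
  assumes "(j, u @ [x], i) \<in> qpaths G"
  shows "x \<in> arcs G" "i = tail G x" "(j, u, head G x) \<in> qpaths G"
  using assms by (auto simp: qpaths_iff awalk_Cons_iff)

lemma qpaths_verts:
  assumes "(j, w, i) \<in> qpaths G"
  shows "j \<in> verts G" "i \<in> verts G"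
  using assms by (auto simp: qpaths_iff)

lemma qpaths_arcs: "(j, w, i) \<in> qpaths G \<Longrightarrow> set w \<subseteq> arcs G"
  by (simp add: qpaths_iff awalk_def)

lemma path_sel:
  "f \<in> carrier P \<longleftrightarrow> finite {q. f q \<noteq> 0} \<and> {q. f q \<noteq> 0} \<subseteq> qpaths G"
  "(f \<oplus>\<^bsub>P\<^esub> g) = (\<lambda>q. f q + g q)"
  "\<zero>\<^bsub>P\<^esub> = (\<lambda>q. 0)"
  "c \<odot>\<^bsub>P\<^esub> f = (\<lambda>q. c * f q)"
  by (simp_all add: path_algebra_def)

lemma path_mult: "(f \<otimes>\<^bsub>P\<^esub> g) (j, w, i) =
    (\<Sum>l\<le>length w. \<Sum>m\<in>verts G. f (j, take l w, m) * g (m, drop l w, i))"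
  by (simp add: path_algebra_def)

lemma path_one: "\<one>\<^bsub>P\<^esub> (j, w, i) = (if j \<in> verts G \<and> w = [] \<and> i = j then 1 else 0)"
  by (simp add: path_algebra_def)

lemma path_support: "f \<in> carrier P \<Longrightarrow> f q \<noteq> 0 \<Longrightarrow> q \<in> qpaths G"
  by (auto simp: path_sel)

lemma path_add_closed: "f \<in> carrier P \<Longrightarrow> g \<in> carrier P \<Longrightarrow> f \<oplus>\<^bsub>P\<^esub> g \<in> carrier P"
proof -
  assume fg: "f \<in> carrier P" "g \<in> carrier P"
  have "{q. f q + g q \<noteq> 0} \<subseteq> {q. f q \<noteq> 0} \<union> {q. g q \<noteq> 0}" by auto
  with fg show ?thesis
    unfolding path_sel by (blast intro: finite_subset[of _ "{q. f q \<noteq> 0} \<union> {q. g q \<noteq> 0}"])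
qed

lemma path_smult_closed: "f \<in> carrier P \<Longrightarrow> c \<odot>\<^bsub>P\<^esub> f \<in> carrier P"
  unfolding path_sel by (auto intro: finite_subset[of _ "{q. f q \<noteq> 0}"])

lemma path_mult_nonzero:
  assumes "(f \<otimes>\<^bsub>P\<^esub> g) (j, w, i) \<noteq> 0"
  shows "\<exists>l m. l \<le> length w \<and> m \<in> verts G \<and> f (j, take l w, m) \<noteq> 0 \<and> g (m, drop l w, i) \<noteq> 0"
proof -
  obtain l where l: "l \<le> length w" "(\<Sum>m\<in>verts G. f (j, take l w, m) * g (m, drop l w, i)) \<noteq> 0"
    using assms unfolding path_mult by (metis (lifting) atMost_iff sum.not_neutral_contains_not_neutral)
  obtain m where "m \<in> verts G" "f (j, take l w, m) * g (m, drop l w, i) \<noteq> 0"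
    using l(2) by (metis (lifting) sum.not_neutral_contains_not_neutral)
  then show ?thesis using l(1) by auto
qed

text \<open>The support lies in the set of concatenations of words from the two finite supports, and
  the shared middle vertex makes each contributing concatenation a path.\<close>

lemma path_mult_closed:
  assumes f: "f \<in> carrier P" and g: "g \<in> carrier P"
  shows "f \<otimes>\<^bsub>P\<^esub> g \<in> carrier P"
proof -
  let ?F = "(\<lambda>((j, u, m), (m', v, i)). (j, u @ v, i)) ` ({q. f q \<noteq> 0} \<times> {q. g q \<noteq> 0})"
  have "(j, w, i) \<in> ?F \<and> (j, w, i) \<in> qpaths G" if nz: "(f \<otimes>\<^bsub>P\<^esub> g) (j, w, i) \<noteq> 0" for j w i
  proof -
    obtain l m where lm: "f (j, take l w, m) \<noteq> 0" "g (m, drop l w, i) \<noteq> 0"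
      using path_mult_nonzero[OF nz] by blast
    then have "(j, w, i) \<in> ?F"
      by (intro image_eqI[of _ _ "((j, take l w, m), (m, drop l w, i))"]) simp_all
    moreover have "(j, w, i) \<in> qpaths G"
      using qpaths_append[OF path_support[OF f lm(1)] path_support[OF g lm(2)]] by simp
    ultimately show ?thesis by blast
  qed
  then have "{q. (f \<otimes>\<^bsub>P\<^esub> g) q \<noteq> 0} \<subseteq> ?F" "{q. (f \<otimes>\<^bsub>P\<^esub> g) q \<noteq> 0} \<subseteq> qpaths G"
    by auto
  moreover have "finite ?F" using f g unfolding path_sel by blast
  ultimately show ?thesis unfolding path_sel using finite_subset by blast
qed

lemma path_one_closed: "\<one>\<^bsub>P\<^esub> \<in> carrier P"
proof -
  have "{q. \<one>\<^bsub>P\<^esub> q \<noteq> 0} \<subseteq> (\<lambda>j. (j, [], j)) ` verts G"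
    by (auto simp: path_one split: if_splits)
  then show ?thesis
    unfolding path_sel using finite_subset[OF _ finite_imageI[OF finite_verts]] by (auto simp: qpaths_Nil)
qed

text \<open>Both bracketings sum over two cut points of the word and the two intermediate vertices
  at the cuts.\<close>

lemma path_mult_assoc: "(f \<otimes>\<^bsub>P\<^esub> g) \<otimes>\<^bsub>P\<^esub> h = f \<otimes>\<^bsub>P\<^esub> (g \<otimes>\<^bsub>P\<^esub> h)"
proof (rule ext, clarify)
  fix j i :: 'a and w :: "'b list"
  let ?V = "verts G" and ?n = "length w"
  \<comment> \<open>The contribution of the cut points l' \<le> l.\<close>
  define S where "S l' l = (\<Sum>m'\<in>?V. \<Sum>m\<in>?V. f (j, take l' w, m') * (g (m', take (l - l') (drop l' w), m) * h (m, drop l w, i)))"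
    for l' l
  have "((f \<otimes>\<^bsub>P\<^esub> g) \<otimes>\<^bsub>P\<^esub> h) (j, w, i) = (\<Sum>l\<le>?n. \<Sum>l'\<le>l. S l' l)"
    unfolding path_mult
  proof (rule sum.cong[OF refl])
    fix l assume "l \<in> {..?n}"
    then have l: "length (take l w) = l" by simp
    have "(\<Sum>m\<in>?V. (\<Sum>l'\<le>length (take l w). \<Sum>m'\<in>?V. f (j, take l' (take l w), m') * g (m', drop l' (take l w), m))
        * h (m, drop l w, i)) =
      (\<Sum>m\<in>?V. \<Sum>l'\<le>l. \<Sum>m'\<in>?V. f (j, take l' w, m') * (g (m', take (l - l') (drop l' w), m) * h (m, drop l w, i)))"
      unfolding l by (intro sum.cong refl)
        (simp add: sum_distrib_right drop_take min_absorb1 mult.assoc)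
    also have "\<dots> = (\<Sum>l'\<le>l. \<Sum>m\<in>?V. \<Sum>m'\<in>?V. f (j, take l' w, m') * (g (m', take (l - l') (drop l' w), m) * h (m, drop l w, i)))"
      by (rule sum.swap)
    also have "\<dots> = (\<Sum>l'\<le>l. S l' l)"
      unfolding S_def by (intro sum.cong refl sum.swap)
    finally show "(\<Sum>m\<in>?V. (\<Sum>l'\<le>length (take l w). \<Sum>m'\<in>?V. f (j, take l' (take l w), m') * g (m', drop l' (take l w), m))
        * h (m, drop l w, i)) = (\<Sum>l'\<le>l. S l' l)" .
  qed
  \<comment> \<open>The pair l' \<le> l is reindexed by l' and the length l'' = l - l' of the middle
    piece.\<close>
  also have "\<dots> = (\<Sum>l'\<le>?n. \<Sum>l''\<le>?n - l'. S l' (l' + l''))"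
    unfolding sum.Sigma[OF finite_atMost ballI[OF finite_atMost]]
    by (rule sum.reindex_bij_witness[of _ "\<lambda>(l', l''). (l' + l'', l')" "\<lambda>(l, l'). (l', l - l')"]) auto
  also have "\<dots> = (f \<otimes>\<^bsub>P\<^esub> (g \<otimes>\<^bsub>P\<^esub> h)) (j, w, i)"
    unfolding path_mult
  proof (rule sum.cong[OF refl])
    fix l' assume "l' \<in> {..?n}"
    have "(\<Sum>l''\<le>?n - l'. S l' (l' + l'')) = (\<Sum>m'\<in>?V. \<Sum>l''\<le>?n - l'. \<Sum>m\<in>?V.
        f (j, take l' w, m') * (g (m', take (l' + l'' - l') (drop l' w), m) * h (m, drop (l' + l'') w, i)))"
      unfolding S_def by (rule sum.swap)
    also have "\<dots> = (\<Sum>m'\<in>?V. f (j, take l' w, m') * (\<Sum>l''\<le>length (drop l' w). \<Sum>m\<in>?V.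
        g (m', take l'' (drop l' w), m) * h (m, drop l'' (drop l' w), i)))"
      by (intro sum.cong refl) (simp add: sum_distrib_left add.commute)
    finally show "(\<Sum>l''\<le>?n - l'. S l' (l' + l'')) = \<dots>" .
  qed
  finally show "((f \<otimes>\<^bsub>P\<^esub> g) \<otimes>\<^bsub>P\<^esub> h) (j, w, i) = (f \<otimes>\<^bsub>P\<^esub> (g \<otimes>\<^bsub>P\<^esub> h)) (j, w, i)" .
qed

text \<open>Only the empty prefix and the middle vertex j contribute. If j is not a vertex of the
  quiver, f vanishes at the word anyway, since the ends of a path are vertices.\<close>

lemma path_one_left:
  assumes "f \<in> carrier P"
  shows "\<one>\<^bsub>P\<^esub> \<otimes>\<^bsub>P\<^esub> f = f"
proof (rule ext, clarify)
  fix j i :: 'a and w :: "'b list"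
  have "(\<Sum>m\<in>verts G. \<one>\<^bsub>P\<^esub> (j, take l w, m) * f (m, drop l w, i)) =
      (if l = 0 then if j \<in> verts G then f (j, w, i) else 0 else 0)" if "l \<le> length w" for l
  proof (cases "l = 0")
    case True
    have "(\<Sum>m\<in>verts G. \<one>\<^bsub>P\<^esub> (j, take l w, m) * f (m, drop l w, i)) =
        (\<Sum>m\<in>verts G. if j = m then f (j, w, i) else 0)"
      using True by (intro sum.cong refl) (simp add: path_one)
    then show ?thesis using True by (simp add: sum.delta')
  next
    case False
    with that have "take l w \<noteq> []" by auto
    then show ?thesis using False by (simp add: path_one)
  qed
  then have "(\<one>\<^bsub>P\<^esub> \<otimes>\<^bsub>P\<^esub> f) (j, w, i) = (\<Sum>l\<le>length w. if l = 0 then if j \<in> verts G then f (j, w, i) else 0 else 0)"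
    unfolding path_mult by (intro sum.cong) simp_all
  also have "\<dots> = f (j, w, i)"
    using path_support[OF assms, of "(j, w, i)"] qpaths_verts[of j w i] by (auto simp: sum.delta)
  finally show "(\<one>\<^bsub>P\<^esub> \<otimes>\<^bsub>P\<^esub> f) (j, w, i) = f (j, w, i)" .
qed

lemma path_one_right:
  assumes "f \<in> carrier P"
  shows "f \<otimes>\<^bsub>P\<^esub> \<one>\<^bsub>P\<^esub> = f"
proof (rule ext, clarify)
  fix j i :: 'a and w :: "'b list"
  have "(\<Sum>m\<in>verts G. f (j, take l w, m) * \<one>\<^bsub>P\<^esub> (m, drop l w, i)) =
      (if l = length w then if i \<in> verts G then f (j, w, i) else 0 else 0)" if "l \<le> length w" for l
  proof (cases "l = length w")
    case True
    have "(\<Sum>m\<in>verts G. f (j, take l w, m) * \<one>\<^bsub>P\<^esub> (m, drop l w, i)) =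
        (\<Sum>m\<in>verts G. if i = m then f (j, w, i) else 0)"
      using True by (intro sum.cong refl) (simp add: path_one)
    then show ?thesis using True by (simp add: sum.delta')
  next
    case False
    with that have "drop l w \<noteq> []" by auto
    then show ?thesis using False by (simp add: path_one)
  qed
  then have "(f \<otimes>\<^bsub>P\<^esub> \<one>\<^bsub>P\<^esub>) (j, w, i) = (\<Sum>l\<le>length w. if l = length w then if i \<in> verts G then f (j, w, i) else 0 else 0)"
    unfolding path_mult by (intro sum.cong) simp_all
  also have "\<dots> = f (j, w, i)"
    using path_support[OF assms, of "(j, w, i)"] qpaths_verts[of j w i] by (auto simp: sum.delta)
  finally show "(f \<otimes>\<^bsub>P\<^esub> \<one>\<^bsub>P\<^esub>) (j, w, i) = f (j, w, i)" .
qed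

lemma path_distrib:
  "(f \<oplus>\<^bsub>P\<^esub> g) \<otimes>\<^bsub>P\<^esub> h = f \<otimes>\<^bsub>P\<^esub> h \<oplus>\<^bsub>P\<^esub> g \<otimes>\<^bsub>P\<^esub> h"
  "h \<otimes>\<^bsub>P\<^esub> (f \<oplus>\<^bsub>P\<^esub> g) = h \<otimes>\<^bsub>P\<^esub> f \<oplus>\<^bsub>P\<^esub> h \<otimes>\<^bsub>P\<^esub> g"
  by (rule ext, clarify, simp add: path_mult path_sel algebra_simps sum.distrib)+

lemma path_smult_mult:
  "(c \<odot>\<^bsub>P\<^esub> f) \<otimes>\<^bsub>P\<^esub> g = c \<odot>\<^bsub>P\<^esub> (f \<otimes>\<^bsub>P\<^esub> g)" "f \<otimes>\<^bsub>P\<^esub> (c \<odot>\<^bsub>P\<^esub> g) = c \<odot>\<^bsub>P\<^esub> (f \<otimes>\<^bsub>P\<^esub> g)"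
  by (rule ext, clarify, simp add: path_mult path_sel sum_distrib_left mult.assoc mult.left_commute)+

lemma path_neg_closed: "f \<in> carrier P \<Longrightarrow> (\<lambda>q. - f q) \<in> carrier P"
  using path_smult_closed[of f "- 1"] by (simp add: path_sel(4))

lemma ring_path_algebra: "ring P"
proof (rule ringI)
  show "abelian_group P"
  proof (rule abelian_groupI)
    fix f assume "f \<in> carrier P"
    then show "\<exists>g\<in>carrier P. g \<oplus>\<^bsub>P\<^esub> f = \<zero>\<^bsub>P\<^esub>"
      by (intro bexI[OF _ path_neg_closed]) (simp_all add: path_sel(2,3))
  qed (use path_add_closed in \<open>auto simp: path_sel(2,3) add.assoc add.commute\<close>, simp add: path_sel)
  show "monoid P"
    by (rule monoidI) (simp_all add: path_mult_closed path_one_closed path_mult_assoc path_one_left path_one_right)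
qed (simp_all add: path_distrib)

sublocale P: ring P
  by (rule ring_path_algebra)

lemma path_neg: "f \<in> carrier P \<Longrightarrow> \<ominus>\<^bsub>P\<^esub> f = (\<lambda>q. - f q)"
  by (rule P.minus_equality) (simp_all add: path_neg_closed path_sel(2,3))

lemma kalgebra_path: "kalgebra P"
  by (intro kalgebra.intro kalgebra_axioms.intro ring_path_algebra)
    (simp_all add: path_smult_closed path_smult_mult, simp_all add: path_sel algebra_simps)

end

section \<open>The quotient by the relations as an algebra over the field\<close>

context quadratic_quiver
begin

abbreviation "A \<equiv> quad_algebra G R"
abbreviation "J \<equiv> quad_ideal G R"
abbreviation "cls \<equiv> quad_class G R"

lemma R_carrier: "R \<subseteq> carrier P"
  using R_subset by (auto simp: path_part_def)

lemma ideal_J: "ideal J P"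
  unfolding quad_ideal_def by (rule P.genideal_ideal[OF R_carrier])

sublocale J: ideal J P
  by (rule ideal_J)

lemma R_in_J: "r \<in> R \<Longrightarrow> r \<in> J"
  using P.genideal_self[OF R_carrier] unfolding quad_ideal_def by blast

lemma A_sel:
  "carrier A = carrier (P Quot J)" "monoid.mult A = monoid.mult (P Quot J)" "\<one>\<^bsub>A\<^esub> = \<one>\<^bsub>P Quot J\<^esub>"
  "\<zero>\<^bsub>A\<^esub> = \<zero>\<^bsub>P Quot J\<^esub>" "add A = add (P Quot J)"
  "c \<odot>\<^bsub>A\<^esub> U = J <+>\<^bsub>P\<^esub> ((\<lambda>f. c \<odot>\<^bsub>P\<^esub> f) ` U)"
  by (simp_all add: quad_algebra_def Let_def)

lemma ring_A: "ring A"
  by (rule ring_transfer[OF J.quotient_is_ring]) (simp_all add: A_sel)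

sublocale A: ring A
  by (rule ring_A)

lemma cls_closed: "f \<in> carrier P \<Longrightarrow> cls f \<in> carrier A"
  unfolding quad_class_def A_sel by (auto simp: FactRing_def A_RCOSETS_def')

lemma cls_surj: "U \<in> carrier A \<Longrightarrow> \<exists>f\<in>carrier P. U = cls f"
  unfolding quad_class_def A_sel by (auto simp: FactRing_def A_RCOSETS_def')

lemma cls_add: "f \<in> carrier P \<Longrightarrow> g \<in> carrier P \<Longrightarrow> cls (f \<oplus>\<^bsub>P\<^esub> g) = cls f \<oplus>\<^bsub>A\<^esub> cls g"
  unfolding quad_class_def A_sel by (simp add: FactRing_def J.a_rcos_sum)

lemma cls_mult: "f \<in> carrier P \<Longrightarrow> g \<in> carrier P \<Longrightarrow> cls (f \<otimes>\<^bsub>P\<^esub> g) = cls f \<otimes>\<^bsub>A\<^esub> cls g"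
  unfolding quad_class_def A_sel by (simp add: FactRing_def J.rcoset_mult_add)

lemma cls_one: "cls \<one>\<^bsub>P\<^esub> = \<one>\<^bsub>A\<^esub>"
  unfolding quad_class_def A_sel by (simp add: FactRing_def)

lemma cls_zero: "f \<in> J \<Longrightarrow> cls f = \<zero>\<^bsub>A\<^esub>"
  unfolding quad_class_def A_sel by (simp add: FactRing_def J.a_rcos_const)

text \<open>The ideal is a subspace because c r = (c 1) r. It has to be added back after scaling,
  since scaling by zero collapses a coset to a point.\<close>

lemma cls_smult:
  assumes f: "f \<in> carrier P"
  shows "c \<odot>\<^bsub>A\<^esub> cls f = cls (c \<odot>\<^bsub>P\<^esub> f)"
proof -
  have cJ: "c \<odot>\<^bsub>P\<^esub> r \<in> J" if "r \<in> J" for r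
  proof -
    have r: "r \<in> carrier P" by (rule J.a_Hcarr[OF that])
    have "c \<odot>\<^bsub>P\<^esub> r = (c \<odot>\<^bsub>P\<^esub> \<one>\<^bsub>P\<^esub>) \<otimes>\<^bsub>P\<^esub> r"
      by (simp add: path_smult_mult path_one_left[OF r])
    then show ?thesis using J.I_l_closed[OF that path_smult_closed[OF path_one_closed]] by simp
  qed
  have sadd: "c \<odot>\<^bsub>P\<^esub> (r \<oplus>\<^bsub>P\<^esub> f) = c \<odot>\<^bsub>P\<^esub> r \<oplus>\<^bsub>P\<^esub> c \<odot>\<^bsub>P\<^esub> f" for r
    by (simp add: path_sel algebra_simps)
  have cf: "c \<odot>\<^bsub>P\<^esub> f \<in> carrier P" by (rule path_smult_closed[OF f])
  show ?thesis
    unfolding A_sel quad_class_def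
  proof (intro equalityI subsetI)
    fix x assume "x \<in> J <+>\<^bsub>P\<^esub> ((\<lambda>f. c \<odot>\<^bsub>P\<^esub> f) ` (J +>\<^bsub>P\<^esub> f))"
    then obtain r r' where r: "r \<in> J" "r' \<in> J" "x = r \<oplus>\<^bsub>P\<^esub> c \<odot>\<^bsub>P\<^esub> (r' \<oplus>\<^bsub>P\<^esub> f)"
      by (auto simp: set_add_def' a_r_coset_def')
    have "x = (r \<oplus>\<^bsub>P\<^esub> c \<odot>\<^bsub>P\<^esub> r') \<oplus>\<^bsub>P\<^esub> c \<odot>\<^bsub>P\<^esub> f"
      unfolding r(3) sadd by (simp add: path_sel add.assoc)
    then show "x \<in> J +>\<^bsub>P\<^esub> (c \<odot>\<^bsub>P\<^esub> f)"
      using J.a_closed[OF r(1) cJ[OF r(2)]] by (auto simp: a_r_coset_def')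
  next
    fix x assume "x \<in> J +>\<^bsub>P\<^esub> (c \<odot>\<^bsub>P\<^esub> f)"
    then obtain r where r: "r \<in> J" "x = r \<oplus>\<^bsub>P\<^esub> c \<odot>\<^bsub>P\<^esub> f"
      by (auto simp: a_r_coset_def')
    have "f \<in> J +>\<^bsub>P\<^esub> f" by (rule J.a_rcos_self[OF f])
    then show "x \<in> J <+>\<^bsub>P\<^esub> ((\<lambda>f. c \<odot>\<^bsub>P\<^esub> f) ` (J +>\<^bsub>P\<^esub> f))"
      using r by (auto simp: set_add_def')
  qed
qed

lemma kalgebra_A: "kalgebra A"
proof (intro kalgebra.intro kalgebra_axioms.intro ring_A)
  interpret p: kalgebra P by (rule kalgebra_path)
  note simps = cls_smult path_smult_closed cls_add[symmetric] cls_mult[symmetric] path_add_closed path_mult_closed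
    cls_closed path_smult_mult
  fix U V c d
  assume "U \<in> carrier A"
  then obtain f where f: "f \<in> carrier P" "U = cls f" using cls_surj by blast
  show "c \<odot>\<^bsub>A\<^esub> U \<in> carrier A" "(c + d) \<odot>\<^bsub>A\<^esub> U = c \<odot>\<^bsub>A\<^esub> U \<oplus>\<^bsub>A\<^esub> d \<odot>\<^bsub>A\<^esub> U"
    "(c * d) \<odot>\<^bsub>A\<^esub> U = c \<odot>\<^bsub>A\<^esub> (d \<odot>\<^bsub>A\<^esub> U)" "1 \<odot>\<^bsub>A\<^esub> U = U"
    using f p.smult_add_left[OF f(1)] p.smult_smult[OF f(1)] p.smult_one[OF f(1)] by (simp_all add: simps)
  assume "V \<in> carrier A"
  then obtain g where g: "g \<in> carrier P" "V = cls g" using cls_surj by blast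
  show "c \<odot>\<^bsub>A\<^esub> (U \<oplus>\<^bsub>A\<^esub> V) = c \<odot>\<^bsub>A\<^esub> U \<oplus>\<^bsub>A\<^esub> c \<odot>\<^bsub>A\<^esub> V" "(c \<odot>\<^bsub>A\<^esub> U) \<otimes>\<^bsub>A\<^esub> V = c \<odot>\<^bsub>A\<^esub> (U \<otimes>\<^bsub>A\<^esub> V)"
    "U \<otimes>\<^bsub>A\<^esub> (c \<odot>\<^bsub>A\<^esub> V) = c \<odot>\<^bsub>A\<^esub> (U \<otimes>\<^bsub>A\<^esub> V)"
    using f g p.smult_add_right[OF f(1) g(1)] by (simp_all add: simps)
qed

sublocale A: kalgebra A
  by (rule kalgebra_A)

end

section \<open>Finite sums and coordinates on subspaces\<close>

lemma abelian_group_field_ring: "abelian_group (field_ring :: 'f::field ring)"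
  by (rule abelian_groupI) (auto simp: field_ring_def intro: exI[of _ "- _"] left_minus)

lemma finsum_field_ring:
  assumes "finite S"
  shows "(\<Oplus>\<^bsub>field_ring\<^esub>i\<in>S. g i) = (\<Sum>i\<in>S. g i)"
proof -
  interpret F: abelian_group "field_ring" by (rule abelian_group_field_ring)
  have z: "\<zero>\<^bsub>field_ring\<^esub> = 0" by (simp add: field_ring_def)
  show ?thesis
    using assms by (induction S rule: finite_induct) (simp_all add: z Pi_def)
qed

lemma (in abelian_group) finsum_swap:
  assumes "finite S" "finite T" "\<And>i j. i \<in> S \<Longrightarrow> j \<in> T \<Longrightarrow> h i j \<in> carrier G"
  shows "(\<Oplus>i\<in>S. \<Oplus>j\<in>T. h i j) = (\<Oplus>j\<in>T. \<Oplus>i\<in>S. h i j)"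
  using assms(1,3)
proof (induction S rule: finite_induct)
  case (insert s S)
  have "(\<Oplus>i\<in>insert s S. \<Oplus>j\<in>T. h i j) = (\<Oplus>j\<in>T. h s j) \<oplus> (\<Oplus>j\<in>T. \<Oplus>i\<in>S. h i j)"
    using insert by (subst finsum_insert) (auto intro!: finsum_closed)
  also have "\<dots> = (\<Oplus>j\<in>T. h s j \<oplus> (\<Oplus>i\<in>S. h i j))"
    using insert by (intro finsum_addf[symmetric]) (auto intro!: finsum_closed)
  also have "\<dots> = (\<Oplus>j\<in>T. \<Oplus>i\<in>insert s S. h i j)"
    using insert by (intro finsum_cong' refl) (auto intro!: finsum_closed)
  finally show ?case .
qed simp

text \<open>\<open>\<pi>\<close> records the images of the unit vectors under a linear projection of
  the coordinate space onto \<open>W\<close>. The induction removes a coordinate q: \<open>W\<close>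
  is the section w q = 0 together with, if some w q is nonzero, one further vector.\<close>

lemma subspace_coordinates:
  fixes W :: "('q \<Rightarrow> 'f::field) set"
  assumes "finite Q" and "\<And>w q. w \<in> W \<Longrightarrow> q \<notin> Q \<Longrightarrow> w q = 0"
    and "(\<lambda>q. 0) \<in> W" and "\<And>v w. v \<in> W \<Longrightarrow> w \<in> W \<Longrightarrow> (\<lambda>q. v q + w q) \<in> W"
    and "\<And>c w. w \<in> W \<Longrightarrow> (\<lambda>q. c * w q) \<in> W"
  shows "\<exists>\<pi>. (\<forall>q\<in>Q. \<pi> q \<in> W) \<and> (\<forall>w\<in>W. \<forall>s. w s = (\<Sum>q\<in>Q. w q * \<pi> q s))"
  using assms
proof (induction Q arbitrary: W rule: finite_induct)
  case empty
  then show ?case by auto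
next
  case (insert q Q)
  note prems = insert.prems
  define W' where "W' = {w \<in> W. w q = 0}"
  have "\<exists>\<pi>. (\<forall>q\<in>Q. \<pi> q \<in> W') \<and> (\<forall>w\<in>W'. \<forall>s. w s = (\<Sum>q\<in>Q. w q * \<pi> q s))"
  proof (rule insert.IH)
    show "w r = 0" if "w \<in> W'" "r \<notin> Q" for w r
      using that insert.prems(1)[of w r] by (cases "r = q") (auto simp: W'_def)
  qed (use insert.prems in \<open>auto simp: W'_def\<close>)
  then obtain \<pi> where \<pi>: "\<And>q. q \<in> Q \<Longrightarrow> \<pi> q \<in> W'" "\<And>w s. w \<in> W' \<Longrightarrow> w s = (\<Sum>q\<in>Q. w q * \<pi> q s)"
    by blast
  have sums: "(\<lambda>s. \<Sum>r\<in>Q'. c r * \<pi> r s) \<in> W" if "Q' \<subseteq> Q" for Q' c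
    using finite_subset[OF that insert.hyps(1)] that
  proof (induction Q' rule: finite_induct)
    case empty
    then show ?case using prems(2) by simp
  next
    case (insert r Q')
    then have "(\<lambda>s. c r * \<pi> r s + (\<Sum>r\<in>Q'. c r * \<pi> r s)) \<in> W"
      using \<pi>(1)[of r] prems(3)[OF prems(4)] by (auto simp: W'_def)
    then show ?case using insert by simp
  qed
  show ?case
  proof (cases "\<exists>w\<in>W. w q \<noteq> 0")
    case True
    then obtain w1 where w1: "w1 \<in> W" "w1 q \<noteq> 0" by blast
    define w0 where "w0 = (\<lambda>s. inverse (w1 q) * w1 s)"
    have w0: "w0 \<in> W" "w0 q = 1" using w1 insert.prems(4) by (simp_all add: w0_def)
    \<comment> \<open>Expanding w - (w q) w0 along \<open>\<pi>\<close> produces the coordinates w r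
      - (w q) (w0 r); collecting the multiples of w q leaves this vector as the image of the unit
      vector at q.\<close>
    define \<rho> where "\<rho> = (\<lambda>s. w0 s + (- 1) * (\<Sum>r\<in>Q. w0 r * \<pi> r s))"
    have \<rho>: "\<rho> \<in> W" unfolding \<rho>_def using w0 sums[OF subset_refl] insert.prems(3,4) by blast
    define \<sigma> where "\<sigma> = (\<lambda>r. if r = q then \<rho> else \<pi> r)"
    have "w s = (\<Sum>r\<in>insert q Q. w r * \<sigma> r s)" if w: "w \<in> W" for w s
    proof -
      have "(\<lambda>s. w s + (- w q) * w0 s) \<in> W" using w w0 insert.prems(3,4) by blast
      then have "(\<lambda>s. w s + (- w q) * w0 s) \<in> W'" by (simp add: W'_def w0)
      from \<pi>(2)[OF this, of s]
      have "w s + (- w q) * w0 s = (\<Sum>r\<in>Q. w r * \<pi> r s) - w q * (\<Sum>r\<in>Q. w0 r * \<pi> r s)"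
        by (simp add: algebra_simps sum.distrib sum_distrib_left sum_negf sum_subtractf)
      moreover have "(\<Sum>r\<in>Q. w r * \<sigma> r s) = (\<Sum>r\<in>Q. w r * \<pi> r s)"
        using insert.hyps by (intro sum.cong refl) (auto simp: \<sigma>_def)
      ultimately show ?thesis
        using insert.hyps by (simp add: \<sigma>_def \<rho>_def algebra_simps)
    qed
    moreover have "\<forall>r\<in>insert q Q. \<sigma> r \<in> W" using \<rho> \<pi>(1) by (auto simp: \<sigma>_def W'_def)
    ultimately show ?thesis by blast
  next
    case False
    then have "W' = W" by (auto simp: W'_def)
    \<comment> \<open>All elements of \<open>W\<close> vanish at q, so the vector placed there is
      only a default, chosen in \<open>W\<close>.\<close>
    define \<sigma> where "\<sigma> = (\<lambda>r. if r = q then (\<lambda>q. 0) else \<pi> r)"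
    have "w s = (\<Sum>r\<in>insert q Q. w r * \<sigma> r s)" if "w \<in> W" for w s
    proof -
      have "(\<Sum>r\<in>Q. w r * \<sigma> r s) = (\<Sum>r\<in>Q. w r * \<pi> r s)"
        using insert.hyps by (intro sum.cong refl) (auto simp: \<sigma>_def)
      then show ?thesis using \<pi>(2)[of w s] that insert.hyps \<open>W' = W\<close> by (simp add: \<sigma>_def)
    qed
    moreover have "\<forall>r\<in>insert q Q. \<sigma> r \<in> W"
      using \<pi>(1) prems(2) \<open>W' = W\<close> by (auto simp: \<sigma>_def)
    ultimately show ?thesis by blast
  qed
qed

section \<open>Homogeneous parts and the spaces W_p\<close>

context quadratic_quiver
begin

abbreviation V :: "nat \<Rightarrow> ('v, 'b, 'f) pelem set" where "V \<equiv> path_part G"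
abbreviation W :: "int \<Rightarrow> ('v, 'b, 'f) pelem set" where "W \<equiv> koszul_W G R"

lemma V_iff: "f \<in> V p \<longleftrightarrow> f \<in> carrier P \<and> (\<forall>j w i. f (j, w, i) \<noteq> 0 \<longrightarrow> length w = p)"
  by (auto simp: path_part_def)

lemma V_carrier: "f \<in> V p \<Longrightarrow> f \<in> carrier P"
  by (simp add: V_iff)

lemma V_length: "f \<in> V p \<Longrightarrow> length w \<noteq> p \<Longrightarrow> f (j, w, i) = 0"
  by (auto simp: V_iff)

lemma V_zero: "\<zero>\<^bsub>P\<^esub> \<in> V p"
  by (simp add: V_iff) (simp add: path_sel)

lemma V_add: "f \<in> V p \<Longrightarrow> g \<in> V p \<Longrightarrow> f \<oplus>\<^bsub>P\<^esub> g \<in> V p"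
  unfolding V_iff using path_add_closed by (auto simp: path_sel(2)) (metis add.right_neutral add.left_neutral)

lemma V_smult:
  assumes f: "f \<in> V p" shows "c \<odot>\<^bsub>P\<^esub> f \<in> V p"
  unfolding V_iff
proof (intro conjI allI impI)
  show "c \<odot>\<^bsub>P\<^esub> f \<in> carrier P" by (rule path_smult_closed[OF V_carrier[OF f]])
  fix j w i assume "(c \<odot>\<^bsub>P\<^esub> f) (j, w, i) \<noteq> 0"
  then have "f (j, w, i) \<noteq> 0" by (auto simp: path_sel(4))
  then show "length w = p" using f unfolding V_iff by blast
qed

lemma V_mult:
  assumes f: "f \<in> V a" and g: "g \<in> V b"
  shows "f \<otimes>\<^bsub>P\<^esub> g \<in> V (a + b)"
  unfolding V_iff
proof (intro conjI allI impI)
  show "f \<otimes>\<^bsub>P\<^esub> g \<in> carrier P" using f g V_carrier path_mult_closed by blast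
  fix j w i assume "(f \<otimes>\<^bsub>P\<^esub> g) (j, w, i) \<noteq> 0"
  then obtain l m where lm: "l \<le> length w" "f (j, take l w, m) \<noteq> 0" "g (m, drop l w, i) \<noteq> 0"
    using path_mult_nonzero by blast
  then have "length (take l w) = a" "length (drop l w) = b" using f g unfolding V_iff by blast+
  then show "length w = a + b" using lm(1) by simp
qed

lemma V_one: "\<one>\<^bsub>P\<^esub> \<in> V 0"
  by (simp add: V_iff path_one_closed path_one)

lemma V0_support: "c \<in> V 0 \<Longrightarrow> c (j, w, m) \<noteq> 0 \<Longrightarrow> w = [] \<and> m = j \<and> j \<in> verts G"
  using path_support[OF V_carrier, of c 0 "(j, w, m)"] V_length[of c 0 w j m]
  by (cases "w = []") (auto simp: qpaths_Nil)

text \<open>An element of degree 0 is a function on the vertices; it multiplies a path by its value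
  at the target when placed on the left, and at the source when placed on the right.\<close>

lemma V0_mult_left:
  assumes c: "c \<in> V 0"
  shows "(c \<otimes>\<^bsub>P\<^esub> f) (j, w, i) = c (j, [], j) * f (j, w, i)"
proof -
  have "(\<Sum>m\<in>verts G. c (j, take l w, m) * f (m, drop l w, i)) =
      (if l = 0 then c (j, [], j) * f (j, w, i) else 0)" if "l \<le> length w" for l
  proof (cases "l = 0")
    case True
    have "(\<Sum>m\<in>verts G. c (j, take l w, m) * f (m, drop l w, i)) =
        (\<Sum>m\<in>verts G. if m = j then c (j, [], j) * f (j, w, i) else 0)"
      using True V0_support[OF c, of j "[]"] by (intro sum.cong refl) auto
    then show ?thesis using True V0_support[OF c, of j "[]" j] by (auto simp: sum.delta)
  next
    case False
    with that have "take l w \<noteq> []" by auto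
    then have "c (j, take l w, m) = 0" for m using V0_support[OF c] by blast
    then show ?thesis using False by simp
  qed
  then have "(c \<otimes>\<^bsub>P\<^esub> f) (j, w, i) = (\<Sum>l\<le>length w. if l = 0 then c (j, [], j) * f (j, w, i) else 0)"
    unfolding path_mult by (intro sum.cong) simp_all
  then show ?thesis by (simp add: sum.delta)
qed

lemma V0_mult_right:
  assumes c: "c \<in> V 0"
  shows "(f \<otimes>\<^bsub>P\<^esub> c) (j, w, i) = f (j, w, i) * c (i, [], i)"
proof -
  have "(\<Sum>m\<in>verts G. f (j, take l w, m) * c (m, drop l w, i)) =
      (if l = length w then f (j, w, i) * c (i, [], i) else 0)" if "l \<le> length w" for l
  proof (cases "l = length w")
    case True
    have "(\<Sum>m\<in>verts G. f (j, take l w, m) * c (m, drop l w, i)) =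
        (\<Sum>m\<in>verts G. if m = i then f (j, w, i) * c (i, [], i) else 0)"
      using True V0_support[OF c, of _ "[]" i] by (intro sum.cong refl) auto
    then show ?thesis using True V0_support[OF c, of i "[]" i] by (auto simp: sum.delta)
  next
    case False
    with that have "drop l w \<noteq> []" by auto
    then have "c (m, drop l w, i) = 0" for m using V0_support[OF c] by blast
    then show ?thesis using False by simp
  qed
  then have "(f \<otimes>\<^bsub>P\<^esub> c) (j, w, i) = (\<Sum>l\<le>length w. if l = length w then f (j, w, i) * c (i, [], i) else 0)"
    unfolding path_mult by (intro sum.cong) simp_all
  then show ?thesis by (simp add: sum.delta)
qed

definition k_subspace :: "nat \<Rightarrow> ('v, 'b, 'f) pelem set \<Rightarrow> bool" where
  "k_subspace p S \<longleftrightarrow> S \<subseteq> V p \<and> \<zero>\<^bsub>P\<^esub> \<in> S \<and> (\<forall>f\<in>S. \<forall>g\<in>S. f \<oplus>\<^bsub>P\<^esub> g \<in> S) \<and>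
     (\<forall>c. \<forall>f\<in>S. c \<odot>\<^bsub>P\<^esub> f \<in> S) \<and> (\<forall>c\<in>V 0. \<forall>f\<in>S. c \<otimes>\<^bsub>P\<^esub> f \<in> S \<and> f \<otimes>\<^bsub>P\<^esub> c \<in> S)"

lemma R_add: "r \<in> R \<Longrightarrow> s \<in> R \<Longrightarrow> r \<oplus>\<^bsub>P\<^esub> s \<in> R"
  using subgroup.m_closed[OF R_subgroup] by simp

lemma R_zero: "\<zero>\<^bsub>P\<^esub> \<in> R"
  using subgroup.one_closed[OF R_subgroup] by simp

text \<open>A sub-bimodule over k is a subspace, because scalar multiples of the unit lie in
  k.\<close>

lemma R_smult:
  assumes "r \<in> R" shows "c \<odot>\<^bsub>P\<^esub> r \<in> R"
  using R_left[OF V_smult[OF V_one] assms, of c] assms R_carrier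
  by (simp add: path_smult_mult path_one_left subset_iff)

text \<open>Zero and negatives need no cases: zero is a product of zeros, and the sign of a
  generator is absorbed into its first factor.\<close>

lemma relation_part_induct [consumes 1, case_names gen add]:
  assumes w: "w \<in> relation_part G R i j"
    and gen: "\<And>f r g. f \<in> V i \<Longrightarrow> r \<in> R \<Longrightarrow> g \<in> V j \<Longrightarrow> Q (f \<otimes>\<^bsub>P\<^esub> r \<otimes>\<^bsub>P\<^esub> g)"
    and add: "\<And>v w. v \<in> relation_part G R i j \<Longrightarrow> w \<in> relation_part G R i j \<Longrightarrow> Q v \<Longrightarrow> Q w \<Longrightarrow> Q (v \<oplus>\<^bsub>P\<^esub> w)"
  shows "Q w"
  using w unfolding relation_part_def
proof (induction rule: generate.induct)
  case one
  have "\<zero>\<^bsub>P\<^esub> \<otimes>\<^bsub>P\<^esub> \<zero>\<^bsub>P\<^esub> \<otimes>\<^bsub>P\<^esub> \<zero>\<^bsub>P\<^esub> = \<zero>\<^bsub>P\<^esub>" by simp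
  then show ?case using gen[OF V_zero R_zero V_zero] by simp
next
  case (incl h)
  then show ?case using gen by blast
next
  case (inv h)
  then obtain f r g where h: "h = f \<otimes>\<^bsub>P\<^esub> r \<otimes>\<^bsub>P\<^esub> g" "f \<in> V i" "r \<in> R" "g \<in> V j" by blast
  have c: "f \<in> carrier P" "r \<in> carrier P" "g \<in> carrier P" using h V_carrier R_carrier by blast+
  have "\<ominus>\<^bsub>P\<^esub> f \<in> V i"
    using V_smult[OF h(2), of "- 1"] path_neg[OF c(1)] by (simp add: path_sel(4))
  moreover have "inv\<^bsub>add_monoid P\<^esub> h = (\<ominus>\<^bsub>P\<^esub> f) \<otimes>\<^bsub>P\<^esub> r \<otimes>\<^bsub>P\<^esub> g"
    unfolding h(1) using c by (simp add: a_inv_def[symmetric] P.l_minus)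
  ultimately show ?case using gen h(3,4) by simp
next
  case (eng v w)
  then show ?case using add unfolding relation_part_def by simp
qed

lemma relation_part_gen:
  "f \<in> V i \<Longrightarrow> r \<in> R \<Longrightarrow> g \<in> V j \<Longrightarrow> f \<otimes>\<^bsub>P\<^esub> r \<otimes>\<^bsub>P\<^esub> g \<in> relation_part G R i j"
  unfolding relation_part_def by (rule generate.incl) blast

lemma relation_part_add:
  "v \<in> relation_part G R i j \<Longrightarrow> w \<in> relation_part G R i j \<Longrightarrow> v \<oplus>\<^bsub>P\<^esub> w \<in> relation_part G R i j"
  unfolding relation_part_def using generate.eng[of v "add_monoid P"] by simp

lemma relation_part_zero: "\<zero>\<^bsub>P\<^esub> \<in> relation_part G R i j"
  unfolding relation_part_def using generate.one[of "add_monoid P"] by simp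

text \<open>Scalars and vertex elements are absorbed into the outer factors of the
  generators.\<close>

lemma k_subspace_relation_part: "k_subspace (i + 2 + j) (relation_part G R i j)"
proof -
  have sub: "w \<in> V (i + 2 + j)" if "w \<in> relation_part G R i j" for w
    using that
  proof (induction rule: relation_part_induct)
    case (gen f r g)
    then have "r \<in> V 2" using R_subset by blast
    then show ?case using V_mult[OF V_mult[OF gen(1)] gen(3)] by blast
  qed (rule V_add)
  have smult: "c \<odot>\<^bsub>P\<^esub> w \<in> relation_part G R i j" if "w \<in> relation_part G R i j" for c w
    using that
  proof (induction rule: relation_part_induct)
    case (gen f r g)
    then show ?case
      using relation_part_gen[OF V_smult[OF gen(1), of c] gen(2,3)] by (simp add: path_smult_mult)
  next
    case (add v w)
    then have "c \<odot>\<^bsub>P\<^esub> v \<oplus>\<^bsub>P\<^esub> c \<odot>\<^bsub>P\<^esub> w \<in> relation_part G R i j" by (intro relation_part_add)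
    then show ?case by (simp add: path_sel algebra_simps)
  qed
  have left: "c \<otimes>\<^bsub>P\<^esub> w \<in> relation_part G R i j" if "w \<in> relation_part G R i j" "c \<in> V 0" for c w
    using that(1)
  proof (induction rule: relation_part_induct)
    case (gen f r g)
    then show ?case
      using relation_part_gen[OF V_mult[OF that(2) gen(1), simplified] gen(2,3)]
      by (simp add: path_mult_assoc)
  next
    case (add v w)
    then show ?case by (simp add: path_distrib relation_part_add)
  qed
  have right: "w \<otimes>\<^bsub>P\<^esub> c \<in> relation_part G R i j" if "w \<in> relation_part G R i j" "c \<in> V 0" for c w
    using that(1)
  proof (induction rule: relation_part_induct)
    case (gen f r g)
    then show ?case
      using relation_part_gen[OF gen(1,2) V_mult[OF gen(3) that(2), simplified]]
      by (simp add: path_mult_assoc)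
  next
    case (add v w)
    then show ?case by (simp add: path_distrib relation_part_add)
  qed
  show ?thesis
    unfolding k_subspace_def using sub smult left right relation_part_add relation_part_zero by blast
qed

lemma k_subspace_V: "k_subspace p (V p)"
  unfolding k_subspace_def using V_add V_smult V_zero V_mult[of _ 0 _ p] V_mult[of _ p _ 0] by auto

lemma koszul_W_relation:
  assumes "2 \<le> p" "i + 2 + j = nat p" "w \<in> W p"
  shows "w \<in> relation_part G R i j"
  using assms unfolding koszul_W_def by auto

lemma koszul_W_I:
  assumes "2 \<le> p" "\<And>i j. i + 2 + j = nat p \<Longrightarrow> w \<in> relation_part G R i j"
  shows "w \<in> W p"
  using assms unfolding koszul_W_def by auto

lemma k_subspace_W: "k_subspace (nat p) (W p)"
proof -
  consider "p < 0" | "0 \<le> p" "p < 2" | "2 \<le> p" by linarith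
  then show ?thesis
  proof cases
    case 1
    have "c \<otimes>\<^bsub>P\<^esub> \<zero>\<^bsub>P\<^esub> = \<zero>\<^bsub>P\<^esub>" "\<zero>\<^bsub>P\<^esub> \<otimes>\<^bsub>P\<^esub> c = \<zero>\<^bsub>P\<^esub>" if "c \<in> V 0" for c
      using V_carrier[OF that] by simp_all
    then show ?thesis
      using 1 V_zero by (auto simp: koszul_W_def k_subspace_def) (simp_all add: path_sel)
  next
    case 2
    then show ?thesis using k_subspace_V by (simp add: koszul_W_def)
  next
    case 3
    have rel: "k_subspace (nat p) (relation_part G R i j)" if "i + 2 + j = nat p" for i j
      using k_subspace_relation_part[of i j] that by simp
    \<comment> \<open>The intersection runs over a nonempty family, so homogeneity can be inherited
      from one of its members.\<close>
    have ex: "0 + 2 + (nat p - 2) = nat p" using 3 by linarith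
    show ?thesis
      unfolding k_subspace_def
    proof (intro conjI subsetI ballI allI)
      fix f assume "f \<in> W p"
      then show "f \<in> V (nat p)"
        using koszul_W_relation[OF 3 ex] rel[OF ex] unfolding k_subspace_def by blast
    qed (rule koszul_W_I[OF 3]; use rel koszul_W_relation[OF 3] in \<open>unfold k_subspace_def; blast\<close>)+
  qed
qed

lemma W_V: "w \<in> W p \<Longrightarrow> w \<in> V (nat p)"
  and W_zero: "\<zero>\<^bsub>P\<^esub> \<in> W p"
  and W_add: "v \<in> W p \<Longrightarrow> w \<in> W p \<Longrightarrow> v \<oplus>\<^bsub>P\<^esub> w \<in> W p"
  and W_smult: "w \<in> W p \<Longrightarrow> c \<odot>\<^bsub>P\<^esub> w \<in> W p"
  and W_left: "d \<in> V 0 \<Longrightarrow> w \<in> W p \<Longrightarrow> d \<otimes>\<^bsub>P\<^esub> w \<in> W p"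
  and W_right: "d \<in> V 0 \<Longrightarrow> w \<in> W p \<Longrightarrow> w \<otimes>\<^bsub>P\<^esub> d \<in> W p"
  using k_subspace_W[of p] unfolding k_subspace_def by blast+

lemma W_carrier: "w \<in> W p \<Longrightarrow> w \<in> carrier P"
  by (rule V_carrier[OF W_V])

subsection \<open>Stripping arrows\<close>

lemma strip_additive:
  "left_strip G x (v \<oplus>\<^bsub>P\<^esub> w) = left_strip G x v \<oplus>\<^bsub>P\<^esub> left_strip G x w"
  "right_strip G x (v \<oplus>\<^bsub>P\<^esub> w) = right_strip G x v \<oplus>\<^bsub>P\<^esub> right_strip G x w"
  by (auto simp: left_strip_def right_strip_def path_sel(2) fun_eq_iff)

lemma left_strip_V:
  assumes w: "w \<in> V (Suc p)"
  shows "left_strip G x w \<in> V p"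
proof -
  have q: "(j, u, i) \<in> qpaths G \<and> length u = p \<and> (head G x, x # u, i) \<in> {q. w q \<noteq> 0} \<and> j = tail G x"
    if "left_strip G x w (j, u, i) \<noteq> 0" for j u i
  proof -
    have 1: "w (head G x, x # u, i) \<noteq> 0" "j = tail G x" using that by (auto simp: left_strip_def split: if_splits)
    then show ?thesis
      using path_support[OF V_carrier[OF w] 1(1)] V_length[OF w, of "x # u"] qpaths_Cons(3) by fastforce
  qed
  \<comment> \<open>Finiteness of the support: each stripped word arises from a word of w by
    deleting its first letter.\<close>
  have "{q. left_strip G x w q \<noteq> 0} \<subseteq> (\<lambda>(j, u, i). (tail G x, tl u, i)) ` {q. w q \<noteq> 0}"
  proof
    fix s assume s: "s \<in> {q. left_strip G x w q \<noteq> 0}"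
    obtain j u i where s': "s = (j, u, i)" by (cases s)
    show "s \<in> (\<lambda>(j, u, i). (tail G x, tl u, i)) ` {q. w q \<noteq> 0}"
      using q[of j u i] s unfolding s' by (intro image_eqI[of _ _ "(head G x, x # u, i)"]) auto
  qed
  moreover have "finite {q. w q \<noteq> 0}" using V_carrier[OF w] by (simp add: path_sel)
  ultimately have "finite {q. left_strip G x w q \<noteq> 0}" by (meson finite_imageI finite_subset)
  then show ?thesis unfolding V_iff path_sel using q by auto
qed

lemma right_strip_V:
  assumes w: "w \<in> V (Suc p)"
  shows "right_strip G x w \<in> V p"
proof -
  have q: "(j, u, i) \<in> qpaths G \<and> length u = p \<and> (j, u @ [x], tail G x) \<in> {q. w q \<noteq> 0} \<and> i = head G x"
    if "right_strip G x w (j, u, i) \<noteq> 0" for j u i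
  proof -
    have 1: "w (j, u @ [x], tail G x) \<noteq> 0" "i = head G x" using that by (auto simp: right_strip_def split: if_splits)
    then show ?thesis
      using path_support[OF V_carrier[OF w] 1(1)] V_length[OF w, of "u @ [x]"] qpaths_snoc(3) by fastforce
  qed
  have "{q. right_strip G x w q \<noteq> 0} \<subseteq> (\<lambda>(j, u, i). (j, butlast u, head G x)) ` {q. w q \<noteq> 0}"
  proof
    fix s assume s: "s \<in> {q. right_strip G x w q \<noteq> 0}"
    obtain j u i where s': "s = (j, u, i)" by (cases s)
    show "s \<in> (\<lambda>(j, u, i). (j, butlast u, head G x)) ` {q. w q \<noteq> 0}"
      using q[of j u i] s unfolding s' by (intro image_eqI[of _ _ "(j, u @ [x], tail G x)"]) auto
  qed
  moreover have "finite {q. w q \<noteq> 0}" using V_carrier[OF w] by (simp add: path_sel)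
  ultimately have "finite {q. right_strip G x w q \<noteq> 0}" by (meson finite_imageI finite_subset)
  then show ?thesis unfolding V_iff path_sel using q by auto
qed

text \<open>There is no arrow to remove in degree 0; below degree 2 double strips are therefore
  zero.\<close>

lemma strip_V0:
  assumes "w \<in> V 0"
  shows "left_strip G x w = \<zero>\<^bsub>P\<^esub>" "right_strip G x w = \<zero>\<^bsub>P\<^esub>"
  using V_length[OF assms] by (auto simp: left_strip_def right_strip_def path_sel(3) fun_eq_iff)

text \<open>The words of f are nonempty, so the first arrow of a product always belongs to f. In
  degree 0 the cut before the first letter would contribute as well.\<close>

lemma left_strip_mult:
  assumes f: "f \<in> V (Suc a)"
  shows "left_strip G x (f \<otimes>\<^bsub>P\<^esub> g) = left_strip G x f \<otimes>\<^bsub>P\<^esub> g"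
proof (rule ext, clarify)
  fix j i and u :: "'b list"
  have 0: "f (head G x, [], m) = 0" for m using V_length[OF f] by simp
  show "left_strip G x (f \<otimes>\<^bsub>P\<^esub> g) (j, u, i) = (left_strip G x f \<otimes>\<^bsub>P\<^esub> g) (j, u, i)"
    unfolding path_mult by (simp add: left_strip_def path_mult sum.atMost_Suc_shift 0 del: sum.atMost_Suc)
qed

lemma right_strip_mult:
  assumes g: "g \<in> V (Suc a)"
  shows "right_strip G x (f \<otimes>\<^bsub>P\<^esub> g) = f \<otimes>\<^bsub>P\<^esub> right_strip G x g"
proof (rule ext, clarify)
  fix j i and u :: "'b list"
  have 0: "g (m, [], tail G x) = 0" for m using V_length[OF g] by simp
  show "right_strip G x (f \<otimes>\<^bsub>P\<^esub> g) (j, u, i) = (f \<otimes>\<^bsub>P\<^esub> right_strip G x g) (j, u, i)"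
    unfolding path_mult by (simp add: right_strip_def path_mult 0)
qed

text \<open>On the side where an arrow is removed, a vertex element becomes the scalar given by its
  value at the outer end of that arrow; on the other side it commutes with the removal.\<close>

lemma strip_V0_mult:
  assumes c: "c \<in> V 0"
  shows "left_strip G x (c \<otimes>\<^bsub>P\<^esub> w) = c (head G x, [], head G x) \<odot>\<^bsub>P\<^esub> left_strip G x w"
    and "left_strip G x (w \<otimes>\<^bsub>P\<^esub> c) = left_strip G x w \<otimes>\<^bsub>P\<^esub> c"
    and "right_strip G x (w \<otimes>\<^bsub>P\<^esub> c) = c (tail G x, [], tail G x) \<odot>\<^bsub>P\<^esub> right_strip G x w"
    and "right_strip G x (c \<otimes>\<^bsub>P\<^esub> w) = c \<otimes>\<^bsub>P\<^esub> right_strip G x w"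
  by (auto simp: left_strip_def right_strip_def path_sel(4) fun_eq_iff V0_mult_left[OF c] V0_mult_right[OF c])

text \<open>With at least one letter in front of the relation, removing the first letter leaves the
  relation intact.\<close>

lemma left_strip_relation:
  assumes "w \<in> relation_part G R (Suc i) j"
  shows "left_strip G x w \<in> relation_part G R i j"
  using assms
proof (induction rule: relation_part_induct)
  case (gen f r g)
  then have "f \<otimes>\<^bsub>P\<^esub> r \<in> V (Suc (i + 2))" using V_mult[of f "Suc i" r 2] R_subset by auto
  then show ?case
    using relation_part_gen[OF left_strip_V[OF gen(1)] gen(2,3), of x]
    by (simp add: left_strip_mult[of _ "i + 2"] left_strip_mult[OF gen(1)])
next
  case (add v w)
  then show ?case by (simp add: strip_additive relation_part_add)
qed

lemma right_strip_relation:
  assumes "w \<in> relation_part G R i (Suc j)"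
  shows "right_strip G x w \<in> relation_part G R i j"
  using assms
proof (induction rule: relation_part_induct)
  case (gen f r g)
  then show ?case
    using relation_part_gen[OF gen(1,2) right_strip_V[OF gen(3)], of x]
    by (simp add: right_strip_mult[OF gen(3)])
next
  case (add v w)
  then show ?case by (simp add: strip_additive relation_part_add)
qed

text \<open>Each condition in degree p - 1 follows from the condition in degree p whose index on the
  stripped side is larger by one. For p = 2 the target is all of V and carries no such conditions,
  so low degrees are treated separately.\<close>

lemma strip_W:
  assumes w: "w \<in> W p"
  shows "left_strip G x w \<in> W (p - 1)" "right_strip G x w \<in> W (p - 1)"
proof -
  consider "p \<le> 0" | "p = 1" | "p = 2" | "3 \<le> p" by linarith
  then have "left_strip G x w \<in> W (p - 1) \<and> right_strip G x w \<in> W (p - 1)"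
  proof cases
    case 1
    then have "w \<in> V 0" using W_V[OF w] by simp
    then show ?thesis by (simp add: strip_V0 W_zero)
  next
    case 2
    then have "w \<in> V (Suc 0)" using W_V[OF w] by simp
    then show ?thesis using 2 left_strip_V[of w 0] right_strip_V[of w 0] by (simp add: koszul_W_def)
  next
    case 3
    then have "w \<in> V (Suc 1)" using W_V[OF w] by (simp add: numeral_2_eq_2)
    then show ?thesis using 3 left_strip_V[of w 1] right_strip_V[of w 1] by (simp add: koszul_W_def)
  next
    case 4
    then have p: "2 \<le> p" "2 \<le> p - 1" by simp_all
    have "left_strip G x w \<in> relation_part G R i j" "right_strip G x w \<in> relation_part G R i j"
      if "i + 2 + j = nat (p - 1)" for i j
    proof -
      have "Suc i + 2 + j = nat p" "i + 2 + Suc j = nat p" using that 4 by simp_all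
      then show "left_strip G x w \<in> relation_part G R i j" "right_strip G x w \<in> relation_part G R i j"
        using koszul_W_relation[OF p(1) _ w] left_strip_relation right_strip_relation by blast+
    qed
    then show ?thesis by (auto intro!: koszul_W_I[OF p(2)])
  qed
  then show "left_strip G x w \<in> W (p - 1)" "right_strip G x w \<in> W (p - 1)" by auto
qed

text \<open>Removals at opposite ends are independent, so the two kinds of mixed terms in the square
  of the differential coincide.\<close>

lemma strip_commute: "left_strip G y (right_strip G x w) = right_strip G x (left_strip G y w)"
  by (auto simp: left_strip_def right_strip_def fun_eq_iff)

abbreviation arr :: "'b \<Rightarrow> ('v, 'b, 'f) pelem" where "arr \<equiv> arrow_elem G"

lemma arr_V: "x \<in> arcs G \<Longrightarrow> arr x \<in> V 1"
  by (auto simp: V_iff path_sel arrow_elem_def qpaths_iff awalk_Cons_iff awalk_Nil_iff split: if_splits)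

lemma arr_carrier: "x \<in> arcs G \<Longrightarrow> arr x \<in> carrier P"
  by (rule V_carrier[OF arr_V])

text \<open>A vertex element passes an arrow as a scalar. The same scalars occur in
  \<open>strip_V0_mult\<close>, and their agreement makes the differential balanced.\<close>

lemma V0_mult_arr:
  assumes c: "c \<in> V 0"
  shows "c \<otimes>\<^bsub>P\<^esub> arr x = c (head G x, [], head G x) \<odot>\<^bsub>P\<^esub> arr x"
    and "arr x \<otimes>\<^bsub>P\<^esub> c = c (tail G x, [], tail G x) \<odot>\<^bsub>P\<^esub> arr x"
  by (auto simp: fun_eq_iff V0_mult_left[OF c] V0_mult_right[OF c] path_sel(4) arrow_elem_def)

lemma arr_mult_arr:
  assumes x: "x \<in> arcs G" and y: "y \<in> arcs G"
  shows "(arr x \<otimes>\<^bsub>P\<^esub> arr y) (h, v, t) =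
    (if v = [x, y] \<and> h = head G x \<and> t = tail G y \<and> head G y = tail G x then 1 else 0)"
proof -
  have xy: "arr x \<otimes>\<^bsub>P\<^esub> arr y \<in> V (1 + 1)" by (rule V_mult[OF arr_V[OF x] arr_V[OF y]])
  show ?thesis
  proof (cases "length v = 2")
    case True
    then obtain a b where v: "v = [a, b]" by (auto simp: numeral_2_eq_2 length_Suc_conv)
    have "(arr x \<otimes>\<^bsub>P\<^esub> arr y) (h, v, t) = (\<Sum>m\<in>verts G. arr x (h, [a], m) * arr y (m, [b], t))"
      unfolding path_mult v by (simp add: arrow_elem_def)
    also have "\<dots> = (\<Sum>m\<in>verts G. if m = tail G x then if a = x \<and> h = head G x \<and> b = y \<and> t = tail G y \<and> head G y = tail G x then 1 else 0 else 0)"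
      by (intro sum.cong refl) (auto simp: arrow_elem_def)
    finally show ?thesis using x v by (simp add: sum.delta)
  next
    case False
    then show ?thesis using V_length[OF xy, of v h t] by auto
  qed
qed

lemma finsum_path_apply:
  assumes "finite S" "\<And>i. i \<in> S \<Longrightarrow> g i \<in> carrier P"
  shows "(\<Oplus>\<^bsub>P\<^esub>i\<in>S. g i) q = (\<Sum>i\<in>S. g i q)"
proof -
  have "additive_map P field_ring (\<lambda>f. f q)" by (simp add: additive_map_def path_sel(2))
  from additive_map_finsum[where g = g and I = S, OF P.abelian_group_axioms abelian_group_field_ring this assms(2)]
  show ?thesis by (simp add: finsum_field_ring[OF assms(1)])
qed

text \<open>Pairs of arrows that do not compose contribute zero, so the sum may run over all
  pairs.\<close>

lemma V2_expand:
  assumes f: "f \<in> V 2"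
  shows "f = (\<Oplus>\<^bsub>P\<^esub>x\<in>arcs G. \<Oplus>\<^bsub>P\<^esub>y\<in>arcs G. f (head G x, [x, y], tail G y) \<odot>\<^bsub>P\<^esub> (arr x \<otimes>\<^bsub>P\<^esub> arr y))"
proof (rule ext, clarify)
  fix h t and v :: "'b list"
  let ?c = "\<lambda>x y. f (head G x, [x, y], tail G y)"
  have cl: "?c x y \<odot>\<^bsub>P\<^esub> (arr x \<otimes>\<^bsub>P\<^esub> arr y) \<in> carrier P" if "x \<in> arcs G" "y \<in> arcs G" for x y
    using that by (intro path_smult_closed path_mult_closed arr_carrier)
  have "(\<Oplus>\<^bsub>P\<^esub>x\<in>arcs G. \<Oplus>\<^bsub>P\<^esub>y\<in>arcs G. ?c x y \<odot>\<^bsub>P\<^esub> (arr x \<otimes>\<^bsub>P\<^esub> arr y)) (h, v, t) =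
      (\<Sum>x\<in>arcs G. \<Sum>y\<in>arcs G. (?c x y \<odot>\<^bsub>P\<^esub> (arr x \<otimes>\<^bsub>P\<^esub> arr y)) (h, v, t))"
    by (subst finsum_path_apply) (auto simp: finsum_path_apply cl intro!: P.finsum_closed sum.cong)
  also have "\<dots> = (\<Sum>x\<in>arcs G. \<Sum>y\<in>arcs G. ?c x y *
      (if v = [x, y] \<and> h = head G x \<and> t = tail G y \<and> head G y = tail G x then 1 else 0))"
    by (intro sum.cong refl) (simp add: path_sel(4) arr_mult_arr)
  also have "\<dots> = f (h, v, t)"
  proof (cases "f (h, v, t) = 0")
    case True
    then show ?thesis by (intro trans[OF sum.neutral]) (auto intro!: sum.neutral)
  next
    case False
    then have q: "(h, v, t) \<in> qpaths G" using path_support[OF V_carrier[OF f]] by blast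
    have "length v = 2" using False V_length[OF f] by blast
    then obtain a b where v: "v = [a, b]" by (auto simp: numeral_2_eq_2 length_Suc_conv)
    note 1 = qpaths_Cons[OF q[unfolded v]]
    note 2 = qpaths_Cons[OF 1(3)]
    have t: "t = tail G b" using 2(3) by (simp add: qpaths_Nil)
    have "?c x y * (if v = [x, y] \<and> h = head G x \<and> t = tail G y \<and> head G y = tail G x then 1 else 0) =
        (if x = a then if y = b then f (h, v, t) else 0 else 0)" for x y
      using 1(2) 2(2) t by (auto simp: v)
    then have "(\<Sum>x\<in>arcs G. \<Sum>y\<in>arcs G. ?c x y *
        (if v = [x, y] \<and> h = head G x \<and> t = tail G y \<and> head G y = tail G x then 1 else 0)) =
      (\<Sum>x\<in>arcs G. if x = a then \<Sum>y\<in>arcs G. if y = b then f (h, v, t) else 0 else 0)"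
      by (intro sum.cong refl) auto
    then show ?thesis using 1(1) 2(1) by (simp add: sum.delta)
  qed
  finally show "f (h, v, t) = (\<Oplus>\<^bsub>P\<^esub>x\<in>arcs G. \<Oplus>\<^bsub>P\<^esub>y\<in>arcs G. ?c x y \<odot>\<^bsub>P\<^esub> (arr x \<otimes>\<^bsub>P\<^esub> arr y)) (h, v, t)"
    by simp
qed

end

section \<open>The Koszul complex\<close>

context quadratic_quiver
begin

text \<open>The vertex algebra k, realized as the degree 0 part of the path algebra.\<close>

definition kring where "kring = P\<lparr>carrier := V 0\<rparr>"

lemma kring_sel [simp]:
  "carrier kring = V 0" "add kring = add P" "monoid.mult kring = monoid.mult P" "\<one>\<^bsub>kring\<^esub> = \<one>\<^bsub>P\<^esub>"
  "\<zero>\<^bsub>kring\<^esub> = \<zero>\<^bsub>P\<^esub>"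
  by (simp_all add: kring_def)

lemma bimod_sel [simp]:
  "carrier (A_k_bimod G R) = carrier A" "add (A_k_bimod G R) = add A"
  "lact (A_k_bimod G R) = monoid.mult A" "ract (A_k_bimod G R) a c = a \<otimes>\<^bsub>A\<^esub> cls c"
  "carrier (k_A_bimod G R) = carrier A" "add (k_A_bimod G R) = add A"
  "ract (k_A_bimod G R) = monoid.mult A" "lact (k_A_bimod G R) c a = cls c \<otimes>\<^bsub>A\<^esub> a"
  "carrier (W_bimod G R p) = W p" "add (W_bimod G R p) = add P" "\<zero>\<^bsub>W_bimod G R p\<^esub> = \<zero>\<^bsub>P\<^esub>"
  "lact (W_bimod G R p) = monoid.mult P" "ract (W_bimod G R p) = monoid.mult P"
  by (simp_all add: A_k_bimod_def k_A_bimod_def W_bimod_def)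

lemma V0_carrier: "c \<in> V 0 \<Longrightarrow> c \<in> carrier P"
  by (rule V_carrier)

lemma V0_mult: "c \<in> V 0 \<Longrightarrow> d \<in> V 0 \<Longrightarrow> c \<otimes>\<^bsub>P\<^esub> d \<in> V 0"
  using V_mult[of c 0 d 0] by simp

lemma neg_smult: "f \<in> carrier P \<Longrightarrow> (- 1) \<odot>\<^bsub>P\<^esub> f \<oplus>\<^bsub>P\<^esub> f = \<zero>\<^bsub>P\<^esub>"
  by (simp add: path_sel(2-4))

lemma ring_kring: "ring kring"
proof (rule ringI)
  show "abelian_group kring"
  proof (rule abelian_groupI)
    show "\<exists>g\<in>carrier kring. g \<oplus>\<^bsub>kring\<^esub> f = \<zero>\<^bsub>kring\<^esub>" if "f \<in> carrier kring" for f
      using that by (intro bexI[of _ "(- 1) \<odot>\<^bsub>P\<^esub> f"]) (simp_all add: V_smult neg_smult V0_carrier)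
  qed (simp_all add: V_add V_zero V0_carrier P.a_ac)
  show "monoid kring"
    by (rule monoidI) (simp_all add: V0_mult V_one V0_carrier path_mult_assoc)
qed (simp_all add: path_distrib)

lemma abelian_group_W: "abelian_group (W_bimod G R p)"
proof (rule abelian_groupI)
  show "\<exists>g\<in>carrier (W_bimod G R p). g \<oplus>\<^bsub>W_bimod G R p\<^esub> f = \<zero>\<^bsub>W_bimod G R p\<^esub>"
    if "f \<in> carrier (W_bimod G R p)" for f
    using that by (intro bexI[of _ "(- 1) \<odot>\<^bsub>P\<^esub> f"]) (simp_all add: W_smult neg_smult W_carrier)
qed (simp_all add: W_add W_zero W_carrier P.a_ac)

lemma bimodule_over_A_k: "bimodule_over A kring (A_k_bimod G R)"
proof (rule bimodule_over.intro)
  show "abelian_group (A_k_bimod G R)"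
    unfolding A_k_bimod_def by (rule abelian_group_as_bimod[OF A.abelian_group_axioms])
  show "bimodule_over_axioms A kring (A_k_bimod G R)"
    by unfold_locales
      (simp_all add: cls_closed cls_add cls_mult cls_one V0_carrier A.l_distr A.r_distr A.m_assoc)
qed

lemma bimodule_over_k_A: "bimodule_over kring A (k_A_bimod G R)"
proof (rule bimodule_over.intro)
  show "abelian_group (k_A_bimod G R)"
    unfolding k_A_bimod_def by (rule abelian_group_as_bimod[OF A.abelian_group_axioms])
  show "bimodule_over_axioms kring A (k_A_bimod G R)"
    by unfold_locales
      (simp_all add: cls_closed cls_add cls_mult cls_one V0_carrier A.l_distr A.r_distr A.m_assoc)
qed

lemma bimodule_over_W: "bimodule_over kring kring (W_bimod G R p)"
proof (rule bimodule_over.intro)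
  show "bimodule_over_axioms kring kring (W_bimod G R p)"
    by unfold_locales
      (simp_all add: W_left W_right path_distrib path_mult_assoc path_one_left path_one_right W_carrier)
qed (rule abelian_group_W)

abbreviation AW where "AW \<equiv> AW_bimod G R"
abbreviation K where "K \<equiv> koszul_obj G R"
abbreviation kp where "kp \<equiv> koszul_pure G R"

lemma AW_eq: "tensor (V 0) (A_k_bimod G R) (W_bimod G R p) = AW p"
  by (simp add: AW_bimod_def)

lemma K_eq: "tensor (V 0) (AW p) (k_A_bimod G R) = K p"
  by (simp add: koszul_obj_def)

text \<open>One condition on three arguments in place of two nested \<open>balanced_map\<close>s;
  each of the two tensor signs contributes a balancing law.\<close>

definition tri :: "int \<Rightarrow> ('q, 'x) ring_scheme \<Rightarrow> (('v, 'b, 'f) qelem \<Rightarrow> ('v, 'b, 'f) pelem \<Rightarrow> ('v, 'b, 'f) qelem \<Rightarrow> 'q) \<Rightarrow> bool"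
  where "tri p Q \<beta> \<longleftrightarrow>
    (\<forall>a\<in>carrier A. \<forall>w\<in>W p. \<forall>a'\<in>carrier A. \<beta> a w a' \<in> carrier Q) \<and>
    (\<forall>a\<in>carrier A. \<forall>b\<in>carrier A. \<forall>w\<in>W p. \<forall>a'\<in>carrier A. \<beta> (a \<oplus>\<^bsub>A\<^esub> b) w a' = \<beta> a w a' \<oplus>\<^bsub>Q\<^esub> \<beta> b w a') \<and>
    (\<forall>a\<in>carrier A. \<forall>v\<in>W p. \<forall>w\<in>W p. \<forall>a'\<in>carrier A. \<beta> a (v \<oplus>\<^bsub>P\<^esub> w) a' = \<beta> a v a' \<oplus>\<^bsub>Q\<^esub> \<beta> a w a') \<and>
    (\<forall>a\<in>carrier A. \<forall>w\<in>W p. \<forall>a'\<in>carrier A. \<forall>b'\<in>carrier A. \<beta> a w (a' \<oplus>\<^bsub>A\<^esub> b') = \<beta> a w a' \<oplus>\<^bsub>Q\<^esub> \<beta> a w b') \<and>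
    (\<forall>a\<in>carrier A. \<forall>c\<in>V 0. \<forall>w\<in>W p. \<forall>a'\<in>carrier A. \<beta> (a \<otimes>\<^bsub>A\<^esub> cls c) w a' = \<beta> a (c \<otimes>\<^bsub>P\<^esub> w) a') \<and>
    (\<forall>a\<in>carrier A. \<forall>c\<in>V 0. \<forall>w\<in>W p. \<forall>a'\<in>carrier A. \<beta> a (w \<otimes>\<^bsub>P\<^esub> c) a' = \<beta> a w (cls c \<otimes>\<^bsub>A\<^esub> a'))"

lemma triD:
  assumes "tri p Q \<beta>"
  shows "a \<in> carrier A \<Longrightarrow> w \<in> W p \<Longrightarrow> a' \<in> carrier A \<Longrightarrow> \<beta> a w a' \<in> carrier Q"
    "a \<in> carrier A \<Longrightarrow> b \<in> carrier A \<Longrightarrow> w \<in> W p \<Longrightarrow> a' \<in> carrier A \<Longrightarrow>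
      \<beta> (a \<oplus>\<^bsub>A\<^esub> b) w a' = \<beta> a w a' \<oplus>\<^bsub>Q\<^esub> \<beta> b w a'"
    "a \<in> carrier A \<Longrightarrow> v \<in> W p \<Longrightarrow> w \<in> W p \<Longrightarrow> a' \<in> carrier A \<Longrightarrow>
      \<beta> a (v \<oplus>\<^bsub>P\<^esub> w) a' = \<beta> a v a' \<oplus>\<^bsub>Q\<^esub> \<beta> a w a'"
    "a \<in> carrier A \<Longrightarrow> w \<in> W p \<Longrightarrow> a' \<in> carrier A \<Longrightarrow> b' \<in> carrier A \<Longrightarrow>
      \<beta> a w (a' \<oplus>\<^bsub>A\<^esub> b') = \<beta> a w a' \<oplus>\<^bsub>Q\<^esub> \<beta> a w b'"
    "a \<in> carrier A \<Longrightarrow> c \<in> V 0 \<Longrightarrow> w \<in> W p \<Longrightarrow> a' \<in> carrier A \<Longrightarrow>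
      \<beta> (a \<otimes>\<^bsub>A\<^esub> cls c) w a' = \<beta> a (c \<otimes>\<^bsub>P\<^esub> w) a'"
    "a \<in> carrier A \<Longrightarrow> c \<in> V 0 \<Longrightarrow> w \<in> W p \<Longrightarrow> a' \<in> carrier A \<Longrightarrow>
      \<beta> a (w \<otimes>\<^bsub>P\<^esub> c) a' = \<beta> a w (cls c \<otimes>\<^bsub>A\<^esub> a')"
  using assms by (simp_all add: tri_def)

text \<open>Nested in the same way as \<open>koszul_dif\<close>, so that the differential is an
  instance.\<close>

definition klift :: "int \<Rightarrow> ('q, 'x) ring_scheme \<Rightarrow> (('v, 'b, 'f) qelem \<Rightarrow> ('v, 'b, 'f) pelem \<Rightarrow> ('v, 'b, 'f) qelem \<Rightarrow> 'q) \<Rightarrow>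
    ('v, 'b, 'f) kelem \<Rightarrow> 'q" where
  "klift p Q \<beta> = tensor_lift (V 0) (AW p) (k_A_bimod G R) Q
     (\<lambda>t a'. tensor_lift (V 0) (A_k_bimod G R) (W_bimod G R p) Q (\<lambda>a w. \<beta> a w a') t)"

context
begin

private abbreviation "pt \<equiv> \<lambda>p. pure_tensor (V 0) (A_k_bimod G R) (W_bimod G R p)"
private abbreviation "pk \<equiv> \<lambda>p. pure_tensor (V 0) (AW p) (k_A_bimod G R)"

interpretation aw: bimodule_tensor A kring kring "A_k_bimod G R" "W_bimod G R p" for p
  by (intro bimodule_tensor.intro ring_A ring_kring bimodule_over_A_k bimodule_over_W)

lemma bimodule_over_AW: "bimodule_over A kring (AW p)"
  using aw.bimodule_over_tensor[of p] by (simp add: AW_eq)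

interpretation kk: bimodule_tensor A kring A "AW p" "k_A_bimod G R" for p
  by (intro bimodule_tensor.intro ring_A ring_kring bimodule_over_AW bimodule_over_k_A)

lemma bimodule_over_K: "bimodule_over A A (K p)"
  using kk.bimodule_over_tensor[of p] by (simp add: K_eq)

private lemmas awf = aw.pure_closed[unfolded kring_sel AW_eq bimod_sel]
  aw.pure_add_left[unfolded kring_sel AW_eq bimod_sel] aw.pure_add_right[unfolded kring_sel AW_eq bimod_sel]
  aw.lact_pure[unfolded kring_sel AW_eq bimod_sel] aw.ract_pure[unfolded kring_sel AW_eq bimod_sel]
private lemmas kkf = kk.pure_closed[unfolded kring_sel K_eq bimod_sel]
  kk.pure_add_left[unfolded kring_sel K_eq bimod_sel] kk.pure_add_right[unfolded kring_sel K_eq bimod_sel]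
  kk.lact_pure[unfolded kring_sel K_eq bimod_sel] kk.ract_pure[unfolded kring_sel K_eq bimod_sel]

lemma tri_kp: "tri p (K p) (kp p)"
  unfolding tri_def koszul_pure_def
proof (intro conjI ballI)
  fix a c w a' assume a: "a \<in> carrier A" and c: "c \<in> V 0" and w: "w \<in> W p" and a': "a' \<in> carrier A"
  show "pk p (pt p (a \<otimes>\<^bsub>A\<^esub> cls c) w) a' = pk p (pt p a (c \<otimes>\<^bsub>P\<^esub> w)) a'"
    using aw.pure_balanced[of a c w p] a c w by simp
  \<comment> \<open>The second balancing law passes through the right k-action on A \<otimes> W_p,
    which acts on the factor W_p.\<close>
  have "pk p (pt p a (w \<otimes>\<^bsub>P\<^esub> c)) a' = pk p (ract (AW p) (pt p a w) c) a'"
    by (simp add: awf a c w)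
  also have "\<dots> = pk p (pt p a w) (cls c \<otimes>\<^bsub>A\<^esub> a')"
    using kk.pure_balanced[of "pt p a w" p c a'] by (simp add: awf a c w a')
  finally show "pk p (pt p a (w \<otimes>\<^bsub>P\<^esub> c)) a' = pk p (pt p a w) (cls c \<otimes>\<^bsub>A\<^esub> a')" .
qed (simp_all add: awf kkf)

lemma K_induct [consumes 1, case_names pure add]:
  assumes t: "t \<in> carrier (K p)"
    and pure: "\<And>a w a'. a \<in> carrier A \<Longrightarrow> w \<in> W p \<Longrightarrow> a' \<in> carrier A \<Longrightarrow> Q (kp p a w a')"
    and add: "\<And>t u. t \<in> carrier (K p) \<Longrightarrow> u \<in> carrier (K p) \<Longrightarrow> Q t \<Longrightarrow> Q u \<Longrightarrow> Q (t \<oplus>\<^bsub>K p\<^esub> u)"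
  shows "Q t"
  using t
proof (induction rule: kk.tensor_induct[of _ p, unfolded kring_sel K_eq bimod_sel, consumes 1, case_names pair sum])
  case (pair s a')
  from pair(1) show ?case
  proof (induction rule: aw.tensor_induct[of _ p, unfolded kring_sel AW_eq bimod_sel, consumes 1, case_names pair' sum'])
    case (pair' a w)
    then show ?case using pure[of a w a'] pair(2) by (simp add: koszul_pure_def)
  next
    case (sum' s u)
    then show ?case using add pair(2) by (simp add: kkf)
  qed
qed (rule add)

lemma kp_act:
  assumes "a \<in> carrier A" "w \<in> W p" "a' \<in> carrier A" "b \<in> carrier A"
  shows "lact (K p) b (kp p a w a') = kp p (b \<otimes>\<^bsub>A\<^esub> a) w a'"
    and "ract (K p) (kp p a w a') b = kp p a w (a' \<otimes>\<^bsub>A\<^esub> b)"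
  unfolding koszul_pure_def using assms by (simp_all add: awf kkf)

text \<open>The inner lift is taken for each fixed a'. Its additivity and balancedness in a' are
  identities between additive maps on A \<otimes> W_p, hence follow from pure tensors; then the
  outer lift applies.\<close>

lemma klift:
  assumes Q: "abelian_group Q" and \<beta>: "tri p Q \<beta>"
  shows klift_additive: "additive_map (K p) Q (klift p Q \<beta>)"
    and klift_pure: "a \<in> carrier A \<Longrightarrow> w \<in> W p \<Longrightarrow> a' \<in> carrier A \<Longrightarrow> klift p Q \<beta> (kp p a w a') = \<beta> a w a'"
proof -
  interpret Q: abelian_group Q by fact
  note \<beta>' = triD[OF \<beta>]
  define h where "h a' t = tensor_lift (V 0) (A_k_bimod G R) (W_bimod G R p) Q (\<lambda>a w. \<beta> a w a') t" for a' t
  have h: "additive_map (AW p) Q (h a')" "\<And>a w. a \<in> carrier A \<Longrightarrow> w \<in> W p \<Longrightarrow> h a' (pt p a w) = \<beta> a w a'"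
    if a': "a' \<in> carrier A" for a'
  proof -
    have b: "balanced_map (V 0) (A_k_bimod G R) (W_bimod G R p) Q (\<lambda>a w. \<beta> a w a')"
      by (rule balanced_mapI) (simp_all add: a' \<beta>')
    show "additive_map (AW p) Q (h a')"
      using aw.lift_props(1)[of Q p "\<lambda>a w. \<beta> a w a'"] Q b unfolding h_def by (simp add: AW_eq)
    show "h a' (pt p a w) = \<beta> a w a'" if "a \<in> carrier A" "w \<in> W p" for a w
      using aw.lift_props(2)[of Q p "\<lambda>a w. \<beta> a w a'" a w] Q b that unfolding h_def by simp
  qed
  note eqI = aw.additive_map_eqI[of p, unfolded kring_sel AW_eq bimod_sel]
  have add: "h (a' \<oplus>\<^bsub>A\<^esub> b') t = h a' t \<oplus>\<^bsub>Q\<^esub> h b' t"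
    if a': "a' \<in> carrier A" and b': "b' \<in> carrier A" and t: "t \<in> carrier (AW p)" for a' b' t
  proof (rule eqI[OF h(1) _ _ t])
    show "additive_map (AW p) Q (\<lambda>t. h a' t \<oplus>\<^bsub>Q\<^esub> h b' t)"
      using h(1)[OF a'] h(1)[OF b'] unfolding additive_map_def by (simp add: Q.a_ac)
  qed (use a' b' in \<open>simp_all add: h(2) \<beta>'\<close>)
  have bal: "h a' (ract (AW p) t c) = h (cls c \<otimes>\<^bsub>A\<^esub> a') t"
    if a': "a' \<in> carrier A" and c: "c \<in> V 0" and t: "t \<in> carrier (AW p)" for a' c t
  proof (rule eqI[OF _ h(1) _ t])
    have "additive_map (AW p) (AW p) (\<lambda>t. ract (AW p) t c)"
      using bimodule_over.r_additive[OF bimodule_over_AW, of c p] c by simp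
    then show "additive_map (AW p) Q (\<lambda>t. h a' (ract (AW p) t c))"
      using h(1)[OF a'] by (rule additive_map_comp)
  qed (use a' c in \<open>simp_all add: awf h(2) \<beta>' cls_closed V0_carrier W_right\<close>)
  have b: "balanced_map (V 0) (AW p) (k_A_bimod G R) Q (\<lambda>t a'. h a' t)"
    by (rule balanced_mapI)
      (simp_all add: add bal additive_map_closed[OF h(1)] additive_map_add[OF h(1)])
  have kl: "klift p Q \<beta> = tensor_lift (V 0) (AW p) (k_A_bimod G R) Q (\<lambda>t a'. h a' t)"
    unfolding klift_def h_def ..
  show "additive_map (K p) Q (klift p Q \<beta>)"
    using kk.lift_props(1)[of Q p "\<lambda>t a'. h a' t"] Q b unfolding kl by (simp add: K_eq)
  show "klift p Q \<beta> (kp p a w a') = \<beta> a w a'" if "a \<in> carrier A" "w \<in> W p" "a' \<in> carrier A"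
    using kk.lift_props(2)[of Q p "\<lambda>t a'. h a' t" "pt p a w" a'] Q b that
    unfolding kl koszul_pure_def by (simp add: awf h(2))
qed

end

lemmas kp = triD[OF tri_kp]

sublocale K: bimodule_over A A "K p" for p
  by (rule bimodule_over_K)

lemma cls_smult_one: "cls (c \<odot>\<^bsub>P\<^esub> \<one>\<^bsub>P\<^esub>) = c \<odot>\<^bsub>A\<^esub> \<one>\<^bsub>A\<^esub>"
  by (simp add: cls_smult[symmetric] path_one_closed cls_one)

text \<open>Balancing over k contains balancing over the field, through the multiples of the unit in
  \<open>V 0\<close>.\<close>

lemma kp_smult:
  assumes "a \<in> carrier A" "w \<in> W p" "a' \<in> carrier A"
  shows "kp p (c \<odot>\<^bsub>A\<^esub> a) w a' = kp p a (c \<odot>\<^bsub>P\<^esub> w) a'"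
    and "kp p a w (c \<odot>\<^bsub>A\<^esub> a') = kp p a (c \<odot>\<^bsub>P\<^esub> w) a'"
proof -
  have c: "c \<odot>\<^bsub>P\<^esub> \<one>\<^bsub>P\<^esub> \<in> V 0" by (rule V_smult[OF V_one])
  show "kp p (c \<odot>\<^bsub>A\<^esub> a) w a' = kp p a (c \<odot>\<^bsub>P\<^esub> w) a'"
    using kp(5)[OF assms(1) c assms(2,3)] assms
    by (simp add: cls_smult_one A.smult_one_mult path_smult_mult path_one_left W_carrier)
  show "kp p a w (c \<odot>\<^bsub>A\<^esub> a') = kp p a (c \<odot>\<^bsub>P\<^esub> w) a'"
    using kp(6)[OF assms(1) c assms(2,3)] assms
    by (simp add: cls_smult_one A.smult_one_mult path_smult_mult path_one_right W_carrier)
qed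

lemma algebra_bimodule_K: "algebra_bimodule A (K p)"
  unfolding algebra_bimodule_iff
proof (intro conjI ballI allI bimodule_over_K)
  fix t c assume "t \<in> carrier (K p)"
  then show "lact (K p) (c \<odot>\<^bsub>A\<^esub> \<one>\<^bsub>A\<^esub>) t = ract (K p) t (c \<odot>\<^bsub>A\<^esub> \<one>\<^bsub>A\<^esub>)"
    by (induction rule: K_induct)
      (simp_all add: kp_act A.smult_one_closed A.smult_one_mult kp_smult K.l_add_right K.r_add_left)
qed

lemma kp_additive_W:
  assumes "a \<in> carrier A" "a' \<in> carrier A"
  shows "additive_map (W_bimod G R p) (K p) (\<lambda>w. kp p a w a')"
  using assms by (simp add: additive_map_def kp)

lemma kp_zero:
  assumes "a \<in> carrier A" "a' \<in> carrier A"
  shows "kp p a \<zero>\<^bsub>P\<^esub> a' = \<zero>\<^bsub>K p\<^esub>"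
  using additive_map_zero[OF abelian_group_W K.abelian_group_axioms kp_additive_W[OF assms]] by simp

lemma K_negative:
  assumes "p < 0"
  shows "carrier (K p) = {\<zero>\<^bsub>K p\<^esub>}"
proof -
  have "t = \<zero>\<^bsub>K p\<^esub>" if "t \<in> carrier (K p)" for t
    using that
  proof (induction rule: K_induct)
    case (pure a w a')
    then have "w = \<zero>\<^bsub>P\<^esub>" using assms by (simp add: koszul_W_def)
    then show ?case using pure by (simp add: kp_zero)
  qed simp
  then show ?thesis using K.zero_closed by blast
qed

subsection \<open>The differential\<close>

lemma tri_comp: "additive_map Q Q' h \<Longrightarrow> tri p Q \<beta> \<Longrightarrow> tri p Q' (\<lambda>a w a'. h (\<beta> a w a'))"
  unfolding tri_def additive_map_def by simp

lemma tri_add: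
  assumes Q: "abelian_group Q" and "tri p Q \<beta>" "tri p Q \<gamma>"
  shows "tri p Q (\<lambda>a w a'. \<beta> a w a' \<oplus>\<^bsub>Q\<^esub> \<gamma> a w a')"
proof -
  interpret Q: abelian_group Q by fact
  note b = triD[OF assms(2)] triD[OF assms(3)]
  show ?thesis
    unfolding tri_def by (intro conjI ballI) (simp_all add: b(1-4,7-10) Q.a_ac b(5,6,11,12))
qed

lemma tri_zero:
  assumes "abelian_group Q"
  shows "tri p Q (\<lambda>a w a'. \<zero>\<^bsub>Q\<^esub>)"
proof -
  interpret Q: abelian_group Q by fact
  show ?thesis by (simp add: tri_def)
qed

lemma tri_cong:
  assumes "tri p Q \<beta>" "\<And>a w a'. a \<in> carrier A \<Longrightarrow> w \<in> W p \<Longrightarrow> a' \<in> carrier A \<Longrightarrow> \<gamma> a w a' = \<beta> a w a'"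
  shows "tri p Q \<gamma>"
  unfolding tri_def using triD[OF assms(1)]
  by (simp add: assms(2) W_add W_left W_right cls_closed V0_carrier)

lemma tri_finsum:
  assumes Q: "abelian_group Q" and "finite S" "\<And>x. x \<in> S \<Longrightarrow> tri p Q (\<beta> x)"
  shows "tri p Q (\<lambda>a w a'. \<Oplus>\<^bsub>Q\<^esub>x\<in>S. \<beta> x a w a')"
proof -
  interpret Q: abelian_group Q by fact
  show ?thesis
    using assms(2,3)
  proof (induction S rule: finite_induct)
    case empty
    then show ?case by (simp add: tri_zero[OF Q])
  next
    case (insert x S)
    then have IH: "tri p Q (\<lambda>a w a'. \<Oplus>\<^bsub>Q\<^esub>x\<in>S. \<beta> x a w a')" and x: "tri p Q (\<beta> x)" by simp_all
    show ?case
    proof (rule tri_cong[OF tri_add[OF Q x IH]])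
      fix a w a' assume a: "a \<in> carrier A" "w \<in> W p" "a' \<in> carrier A"
      have "\<beta> y a w a' \<in> carrier Q" if "y \<in> insert x S" for y
        using triD(1)[OF insert.prems[OF that]] a by blast
      then show "(\<Oplus>\<^bsub>Q\<^esub>y\<in>insert x S. \<beta> y a w a') = \<beta> x a w a' \<oplus>\<^bsub>Q\<^esub> (\<Oplus>\<^bsub>Q\<^esub>y\<in>S. \<beta> y a w a')"
        using insert.hyps by (intro Q.finsum_insert) auto
    qed
  qed
qed

lemma signed_additive:
  assumes "abelian_group Q"
  shows "additive_map Q Q (signed Q p)"
proof -
  interpret Q: abelian_group Q by fact
  show ?thesis by (simp add: additive_map_def signed_def Q.minus_add)
qed

abbreviation c :: "'b \<Rightarrow> ('v, 'b, 'f) qelem" where "c x \<equiv> cls (arr x)"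

lemma c_closed: "x \<in> arcs G \<Longrightarrow> c x \<in> carrier A"
  by (rule cls_closed[OF arr_carrier])

text \<open>Balanced already for each single arrow: moving a vertex element across the left tensor
  sign produces, on either side, its value at the target of the arrow. At the right tensor sign,
  removal on the left commutes with right multiplication.\<close>

lemma tri_left:
  assumes x: "x \<in> arcs G"
  shows "tri p (K (p - 1)) (\<lambda>a w a'. kp (p - 1) (a \<otimes>\<^bsub>A\<^esub> c x) (left_strip G x w) a')"
proof -
  have "kp (p - 1) (a \<otimes>\<^bsub>A\<^esub> cls d \<otimes>\<^bsub>A\<^esub> c x) (left_strip G x w) a' =
      kp (p - 1) (a \<otimes>\<^bsub>A\<^esub> c x) (left_strip G x (d \<otimes>\<^bsub>P\<^esub> w)) a'"
    if "a \<in> carrier A" "d \<in> V 0" "w \<in> W p" "a' \<in> carrier A" for a d w a'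
  proof -
    have "a \<otimes>\<^bsub>A\<^esub> cls d \<otimes>\<^bsub>A\<^esub> c x = a \<otimes>\<^bsub>A\<^esub> cls (d \<otimes>\<^bsub>P\<^esub> arr x)"
      using that x by (simp add: cls_mult V0_carrier arr_carrier A.m_assoc cls_closed)
    also have "\<dots> = d (head G x, [], head G x) \<odot>\<^bsub>A\<^esub> (a \<otimes>\<^bsub>A\<^esub> c x)"
      using that x by (simp add: V0_mult_arr cls_smult[symmetric] arr_carrier A.smult_mult_right c_closed)
    finally show ?thesis
      using that x by (simp add: kp_smult strip_W c_closed strip_V0_mult)
  qed
  then show ?thesis
    unfolding tri_def using x
    by (simp add: strip_additive strip_W kp c_closed A.l_distr strip_V0_mult)
qed

text \<open>The mirror image of \<open>tri_left\<close>, with the value at the source of the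
  arrow.\<close>

lemma tri_right:
  assumes x: "x \<in> arcs G"
  shows "tri p (K (p - 1)) (\<lambda>a w a'. kp (p - 1) a (right_strip G x w) (c x \<otimes>\<^bsub>A\<^esub> a'))"
proof -
  have "kp (p - 1) a (right_strip G x (w \<otimes>\<^bsub>P\<^esub> d)) (c x \<otimes>\<^bsub>A\<^esub> a') =
      kp (p - 1) a (right_strip G x w) (c x \<otimes>\<^bsub>A\<^esub> (cls d \<otimes>\<^bsub>A\<^esub> a'))"
    if "a \<in> carrier A" "d \<in> V 0" "w \<in> W p" "a' \<in> carrier A" for a d w a'
  proof -
    have "c x \<otimes>\<^bsub>A\<^esub> (cls d \<otimes>\<^bsub>A\<^esub> a') = cls (arr x \<otimes>\<^bsub>P\<^esub> d) \<otimes>\<^bsub>A\<^esub> a'"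
      using that x by (simp add: cls_mult V0_carrier arr_carrier A.m_assoc cls_closed)
    also have "\<dots> = d (tail G x, [], tail G x) \<odot>\<^bsub>A\<^esub> (c x \<otimes>\<^bsub>A\<^esub> a')"
      using that x by (simp add: V0_mult_arr cls_smult[symmetric] arr_carrier A.smult_mult_left c_closed)
    finally show ?thesis
      using that x by (simp add: kp_smult strip_W c_closed strip_V0_mult)
  qed
  then show ?thesis
    unfolding tri_def using x
    by (simp add: strip_additive strip_W kp c_closed A.r_distr strip_V0_mult)
qed

lemma dif_pure_def: "koszul_dif_pure G R p a w a' =
   (\<Oplus>\<^bsub>K (p - 1)\<^esub>x\<in>arcs G. kp (p - 1) (a \<otimes>\<^bsub>A\<^esub> c x) (left_strip G x w) a') \<oplus>\<^bsub>K (p - 1)\<^esub>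
   signed (K (p - 1)) p (\<Oplus>\<^bsub>K (p - 1)\<^esub>x\<in>arcs G. kp (p - 1) a (right_strip G x w) (c x \<otimes>\<^bsub>A\<^esub> a'))"
  by (simp add: koszul_dif_pure_def Let_def)

lemma tri_dif: "tri p (K (p - 1)) (koszul_dif_pure G R p)"
  unfolding dif_pure_def[abs_def]
  by (intro tri_add tri_comp[OF signed_additive] tri_finsum K.abelian_group_axioms finite_arcs
      tri_left tri_right)

lemma dif_eq: "koszul_dif G R p = klift p (K (p - 1)) (koszul_dif_pure G R p)"
  by (simp add: koszul_dif_def klift_def)

lemmas dif_additive = klift_additive[OF K.abelian_group_axioms tri_dif, folded dif_eq]
  and dif_pure = klift_pure[OF K.abelian_group_axioms tri_dif, folded dif_eq]

lemma signed_act: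
  assumes "b \<in> carrier A" "t \<in> carrier (K p)"
  shows "lact (K p) b (signed (K p) q t) = signed (K p) q (lact (K p) b t)"
    and "ract (K p) (signed (K p) q t) b = signed (K p) q (ract (K p) t b)"
  using additive_map_neg[OF K.abelian_group_axioms K.abelian_group_axioms K.l_additive[OF assms(1)] assms(2)]
    additive_map_neg[OF K.abelian_group_axioms K.abelian_group_axioms K.r_additive[OF assms(1)] assms(2)]
  by (auto simp: signed_def)

lemma dif_pure_act:
  assumes a: "a \<in> carrier A" and w: "w \<in> W p" and a': "a' \<in> carrier A" and b: "b \<in> carrier A"
  shows "koszul_dif_pure G R p (b \<otimes>\<^bsub>A\<^esub> a) w a' = lact (K (p - 1)) b (koszul_dif_pure G R p a w a')"
    and "koszul_dif_pure G R p a w (a' \<otimes>\<^bsub>A\<^esub> b) = ract (K (p - 1)) (koszul_dif_pure G R p a w a') b"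
proof -
  let ?K = "K (p - 1)"
  let ?l = "\<lambda>x. kp (p - 1) (a \<otimes>\<^bsub>A\<^esub> c x) (left_strip G x w) a'"
  let ?r = "\<lambda>x. kp (p - 1) a (right_strip G x w) (c x \<otimes>\<^bsub>A\<^esub> a')"
  have cl: "?l x \<in> carrier ?K" "?r x \<in> carrier ?K" if "x \<in> arcs G" for x
    using that a w a' by (simp_all add: kp(1) strip_W c_closed)
  have sl: "(\<Oplus>\<^bsub>?K\<^esub>x\<in>arcs G. ?l x) \<in> carrier ?K" and sr: "(\<Oplus>\<^bsub>?K\<^esub>x\<in>arcs G. ?r x) \<in> carrier ?K"
    using cl by (auto intro!: K.finsum_closed)
  note ssr = additive_map_closed[OF signed_additive[OF K.abelian_group_axioms] sr]
  note fl = additive_map_finsum[OF K.abelian_group_axioms K.abelian_group_axioms K.l_additive[OF b]]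
    and fr = additive_map_finsum[OF K.abelian_group_axioms K.abelian_group_axioms K.r_additive[OF b]]
  have "lact ?K b (\<Oplus>\<^bsub>?K\<^esub>x\<in>arcs G. ?l x) = (\<Oplus>\<^bsub>?K\<^esub>x\<in>arcs G. kp (p - 1) (b \<otimes>\<^bsub>A\<^esub> a \<otimes>\<^bsub>A\<^esub> c x) (left_strip G x w) a')"
    using a w a' b
    by (intro trans[OF fl K.finsum_cong'[OF refl]]) (auto simp: kp_act strip_W c_closed A.m_assoc kp(1))
  moreover have "lact ?K b (\<Oplus>\<^bsub>?K\<^esub>x\<in>arcs G. ?r x) = (\<Oplus>\<^bsub>?K\<^esub>x\<in>arcs G. kp (p - 1) (b \<otimes>\<^bsub>A\<^esub> a) (right_strip G x w) (c x \<otimes>\<^bsub>A\<^esub> a'))"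
    using a w a' b
    by (intro trans[OF fl K.finsum_cong'[OF refl]]) (auto simp: kp_act strip_W c_closed A.m_assoc kp(1))
  ultimately show "koszul_dif_pure G R p (b \<otimes>\<^bsub>A\<^esub> a) w a' = lact ?K b (koszul_dif_pure G R p a w a')"
    unfolding dif_pure_def using sl sr ssr b by (simp add: K.l_add_right signed_act)
  have "ract ?K (\<Oplus>\<^bsub>?K\<^esub>x\<in>arcs G. ?l x) b = (\<Oplus>\<^bsub>?K\<^esub>x\<in>arcs G. kp (p - 1) (a \<otimes>\<^bsub>A\<^esub> c x) (left_strip G x w) (a' \<otimes>\<^bsub>A\<^esub> b))"
    using a w a' b
    by (intro trans[OF fr K.finsum_cong'[OF refl]]) (auto simp: kp_act strip_W c_closed A.m_assoc kp(1))
  moreover have "ract ?K (\<Oplus>\<^bsub>?K\<^esub>x\<in>arcs G. ?r x) b = (\<Oplus>\<^bsub>?K\<^esub>x\<in>arcs G. kp (p - 1) a (right_strip G x w) (c x \<otimes>\<^bsub>A\<^esub> (a' \<otimes>\<^bsub>A\<^esub> b)))"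
    using a w a' b
    by (intro trans[OF fr K.finsum_cong'[OF refl]]) (auto simp: kp_act strip_W c_closed A.m_assoc kp(1))
  ultimately show "koszul_dif_pure G R p a w (a' \<otimes>\<^bsub>A\<^esub> b) = ract ?K (koszul_dif_pure G R p a w a') b"
    unfolding dif_pure_def using sl sr ssr b by (simp add: K.r_add_left signed_act)
qed

lemma dif_linear: "bimod_linear A (K p) (K (p - 1)) (koszul_dif G R p)"
  unfolding bimod_linear_iff
proof (intro conjI ballI dif_additive)
  fix b t assume b: "b \<in> carrier A" and t: "t \<in> carrier (K p)"
  note d = additive_map_closed[OF dif_additive] additive_map_add[OF dif_additive]
  show "koszul_dif G R p (lact (K p) b t) = lact (K (p - 1)) b (koszul_dif G R p t)"
    using t by (induction rule: K_induct)
      (simp_all add: b kp_act dif_pure dif_pure_act d K.l_add_right K.l_closed)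
  show "koszul_dif G R p (ract (K p) t b) = ract (K (p - 1)) (koszul_dif G R p t) b"
    using t by (induction rule: K_induct)
      (simp_all add: b kp_act dif_pure dif_pure_act d K.r_add_left K.r_closed)
qed

end

section \<open>A dual basis of K_p indexed by paths, and the square of the differential\<close>

context quadratic_quiver
begin

text \<open>The idempotent e_j.\<close>

definition vert :: "'v \<Rightarrow> ('v, 'b, 'f) pelem" where
  "vert j = (\<lambda>q. if q = (j, [], j) then 1 else 0)"

lemma vert_V0: "j \<in> verts G \<Longrightarrow> vert j \<in> V 0"
  by (auto simp: V_iff path_sel vert_def qpaths_Nil)

lemma vert_apply: "vert j (i, [], i) = (if i = j then 1 else 0)"
  by (auto simp: vert_def)

lemma V0_mult_vert:
  assumes d: "d \<in> V 0"
  shows "d \<otimes>\<^bsub>P\<^esub> vert j = d (j, [], j) \<odot>\<^bsub>P\<^esub> vert j" "vert j \<otimes>\<^bsub>P\<^esub> d = d (j, [], j) \<odot>\<^bsub>P\<^esub> vert j"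
  by (auto simp: fun_eq_iff V0_mult_left[OF d] V0_mult_right[OF d] path_sel(4) vert_def)

lemma vert_closed: "j \<in> verts G \<Longrightarrow> cls (vert j) \<in> carrier A"
  by (simp add: cls_closed V0_carrier vert_V0)

text \<open>These paths index the dual basis of K_p although they need not lie in W_p; a projection
  onto W_p makes up for that.\<close>

definition qbasis :: "nat \<Rightarrow> ('v, 'b) qpath set" where
  "qbasis p = {(j, u, i). (j, u, i) \<in> qpaths G \<and> length u = p}"

lemma finite_qbasis: "finite (qbasis p)"
proof (rule finite_subset)
  show "qbasis p \<subseteq> verts G \<times> {u. set u \<subseteq> arcs G \<and> length u = p} \<times> verts G"
    using qpaths_verts qpaths_arcs by (fastforce simp: qbasis_def)
  show "finite (verts G \<times> {u. set u \<subseteq> arcs G \<and> length u = p} \<times> verts G)"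
    by (intro finite_cartesian_product finite_verts finite_lists_length_eq finite_arcs)
qed

text \<open>The functional dual to the path \<open>(j, u, i)\<close>; the idempotents of the two end vertices make it balanced
  over the vertex algebra.\<close>

definition coef :: "('v, 'b) qpath \<Rightarrow> ('v, 'b, 'f) qelem \<Rightarrow> ('v, 'b, 'f) pelem \<Rightarrow> ('v, 'b, 'f) qelem \<Rightarrow>
    (('v, 'b, 'f) qelem \<times> ('v, 'b, 'f) qelem \<Rightarrow>\<^sub>0 int) set" where
  "coef = (\<lambda>(j, u, i) a w a'. A.epure (w (j, u, i) \<odot>\<^bsub>A\<^esub> (a \<otimes>\<^bsub>A\<^esub> cls (vert j))) (cls (vert i) \<otimes>\<^bsub>A\<^esub> a'))"

text \<open>A vertex element d next to e_j is the scalar d(j), and next to e_i the scalar d(i);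
  evaluating the product of w with d at a path from i to j produces the same scalars.\<close>

lemma tri_coef:
  assumes ji: "j \<in> verts G" "i \<in> verts G"
  shows "tri p (env A) (coef (j, u, i))"
proof -
  note e = vert_closed[OF ji(1)] vert_closed[OF ji(2)]
  have 1: "a \<otimes>\<^bsub>A\<^esub> cls d \<otimes>\<^bsub>A\<^esub> cls (vert j) = d (j, [], j) \<odot>\<^bsub>A\<^esub> (a \<otimes>\<^bsub>A\<^esub> cls (vert j))"
    if "a \<in> carrier A" "d \<in> V 0" for a d
  proof -
    have "a \<otimes>\<^bsub>A\<^esub> cls d \<otimes>\<^bsub>A\<^esub> cls (vert j) = a \<otimes>\<^bsub>A\<^esub> cls (d \<otimes>\<^bsub>P\<^esub> vert j)"
      using that ji by (simp add: cls_mult V0_carrier vert_V0 A.m_assoc cls_closed)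
    then show ?thesis
      using that ji e by (simp add: V0_mult_vert cls_smult[symmetric] V0_carrier vert_V0 A.smult_mult_right)
  qed
  have 2: "cls (vert i) \<otimes>\<^bsub>A\<^esub> (cls d \<otimes>\<^bsub>A\<^esub> a) = d (i, [], i) \<odot>\<^bsub>A\<^esub> (cls (vert i) \<otimes>\<^bsub>A\<^esub> a)"
    if "a \<in> carrier A" "d \<in> V 0" for a d
  proof -
    have "cls (vert i) \<otimes>\<^bsub>A\<^esub> (cls d \<otimes>\<^bsub>A\<^esub> a) = cls (vert i \<otimes>\<^bsub>P\<^esub> d) \<otimes>\<^bsub>A\<^esub> a"
      using that ji by (simp add: cls_mult V0_carrier vert_V0 A.m_assoc cls_closed)
    then show ?thesis
      using that ji e by (simp add: V0_mult_vert cls_smult[symmetric] V0_carrier vert_V0 A.smult_mult_left)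
  qed
  show ?thesis
    unfolding tri_def coef_def
    by (simp add: e A.env_pure_closed A.smult_closed A.l_distr A.r_distr A.env_pure_add_left
        A.env_pure_add_right A.smult_add_left A.smult_add_right path_sel(2) 1 2 V0_mult_left V0_mult_right
        A.smult_smult[symmetric] A.env_pure_smult[symmetric] mult.commute)
qed

lemma qbasis_verts: "(j, u, i) \<in> qbasis p \<Longrightarrow> j \<in> verts G \<and> i \<in> verts G"
  using qpaths_verts[of j u i] by (simp add: qbasis_def)

lemma tri_coef': "q \<in> qbasis n \<Longrightarrow> tri p (env A) (coef q)"
  using tri_coef qbasis_verts by (cases q) blast

definition kfun :: "int \<Rightarrow> ('v, 'b) qpath \<Rightarrow> ('v, 'b, 'f) kelem \<Rightarrow>
    (('v, 'b, 'f) qelem \<times> ('v, 'b, 'f) qelem \<Rightarrow>\<^sub>0 int) set" where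
  "kfun p q = (\<lambda>t\<in>carrier (K p). klift p (env A) (coef q) t)"

lemma kfun_pure:
  assumes "q \<in> qbasis n" "a \<in> carrier A" "w \<in> W p" "a' \<in> carrier A"
  shows "kfun p q (kp p a w a') = coef q a w a'"
  using klift_pure[OF A.E.abelian_group_axioms tri_coef'[OF assms(1)]] assms
  by (simp add: kfun_def kp)

text \<open>In \<open>coef\<close> the factor a stands leftmost and a' rightmost, so the outer
  actions on A^e match the actions on K_p.\<close>

lemma kfun_hom:
  assumes q: "q \<in> qbasis n"
  shows "kfun p q \<in> bimod_hom A (K p) (env A)"
  unfolding kfun_def
proof (rule restrict_bimod_hom[OF _ algebra_bimodule_K])
  note tri = tri_coef'[OF q]
  note a = klift_additive[OF A.E.abelian_group_axioms tri] and v = klift_pure[OF A.E.abelian_group_axioms tri]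
  obtain j u i where q': "q = (j, u, i)" by (cases q)
  note e = qbasis_verts[OF q[unfolded q']]
  have act: "coef q (b \<otimes>\<^bsub>A\<^esub> x) w a' = lact (env A) b (coef q x w a')"
    "coef q x w (a' \<otimes>\<^bsub>A\<^esub> b) = ract (env A) (coef q x w a') b"
    if "x \<in> carrier A" "a' \<in> carrier A" "b \<in> carrier A" for x w a' b
    using that e unfolding q' coef_def
    by (simp_all add: A.env_lact_pure A.env_ract_pure A.smult_closed vert_closed A.m_assoc
        A.smult_mult_right[symmetric])
  show "bimod_linear A (K p) (env A) (klift p (env A) (coef q))"
    unfolding bimod_linear_iff
  proof (intro conjI ballI a)
    fix b t assume b: "b \<in> carrier A" and t: "t \<in> carrier (K p)"
    show "klift p (env A) (coef q) (lact (K p) b t) = lact (env A) b (klift p (env A) (coef q) t)"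
      using t by (induction rule: K_induct)
        (simp_all add: b kp_act v act additive_map_add[OF a] additive_map_closed[OF a]
          K.l_add_right K.l_closed A.E.l_add_right)
    show "klift p (env A) (coef q) (ract (K p) t b) = ract (env A) (klift p (env A) (coef q) t) b"
      using t by (induction rule: K_induct)
        (simp_all add: b kp_act v act additive_map_add[OF a] additive_map_closed[OF a]
          K.r_add_left K.r_closed A.E.r_add_left)
  qed
qed

lemma finsum_W_apply:
  assumes "finite S" "\<And>i. i \<in> S \<Longrightarrow> g i \<in> W p"
  shows "(\<Oplus>\<^bsub>W_bimod G R p\<^esub>i\<in>S. g i) q = (\<Sum>i\<in>S. g i q)"
proof -
  have "additive_map (W_bimod G R p) field_ring (\<lambda>f. f q)" by (simp add: additive_map_def path_sel(2))
  from additive_map_finsum[where g = g and I = S, OF abelian_group_W abelian_group_field_ring this] assms(2)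
  show ?thesis by (simp add: finsum_field_ring[OF assms(1)])
qed

lemma W_coordinates:
  "\<exists>\<pi>. (\<forall>q\<in>qbasis (nat p). \<pi> q \<in> W p) \<and>
    (\<forall>w\<in>W p. \<forall>s. w s = (\<Sum>q\<in>qbasis (nat p). w q * \<pi> q s))"
proof (rule subspace_coordinates[OF finite_qbasis])
  fix w q assume w: "w \<in> W p" and q: "q \<notin> qbasis (nat p)"
  obtain j u i where q': "q = (j, u, i)" by (cases q)
  show "w q = 0"
    using q V_length[OF W_V[OF w], of u j i] path_support[OF W_carrier[OF w], of "(j, u, i)"]
    unfolding q' qbasis_def by auto
next
  show "(\<lambda>q. 0) \<in> W p" using W_zero by (simp add: path_sel)
  show "(\<lambda>q. v q + w q) \<in> W p" if "v \<in> W p" "w \<in> W p" for v w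
    using W_add[OF that] by (simp add: path_sel)
  show "(\<lambda>q. c * w q) \<in> W p" if "w \<in> W p" for c w
    using W_smult[OF that, of c] by (simp add: path_sel)
qed

text \<open>The generators are x_q = 1 \<otimes> \<pi>_q \<otimes> 1, with \<open>\<pi>\<close> a
  field-linear projection onto W_p. For a path q from i to j, letting the value of
  \<open>coef\<close> act on x_q gives a \<otimes> w(q) e_j \<pi>_q e_i \<otimes> a', so the point
  is that these middle factors sum to w.\<close>

lemma dual_basis_K: "\<exists>x. dual_basis A (K p) (qbasis (nat p)) x (kfun p)"
proof -
  let ?Q = "qbasis (nat p)"
  obtain \<pi> where \<pi>: "\<And>q. q \<in> ?Q \<Longrightarrow> \<pi> q \<in> W p"
    and w\<pi>: "\<And>w s. w \<in> W p \<Longrightarrow> w s = (\<Sum>q\<in>?Q. w q * \<pi> q s)"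
    using W_coordinates[of p] by (elim exE conjE) blast
  define x where "x q = kp p \<one>\<^bsub>A\<^esub> (\<pi> q) \<one>\<^bsub>A\<^esub>" for q
  have x: "x q \<in> carrier (K p)" if "q \<in> ?Q" for q
    unfolding x_def using \<pi>[OF that] by (simp add: kp)
  interpret k: algebra_with_bimodule A "K p"
    by (intro algebra_with_bimodule.intro kalgebra_A algebra_bimodule_K)
  have lin: "bimod_linear A (K p) (K p) (dual_ext A (K p) ?Q (kfun p) x)"
    by (rule A.dual_ext_linear[OF algebra_bimodule_K kfun_hom x])
  have ext: "dual_ext A (K p) ?Q (kfun p) x t = t" if "t \<in> carrier (K p)" for t
    using that
  proof (induction rule: K_induct)
    case (pure a w a')
    \<comment> \<open>The projection need not be k-linear; the idempotents contributed by the
      functionals keep only the part of \<pi>_q with the same end vertices as q.\<close>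
    define g where "g = (\<lambda>(j, u, i). w (j, u, i) \<odot>\<^bsub>P\<^esub> (vert j \<otimes>\<^bsub>P\<^esub> \<pi> (j, u, i) \<otimes>\<^bsub>P\<^esub> vert i))"
    have g: "g q \<in> W p" if q: "q \<in> ?Q" for q
    proof -
      obtain j u i where q': "q = (j, u, i)" by (cases q)
      show ?thesis
        using \<pi>[OF q] qbasis_verts[OF q[unfolded q']] unfolding q' g_def
        by (simp add: W_smult W_left W_right vert_V0)
    qed
    have act: "env_act A (K p) (kfun p q (kp p a w a')) (x q) = kp p a (g q) a'" if q: "q \<in> ?Q" for q
    proof -
      obtain j u i where q': "q = (j, u, i)" by (cases q)
      note e = qbasis_verts[OF q[unfolded q']]
      have \<pi>': "\<pi> (j, u, i) \<in> W p" using \<pi>[OF q] q' by simp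
      have v: "vert j \<in> V 0" "vert i \<in> V 0" using e by (simp_all add: vert_V0)
      have c: "a \<otimes>\<^bsub>A\<^esub> cls (vert j) \<in> carrier A" "cls (vert i) \<otimes>\<^bsub>A\<^esub> a' \<in> carrier A"
        using pure e by (simp_all add: vert_closed)
      have "env_act A (K p) (kfun p q (kp p a w a')) (x q) =
          lact (K p) (w q \<odot>\<^bsub>A\<^esub> (a \<otimes>\<^bsub>A\<^esub> cls (vert j))) (ract (K p) (x q) (cls (vert i) \<otimes>\<^bsub>A\<^esub> a'))"
        unfolding kfun_pure[OF q pure] using c x[OF q] by (simp add: coef_def q' k.act_pure A.smult_closed)
      also have "\<dots> = kp p (w q \<odot>\<^bsub>A\<^esub> (a \<otimes>\<^bsub>A\<^esub> cls (vert j))) (\<pi> q) (cls (vert i) \<otimes>\<^bsub>A\<^esub> a')"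
        unfolding x_def using c \<pi>[OF q] by (simp add: kp_act A.smult_closed)
      also have "\<dots> = kp p (a \<otimes>\<^bsub>A\<^esub> cls (vert j)) (w q \<odot>\<^bsub>P\<^esub> \<pi> q) (cls (vert i) \<otimes>\<^bsub>A\<^esub> a')"
        using c \<pi>[OF q] by (simp add: kp_smult)
      also have "\<dots> = kp p a (vert j \<otimes>\<^bsub>P\<^esub> (w q \<odot>\<^bsub>P\<^esub> \<pi> q)) (cls (vert i) \<otimes>\<^bsub>A\<^esub> a')"
        using pure c \<pi>[OF q] v by (simp add: kp(5) W_smult)
      also have "\<dots> = kp p a (vert j \<otimes>\<^bsub>P\<^esub> (w q \<odot>\<^bsub>P\<^esub> \<pi> q) \<otimes>\<^bsub>P\<^esub> vert i) a'"
        using pure c \<pi>[OF q] v by (simp add: kp(6) W_smult W_left)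
      also have "vert j \<otimes>\<^bsub>P\<^esub> (w q \<odot>\<^bsub>P\<^esub> \<pi> q) \<otimes>\<^bsub>P\<^esub> vert i = g q"
        unfolding g_def q' by (simp add: path_smult_mult)
      finally show ?thesis .
    qed
    have "(\<Oplus>\<^bsub>W_bimod G R p\<^esub>q\<in>?Q. g q) = w"
    proof (rule ext, clarify)
      fix h v t
      have "(\<Oplus>\<^bsub>W_bimod G R p\<^esub>q\<in>?Q. g q) (h, v, t) = (\<Sum>q\<in>?Q. g q (h, v, t))"
        by (rule finsum_W_apply[OF finite_qbasis g])
      also have "\<dots> = w (h, v, t)"
      proof (cases "h \<in> verts G \<and> t \<in> verts G")
        case True
        then have vw: "vert h \<in> V 0" "vert t \<in> V 0" by (simp_all add: vert_V0)
        \<comment> \<open>For values at words from t to h only the component e_h w e_t matters. It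
          lies in W_p, so the coordinate formula applies to it, and its coordinates vanish at paths
          with other ends.\<close>
        define w' where "w' = vert h \<otimes>\<^bsub>P\<^esub> w \<otimes>\<^bsub>P\<^esub> vert t"
        have w': "w' \<in> W p" unfolding w'_def using pure(2) vw by (simp add: W_left W_right)
        have w'a: "w' (j, u, i) = (if j = h \<and> i = t then w (j, u, i) else 0)" for j u i
          unfolding w'_def by (simp add: V0_mult_right[OF vw(2)] V0_mult_left[OF vw(1)] vert_apply)
        have "(\<Sum>q\<in>?Q. g q (h, v, t)) = (\<Sum>q\<in>?Q. w' q * \<pi> q (h, v, t))"
        proof (rule sum.cong[OF refl])
          fix q assume q: "q \<in> ?Q"
          obtain j u i where q': "q = (j, u, i)" by (cases q)
          have v': "vert j \<in> V 0" "vert i \<in> V 0"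
            using qbasis_verts[OF q[unfolded q']] by (simp_all add: vert_V0)
          show "g q (h, v, t) = w' q * \<pi> q (h, v, t)"
            unfolding q' g_def w'a
            by (simp add: path_sel(4) V0_mult_right[OF v'(2)] V0_mult_left[OF v'(1)] vert_apply)
        qed
        also have "\<dots> = w (h, v, t)" using w\<pi>[OF w', of "(h, v, t)"] w'a by simp
        finally show ?thesis .
      next
        case False
        then have nq: "(h, v, t) \<notin> qpaths G" using qpaths_verts[of h v t] by blast
        have z: "f (h, v, t) = 0" if "f \<in> W p" for f
          using path_support[OF W_carrier[OF that], of "(h, v, t)"] nq by auto
        have "g q (h, v, t) = 0" if "q \<in> ?Q" for q by (rule z[OF g[OF that]])
        then show ?thesis using z[OF pure(2)] by simp
      qed
      finally show "(\<Oplus>\<^bsub>W_bimod G R p\<^esub>q\<in>?Q. g q) (h, v, t) = w (h, v, t)" .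
    qed
    moreover have "dual_ext A (K p) ?Q (kfun p) x (kp p a w a') = (\<Oplus>\<^bsub>K p\<^esub>q\<in>?Q. kp p a (g q) a')"
      unfolding dual_ext_def by (rule K.finsum_cong'[OF refl]) (auto simp: act kp g pure)
    moreover have "kp p a (\<Oplus>\<^bsub>W_bimod G R p\<^esub>q\<in>?Q. g q) a' = (\<Oplus>\<^bsub>K p\<^esub>q\<in>?Q. kp p a (g q) a')"
      by (rule additive_map_finsum[OF abelian_group_W K.abelian_group_axioms kp_additive_W[OF pure(1,3)]])
        (simp add: g)
    ultimately show ?case by simp
  next
    case (add t u)
    then show ?case by (simp add: bimod_linear_add[OF lin])
  qed
  show ?thesis
    unfolding dual_basis_def by (intro exI[of _ x] conjI ballI finite_qbasis x kfun_hom ext)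
qed

text \<open>The functionals of a dual basis separate points. Elements of K_p are cosets in a nested
  quotient, and this criterion moves the proof that a sum of them vanishes into A^e.\<close>

lemma K_zeroI:
  assumes t: "t \<in> carrier (K p)" and z: "\<And>q. q \<in> qbasis (nat p) \<Longrightarrow> kfun p q t = \<zero>\<^bsub>env A\<^esub>"
  shows "t = \<zero>\<^bsub>K p\<^esub>"
proof -
  obtain x where d: "dual_basis A (K p) (qbasis (nat p)) x (kfun p)" using dual_basis_K by blast
  interpret k: algebra_with_bimodule A "K p"
    by (intro algebra_with_bimodule.intro kalgebra_A algebra_bimodule_K)
  have "env_act A (K p) (kfun p q t) (x q) = \<zero>\<^bsub>K p\<^esub>" if "q \<in> qbasis (nat p)" for q
    using additive_map_zero[OF A.E.abelian_group_axioms K.abelian_group_axioms k.act_additive, of "x q"] d that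
    unfolding z[OF that] dual_basis_def by blast
  then have "(\<Oplus>\<^bsub>K p\<^esub>q\<in>qbasis (nat p). env_act A (K p) (kfun p q t) (x q)) = (\<Oplus>\<^bsub>K p\<^esub>q\<in>qbasis (nat p). \<zero>\<^bsub>K p\<^esub>)"
    by (intro K.finsum_cong' refl) auto
  then show ?thesis
    using d t unfolding dual_basis_def dual_ext_def by simp
qed

text \<open>For \<open>w \<in> R V\<^sup>m\<close> the coefficient of a path \<open>u\<close> of length \<open>m\<close> at the right end of \<open>w\<close> is a relation;
  this is why the two outer terms of the square of the differential vanish.\<close>

definition suffix_coef :: "('v, 'b) qpath \<Rightarrow> ('v, 'b, 'f) pelem \<Rightarrow> ('v, 'b, 'f) pelem" where
  "suffix_coef = (\<lambda>(j, u, i) w (h, v, t). if t = j then w (h, v @ u, i) else 0)"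

definition prefix_coef :: "('v, 'b) qpath \<Rightarrow> ('v, 'b, 'f) pelem \<Rightarrow> ('v, 'b, 'f) pelem" where
  "prefix_coef = (\<lambda>(j, u, i) w (h, v, t). if h = i then w (j, u @ v, t) else 0)"

text \<open>For a nonempty word the missing end is the head of its first or the tail of its last
  arrow; for the empty word both ends agree.\<close>

lemma qpaths_unique:
  shows "(j, u, i) \<in> qpaths G \<Longrightarrow> (m, u, i) \<in> qpaths G \<Longrightarrow> m = j"
    and "(j, u, i) \<in> qpaths G \<Longrightarrow> (j, u, m) \<in> qpaths G \<Longrightarrow> m = i"
proof -
  show "m = j" if "(j, u, i) \<in> qpaths G" "(m, u, i) \<in> qpaths G"
  proof (cases u)
    case Nil
    then show ?thesis using that by (simp add: qpaths_Nil)
  next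
    case (Cons x v)
    then show ?thesis using that qpaths_Cons(2)[of j x v i] qpaths_Cons(2)[of m x v i] by simp
  qed
  show "m = i" if "(j, u, i) \<in> qpaths G" "(j, u, m) \<in> qpaths G"
  proof (cases u rule: rev_cases)
    case Nil
    then show ?thesis using that by (simp add: qpaths_Nil)
  next
    case (snoc v x)
    then show ?thesis using that qpaths_snoc(2)[of j v x i] qpaths_snoc(2)[of j v x m] by simp
  qed
qed

text \<open>Since g is homogeneous of the length of u, only the cut just before u contributes, and
  the middle vertex is forced to be the target j of u.\<close>

lemma suffix_coef_mult:
  assumes q: "(j, u, i) \<in> qbasis m" and g: "g \<in> V m"
  shows "suffix_coef (j, u, i) (f \<otimes>\<^bsub>P\<^esub> g) = g (j, u, i) \<odot>\<^bsub>P\<^esub> (f \<otimes>\<^bsub>P\<^esub> vert j)"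
proof (rule ext, clarify)
  fix h t and v :: "'b list"
  have jv: "j \<in> verts G" and u: "length u = m" and qp: "(j, u, i) \<in> qpaths G"
    using q qbasis_verts by (auto simp: qbasis_def)
  have g0: "g (k, u, i) = (if k = j then g (j, u, i) else 0)" for k
    using path_support[OF V_carrier[OF g], of "(k, u, i)"] qpaths_unique(1)[OF qp, of k] by auto
  have "(f \<otimes>\<^bsub>P\<^esub> g) (h, v @ u, i) = (\<Sum>l\<le>length (v @ u). if l = length v then f (h, v, j) * g (j, u, i) else 0)"
    unfolding path_mult
  proof (rule sum.cong[OF refl])
    fix l assume l: "l \<in> {..length (v @ u)}"
    show "(\<Sum>k\<in>verts G. f (h, take l (v @ u), k) * g (k, drop l (v @ u), i)) =
        (if l = length v then f (h, v, j) * g (j, u, i) else 0)"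
    proof (cases "l = length v")
      case True
      have "(\<Sum>k\<in>verts G. f (h, v, k) * g (k, u, i)) = (\<Sum>k\<in>verts G. if k = j then f (h, v, j) * g (j, u, i) else 0)"
        by (intro sum.cong refl) (subst g0, auto)
      then show ?thesis using True jv by (simp add: sum.delta)
    next
      case False
      then have "length (drop l (v @ u)) \<noteq> m" using l u by auto
      then have "g (k, drop l (v @ u), i) = 0" for k by (rule V_length[OF g])
      then show ?thesis using False by simp
    qed
  qed
  then have "(f \<otimes>\<^bsub>P\<^esub> g) (h, v @ u, i) = f (h, v, j) * g (j, u, i)"
    by (simp add: sum.delta)
  then show "suffix_coef (j, u, i) (f \<otimes>\<^bsub>P\<^esub> g) (h, v, t) = (g (j, u, i) \<odot>\<^bsub>P\<^esub> (f \<otimes>\<^bsub>P\<^esub> vert j)) (h, v, t)"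
    by (simp add: suffix_coef_def path_sel(4) V0_mult_right[OF vert_V0[OF jv]] vert_apply)
qed

lemma prefix_coef_mult:
  assumes q: "(j, u, i) \<in> qbasis m" and f: "f \<in> V m"
  shows "prefix_coef (j, u, i) (f \<otimes>\<^bsub>P\<^esub> g) = f (j, u, i) \<odot>\<^bsub>P\<^esub> (vert i \<otimes>\<^bsub>P\<^esub> g)"
proof (rule ext, clarify)
  fix h t and v :: "'b list"
  have iv: "i \<in> verts G" and u: "length u = m" and qp: "(j, u, i) \<in> qpaths G"
    using q qbasis_verts by (auto simp: qbasis_def)
  have f0: "f (j, u, k) = (if k = i then f (j, u, i) else 0)" for k
    using path_support[OF V_carrier[OF f], of "(j, u, k)"] qpaths_unique(2)[OF qp, of k] by auto
  have "(f \<otimes>\<^bsub>P\<^esub> g) (j, u @ v, t) = (\<Sum>l\<le>length (u @ v). if l = length u then f (j, u, i) * g (i, v, t) else 0)"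
    unfolding path_mult
  proof (rule sum.cong[OF refl])
    fix l assume l: "l \<in> {..length (u @ v)}"
    show "(\<Sum>k\<in>verts G. f (j, take l (u @ v), k) * g (k, drop l (u @ v), t)) =
        (if l = length u then f (j, u, i) * g (i, v, t) else 0)"
    proof (cases "l = length u")
      case True
      have "(\<Sum>k\<in>verts G. f (j, u, k) * g (k, v, t)) = (\<Sum>k\<in>verts G. if k = i then f (j, u, i) * g (i, v, t) else 0)"
        by (intro sum.cong refl) (subst f0, auto)
      then show ?thesis using True iv by (simp add: sum.delta)
    next
      case False
      then have "length (take l (u @ v)) \<noteq> m" using l u by auto
      then have "f (j, take l (u @ v), k) = 0" for k by (rule V_length[OF f])
      then show ?thesis using False by simp
    qed
  qed
  then have "(f \<otimes>\<^bsub>P\<^esub> g) (j, u @ v, t) = f (j, u, i) * g (i, v, t)"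
    by (simp add: sum.delta)
  then show "prefix_coef (j, u, i) (f \<otimes>\<^bsub>P\<^esub> g) (h, v, t) = (f (j, u, i) \<odot>\<^bsub>P\<^esub> (vert i \<otimes>\<^bsub>P\<^esub> g)) (h, v, t)"
    by (auto simp: prefix_coef_def path_sel(4) V0_mult_left[OF vert_V0[OF iv]] vert_apply)
qed

text \<open>On a generator f r g the coefficient is a scalar multiple of f r e_j with f of degree 0,
  and \<open>R\<close> is a sub-bimodule over k.\<close>

lemma suffix_coef_R:
  assumes "w \<in> relation_part G R 0 m" and q: "(j, u, i) \<in> qbasis m"
  shows "suffix_coef (j, u, i) w \<in> R"
  using assms(1)
proof (induction rule: relation_part_induct)
  case (gen f r g)
  have "f \<otimes>\<^bsub>P\<^esub> r \<otimes>\<^bsub>P\<^esub> vert j \<in> R"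
    using gen qbasis_verts[OF q] R_left R_right vert_V0 by blast
  then show ?case by (simp add: suffix_coef_mult[OF q gen(3)] R_smult)
next
  case (add v w)
  have "suffix_coef (j, u, i) (v \<oplus>\<^bsub>P\<^esub> w) = suffix_coef (j, u, i) v \<oplus>\<^bsub>P\<^esub> suffix_coef (j, u, i) w"
    by (auto simp: suffix_coef_def path_sel(2) fun_eq_iff)
  then show ?case using add by (simp add: R_add)
qed

text \<open>The mirror image: on f r g with g of degree 0 there remains a scalar multiple of e_i r
  g.\<close>

lemma prefix_coef_R:
  assumes "w \<in> relation_part G R m 0" and q: "(j, u, i) \<in> qbasis m"
  shows "prefix_coef (j, u, i) w \<in> R"
  using assms(1)
proof (induction rule: relation_part_induct)
  case (gen f r g)
  have "vert i \<otimes>\<^bsub>P\<^esub> (r \<otimes>\<^bsub>P\<^esub> g) \<in> R"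
    using gen qbasis_verts[OF q] R_left R_right vert_V0 by blast
  then show ?case by (simp add: path_mult_assoc prefix_coef_mult[OF q gen(1)] R_smult)
next
  case (add v w)
  have "prefix_coef (j, u, i) (v \<oplus>\<^bsub>P\<^esub> w) = prefix_coef (j, u, i) v \<oplus>\<^bsub>P\<^esub> prefix_coef (j, u, i) w"
    by (auto simp: prefix_coef_def path_sel(2) fun_eq_iff)
  then show ?case using add by (simp add: R_add)
qed

text \<open>The outer terms of d^2 present a relation only as a double sum over arrows. An additive
  \<open>\<Phi>\<close> can be taken out of the sum, which then is r itself, an element of the
  ideal.\<close>

lemma relation_expand:
  assumes r: "r \<in> R" and \<Phi>: "additive_map P Q \<Phi>" and Q: "abelian_group Q"
    and J: "\<And>f. f \<in> J \<Longrightarrow> \<Phi> f = \<zero>\<^bsub>Q\<^esub>"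
  shows "(\<Oplus>\<^bsub>Q\<^esub>x\<in>arcs G. \<Oplus>\<^bsub>Q\<^esub>y\<in>arcs G. \<Phi> (r (head G x, [x, y], tail G y) \<odot>\<^bsub>P\<^esub> (arr x \<otimes>\<^bsub>P\<^esub> arr y))) = \<zero>\<^bsub>Q\<^esub>"
proof -
  interpret Q: abelian_group Q by fact
  let ?f = "\<lambda>x y. r (head G x, [x, y], tail G y) \<odot>\<^bsub>P\<^esub> (arr x \<otimes>\<^bsub>P\<^esub> arr y)"
  have cl: "?f x y \<in> carrier P" if "x \<in> arcs G" "y \<in> arcs G" for x y
    using that by (intro path_smult_closed path_mult_closed arr_carrier)
  note fs = additive_map_finsum[OF P.abelian_group_axioms Q \<Phi>]
  have "(\<Oplus>\<^bsub>Q\<^esub>x\<in>arcs G. \<Oplus>\<^bsub>Q\<^esub>y\<in>arcs G. \<Phi> (?f x y)) = (\<Oplus>\<^bsub>Q\<^esub>x\<in>arcs G. \<Phi> (\<Oplus>\<^bsub>P\<^esub>y\<in>arcs G. ?f x y))"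
    using cl additive_map_closed[OF \<Phi>]
    by (intro Q.finsum_cong' refl fs[symmetric]) (auto intro!: P.finsum_closed)
  also have "\<dots> = \<Phi> (\<Oplus>\<^bsub>P\<^esub>x\<in>arcs G. \<Oplus>\<^bsub>P\<^esub>y\<in>arcs G. ?f x y)"
    using cl by (intro fs[symmetric]) (auto intro!: P.finsum_closed)
  also have "\<dots> = \<Phi> r"
    using V2_expand[of r] r R_subset by (simp add: subset_iff)
  also have "\<dots> = \<zero>\<^bsub>Q\<^esub>" by (rule J[OF R_in_J[OF r]])
  finally show ?thesis .
qed

lemma double_strip_carrier:
  assumes "w \<in> W p"
  shows "left_strip G y (left_strip G x w) \<in> W (p - 2)" "right_strip G y (right_strip G x w) \<in> W (p - 2)"
    "right_strip G y (left_strip G x w) \<in> W (p - 2)"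
  using strip_W[OF strip_W(1)[OF assms]] strip_W[OF strip_W(2)[OF assms]] by simp_all

text \<open>Under the functional of a path u of length p - 2, the sum becomes the expansion of the
  coefficient of w at the final segment u. This coefficient is a relation, because W_p lies in R
  V^(p-2), and relations vanish in the quotient.\<close>

lemma outer_left_zero:
  assumes a: "a \<in> carrier A" and w: "w \<in> W p" and a': "a' \<in> carrier A"
  shows "(\<Oplus>\<^bsub>K (p - 2)\<^esub>x\<in>arcs G. \<Oplus>\<^bsub>K (p - 2)\<^esub>y\<in>arcs G.
    kp (p - 2) (a \<otimes>\<^bsub>A\<^esub> c x \<otimes>\<^bsub>A\<^esub> c y) (left_strip G y (left_strip G x w)) a') = \<zero>\<^bsub>K (p - 2)\<^esub>"
    (is "?s = _")
proof -
  let ?K = "K (p - 2)"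
  let ?k = "\<lambda>x y. kp (p - 2) (a \<otimes>\<^bsub>A\<^esub> c x \<otimes>\<^bsub>A\<^esub> c y) (left_strip G y (left_strip G x w)) a'"
  have cl: "?k x y \<in> carrier ?K" if "x \<in> arcs G" "y \<in> arcs G" for x y
    using that a a' by (simp add: kp double_strip_carrier[OF w] c_closed)
  have cl': "(\<Oplus>\<^bsub>?K\<^esub>y\<in>arcs G. ?k x y) \<in> carrier ?K" if "x \<in> arcs G" for x
    by (rule K.finsum_closed[OF Pi_I[OF cl[OF that]]])
  show ?thesis
  proof (cases "2 \<le> p")
    case False
    have "left_strip G y (left_strip G x w) = \<zero>\<^bsub>P\<^esub>" for x y
    proof -
      have "nat (p - 1) = 0" using False by simp
      then have "left_strip G x w \<in> V 0" using W_V[OF strip_W(1)[OF w]] by simp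
      then show ?thesis by (rule strip_V0)
    qed
    then have "?k x y = \<zero>\<^bsub>?K\<^esub>" if "x \<in> arcs G" "y \<in> arcs G" for x y
      using that a a' by (simp add: kp_zero c_closed)
    then have "(\<Oplus>\<^bsub>?K\<^esub>y\<in>arcs G. ?k x y) = \<zero>\<^bsub>?K\<^esub>" if "x \<in> arcs G" for x
      using that by (intro K.add.finprod_one_eqI) blast
    then show ?thesis
      by (rule K.add.finprod_one_eqI)
  next
    case True
    show ?thesis
    proof (rule K_zeroI)
      show "?s \<in> carrier ?K" by (rule K.finsum_closed[OF Pi_I[OF cl']])
      fix q assume q: "q \<in> qbasis (nat (p - 2))"
      obtain j u i where q': "q = (j, u, i)" by (cases q)
      have ji: "j \<in> verts G" "i \<in> verts G" using qbasis_verts q q' by blast+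
      note e = vert_closed[OF ji(1)] vert_closed[OF ji(2)]
      let ?r = "suffix_coef (j, u, i) w"
      have r: "?r \<in> R"
        by (rule suffix_coef_R[OF koszul_W_relation[OF True _ w] q[unfolded q']]) (use True in simp)
      \<comment> \<open>\<open>\<Phi>\<close> puts an element of the path algebra in the place of
        the product of the two removed arrows; it factors through the quotient and so kills the
        ideal.\<close>
      define \<Phi> where "\<Phi> f = A.epure (a \<otimes>\<^bsub>A\<^esub> cls f \<otimes>\<^bsub>A\<^esub> cls (vert j)) (cls (vert i) \<otimes>\<^bsub>A\<^esub> a')" for f
      have \<Phi>: "additive_map P (env A) \<Phi>"
        unfolding \<Phi>_def using a a' e
        by (intro additive_mapI) (simp_all add: cls_closed cls_add A.r_distr A.l_distr A.env_pure_closed A.env_pure_add_left)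
      have e0: "A.epure \<zero>\<^bsub>A\<^esub> b = \<zero>\<^bsub>env A\<^esub>" if "b \<in> carrier A" for b
      proof (rule additive_map_zero[OF A.abelian_group_axioms A.E.abelian_group_axioms, of "\<lambda>x. A.epure x b"])
        show "additive_map A (env A) (\<lambda>x. A.epure x b)"
          using that by (intro additive_mapI) (simp_all add: A.env_pure_closed A.env_pure_add_left)
      qed
      have \<Phi>J: "\<Phi> f = \<zero>\<^bsub>env A\<^esub>" if "f \<in> J" for f
        unfolding \<Phi>_def cls_zero[OF that] using a a' e by (simp add: e0)
      note kf = bimod_linear_additive[OF bimod_hom_linear[OF kfun_hom[OF q]]]
      note fs = additive_map_finsum[OF K.abelian_group_axioms A.E.abelian_group_axioms kf]
      have kq: "kfun (p - 2) q (?k x y) = \<Phi> (?r (head G x, [x, y], tail G y) \<odot>\<^bsub>P\<^esub> (arr x \<otimes>\<^bsub>P\<^esub> arr y))"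
        if xy: "x \<in> arcs G" "y \<in> arcs G" for x y
      proof -
        \<comment> \<open>\<open>left_strip\<close> demands that the two arrows compose and
          \<open>suffix_coef\<close> does not; they agree because w vanishes on words that are not
          paths.\<close>
        have "head G y = tail G x" if "w (head G x, x # y # u, i) \<noteq> 0"
          using qpaths_Cons(2)[OF qpaths_Cons(3)[OF path_support[OF W_carrier[OF w] that]]] by simp
        then have "left_strip G y (left_strip G x w) (j, u, i) = ?r (head G x, [x, y], tail G y)"
          by (cases "w (head G x, x # y # u, i) = 0") (simp_all add: left_strip_def suffix_coef_def)
        then have "kfun (p - 2) q (?k x y) = A.epure (?r (head G x, [x, y], tail G y) \<odot>\<^bsub>A\<^esub>
            (a \<otimes>\<^bsub>A\<^esub> c x \<otimes>\<^bsub>A\<^esub> c y \<otimes>\<^bsub>A\<^esub> cls (vert j))) (cls (vert i) \<otimes>\<^bsub>A\<^esub> a')"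
          using kfun_pure[OF q _ double_strip_carrier(1)[OF w] a'] a xy by (simp add: c_closed coef_def q')
        then show ?thesis
          unfolding \<Phi>_def using a e xy
          by (simp add: cls_smult[symmetric] cls_mult arr_carrier path_mult_closed c_closed A.m_assoc
              A.smult_mult_left A.smult_mult_right)
      qed
      have "kfun (p - 2) q ?s = (\<Oplus>\<^bsub>env A\<^esub>x\<in>arcs G. kfun (p - 2) q (\<Oplus>\<^bsub>?K\<^esub>y\<in>arcs G. ?k x y))"
        by (rule fs[OF cl'])
      also have "\<dots> = (\<Oplus>\<^bsub>env A\<^esub>x\<in>arcs G. \<Oplus>\<^bsub>env A\<^esub>y\<in>arcs G. \<Phi> (?r (head G x, [x, y], tail G y) \<odot>\<^bsub>P\<^esub> (arr x \<otimes>\<^bsub>P\<^esub> arr y)))"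
      proof (rule A.E.finsum_cong'[OF refl])
        have c\<Phi>: "\<Phi> (?r (head G x, [x, y], tail G y) \<odot>\<^bsub>P\<^esub> (arr x \<otimes>\<^bsub>P\<^esub> arr y)) \<in> carrier (env A)"
          if "x \<in> arcs G" "y \<in> arcs G" for x y
          using that by (intro additive_map_closed[OF \<Phi>] path_smult_closed path_mult_closed arr_carrier)
        show "kfun (p - 2) q (\<Oplus>\<^bsub>?K\<^esub>y\<in>arcs G. ?k x y) =
            (\<Oplus>\<^bsub>env A\<^esub>y\<in>arcs G. \<Phi> (?r (head G x, [x, y], tail G y) \<odot>\<^bsub>P\<^esub> (arr x \<otimes>\<^bsub>P\<^esub> arr y)))"
          if x: "x \<in> arcs G" for x
          by (rule trans[OF fs A.E.finsum_cong'[OF refl]]) (use x in \<open>auto simp: cl kq c\<Phi>\<close>)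
        show "(\<lambda>x. \<Oplus>\<^bsub>env A\<^esub>y\<in>arcs G. \<Phi> (?r (head G x, [x, y], tail G y) \<odot>\<^bsub>P\<^esub> (arr x \<otimes>\<^bsub>P\<^esub> arr y)))
            \<in> arcs G \<rightarrow> carrier (env A)"
          by (rule Pi_I, rule A.E.finsum_closed[OF Pi_I[OF c\<Phi>]])
      qed
      also have "\<dots> = \<zero>\<^bsub>env A\<^esub>"
        by (rule relation_expand[OF r \<Phi> A.E.abelian_group_axioms \<Phi>J])
      finally show "kfun (p - 2) q ?s = \<zero>\<^bsub>env A\<^esub>" .
    qed
  qed
qed

text \<open>As on the left, with the initial segment of length p - 2. The sums are interchanged
  because the arrow x, removed first, is the last letter of the remaining pair [y, x].\<close>

lemma outer_right_zero:
  assumes a: "a \<in> carrier A" and w: "w \<in> W p" and a': "a' \<in> carrier A"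
  shows "(\<Oplus>\<^bsub>K (p - 2)\<^esub>x\<in>arcs G. \<Oplus>\<^bsub>K (p - 2)\<^esub>y\<in>arcs G.
    kp (p - 2) a (right_strip G y (right_strip G x w)) (c y \<otimes>\<^bsub>A\<^esub> (c x \<otimes>\<^bsub>A\<^esub> a'))) = \<zero>\<^bsub>K (p - 2)\<^esub>"
    (is "?s = _")
proof -
  let ?K = "K (p - 2)"
  let ?k = "\<lambda>x y. kp (p - 2) a (right_strip G y (right_strip G x w)) (c y \<otimes>\<^bsub>A\<^esub> (c x \<otimes>\<^bsub>A\<^esub> a'))"
  have cl: "?k x y \<in> carrier ?K" if "x \<in> arcs G" "y \<in> arcs G" for x y
    using that a a' by (simp add: kp double_strip_carrier[OF w] c_closed)
  have cl': "(\<Oplus>\<^bsub>?K\<^esub>x\<in>arcs G. ?k x y) \<in> carrier ?K" if "y \<in> arcs G" for y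
    by (rule K.finsum_closed[OF Pi_I[OF cl[OF _ that]]])
  have sw: "?s = (\<Oplus>\<^bsub>?K\<^esub>y\<in>arcs G. \<Oplus>\<^bsub>?K\<^esub>x\<in>arcs G. ?k x y)"
    by (rule K.finsum_swap[OF finite_arcs finite_arcs cl])
  show ?thesis
  proof (cases "2 \<le> p")
    case False
    have "right_strip G y (right_strip G x w) = \<zero>\<^bsub>P\<^esub>" for x y
    proof -
      have "nat (p - 1) = 0" using False by simp
      then have "right_strip G x w \<in> V 0" using W_V[OF strip_W(2)[OF w]] by simp
      then show ?thesis by (rule strip_V0)
    qed
    then have "?k x y = \<zero>\<^bsub>?K\<^esub>" if "x \<in> arcs G" "y \<in> arcs G" for x y
      using that a a' by (simp add: kp_zero c_closed)
    then have "(\<Oplus>\<^bsub>?K\<^esub>y\<in>arcs G. ?k x y) = \<zero>\<^bsub>?K\<^esub>" if "x \<in> arcs G" for x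
      using that by (intro K.add.finprod_one_eqI) blast
    then show ?thesis
      by (rule K.add.finprod_one_eqI)
  next
    case True
    show ?thesis
      unfolding sw
    proof (rule K_zeroI)
      show "(\<Oplus>\<^bsub>?K\<^esub>y\<in>arcs G. \<Oplus>\<^bsub>?K\<^esub>x\<in>arcs G. ?k x y) \<in> carrier ?K" by (rule K.finsum_closed[OF Pi_I[OF cl']])
      fix q assume q: "q \<in> qbasis (nat (p - 2))"
      obtain j u i where q': "q = (j, u, i)" by (cases q)
      have ji: "j \<in> verts G" "i \<in> verts G" using qbasis_verts q q' by blast+
      note e = vert_closed[OF ji(1)] vert_closed[OF ji(2)]
      let ?r = "prefix_coef (j, u, i) w"
      have r: "?r \<in> R"
        by (rule prefix_coef_R[OF koszul_W_relation[OF True _ w] q[unfolded q']]) (use True in simp)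
      define \<Phi> where "\<Phi> f = A.epure (a \<otimes>\<^bsub>A\<^esub> cls (vert j)) (cls (vert i) \<otimes>\<^bsub>A\<^esub> (cls f \<otimes>\<^bsub>A\<^esub> a'))" for f
      have \<Phi>: "additive_map P (env A) \<Phi>"
        unfolding \<Phi>_def using a a' e
        by (intro additive_mapI) (simp_all add: cls_closed cls_add A.r_distr A.l_distr A.env_pure_closed A.env_pure_add_right)
      have e0: "A.epure b \<zero>\<^bsub>A\<^esub> = \<zero>\<^bsub>env A\<^esub>" if "b \<in> carrier A" for b
      proof (rule additive_map_zero[OF A.abelian_group_axioms A.E.abelian_group_axioms])
        show "additive_map A (env A) (A.epure b)"
          using that by (intro additive_mapI) (simp_all add: A.env_pure_closed A.env_pure_add_right)
      qed
      have \<Phi>J: "\<Phi> f = \<zero>\<^bsub>env A\<^esub>" if "f \<in> J" for f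
        unfolding \<Phi>_def cls_zero[OF that] using a a' e by (simp add: e0)
      note kf = bimod_linear_additive[OF bimod_hom_linear[OF kfun_hom[OF q]]]
      note fs = additive_map_finsum[OF K.abelian_group_axioms A.E.abelian_group_axioms kf]
      have kq: "kfun (p - 2) q (?k x y) = \<Phi> (?r (head G y, [y, x], tail G x) \<odot>\<^bsub>P\<^esub> (arr y \<otimes>\<^bsub>P\<^esub> arr x))"
        if xy: "x \<in> arcs G" "y \<in> arcs G" for x y
      proof -
        have "tail G y = head G x" if nz: "w (j, u @ [y, x], tail G x) \<noteq> 0"
        proof -
          have "(j, (u @ [y]) @ [x], tail G x) \<in> qpaths G"
            using path_support[OF W_carrier[OF w] nz] by simp
          from qpaths_snoc(2)[OF qpaths_snoc(3)[OF this]] show ?thesis by simp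
        qed
        then have "right_strip G y (right_strip G x w) (j, u, i) = ?r (head G y, [y, x], tail G x)"
          by (cases "w (j, u @ [y, x], tail G x) = 0") (simp_all add: right_strip_def prefix_coef_def)
        then have "kfun (p - 2) q (?k x y) = A.epure (?r (head G y, [y, x], tail G x) \<odot>\<^bsub>A\<^esub>
            (a \<otimes>\<^bsub>A\<^esub> cls (vert j))) (cls (vert i) \<otimes>\<^bsub>A\<^esub> (c y \<otimes>\<^bsub>A\<^esub> (c x \<otimes>\<^bsub>A\<^esub> a')))"
          using kfun_pure[OF q a double_strip_carrier(2)[OF w]] a' xy by (simp add: c_closed coef_def q')
        then show ?thesis
          unfolding \<Phi>_def using a a' e xy
          by (simp add: cls_smult[symmetric] cls_mult arr_carrier path_mult_closed c_closed A.m_assoc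
              A.smult_mult_left A.smult_mult_right A.env_pure_smult)
      qed
      have "kfun (p - 2) q (\<Oplus>\<^bsub>?K\<^esub>y\<in>arcs G. \<Oplus>\<^bsub>?K\<^esub>x\<in>arcs G. ?k x y) =
          (\<Oplus>\<^bsub>env A\<^esub>y\<in>arcs G. kfun (p - 2) q (\<Oplus>\<^bsub>?K\<^esub>x\<in>arcs G. ?k x y))"
        by (rule fs[OF cl'])
      also have "\<dots> = (\<Oplus>\<^bsub>env A\<^esub>y\<in>arcs G. \<Oplus>\<^bsub>env A\<^esub>x\<in>arcs G. \<Phi> (?r (head G y, [y, x], tail G x) \<odot>\<^bsub>P\<^esub> (arr y \<otimes>\<^bsub>P\<^esub> arr x)))"
      proof (rule A.E.finsum_cong'[OF refl])
        have c\<Phi>: "\<Phi> (?r (head G y, [y, x], tail G x) \<odot>\<^bsub>P\<^esub> (arr y \<otimes>\<^bsub>P\<^esub> arr x)) \<in> carrier (env A)"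
          if "x \<in> arcs G" "y \<in> arcs G" for x y
          using that by (intro additive_map_closed[OF \<Phi>] path_smult_closed path_mult_closed arr_carrier)
        show "kfun (p - 2) q (\<Oplus>\<^bsub>?K\<^esub>x\<in>arcs G. ?k x y) =
            (\<Oplus>\<^bsub>env A\<^esub>x\<in>arcs G. \<Phi> (?r (head G y, [y, x], tail G x) \<odot>\<^bsub>P\<^esub> (arr y \<otimes>\<^bsub>P\<^esub> arr x)))"
          if y: "y \<in> arcs G" for y
          by (rule trans[OF fs A.E.finsum_cong'[OF refl]]) (use y in \<open>auto simp: cl kq c\<Phi>\<close>)
        show "(\<lambda>y. \<Oplus>\<^bsub>env A\<^esub>x\<in>arcs G. \<Phi> (?r (head G y, [y, x], tail G x) \<odot>\<^bsub>P\<^esub> (arr y \<otimes>\<^bsub>P\<^esub> arr x)))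
            \<in> arcs G \<rightarrow> carrier (env A)"
          by (rule Pi_I, rule A.E.finsum_closed[OF Pi_I[OF c\<Phi>]])
      qed
      also have "\<dots> = \<zero>\<^bsub>env A\<^esub>"
        by (rule relation_expand[OF r \<Phi> A.E.abelian_group_axioms \<Phi>J])
      finally show "kfun (p - 2) q (\<Oplus>\<^bsub>?K\<^esub>y\<in>arcs G. \<Oplus>\<^bsub>?K\<^esub>x\<in>arcs G. ?k x y) = \<zero>\<^bsub>env A\<^esub>" .
    qed
  qed
qed

text \<open>Of the four double sums the outer two vanish because of the relations; the mixed two
  coincide and carry the opposite signs (-1)^(p-1) and (-1)^p.\<close>

lemma dif_dif:
  assumes t: "t \<in> carrier (K p)"
  shows "koszul_dif G R (p - 1) (koszul_dif G R p t) = \<zero>\<^bsub>K (p - 2)\<^esub>"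
  using t
proof (induction rule: K_induct)
  case (pure a w a')
  let ?K = "K (p - 1)" and ?L = "K (p - 2)"
  let ?d = "koszul_dif G R (p - 1)"
  let ?l = "\<lambda>x. kp (p - 1) (a \<otimes>\<^bsub>A\<^esub> c x) (left_strip G x w) a'"
  let ?r = "\<lambda>x. kp (p - 1) a (right_strip G x w) (c x \<otimes>\<^bsub>A\<^esub> a')"
  let ?ll = "\<lambda>x y. kp (p - 2) (a \<otimes>\<^bsub>A\<^esub> c x \<otimes>\<^bsub>A\<^esub> c y) (left_strip G y (left_strip G x w)) a'"
  let ?rr = "\<lambda>x y. kp (p - 2) a (right_strip G y (right_strip G x w)) (c y \<otimes>\<^bsub>A\<^esub> (c x \<otimes>\<^bsub>A\<^esub> a'))"
  let ?lr = "\<lambda>x y. kp (p - 2) (a \<otimes>\<^bsub>A\<^esub> c x) (right_strip G y (left_strip G x w)) (c y \<otimes>\<^bsub>A\<^esub> a')"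
  note cc = kp(1) strip_W double_strip_carrier c_closed pure
  have cl: "?l x \<in> carrier ?K" "?r x \<in> carrier ?K" if "x \<in> arcs G" for x
    using that by (simp_all add: cc)
  have cl2: "?ll x y \<in> carrier ?L" "?rr x y \<in> carrier ?L" "?lr x y \<in> carrier ?L"
    if "x \<in> arcs G" "y \<in> arcs G" for x y
    using that by (simp_all add: cc)
  have s2: "(\<Oplus>\<^bsub>?L\<^esub>y\<in>arcs G. ?ll x y) \<in> carrier ?L" "(\<Oplus>\<^bsub>?L\<^esub>y\<in>arcs G. ?rr x y) \<in> carrier ?L"
    "(\<Oplus>\<^bsub>?L\<^esub>y\<in>arcs G. ?lr x y) \<in> carrier ?L" "(\<Oplus>\<^bsub>?L\<^esub>y\<in>arcs G. ?lr y x) \<in> carrier ?L" if "x \<in> arcs G" for x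
    using that by (auto intro!: K.finsum_closed[OF Pi_I] cl2)
  \<comment> \<open>The common value of the two mixed sums; interchanging the order of summation
    identifies the second with the first.\<close>
  define B where "B = (\<Oplus>\<^bsub>?L\<^esub>x\<in>arcs G. \<Oplus>\<^bsub>?L\<^esub>y\<in>arcs G. ?lr x y)"
  have B: "B \<in> carrier ?L" unfolding B_def by (rule K.finsum_closed[OF Pi_I[OF s2(3)]])
  have Bsw: "(\<Oplus>\<^bsub>?L\<^esub>x\<in>arcs G. \<Oplus>\<^bsub>?L\<^esub>y\<in>arcs G. ?lr y x) = B"
    unfolding B_def by (rule K.finsum_swap[OF finite_arcs finite_arcs cl2(3), symmetric])
  note sg = signed_additive[OF K.abelian_group_axioms]
  note sgf = additive_map_finsum[OF K.abelian_group_axioms K.abelian_group_axioms sg]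
  have da: "additive_map ?K ?L ?d"
    using dif_additive[of "p - 1"] by simp
  note df = additive_map_finsum[OF K.abelian_group_axioms K.abelian_group_axioms da]
  have dl: "?d (?l x) = (\<Oplus>\<^bsub>?L\<^esub>y\<in>arcs G. ?ll x y) \<oplus>\<^bsub>?L\<^esub> signed ?L (p - 1) (\<Oplus>\<^bsub>?L\<^esub>y\<in>arcs G. ?lr x y)"
    if "x \<in> arcs G" for x
    using that by (simp add: dif_pure cc dif_pure_def)
  have dr: "?d (?r x) = (\<Oplus>\<^bsub>?L\<^esub>y\<in>arcs G. ?lr y x) \<oplus>\<^bsub>?L\<^esub> signed ?L (p - 1) (\<Oplus>\<^bsub>?L\<^esub>y\<in>arcs G. ?rr x y)"
    if "x \<in> arcs G" for x
    using that by (simp add: dif_pure cc dif_pure_def strip_commute)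
  have "?d (\<Oplus>\<^bsub>?K\<^esub>x\<in>arcs G. ?l x) = (\<Oplus>\<^bsub>?L\<^esub>x\<in>arcs G. (\<Oplus>\<^bsub>?L\<^esub>y\<in>arcs G. ?ll x y) \<oplus>\<^bsub>?L\<^esub> signed ?L (p - 1) (\<Oplus>\<^bsub>?L\<^esub>y\<in>arcs G. ?lr x y))"
  proof -
    have "?d (\<Oplus>\<^bsub>?K\<^esub>x\<in>arcs G. ?l x) = (\<Oplus>\<^bsub>?L\<^esub>x\<in>arcs G. ?d (?l x))"
      by (rule df) (rule cl)
    also have "\<dots> = (\<Oplus>\<^bsub>?L\<^esub>x\<in>arcs G. (\<Oplus>\<^bsub>?L\<^esub>y\<in>arcs G. ?ll x y) \<oplus>\<^bsub>?L\<^esub> signed ?L (p - 1) (\<Oplus>\<^bsub>?L\<^esub>y\<in>arcs G. ?lr x y))"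
      by (rule K.finsum_cong'[OF refl]) (use s2 dl in \<open>auto intro!: K.add.m_closed additive_map_closed[OF sg]\<close>)
    finally show ?thesis .
  qed
  also have "\<dots> = (\<Oplus>\<^bsub>?L\<^esub>x\<in>arcs G. \<Oplus>\<^bsub>?L\<^esub>y\<in>arcs G. ?ll x y) \<oplus>\<^bsub>?L\<^esub>
      (\<Oplus>\<^bsub>?L\<^esub>x\<in>arcs G. signed ?L (p - 1) (\<Oplus>\<^bsub>?L\<^esub>y\<in>arcs G. ?lr x y))"
    by (rule K.finsum_addf) (auto simp: s2 intro!: additive_map_closed[OF sg])
  also have "(\<Oplus>\<^bsub>?L\<^esub>x\<in>arcs G. signed ?L (p - 1) (\<Oplus>\<^bsub>?L\<^esub>y\<in>arcs G. ?lr x y)) = signed ?L (p - 1) B"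
    unfolding B_def by (rule sgf[symmetric]) (rule s2)
  also have "(\<Oplus>\<^bsub>?L\<^esub>x\<in>arcs G. \<Oplus>\<^bsub>?L\<^esub>y\<in>arcs G. ?ll x y) = \<zero>\<^bsub>?L\<^esub>"
    by (rule outer_left_zero[OF pure])
  finally have d1: "?d (\<Oplus>\<^bsub>?K\<^esub>x\<in>arcs G. ?l x) = \<zero>\<^bsub>?L\<^esub> \<oplus>\<^bsub>?L\<^esub> signed ?L (p - 1) B" .
  have "?d (\<Oplus>\<^bsub>?K\<^esub>x\<in>arcs G. ?r x) = (\<Oplus>\<^bsub>?L\<^esub>x\<in>arcs G. (\<Oplus>\<^bsub>?L\<^esub>y\<in>arcs G. ?lr y x) \<oplus>\<^bsub>?L\<^esub> signed ?L (p - 1) (\<Oplus>\<^bsub>?L\<^esub>y\<in>arcs G. ?rr x y))"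
  proof -
    have "?d (\<Oplus>\<^bsub>?K\<^esub>x\<in>arcs G. ?r x) = (\<Oplus>\<^bsub>?L\<^esub>x\<in>arcs G. ?d (?r x))"
      by (rule df) (rule cl)
    also have "\<dots> = (\<Oplus>\<^bsub>?L\<^esub>x\<in>arcs G. (\<Oplus>\<^bsub>?L\<^esub>y\<in>arcs G. ?lr y x) \<oplus>\<^bsub>?L\<^esub> signed ?L (p - 1) (\<Oplus>\<^bsub>?L\<^esub>y\<in>arcs G. ?rr x y))"
      by (rule K.finsum_cong'[OF refl]) (use s2 dr in \<open>auto intro!: K.add.m_closed additive_map_closed[OF sg]\<close>)
    finally show ?thesis .
  qed
  also have "\<dots> = (\<Oplus>\<^bsub>?L\<^esub>x\<in>arcs G. \<Oplus>\<^bsub>?L\<^esub>y\<in>arcs G. ?lr y x) \<oplus>\<^bsub>?L\<^esub>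
      (\<Oplus>\<^bsub>?L\<^esub>x\<in>arcs G. signed ?L (p - 1) (\<Oplus>\<^bsub>?L\<^esub>y\<in>arcs G. ?rr x y))"
    by (rule K.finsum_addf) (auto simp: s2 intro!: additive_map_closed[OF sg])
  also have "(\<Oplus>\<^bsub>?L\<^esub>x\<in>arcs G. signed ?L (p - 1) (\<Oplus>\<^bsub>?L\<^esub>y\<in>arcs G. ?rr x y)) =
      signed ?L (p - 1) (\<Oplus>\<^bsub>?L\<^esub>x\<in>arcs G. \<Oplus>\<^bsub>?L\<^esub>y\<in>arcs G. ?rr x y)"
    by (rule sgf[symmetric]) (rule s2)
  also have "(\<Oplus>\<^bsub>?L\<^esub>x\<in>arcs G. \<Oplus>\<^bsub>?L\<^esub>y\<in>arcs G. ?rr x y) = \<zero>\<^bsub>?L\<^esub>"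
    by (rule outer_right_zero[OF pure])
  also have "signed ?L (p - 1) \<zero>\<^bsub>?L\<^esub> = \<zero>\<^bsub>?L\<^esub>"
    by (rule additive_map_zero[OF K.abelian_group_axioms K.abelian_group_axioms sg])
  finally have d2: "?d (\<Oplus>\<^bsub>?K\<^esub>x\<in>arcs G. ?r x) = B"
    unfolding Bsw using B by simp
  have sl: "(\<Oplus>\<^bsub>?K\<^esub>x\<in>arcs G. ?l x) \<in> carrier ?K" and sr: "(\<Oplus>\<^bsub>?K\<^esub>x\<in>arcs G. ?r x) \<in> carrier ?K"
    by (rule K.finsum_closed[OF Pi_I], erule cl)+
  have ds: "?d (signed ?K p s) = signed ?L p (?d s)" if "s \<in> carrier ?K" for s
    using additive_map_neg[OF K.abelian_group_axioms K.abelian_group_axioms da that]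
    by (simp add: signed_def)
  have "?d (koszul_dif_pure G R p a w a') = ?d (\<Oplus>\<^bsub>?K\<^esub>x\<in>arcs G. ?l x) \<oplus>\<^bsub>?L\<^esub> signed ?L p (?d (\<Oplus>\<^bsub>?K\<^esub>x\<in>arcs G. ?r x))"
    unfolding dif_pure_def
    using additive_map_add[OF da sl additive_map_closed[OF sg sr]] ds[OF sr] by simp
  also have "\<dots> = signed ?L (p - 1) B \<oplus>\<^bsub>?L\<^esub> signed ?L p B"
    unfolding d1 d2 using additive_map_closed[OF sg B] by simp
  also have "\<dots> = \<zero>\<^bsub>?L\<^esub>"
    using B by (simp add: signed_def K.l_neg K.r_neg)
  finally show ?case using pure by (simp add: dif_pure)
next
  case (add t u)
  have "additive_map (K (p - 1)) (K (p - 2)) (koszul_dif G R (p - 1))"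
    using dif_additive[of "p - 1"] by simp
  from additive_map_add[OF this] add show ?case
    by (simp add: additive_map_add[OF dif_additive] additive_map_closed[OF dif_additive])
qed

end

theorem theorem1p5:
  fixes G :: "('v, 'b) pre_digraph"
    and R :: "('v, 'b, 'f::field) pelem set"
    and M :: "(('v, 'b, 'f) qelem, ('v, 'b, 'f) qelem, 'm) bimod"
    and n :: nat and p :: int
  assumes "quadratic_quiver G R"
    and "kc_calabi_yau TYPE('z) G R n"
    and "algebra_bimodule (quad_algebra G R) M"
  shows "vector_space_iso (HK_cohomology G R M p) (HK_homology G R M (int n - p))"
proof -
  interpret quadratic_quiver G R by fact
  have len: "koszul_length G R n"
    and der: "derived_iso TYPE('z) (quad_algebra G R) (hom_env_complex (quad_algebra G R) (koszul_complex G R))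
      (shift_cochain (int n) (koszul_complex G R))"
    using assms(2) by (simp_all add: kc_calabi_yau_def)
  have o: "obj (koszul_complex G R) = koszul_obj G R" and d: "dif (koszul_complex G R) = koszul_dif G R"
    by (simp_all add: koszul_complex_def)
  show ?thesis
    unfolding HK_cohomology_def HK_homology_def
  \<comment> \<open>The index type is that of quiver paths. The lower bound on the complex is its
    vanishing in negative degrees, and the upper bound comes from the Koszul length.\<close>
  proof (rule A.derived_duality[where 'i = "('v, 'b) qpath", OF assms(3) _ _ _ _ _ _ der], unfold o d)
    fix p
    show "algebra_bimodule (quad_algebra G R) (koszul_obj G R p)"
      by (rule algebra_bimodule_K)
    show "bimod_linear (quad_algebra G R) (koszul_obj G R p) (koszul_obj G R (p - 1)) (koszul_dif G R p)"
      by (rule dif_linear)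
    show "koszul_dif G R (p - 1) (koszul_dif G R p x) = \<zero>\<^bsub>koszul_obj G R (p - 2)\<^esub>"
      if "x \<in> carrier (koszul_obj G R p)" for x
      by (rule dif_dif[OF that])
    show "\<exists>J x f. dual_basis (quad_algebra G R) (koszul_obj G R p) (J :: ('v, 'b) qpath set) x f"
      using dual_basis_K by blast
    show "carrier (koszul_obj G R p) = {\<zero>\<^bsub>koszul_obj G R p\<^esub>}" if "p < 0"
      by (rule K_negative[OF that])
    show "carrier (koszul_obj G R p) = {\<zero>\<^bsub>koszul_obj G R p\<^esub>}" if "int n < p"
      using len that by (simp add: koszul_length_def)
  qed
qed

end
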